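(* Let $\mathcal E$ be a Grothendieck topos. The following are equivalent: (1) the counit $\epsilon_{\mathcal E}:\mathsf{S}\mathsf{pt}(\mathcal E)\to\mathcal E$ of the Scott adjunction is an equivalence of categories; (2) $\mathcal E$ has enough points and for all presentations $i^*:\mathbf{Set}^X\leftrightarrows\mathcal E:i_*$, the functor $\mathsf{pt}(i):\mathsf{pt}(\mathcal E)\to\mathsf{pt}(\mathbf{Set}^X)$ is a topological embedding; (3) $\mathcal E$ has enough points and there exists a presentation $i^*:\mathbf{Set}^X\leftrightarrows\mathcal E:i_*$ such that $\mathsf{pt}(i)$ is a topological embedding.
   Context: $\mathrm{Acc}_\omega$ is the $2$-category of accessible categories with directed colimits, functors preserving directed colimits, and natural transformations. A geometric morphism $f:\mathcal E\to\mathcal F$ of Grothendieck topoi is an adjunction $f^*:\mathcal F\leftrightarrows\mathcal E:f_*$ with $f^*\dashv f_*$ and $f^*$ left exact; it is a geometric embedding if $f_*$ is fully faithful. $\mathsf{pt}(\mathcal E)$ is the category of points of $\mathcal E$ (cocontinuous left exact functors $p^*:\mathcal E\to\mathbf{Set}$ and natural transformations), an object of $\mathrm{Acc}_\omega$; for a geometric morphism $f$, $\mathsf{pt}(f)(p^* )=p^*\circ f^*$. For $\mathcal A\in\mathrm{Acc}_\omega$, $\mathsf{S}(\mathcal A)=\mathrm{Acc}_\omega(\mathcal A,\mathbf{Set})$ is the topos of directed-colimit-preserving functors $\mathcal A\to\mathbf{Set}$; for $f:\mathcal A\to\mathcal B$ in $\mathrm{Acc}_\omega$, $\mathsf{S}(f):\mathsf{S}(\mathcal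 A)\to\mathsf{S}(\mathcal B)$ is the geometric morphism with inverse image $g\mapsto g\circ f$. The Scott adjunction is $\mathsf{S}\dashv\mathsf{pt}$; its counit $\epsilon_{\mathcal E}:\mathsf{S}\mathsf{pt}(\mathcal E)\to\mathcal E$ is the geometric morphism with inverse image $\epsilon_{\mathcal E}^*(e)(p)=p^*(e)$. A topos has enough points if the inverse images of all its points are jointly conservative. A presentation of $\mathcal E$ is a geometric embedding $i:\mathcal E\to\mathbf{Set}^X$ into a presheaf topos, $X$ a small category. A $1$-cell $f$ of $\mathrm{Acc}_\omega$ is a topological embedding if $\mathsf{S}(f)$ is a geometric embedding. *)

theory Defs
  imports "HOL-Library.FuncSet" "HOL-Library.Equipollence"
begin

section \<open>Size\<close>

text \<open>
  The base category of sets is taken relative to a Grothendieck universe, given by a type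
  \<open>'u\<close> of inaccessible cardinality \<open>\<kappa>\<close>: a set is small if it has fewer than \<open>\<kappa>\<close> elements.
  Every small set is in bijection with a small subset of \<open>'u\<close>, so small sets are represented
  by the small subsets of \<open>'u\<close>, and small categories, up to isomorphism, by categories whose
  objects and arrows form small subsets of \<open>'u\<close>.
\<close>

definition small_set :: "'u set \<Rightarrow> bool" where
  "small_set A \<longleftrightarrow> A \<prec> (UNIV :: 'u set)"

definition grothendieck_universe :: "'u itself \<Rightarrow> bool" where
  "grothendieck_universe U \<longleftrightarrow>
     (UNIV :: nat set) \<prec> (UNIV :: 'u set) \<and>
     (\<forall>A :: 'u set. small_set A \<longrightarrow> Pow A \<prec> (UNIV :: 'u set)) \<and>
     (\<forall>(A :: 'u set) B. small_set A \<longrightarrow> (\<forall>a\<in>A. small_set (B a)) \<longrightarrow> small_set (\<Union>a\<in>A. B a :: 'u set))"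


section \<open>Categories, functors, natural transformations\<close>

record ('o, 'a) category =
  Obj :: "'o set"
  Arr :: "'a set"
  Dom :: "'a \<Rightarrow> 'o"
  Cod :: "'a \<Rightarrow> 'o"
  Ident :: "'o \<Rightarrow> 'a"
  Comp :: "'a \<Rightarrow> 'a \<Rightarrow> 'a" (infixl "\<cdot>\<index>" 70)

definition Hom :: "('o, 'a) category \<Rightarrow> 'o \<Rightarrow> 'o \<Rightarrow> 'a set" where
  "Hom C a b = {f \<in> Arr C. Dom C f = a \<and> Cod C f = b}"

locale category =
  fixes C :: "('o, 'a) category" (structure)
  assumes dom_in: "f \<in> Arr C \<Longrightarrow> Dom C f \<in> Obj C"
    and cod_in: "f \<in> Arr C \<Longrightarrow> Cod C f \<in> Obj C"
    and id_in: "a \<in> Obj C \<Longrightarrow> Ident C a \<in> Hom C a a"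
    and comp_in: "\<lbrakk>f \<in> Hom C a b; g \<in> Hom C b c\<rbrakk> \<Longrightarrow> g \<cdot> f \<in> Hom C a c"
    and id_left: "f \<in> Hom C a b \<Longrightarrow> Ident C b \<cdot> f = f"
    and id_right: "f \<in> Hom C a b \<Longrightarrow> f \<cdot> Ident C a = f"
    and assoc: "\<lbrakk>f \<in> Hom C a b; g \<in> Hom C b c; h \<in> Hom C c d\<rbrakk> \<Longrightarrow> (h \<cdot> g) \<cdot> f = h \<cdot> (g \<cdot> f)"

definition is_iso :: "('o, 'a) category \<Rightarrow> 'a \<Rightarrow> bool" where
  "is_iso C f \<longleftrightarrow> f \<in> Arr C \<and>
     (\<exists>g \<in> Hom C (Cod C f) (Dom C f).
        g \<cdot>\<^bsub>C\<^esub> f = Ident C (Dom C f) \<and> f \<cdot>\<^bsub>C\<^esub> g = Ident C (Cod C f))"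

definition opposite :: "('o, 'a) category \<Rightarrow> ('o, 'a) category" where
  "opposite C = \<lparr>Obj = Obj C, Arr = Arr C, Dom = Cod C, Cod = Dom C, Ident = Ident C,
                 Comp = (\<lambda>g f. f \<cdot>\<^bsub>C\<^esub> g)\<rparr>"

definition full_subcategory :: "('o, 'a) category \<Rightarrow> ('o \<Rightarrow> bool) \<Rightarrow> ('o, 'a) category" where
  "full_subcategory C P =
     C\<lparr>Obj := {a \<in> Obj C. P a}, Arr := {f \<in> Arr C. P (Dom C f) \<and> P (Cod C f)}\<rparr>"

definition small_category :: "('u, 'u) category \<Rightarrow> bool" where
  "small_category C \<longleftrightarrow> category C \<and> small_set (Obj C) \<and> small_set (Arr C)"

definition finite_category :: "('o, 'a) category \<Rightarrow> bool" where
  "finite_category C \<longleftrightarrow> category C \<and> finite (Obj C) \<and> finite (Arr C)"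

datatype ('o, 'a, 'p, 'b) funct = Funct (fobj: "'o \<Rightarrow> 'p") (farr: "'a \<Rightarrow> 'b")

text \<open>The object and arrow maps are extensional, so that equality of functors is HOL equality.\<close>

locale cat_functor = dom: category C + cod: category D
  for C :: "('o, 'a) category" and D :: "('p, 'b) category" +
  fixes F :: "('o, 'a, 'p, 'b) funct"
  assumes fobj_ext: "fobj F \<in> extensional (Obj C)"
    and farr_ext: "farr F \<in> extensional (Arr C)"
    and fobj_in: "a \<in> Obj C \<Longrightarrow> fobj F a \<in> Obj D"
    and farr_in: "f \<in> Hom C a b \<Longrightarrow> farr F f \<in> Hom D (fobj F a) (fobj F b)"
    and farr_id: "a \<in> Obj C \<Longrightarrow> farr F (Ident C a) = Ident D (fobj F a)"
    and farr_comp: "\<lbrakk>f \<in> Hom C a b; g \<in> Hom C b c\<rbrakk> \<Longrightarrow>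
      farr F (g \<cdot>\<^bsub>C\<^esub> f) = farr F g \<cdot>\<^bsub>D\<^esub> farr F f"

definition id_funct :: "('o, 'a) category \<Rightarrow> ('o, 'a, 'o, 'a) funct" where
  "id_funct C = Funct (\<lambda>a\<in>Obj C. a) (\<lambda>f\<in>Arr C. f)"

definition comp_funct ::
  "('o, 'a) category \<Rightarrow> ('p, 'b, 'q, 'c) funct \<Rightarrow> ('o, 'a, 'p, 'b) funct \<Rightarrow> ('o, 'a, 'q, 'c) funct"
  where
  "comp_funct C G F =
     Funct (\<lambda>a\<in>Obj C. fobj G (fobj F a)) (\<lambda>f\<in>Arr C. farr G (farr F f))"

definition nat_trans ::
  "('o, 'a) category \<Rightarrow> ('p, 'b) category \<Rightarrow> ('o, 'a, 'p, 'b) funct \<Rightarrow> ('o, 'a, 'p, 'b) funct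
     \<Rightarrow> ('o \<Rightarrow> 'b) \<Rightarrow> bool" where
  "nat_trans C D F G \<eta> \<longleftrightarrow> cat_functor C D F \<and> cat_functor C D G \<and> \<eta> \<in> extensional (Obj C) \<and>
     (\<forall>a\<in>Obj C. \<eta> a \<in> Hom D (fobj F a) (fobj G a)) \<and>
     (\<forall>f\<in>Arr C. \<eta> (Cod C f) \<cdot>\<^bsub>D\<^esub> farr F f = farr G f \<cdot>\<^bsub>D\<^esub> \<eta> (Dom C f))"

definition naturally_isomorphic ::
  "('o, 'a) category \<Rightarrow> ('p, 'b) category \<Rightarrow> ('o, 'a, 'p, 'b) funct \<Rightarrow> ('o, 'a, 'p, 'b) funct \<Rightarrow> bool"
  where
  "naturally_isomorphic C D F G \<longleftrightarrow> (\<exists>\<eta>. nat_trans C D F G \<eta> \<and> (\<forall>a\<in>Obj C. is_iso D (\<eta> a)))"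

definition equivalence :: "('o, 'a) category \<Rightarrow> ('p, 'b) category \<Rightarrow> ('o, 'a, 'p, 'b) funct \<Rightarrow> bool"
  where
  "equivalence C D F \<longleftrightarrow> cat_functor C D F \<and>
     (\<exists>G. cat_functor D C G \<and>
        naturally_isomorphic C C (comp_funct C G F) (id_funct C) \<and>
        naturally_isomorphic D D (comp_funct D F G) (id_funct D))"

definition fully_faithful ::
  "('o, 'a) category \<Rightarrow> ('p, 'b) category \<Rightarrow> ('o, 'a, 'p, 'b) funct \<Rightarrow> bool" where
  "fully_faithful C D F \<longleftrightarrow> cat_functor C D F \<and>
     (\<forall>a\<in>Obj C. \<forall>b\<in>Obj C. bij_betw (farr F) (Hom C a b) (Hom D (fobj F a) (fobj F b)))"

text \<open>\<open>L \<stileturn> R\<close> for \<open>L : C \<rightarrow> D\<close> and \<open>R : D \<rightarrow> C\<close>, by unit, counit and triangle identities.\<close>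

definition adjoint ::
  "('o, 'a) category \<Rightarrow> ('p, 'b) category \<Rightarrow> ('o, 'a, 'p, 'b) funct \<Rightarrow> ('p, 'b, 'o, 'a) funct \<Rightarrow> bool"
  where
  "adjoint C D L R \<longleftrightarrow> cat_functor C D L \<and> cat_functor D C R \<and>
     (\<exists>\<eta> \<epsilon>. nat_trans C C (id_funct C) (comp_funct C R L) \<eta> \<and>
            nat_trans D D (comp_funct D L R) (id_funct D) \<epsilon> \<and>
            (\<forall>c\<in>Obj C. \<epsilon> (fobj L c) \<cdot>\<^bsub>D\<^esub> farr L (\<eta> c) = Ident D (fobj L c)) \<and>
            (\<forall>d\<in>Obj D. farr R (\<epsilon> d) \<cdot>\<^bsub>C\<^esub> \<eta> (fobj R d) = Ident C (fobj R d)))"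

text \<open>
  Arrows of the category of sets and of functor categories carry their source and target.
\<close>

datatype ('x, 'y) arrow = Arrow (src: 'x) (body: 'y) (tgt: 'x)

definition functor_category ::
  "('o, 'a) category \<Rightarrow> ('p, 'b) category
     \<Rightarrow> (('o, 'a, 'p, 'b) funct, (('o, 'a, 'p, 'b) funct, 'o \<Rightarrow> 'b) arrow) category" where
  "functor_category C D =
     \<lparr>Obj = {F. cat_functor C D F},
      Arr = {\<alpha>. nat_trans C D (src \<alpha>) (tgt \<alpha>) (body \<alpha>)},
      Dom = src,
      Cod = tgt,
      Ident = (\<lambda>F. Arrow F (\<lambda>a\<in>Obj C. Ident D (fobj F a)) F),
      Comp = (\<lambda>\<beta> \<alpha>. Arrow (src \<alpha>) (\<lambda>a\<in>Obj C. body \<beta> a \<cdot>\<^bsub>D\<^esub> body \<alpha> a) (tgt \<beta>))\<rparr>"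


section \<open>Limits and colimits\<close>

definition is_cone ::
  "('j, 'k) category \<Rightarrow> ('o, 'a) category \<Rightarrow> ('j, 'k, 'o, 'a) funct \<Rightarrow> 'o \<Rightarrow> ('j \<Rightarrow> 'a) \<Rightarrow> bool" where
  "is_cone J C D c p \<longleftrightarrow> c \<in> Obj C \<and> (\<forall>j\<in>Obj J. p j \<in> Hom C c (fobj D j)) \<and>
     (\<forall>k\<in>Arr J. farr D k \<cdot>\<^bsub>C\<^esub> p (Dom J k) = p (Cod J k))"

definition is_limit ::
  "('j, 'k) category \<Rightarrow> ('o, 'a) category \<Rightarrow> ('j, 'k, 'o, 'a) funct \<Rightarrow> 'o \<Rightarrow> ('j \<Rightarrow> 'a) \<Rightarrow> bool" where
  "is_limit J C D c p \<longleftrightarrow> is_cone J C D c p \<and>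
     (\<forall>x q. is_cone J C D x q \<longrightarrow> (\<exists>!u. u \<in> Hom C x c \<and> (\<forall>j\<in>Obj J. p j \<cdot>\<^bsub>C\<^esub> u = q j)))"

definition is_cocone ::
  "('j, 'k) category \<Rightarrow> ('o, 'a) category \<Rightarrow> ('j, 'k, 'o, 'a) funct \<Rightarrow> 'o \<Rightarrow> ('j \<Rightarrow> 'a) \<Rightarrow> bool" where
  "is_cocone J C D c i \<longleftrightarrow> c \<in> Obj C \<and> (\<forall>j\<in>Obj J. i j \<in> Hom C (fobj D j) c) \<and>
     (\<forall>k\<in>Arr J. i (Cod J k) \<cdot>\<^bsub>C\<^esub> farr D k = i (Dom J k))"

definition is_colimit ::
  "('j, 'k) category \<Rightarrow> ('o, 'a) category \<Rightarrow> ('j, 'k, 'o, 'a) funct \<Rightarrow> 'o \<Rightarrow> ('j \<Rightarrow> 'a) \<Rightarrow> bool" where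
  "is_colimit J C D c i \<longleftrightarrow> is_cocone J C D c i \<and>
     (\<forall>x q. is_cocone J C D x q \<longrightarrow> (\<exists>!u. u \<in> Hom C c x \<and> (\<forall>j\<in>Obj J. u \<cdot>\<^bsub>C\<^esub> i j = q j)))"

definition preserves_limits_of_shape ::
  "('j, 'k) category \<Rightarrow> ('o, 'a) category \<Rightarrow> ('p, 'b) category \<Rightarrow> ('o, 'a, 'p, 'b) funct \<Rightarrow> bool"
  where
  "preserves_limits_of_shape J C C' F \<longleftrightarrow>
     (\<forall>D c p. cat_functor J C D \<longrightarrow> is_limit J C D c p \<longrightarrow>
        is_limit J C' (comp_funct J F D) (fobj F c) (\<lambda>j. farr F (p j)))"

definition preserves_colimits_of_shape ::
  "('j, 'k) category \<Rightarrow> ('o, 'a) category \<Rightarrow> ('p, 'b) category \<Rightarrow> ('o, 'a, 'p, 'b) funct \<Rightarrow> bool"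
  where
  "preserves_colimits_of_shape J C C' F \<longleftrightarrow>
     (\<forall>D c i. cat_functor J C D \<longrightarrow> is_colimit J C D c i \<longrightarrow>
        is_colimit J C' (comp_funct J F D) (fobj F c) (\<lambda>j. farr F (i j)))"

text \<open>Every finite category is isomorphic to one whose objects and arrows are natural numbers.\<close>

definition left_exact ::
  "('o, 'a) category \<Rightarrow> ('p, 'b) category \<Rightarrow> ('o, 'a, 'p, 'b) funct \<Rightarrow> bool" where
  "left_exact C C' F \<longleftrightarrow> cat_functor C C' F \<and>
     (\<forall>J :: (nat, nat) category. finite_category J \<longrightarrow> preserves_limits_of_shape J C C' F)"

definition cocontinuous ::
  "'u itself \<Rightarrow> ('o, 'a) category \<Rightarrow> ('p, 'b) category \<Rightarrow> ('o, 'a, 'p, 'b) funct \<Rightarrow> bool" where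
  "cocontinuous U C C' F \<longleftrightarrow> cat_functor C C' F \<and>
     (\<forall>J :: ('u, 'u) category. small_category J \<longrightarrow> preserves_colimits_of_shape J C C' F)"

definition directed_poset :: "'u set \<Rightarrow> 'u rel \<Rightarrow> bool" where
  "directed_poset P r \<longleftrightarrow> partial_order_on P r \<and> P \<noteq> {} \<and>
     (\<forall>x\<in>P. \<forall>y\<in>P. \<exists>z\<in>P. (x, z) \<in> r \<and> (y, z) \<in> r)"

definition poset_category :: "'u set \<Rightarrow> 'u rel \<Rightarrow> ('u, 'u \<times> 'u) category" where
  "poset_category P r =
     \<lparr>Obj = P, Arr = r, Dom = fst, Cod = snd, Ident = (\<lambda>x. (x, x)),
      Comp = (\<lambda>g f. (fst f, snd g))\<rparr>"

definition preserves_directed_colimits ::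
  "'u itself \<Rightarrow> ('o, 'a) category \<Rightarrow> ('p, 'b) category \<Rightarrow> ('o, 'a, 'p, 'b) funct \<Rightarrow> bool" where
  "preserves_directed_colimits U C C' F \<longleftrightarrow> cat_functor C C' F \<and>
     (\<forall>(P :: 'u set) r. small_set P \<longrightarrow> directed_poset P r \<longrightarrow>
        preserves_colimits_of_shape (poset_category P r) C C' F)"


section \<open>Sets and Grothendieck topoi\<close>

type_synonym 'u set_arrow = "('u set, 'u \<Rightarrow> 'u) arrow"
type_synonym ('o, 'a, 'u) set_funct = "('o, 'a, 'u set, 'u set_arrow) funct"
type_synonym ('o, 'a, 'u) set_nat = "(('o, 'a, 'u) set_funct, 'o \<Rightarrow> 'u set_arrow) arrow"

definition set_category :: "('u set, 'u set_arrow) category" where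
  "set_category =
     \<lparr>Obj = {A. small_set A},
      Arr = {f. small_set (src f) \<and> small_set (tgt f) \<and> body f \<in> src f \<rightarrow>\<^sub>E tgt f},
      Dom = src,
      Cod = tgt,
      Ident = (\<lambda>A. Arrow A (\<lambda>x\<in>A. x) A),
      Comp = (\<lambda>g f. Arrow (src f) (\<lambda>x\<in>src f. body g (body f x)) (tgt g))\<rparr>"

text \<open>The category \<open>Set\<^sup>X\<close> of covariant functors from \<open>X\<close> to sets.\<close>

abbreviation set_power ::
  "('o, 'a) category \<Rightarrow> (('o, 'a, 'u) set_funct, ('o, 'a, 'u) set_nat) category" where
  "set_power X \<equiv> functor_category X set_category"

definition is_sieve :: "('o, 'a) category \<Rightarrow> 'o \<Rightarrow> 'a set \<Rightarrow> bool" where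
  "is_sieve C c S \<longleftrightarrow> S \<subseteq> {f \<in> Arr C. Cod C f = c} \<and>
     (\<forall>f\<in>S. \<forall>g\<in>Arr C. Cod C g = Dom C f \<longrightarrow> f \<cdot>\<^bsub>C\<^esub> g \<in> S)"

definition pullback_sieve :: "('o, 'a) category \<Rightarrow> 'a \<Rightarrow> 'a set \<Rightarrow> 'a set" where
  "pullback_sieve C h S = {g \<in> Arr C. Cod C g = Dom C h \<and> h \<cdot>\<^bsub>C\<^esub> g \<in> S}"

definition grothendieck_topology :: "('o, 'a) category \<Rightarrow> ('o \<Rightarrow> 'a set set) \<Rightarrow> bool" where
  "grothendieck_topology C J \<longleftrightarrow>
     (\<forall>c\<in>Obj C. \<forall>S\<in>J c. is_sieve C c S) \<and>
     (\<forall>c\<in>Obj C. {f \<in> Arr C. Cod C f = c} \<in> J c) \<and>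
     (\<forall>h\<in>Arr C. \<forall>S\<in>J (Cod C h). pullback_sieve C h S \<in> J (Dom C h)) \<and>
     (\<forall>c\<in>Obj C. \<forall>S\<in>J c. \<forall>R. is_sieve C c R \<longrightarrow>
        (\<forall>h\<in>S. pullback_sieve C h R \<in> J (Dom C h)) \<longrightarrow> R \<in> J c)"

definition matching_family ::
  "('o, 'a) category \<Rightarrow> ('o, 'a, 'u) set_funct \<Rightarrow> 'a set \<Rightarrow> ('a \<Rightarrow> 'u) \<Rightarrow> bool" where
  "matching_family C P S x \<longleftrightarrow>
     (\<forall>f\<in>S. x f \<in> fobj P (Dom C f)) \<and>
     (\<forall>f\<in>S. \<forall>g\<in>Arr C. Cod C g = Dom C f \<longrightarrow> x (f \<cdot>\<^bsub>C\<^esub> g) = body (farr P g) (x f))"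

definition is_sheaf ::
  "('o, 'a) category \<Rightarrow> ('o \<Rightarrow> 'a set set) \<Rightarrow> ('o, 'a, 'u) set_funct \<Rightarrow> bool" where
  "is_sheaf C J P \<longleftrightarrow> cat_functor (opposite C) set_category P \<and>
     (\<forall>c\<in>Obj C. \<forall>S\<in>J c. \<forall>x. matching_family C P S x \<longrightarrow>
        (\<exists>!y. y \<in> fobj P c \<and> (\<forall>f\<in>S. body (farr P f) y = x f)))"

definition sheaf_category ::
  "('o, 'a) category \<Rightarrow> ('o \<Rightarrow> 'a set set)
     \<Rightarrow> (('o, 'a, 'u) set_funct, ('o, 'a, 'u) set_nat) category" where
  "sheaf_category C J = full_subcategory (set_power (opposite C)) (is_sheaf C J)"

definition grothendieck_topos :: "'u itself \<Rightarrow> ('o, 'a) category \<Rightarrow> bool" where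
  "grothendieck_topos U E \<longleftrightarrow> category E \<and>
     (\<exists>(C :: ('u, 'u) category) J (F :: ('o, 'a, ('u, 'u, 'u) set_funct, ('u, 'u, 'u) set_nat) funct).
        small_category C \<and> grothendieck_topology C J \<and> equivalence E (sheaf_category C J) F)"


section \<open>Geometric morphisms\<close>

text \<open>
  A geometric morphism \<open>f : E \<rightarrow> F\<close> is given by its inverse image \<open>f_inv : F \<rightarrow> E\<close> and its direct
  image \<open>f_dir : E \<rightarrow> F\<close>.
\<close>

definition geometric_morphism ::
  "('o, 'a) category \<Rightarrow> ('p, 'b) category \<Rightarrow> ('p, 'b, 'o, 'a) funct \<Rightarrow> ('o, 'a, 'p, 'b) funct \<Rightarrow> bool"
  where
  "geometric_morphism E F f_inv f_dir \<longleftrightarrow> adjoint F E f_inv f_dir \<and> left_exact F E f_inv"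

definition geometric_embedding ::
  "('o, 'a) category \<Rightarrow> ('p, 'b) category \<Rightarrow> ('p, 'b, 'o, 'a) funct \<Rightarrow> ('o, 'a, 'p, 'b) funct \<Rightarrow> bool"
  where
  "geometric_embedding E F f_inv f_dir \<longleftrightarrow> geometric_morphism E F f_inv f_dir \<and> fully_faithful E F f_dir"

definition geometric_equivalence ::
  "('o, 'a) category \<Rightarrow> ('p, 'b) category \<Rightarrow> ('p, 'b, 'o, 'a) funct \<Rightarrow> ('o, 'a, 'p, 'b) funct \<Rightarrow> bool"
  where
  "geometric_equivalence E F f_inv f_dir \<longleftrightarrow> geometric_morphism E F f_inv f_dir \<and> equivalence F E f_inv"

definition is_presentation ::
  "('o, 'a) category \<Rightarrow> ('u, 'u) category
     \<Rightarrow> (('u, 'u, 'u) set_funct, ('u, 'u, 'u) set_nat, 'o, 'a) funct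
     \<Rightarrow> ('o, 'a, ('u, 'u, 'u) set_funct, ('u, 'u, 'u) set_nat) funct \<Rightarrow> bool" where
  "is_presentation E X f_inv f_dir \<longleftrightarrow> small_category X \<and> geometric_embedding E (set_power X) f_inv f_dir"


section \<open>The Scott adjunction\<close>

text \<open>
  Precomposition with \<open>F : C \<rightarrow> D\<close>, as a functor defined on a category \<open>Q\<close> of functors
  out of \<open>D\<close>; \<open>D\<close> itself is not needed to write it down.
\<close>

definition precomposition ::
  "(('p, 'b, 'q, 'c) funct, (('p, 'b, 'q, 'c) funct, 'p \<Rightarrow> 'c) arrow) category
     \<Rightarrow> ('o, 'a) category \<Rightarrow> ('o, 'a, 'p, 'b) funct
     \<Rightarrow> (('p, 'b, 'q, 'c) funct, (('p, 'b, 'q, 'c) funct, 'p \<Rightarrow> 'c) arrow,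
         ('o, 'a, 'q, 'c) funct, (('o, 'a, 'q, 'c) funct, 'o \<Rightarrow> 'c) arrow) funct" where
  "precomposition Q C F =
     Funct (\<lambda>G\<in>Obj Q. comp_funct C G F)
           (\<lambda>\<alpha>\<in>Arr Q. Arrow (comp_funct C (src \<alpha>) F) (\<lambda>a\<in>Obj C. body \<alpha> (fobj F a))
                            (comp_funct C (tgt \<alpha>) F))"

definition points ::
  "'u itself \<Rightarrow> ('o, 'a) category \<Rightarrow> (('o, 'a, 'u) set_funct, ('o, 'a, 'u) set_nat) category" where
  "points U E = full_subcategory (set_power E)
     (\<lambda>p. cocontinuous U E set_category p \<and> left_exact E set_category p)"

text \<open>The functor \<open>pt(f) : pt(E) \<rightarrow> pt(F)\<close> for \<open>f : E \<rightarrow> F\<close> with inverse image \<open>f_inv\<close>.\<close>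

definition points_map ::
  "'u itself \<Rightarrow> ('o, 'a) category \<Rightarrow> ('p, 'b) category \<Rightarrow> ('p, 'b, 'o, 'a) funct
     \<Rightarrow> (('o, 'a, 'u) set_funct, ('o, 'a, 'u) set_nat,
         ('p, 'b, 'u) set_funct, ('p, 'b, 'u) set_nat) funct" where
  "points_map U E F f_inv = precomposition (points U E) F f_inv"

definition enough_points :: "'u itself \<Rightarrow> ('o, 'a) category \<Rightarrow> bool" where
  "enough_points U E \<longleftrightarrow>
     (\<forall>f\<in>Arr E. (\<forall>p\<in>Obj (points U E). is_iso set_category (farr p f)) \<longrightarrow> is_iso E f)"

definition scott ::
  "'u itself \<Rightarrow> ('o, 'a) category \<Rightarrow> (('o, 'a, 'u) set_funct, ('o, 'a, 'u) set_nat) category" where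
  "scott U A = full_subcategory (set_power A) (preserves_directed_colimits U A set_category)"

text \<open>The inverse image \<open>S(B) \<rightarrow> S(A)\<close> of the geometric morphism \<open>S(f) : S(A) \<rightarrow> S(B)\<close>.\<close>

definition scott_inverse_image ::
  "'u itself \<Rightarrow> ('o, 'a) category \<Rightarrow> ('p, 'b) category \<Rightarrow> ('o, 'a, 'p, 'b) funct
     \<Rightarrow> (('p, 'b, 'u) set_funct, ('p, 'b, 'u) set_nat,
         ('o, 'a, 'u) set_funct, ('o, 'a, 'u) set_nat) funct" where
  "scott_inverse_image U A B f = precomposition (scott U B) A f"

text \<open>
  The direct image of \<open>S(f)\<close> is only determined up to isomorphism as a right adjoint, whence the
  existential quantifier; being fully faithful does not depend on the choice.
  Accessibility of \<open>A\<close> and \<open>B\<close> is not imposed, since the construction of \<open>S\<close> makes no use of it;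
  categories of points of topoi are always accessible.
\<close>

definition topological_embedding ::
  "'u itself \<Rightarrow> ('o, 'a) category \<Rightarrow> ('p, 'b) category \<Rightarrow> ('o, 'a, 'p, 'b) funct \<Rightarrow> bool" where
  "topological_embedding U A B f \<longleftrightarrow> preserves_directed_colimits U A B f \<and>
     (\<exists>dir. geometric_embedding (scott U A) (scott U B) (scott_inverse_image U A B f) dir)"

text \<open>Evaluation: \<open>e\<close> is sent to \<open>p \<mapsto> p(e)\<close>.\<close>

definition counit_inverse_image ::
  "'u itself \<Rightarrow> ('o, 'a) category
     \<Rightarrow> ('o, 'a, (('o, 'a, 'u) set_funct, ('o, 'a, 'u) set_nat, 'u) set_funct,
                 (('o, 'a, 'u) set_funct, ('o, 'a, 'u) set_nat, 'u) set_nat) funct" where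
  "counit_inverse_image U E =
     (let ev = (\<lambda>e. Funct (\<lambda>p\<in>Obj (points U E). fobj p e) (\<lambda>\<alpha>\<in>Arr (points U E). body \<alpha> e))
      in Funct (\<lambda>e\<in>Obj E. ev e)
               (\<lambda>u\<in>Arr E. Arrow (ev (Dom E u)) (\<lambda>p\<in>Obj (points U E). farr p u) (ev (Cod E u))))"

definition counit_is_equivalence :: "'u itself \<Rightarrow> ('o, 'a) category \<Rightarrow> bool" where
  "counit_is_equivalence U E \<longleftrightarrow>
     (\<exists>dir. geometric_equivalence (scott U (points U E)) E (counit_inverse_image U E) dir)"

end

theory Submission
  imports Defs
begin

abbreviation Sets :: "('u set, 'u set_arrow) category" where "Sets \<equiv> set_category"

notation fobj (infixl "$" 999)

notation iff (infixr "<->" 25)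

type_synonym 'u psh = "('u, 'u, 'u) set_funct"
type_synonym 'u psh_map = "('u, 'u, 'u) set_nat"
type_synonym 'u psh_funct = "('u psh, 'u psh_map, 'u) set_funct"
type_synonym 'u psh_nat = "('u psh, 'u psh_map, 'u) set_nat"

abbreviation comp_in :: "'a => ('o, 'a) category => 'a => 'a" ("(_/ $$_$$ _)" [70, 0, 71] 70)
 where "g $$C$$ f \<equiv> Comp C g f"

section \<open>Arrows, isomorphisms and functors\<close>

lemma in_Hom: "f : Hom C a b <-> f : Arr C & Dom C f = a & Cod C f = b"
 by (simp add: Hom_def)

lemma HomD: assumes "f : Hom C a b" shows "f : Arr C" "Dom C f = a" "Cod C f = b"
 using assms by (simp_all add: Hom_def)

context category
begin

lemma obj_simps [simp]: "f : Arr C ==> Dom C f : Obj C" "f : Arr C ==> Cod C f : Obj C"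
 using dom_in cod_in by auto

lemma Hom_obj: assumes "f : Hom C a b" shows "a : Obj C" "b : Obj C"
 using assms by (auto simp: in_Hom)

lemma ident_simps [simp]:
 assumes "a : Obj C"
 shows "Ident C a : Arr C" "Dom C (Ident C a) = a" "Cod C (Ident C a) = a"
 using id_in[OF assms] by (simp_all add: in_Hom)

lemma comp_simps [simp]:
 assumes "f : Arr C" "g : Arr C" "Dom C g = Cod C f"
 shows "g \<cdot> f : Arr C" "Dom C (g \<cdot> f) = Dom C f" "Cod C (g \<cdot> f) = Cod C g"
 using comp_in[of f "Dom C f" "Cod C f" g "Cod C g"] assms by (simp_all add: in_Hom)

lemma assoc_simp [simp]:
 assumes "f : Arr C" "g : Arr C" "h : Arr C" "Dom C g = Cod C f" "Dom C h = Cod C g"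
 shows "(h \<cdot> g) \<cdot> f = h \<cdot> (g \<cdot> f)"
 using assoc[of f "Dom C f" "Cod C f" g "Cod C g" h "Cod C h"] assms by (simp add: in_Hom)

lemma id_simps [simp]:
 assumes "f : Arr C"
 shows "Cod C f = b ==> Ident C b \<cdot> f = f" "Dom C f = a ==> f \<cdot> Ident C a = f"
 using id_left[of f] id_right[of f] assms by (auto simp: in_Hom)

lemma comp_left_eq:
 assumes "g \<cdot> f = k" "f : Arr C" "g : Arr C" "h : Arr C" "Dom C g = Cod C f" "Dom C f = Cod C h"
 shows "g \<cdot> (f \<cdot> h) = k \<cdot> h"
 using assoc_simp[of h f g] assms by simp

lemma cancel_left:
 assumes "g \<cdot> f = Ident C a" "f : Hom C a b" "g : Hom C b a" "h : Hom C c a"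
 shows "g \<cdot> (f \<cdot> h) = h"
 using assoc[OF assms(4,2,3)] assms(1) id_left[OF assms(4)] by simp

lemma cancel_right:
 assumes "f \<cdot> g = Ident C b" "f : Hom C a b" "g : Hom C b a" "h : Hom C b c"
 shows "(h \<cdot> f) \<cdot> g = h"
 using assoc[OF assms(3,2,4)] assms(1) id_right[OF assms(4)] by simp

lemma is_isoI:
 assumes "f : Hom C a b" "g : Hom C b a" "g \<cdot> f = Ident C a" "f \<cdot> g = Ident C b"
 shows "is_iso C f"
 using assms by (auto simp: is_iso_def in_Hom)

lemma is_isoE:
 assumes "is_iso C f" "f : Hom C a b"
 obtains g where "g : Hom C b a" "g \<cdot> f = Ident C a" "f \<cdot> g = Ident C b"
proof -
 have "Dom C f = a" "Cod C f = b" using assms(2) by (simp_all add: in_Hom)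
 with assms(1) that show thesis unfolding is_iso_def by auto
qed

lemma iso_inverse:
 assumes "is_iso C f" "f : Hom C a b"
 obtains g where "g : Hom C b a" "is_iso C g" "g \<cdot> f = Ident C a" "f \<cdot> g = Ident C b"
proof -
 obtain g where "g : Hom C b a" "g \<cdot> f = Ident C a" "f \<cdot> g = Ident C b"
  using is_isoE[OF assms] .
 with is_isoI[OF this(1) assms(2) this(3,2)] show thesis by (intro that)
qed

lemma iso_ident: "a : Obj C ==> is_iso C (Ident C a)"
 by (rule is_isoI[of _ a a "Ident C a"]) (auto simp: in_Hom)

lemma iso_comp:
 assumes "is_iso C f" "f : Hom C a b" "is_iso C g" "g : Hom C b c"
 shows "is_iso C (g \<cdot> f)"
proof -
 obtain f' where f': "f' : Hom C b a" "f' \<cdot> f = Ident C a" "f \<cdot> f' = Ident C b"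
  using is_isoE[OF assms(1,2)] by blast
 obtain g' where g': "g' : Hom C c b" "g' \<cdot> g = Ident C b" "g \<cdot> g' = Ident C c"
  using is_isoE[OF assms(3,4)] by blast
 note h = assms(2,4) f'(1) g'(1)
 have "(f' \<cdot> g') \<cdot> (g \<cdot> f) = f' \<cdot> ((g' \<cdot> g) \<cdot> f)" using h by (simp add: in_Hom)
 moreover have "(g \<cdot> f) \<cdot> (f' \<cdot> g') = g \<cdot> ((f \<cdot> f') \<cdot> g')" using h by (simp add: in_Hom)
 ultimately show ?thesis
  using h f' g' by (intro is_isoI[of "g \<cdot> f" a c "f' \<cdot> g'"]) (auto simp: in_Hom)
qed

lemma iso_mono:
 assumes "is_iso C f" "f : Hom C a b" "x : Hom C c a" "y : Hom C c a" "f \<cdot> x = f \<cdot> y"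
 shows "x = y"
proof -
 obtain f' where f': "f' : Hom C b a" "f' \<cdot> f = Ident C a"
  using is_isoE[OF assms(1,2)] by blast
 have "f' \<cdot> (f \<cdot> x) = x" "f' \<cdot> (f \<cdot> y) = y"
  using cancel_left[OF f'(2) assms(2) f'(1)] assms(3,4) by blast+
 with assms(5) show ?thesis by metis
qed

lemma iso_epi:
 assumes "is_iso C f" "f : Hom C a b" "x : Hom C b c" "y : Hom C b c" "x \<cdot> f = y \<cdot> f"
 shows "x = y"
proof -
 obtain f' where f': "f' : Hom C b a" "f \<cdot> f' = Ident C b"
  using is_isoE[OF assms(1,2)] by blast
 have "(x \<cdot> f) \<cdot> f' = x" "(y \<cdot> f) \<cdot> f' = y"
  using cancel_right[OF f'(2) assms(2) f'(1)] assms(3,4) by blast+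
 with assms(5) show ?thesis by metis
qed

end

definition isomorphic :: "('o, 'a) category => 'o => 'o => bool" where
 "isomorphic C a b <-> (EX f:Hom C a b. is_iso C f)"

lemma (in category) isomorphic_sym: "isomorphic C a b ==> isomorphic C b a"
proof -
 assume "isomorphic C a b"
 then obtain f where f: "f : Hom C a b" "is_iso C f" by (auto simp: isomorphic_def)
 obtain g where "g : Hom C b a" "is_iso C g" using iso_inverse[OF f(2,1)] .
 then show ?thesis by (auto simp: isomorphic_def)
qed

lemma (in category) isomorphic_trans: "isomorphic C a b ==> isomorphic C b c ==> isomorphic C a c"
proof -
 assume "isomorphic C a b" "isomorphic C b c"
 then obtain f g where fg: "f : Hom C a b" "is_iso C f" "g : Hom C b c" "is_iso C g"
  by (auto simp: isomorphic_def)
 show ?thesis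
  using iso_comp[OF fg(2,1,4,3)] comp_in[OF fg(1,3)] by (auto simp: isomorphic_def)
qed

lemma Hom_opposite [simp]: "Hom (opposite C) a b = Hom C b a"
 by (auto simp: Hom_def opposite_def)

lemma opposite_simps [simp]:
 "Obj (opposite C) = Obj C" "Arr (opposite C) = Arr C" "Dom (opposite C) = Cod C"
 "Cod (opposite C) = Dom C" "Ident (opposite C) = Ident C"
 "g $$opposite C$$ f = f $$C$$ g"
 by (simp_all add: opposite_def)

lemma category_opposite: "category C ==> category (opposite C)"
proof -
 assume "category C"
 then interpret category C .
 show ?thesis
  by unfold_locales (auto simp: in_Hom)
qed

lemma full_subcategory_simps [simp]:
 "Obj (full_subcategory C P) = {a : Obj C. P a}"
 "Arr (full_subcategory C P) = {f : Arr C. P (Dom C f) & P (Cod C f)}"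
 "Dom (full_subcategory C P) = Dom C" "Cod (full_subcategory C P) = Cod C"
 "Ident (full_subcategory C P) = Ident C" "Comp (full_subcategory C P) = Comp C"
 by (simp_all add: full_subcategory_def)

lemma Hom_full_subcategory [simp]: "P a ==> P b ==> Hom (full_subcategory C P) a b = Hom C a b"
 by (auto simp: Hom_def)

lemma category_full_subcategory: "category C ==> category (full_subcategory C P)"
proof -
 assume "category C"
 then interpret category C .
 show ?thesis
  by unfold_locales (auto simp: in_Hom)
qed

lemma is_iso_full_subcategory:
 assumes "category C" "f : Arr (full_subcategory C P)"
 shows "is_iso (full_subcategory C P) f <-> is_iso C f"
 using assms by (simp add: is_iso_def)

context cat_functor
begin

lemma arr_simps [simp]:
 assumes "f : Arr C"
 shows "farr F f : Arr D" "Dom D (farr F f) = F$(Dom C f)" "Cod D (farr F f) = F$(Cod C f)"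
 using farr_in[of f "Dom C f" "Cod C f"] assms by (simp_all add: in_Hom)

lemma fcomp_simp [simp]:
 assumes "f : Arr C" "g : Arr C" "Dom C g = Cod C f"
 shows "farr F (g $$C$$ f) = farr F g $$D$$ farr F f"
 using farr_comp[of f "Dom C f" "Cod C f" g "Cod C g"] assms by (simp_all add: in_Hom)

declare fobj_in [simp] farr_id [simp]

lemma preserves_iso: "is_iso C f ==> is_iso D (farr F f)"
proof -
 assume f: "is_iso C f"
 then have fA: "f : Hom C (Dom C f) (Cod C f)" by (simp add: is_iso_def in_Hom)
 then obtain g where g: "g : Hom C (Cod C f) (Dom C f)" "g $$C$$ f = Ident C (Dom C f)"
   "f $$C$$ g = Ident C (Cod C f)"
  using dom.is_isoE[OF f fA] by blast
 have "farr F g $$D$$ farr F f = farr F (g $$C$$ f)" "farr F f $$D$$ farr F g = farr F (f $$C$$ g)"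
  using fA g(1) by (simp_all add: in_Hom)
 then show ?thesis using g fA
  by (intro cod.is_isoI[of "farr F f" "F$(Dom C f)" "F$(Cod C f)" "farr F g"])
   (auto simp: in_Hom)
qed

lemma preserves_isomorphic: "isomorphic C a b ==> isomorphic D (F$a) (F$b)"
 unfolding isomorphic_def using farr_in preserves_iso by blast

text \<open>Conjugating with isomorphisms commutes with applying the functor.\<close>

lemma bij_on_Hom_transport:
 assumes "isomorphic C a' a" "isomorphic C b b'"
  and bij: "bij_betw (farr F) (Hom C a b) (Hom D (F$a) (F$b))"
 shows "bij_betw (farr F) (Hom C a' b') (Hom D (F$a') (F$b'))"
proof -
 obtain u where u: "u : Hom C a' a" "is_iso C u" using assms(1) by (auto simp: isomorphic_def)
 obtain v where v: "v : Hom C b b'" "is_iso C v" using assms(2) by (auto simp: isomorphic_def)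
 obtain u' where u': "u' : Hom C a a'" "is_iso C u'" "u' $$C$$ u = Ident C a'" "u $$C$$ u' = Ident C a"
  using dom.iso_inverse[OF u(2,1)] by blast
 obtain v' where v': "v' : Hom C b' b" "is_iso C v'" "v' $$C$$ v = Ident C b" "v $$C$$ v' = Ident C b'"
  using dom.iso_inverse[OF v(2,1)] by blast
 have Fu: "farr F u' $$D$$ farr F u = Ident D (F$a')"
  using u u' dom.Hom_obj[OF u(1)] by (metis HomD fcomp_simp farr_id)
 have Fv: "farr F v $$D$$ farr F v' = Ident D (F$b')"
  using v v' dom.Hom_obj[OF v(1)] by (metis HomD fcomp_simp farr_id)
 have obs: "a : Obj C" "a' : Obj C" "b : Obj C" "b' : Obj C"
  using u v dom.Hom_obj by auto
 show ?thesis
 proof (rule bij_betwI')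
  fix f g assume fg: "f : Hom C a' b'" "g : Hom C a' b'"
  show "farr F f = farr F g <-> f = g"
  proof
   assume eq: "farr F f = farr F g"
   have "farr F (v' $$C$$ (f $$C$$ u')) = farr F (v' $$C$$ (g $$C$$ u'))"
    using fg u' v' eq by (simp add: in_Hom)
   moreover have "v' $$C$$ (f $$C$$ u') : Hom C a b" "v' $$C$$ (g $$C$$ u') : Hom C a b"
    using fg u' v' by (auto simp: in_Hom)
   ultimately have "v' $$C$$ (f $$C$$ u') = v' $$C$$ (g $$C$$ u')"
    using bij by (meson bij_betw_imp_inj_on inj_onD)
   then have "f $$C$$ u' = g $$C$$ u'"
    by (rule dom.iso_mono[OF v'(2,1), rotated 2]) (use fg u' in \<open>auto simp: in_Hom\<close>)
   then show "f = g"
    by (rule dom.iso_epi[OF u'(2,1), rotated 2]) (use fg in \<open>auto\<close>)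
  qed simp
 next
  fix f assume "f : Hom C a' b'"
  then show "farr F f : Hom D (F$a') (F$b')" by (rule farr_in)
 next
  fix k assume k: "k : Hom D (F$a') (F$b')"
  have "farr F v' $$D$$ (k $$D$$ farr F u') : Hom D (F$a) (F$b)"
   using k u' v' by (auto simp: in_Hom)
  then obtain h where h: "h : Hom C a b" "farr F h = farr F v' $$D$$ (k $$D$$ farr F u')"
   using bij by (metis bij_betw_imp_surj_on imageE)
  have "farr F (v $$C$$ (h $$C$$ u)) = farr F v $$D$$ (farr F v' $$D$$ (k $$D$$ (farr F u' $$D$$ farr F u)))"
   using h u v u' v' k by (simp add: in_Hom)
  also have "\<dots> = k"
   using cod.cancel_left[OF Fv farr_in[OF v'(1)] farr_in[OF v(1)] k] Fu k obs
   by (simp add: in_Hom)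
  finally show "EX x:Hom C a' b'. k = farr F x"
   using h u v by (intro bexI[of _ "v $$C$$ (h $$C$$ u)"]) (auto simp: in_Hom)
 qed
qed

end

lemma comp_funct_simps [simp]:
 "a : Obj C ==> (comp_funct C G F)$a = G$(F$a)"
 "f : Arr C ==> farr (comp_funct C G F) f = farr G (farr F f)"
 by (simp_all add: comp_funct_def)

lemma id_funct_simps [simp]:
 "a : Obj C ==> (id_funct C)$a = a"
 "f : Arr C ==> farr (id_funct C) f = f"
 by (simp_all add: id_funct_def)

lemma cat_functor_comp:
 assumes "cat_functor C D F" "cat_functor D E G"
 shows "cat_functor C E (comp_funct C G F)"
proof -
 interpret F: cat_functor C D F by fact
 interpret G: cat_functor D E G by fact
 show ?thesis
  by unfold_locales (auto simp: comp_funct_def in_Hom)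
qed

lemma cat_functor_id: "category C ==> cat_functor C C (id_funct C)"
proof -
 assume "category C"
 then interpret category C .
 show ?thesis by unfold_locales (auto simp: id_funct_def in_Hom)
qed

lemma funct_eqI: "fobj F = fobj G ==> farr F = farr G ==> F = G"
 by (cases F; cases G) simp

lemma cat_functor_eqI:
 assumes "cat_functor C D F" "cat_functor C D G"
  and "!!a. a : Obj C ==> F$a = G$a" "!!f. f : Arr C ==> farr F f = farr G f"
 shows "F = G"
proof -
 interpret F: cat_functor C D F by fact
 interpret G: cat_functor C D G by fact
 show ?thesis
  using extensionalityI[OF F.fobj_ext G.fobj_ext] extensionalityI[OF F.farr_ext G.farr_ext] assms
  by (intro funct_eqI) auto
qed

lemma nat_transD:
 assumes "nat_trans C D F G eta"
 shows "cat_functor C D F" "cat_functor C D G" "!!a. a : Obj C ==> eta a : Arr D"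
  "!!a. a : Obj C ==> Dom D (eta a) = F$a" "!!a. a : Obj C ==> Cod D (eta a) = G$a"
  "!!f. f : Arr C ==> eta (Cod C f) $$D$$ farr F f = farr G f $$D$$ eta (Dom C f)"
 using assms by (auto simp: nat_trans_def in_Hom)

lemma inverse_nat_trans:
 assumes eta: "nat_trans C D F G eta" and iso: "!!a. a : Obj C ==> is_iso D (eta a)"
 obtains tht where "nat_trans C D G F tht" "!!a. a : Obj C ==> is_iso D (tht a)"
  "!!a. a : Obj C ==> tht a $$D$$ eta a = Ident D (F$a)"
  "!!a. a : Obj C ==> eta a $$D$$ tht a = Ident D (G$a)"
proof -
 note N = nat_transD[OF eta]
 interpret F: cat_functor C D F by (rule N(1))
 interpret G: cat_functor C D G by (rule N(2))
 have "EX g. g : Hom D (G$a) (F$a) & is_iso D g & g $$D$$ eta a = Ident D (F$a)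
   & eta a $$D$$ g = Ident D (G$a)" if "a : Obj C" for a
 proof -
  have "eta a : Hom D (F$a) (G$a)" using N(3-5) that by (simp add: in_Hom)
  from F.cod.iso_inverse[OF iso[OF that] this] show ?thesis by blast
 qed
 then have "ALL a:Obj C. EX g. g : Hom D (G$a) (F$a) & is_iso D g & g $$D$$ eta a = Ident D (F$a)
   & eta a $$D$$ g = Ident D (G$a)" by blast
 from bchoice[OF this] obtain tht where tht: "!!a. a : Obj C ==> tht a : Hom D (G$a) (F$a) & is_iso D (tht a) \<and>
   tht a $$D$$ eta a = Ident D (F$a) & eta a $$D$$ tht a = Ident D (G$a)"
  by blast
 have thts: "tht a : Arr D" "Dom D (tht a) = G$a" "Cod D (tht a) = F$a" if "a : Obj C" for a
  using tht[OF that] by (auto simp: in_Hom)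
 have nat: "tht (Cod C f) $$D$$ farr G f = farr F f $$D$$ tht (Dom C f)" if f: "f : Arr C" for f
 proof -
  note t = thts N(3-5) f
  have "tht (Cod C f) $$D$$ farr G f = tht (Cod C f) $$D$$ (farr G f $$D$$ (eta (Dom C f) $$D$$ tht (Dom C f)))"
   using t tht[of "Dom C f"] by simp
  also have "\<dots> = tht (Cod C f) $$D$$ ((farr G f $$D$$ eta (Dom C f)) $$D$$ tht (Dom C f))"
   using t by simp
  also have "\<dots> = tht (Cod C f) $$D$$ ((eta (Cod C f) $$D$$ farr F f) $$D$$ tht (Dom C f))"
   using N(6)[OF f] by simp
  also have "\<dots> = (tht (Cod C f) $$D$$ eta (Cod C f)) $$D$$ (farr F f $$D$$ tht (Dom C f))"
   using t by simp
  also have "\<dots> = farr F f $$D$$ tht (Dom C f)"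
   using t tht[of "Cod C f"] by simp
  finally show ?thesis .
 qed
 have "nat_trans C D G F (restrict tht (Obj C))"
  unfolding nat_trans_def
 proof (intro conjI ballI)
  fix f assume "f : Arr C"
  then show "restrict tht (Obj C) (Cod C f) $$D$$ farr G f = farr F f $$D$$ restrict tht (Obj C) (Dom C f)"
   using nat by simp
 next
  show "cat_functor C D G" "cat_functor C D F" by (rule N)+
 qed (use tht in simp_all)
 then show thesis by (rule that) (use tht in simp_all)
qed

lemma naturally_isomorphic_sym:
 assumes "naturally_isomorphic C D F G"
 shows "naturally_isomorphic C D G F"
proof -
 obtain eta where "nat_trans C D F G eta" "!!a. a : Obj C ==> is_iso D (eta a)"
  using assms by (auto simp: naturally_isomorphic_def)
 then show ?thesis by (rule inverse_nat_trans) (auto simp: naturally_isomorphic_def)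
qed

lemma (in cat_functor) farr_Hom:
 "f : Arr C ==> farr F f : Hom D (F$(Dom C f)) (F$(Cod C f))"
 by (rule farr_in) (simp add: in_Hom)

lemma cocone_image:
 assumes F: "cat_functor C C' F" and D: "cat_functor J C D" and cocone: "is_cocone J C D c i"
 shows "is_cocone J C' (comp_funct J F D) (F$c) (%j. farr F (i j))"
proof -
 interpret F: cat_functor C C' F by fact
 interpret D: cat_functor J C D by fact
 have c: "c : Obj C" and i: "!!j. j : Obj J ==> i j : Hom C (D$j) c"
  and i_n: "!!k. k : Arr J ==> i (Cod J k) $$C$$ farr D k = i (Dom J k)"
  using cocone by (auto simp: is_cocone_def)
 show ?thesis
  unfolding is_cocone_def
 proof (intro conjI ballI)
  fix k assume k: "k : Arr J"
  then have Dk: "farr D k : Hom C (D$(Dom J k)) (D$(Cod J k))" by (simp add: in_Hom)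
  show "farr F (i (Cod J k)) $$C'$$ farr (comp_funct J F D) k = farr F (i (Dom J k))"
   using F.farr_comp[OF Dk i] i_n[OF k] k by simp
 qed (use c i F.farr_in in auto)
qed

section \<open>Duality\<close>

lemma opposite_opposite [simp]: "opposite (opposite C) = C"
 by (cases C) (simp add: opposite_def)

lemma id_funct_opposite [simp]: "id_funct (opposite C) = id_funct C"
 by (simp add: id_funct_def)

lemma comp_funct_opposite [simp]: "comp_funct (opposite C) G F = comp_funct C G F"
 by (simp add: comp_funct_def)

lemma is_iso_opposite [simp]: "is_iso (opposite C) f <-> is_iso C f"
 by (auto simp: is_iso_def)

lemma cat_functor_oppositeI:
 assumes "cat_functor C D F"
 shows "cat_functor (opposite C) (opposite D) F"
proof -
 interpret cat_functor C D F by (rule assms)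
 interpret C': category "opposite C" by (rule category_opposite[OF dom.category_axioms])
 interpret D': category "opposite D" by (rule category_opposite[OF cod.category_axioms])
 show ?thesis by unfold_locales (auto simp: fobj_ext farr_ext farr_comp intro: farr_in)
qed

lemma cat_functor_opposite [simp]: "cat_functor (opposite C) (opposite D) F <-> cat_functor C D F"
 using cat_functor_oppositeI[of C D F] cat_functor_oppositeI[of "opposite C" "opposite D" F] by auto

lemma nat_trans_opposite [simp]: "nat_trans (opposite C) (opposite D) F G eta <-> nat_trans C D G F eta"
 by (auto simp: nat_trans_def)

lemma adjoint_of_opposite: "adjoint (opposite D) (opposite C) R L ==> adjoint C D L R"
 unfolding adjoint_def by auto

lemma is_cone_opposite: "is_cone J C D c p <-> is_cocone (opposite J) (opposite C) D c p"
 by (auto simp: is_cone_def is_cocone_def)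

lemma is_limit_opposite: "is_limit J C D c p <-> is_colimit (opposite J) (opposite C) D c p"
 by (simp add: is_limit_def is_colimit_def is_cone_opposite)

lemma preserves_limits_opposite:
 "preserves_limits_of_shape J C D F <-> preserves_colimits_of_shape (opposite J) (opposite C) (opposite D) F"
 by (simp add: preserves_limits_of_shape_def preserves_colimits_of_shape_def is_limit_opposite)

lemma cone_image:
 assumes F: "cat_functor C C' F" and D: "cat_functor J C D" and cone: "is_cone J C D c p"
 shows "is_cone J C' (comp_funct J F D) (F$c) (%j. farr F (p j))"
 using cocone_image[of "opposite C" "opposite C'" F "opposite J" D c p] assms by (simp add: is_cone_opposite)

section \<open>Adjunctions and localizations\<close>

locale adjunction = L: cat_functor C D L + R: cat_functor D C R
 for C :: "('o, 'a) category" and D :: "('p, 'b) category" and L R +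
 fixes eta eps
 assumes unit: "nat_trans C C (id_funct C) (comp_funct C R L) eta"
  and counit: "nat_trans D D (comp_funct D L R) (id_funct D) eps"
  and triangle_left: "c : Obj C ==> eps (L$c) $$D$$ farr L (eta c) = Ident D (L$c)"
  and triangle_right: "d : Obj D ==> farr R (eps d) $$C$$ eta (R$d) = Ident C (R$d)"

lemma adjoint_iff: "adjoint C D L R <-> (EX eta eps. adjunction C D L R eta eps)"
 unfolding adjoint_def adjunction_def adjunction_axioms_def by auto

context adjunction
begin

lemma unit_simps [simp]:
 assumes "c : Obj C"
 shows "eta c : Arr C" "Dom C (eta c) = c" "Cod C (eta c) = R$(L$c)"
 using nat_transD[OF unit] assms by auto

lemma counit_simps [simp]:
 assumes "d : Obj D"
 shows "eps d : Arr D" "Dom D (eps d) = L$(R$d)" "Cod D (eps d) = d"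
 using nat_transD[OF counit] assms by auto

lemma unit_natural:
 assumes "f : Hom C a b"
 shows "eta b $$C$$ f = farr R (farr L f) $$C$$ eta a"
 using nat_transD(6)[OF unit, of f] assms by (auto simp: in_Hom)

lemma counit_natural:
 assumes "f : Hom D a b"
 shows "eps b $$D$$ farr L (farr R f) = f $$D$$ eps a"
 using nat_transD(6)[OF counit, of f] assms by (auto simp: in_Hom)

lemma counit_iso:
 assumes ff: "fully_faithful D C R" and d: "d : Obj D"
 shows "is_iso D (eps d)"
proof -
 have bij: "bij_betw (farr R) (Hom D d (L$(R$d)))
   (Hom C (R$d) (R$(L$(R$d))))"
  "bij_betw (farr R) (Hom D d d) (Hom C (R$d) (R$d))"
  using ff d by (auto simp: fully_faithful_def)
 have "eta (R$d) : Hom C (R$d) (R$(L$(R$d)))"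
  using d by (simp add: in_Hom)
 then obtain k where k: "k : Hom D d (L$(R$d))" "farr R k = eta (R$d)"
  using bij(1) unfolding bij_betw_def by (metis imageE)
 note kk = HomD[OF k(1)]
 have "farr R (eps d $$D$$ k) = farr R (Ident D d)"
  using kk d k(2) triangle_right[OF d] by simp
 moreover have "eps d $$D$$ k : Hom D d d" "Ident D d : Hom D d d"
  using kk d by (auto simp: in_Hom)
 ultimately have 1: "eps d $$D$$ k = Ident D d"
  using bij(2) by (meson bij_betw_def inj_onD)
 have 2: "k $$D$$ eps d = Ident D (L$(R$d))"
  using counit_natural[OF k(1)] k(2) triangle_left[of "R$d"] d by simp
 show ?thesis
  using k 1 2 d by (intro L.cod.is_isoI[of "eps d" "L$(R$d)" d k]) (auto simp: in_Hom)
qed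

end

definition essentially_surjective ::
 "('o, 'a) category => ('p, 'b) category => ('o, 'a, 'p, 'b) funct => bool" where
 "essentially_surjective C D F <-> (ALL d:Obj D. EX c:Obj C. isomorphic D (F$c) d)"

definition local_object ::
 "('o, 'a) category => ('p, 'b) category => ('o, 'a, 'p, 'b) funct => 'o => bool" where
 "local_object C D L r <-> r : Obj C \<and>
  (ALL c:Obj C. bij_betw (farr L) (Hom C c r) (Hom D (L$c) (L$r)))"

text \<open>
 A functor has a fully faithful right adjoint if and only if every object of its codomain is
 isomorphic to the image of a local object. In this form the property involves no choice of
 a right adjoint, so it can be transported along equivalences by comparing hom-sets.
\<close>

definition reflective_localization ::
 "('o, 'a) category => ('p, 'b) category => ('o, 'a, 'p, 'b) funct => bool" where
 "reflective_localization C D L <-> cat_functor C D L \<and>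
  (ALL d:Obj D. EX r. local_object C D L r & isomorphic D (L$r) d)"

lemma localization_of_adjoint:
 assumes "adjoint C D L R" "fully_faithful D C R"
 shows "reflective_localization C D L"
proof -
 obtain eta eps where "adjunction C D L R eta eps" using assms(1) by (auto simp: adjoint_iff)
 then interpret adjunction C D L R eta eps .
 have "local_object C D L (R$d)" if d: "d : Obj D" for d
  unfolding local_object_def
 proof (intro conjI ballI bij_betwI')
  fix c h h' assume c: "c : Obj C" and h: "h : Hom C c (R$d)" "h' : Hom C c (R$d)"
  have inv: "farr R (eps d) $$C$$ (farr R (farr L k) $$C$$ eta c) = k" if k: "k : Hom C c (R$d)" for k
  proof -
   have "farr R (eps d) $$C$$ (farr R (farr L k) $$C$$ eta c) = farr R (eps d) $$C$$ (eta (R$d) $$C$$ k)"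
    using unit_natural[OF k] by simp
   also have "\<dots> = (farr R (eps d) $$C$$ eta (R$d)) $$C$$ k"
    using k d by (simp add: in_Hom)
   also have "\<dots> = k" using triangle_right[OF d] k by (simp add: in_Hom)
   finally show ?thesis .
  qed
  show "farr L h = farr L h' <-> h = h'" using inv[OF h(1)] inv[OF h(2)] by metis
 next
  fix c g assume c: "c : Obj C" and g: "g : Hom D (L$c) (L$(R$d))"
  note gg = HomD[OF g]
  define h where "h = farr R (eps d $$D$$ g) $$C$$ eta c"
  have h: "h : Hom C c (R$d)" using gg c d by (simp add: in_Hom h_def)
  have "eps d $$D$$ farr L h = (eps d $$D$$ farr L (farr R (eps d $$D$$ g))) $$D$$ farr L (eta c)"
   using gg c d by (simp add: h_def)
  also have "\<dots> = ((eps d $$D$$ g) $$D$$ eps (L$c)) $$D$$ farr L (eta c)"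
   using counit_natural[of "eps d $$D$$ g" "L$c" d] gg d by (simp add: in_Hom)
  also have "\<dots> = (eps d $$D$$ g) $$D$$ (eps (L$c) $$D$$ farr L (eta c))"
   using gg c d by simp
  also have "\<dots> = eps d $$D$$ g" using triangle_left[OF c] gg c d by simp
  finally have "eps d $$D$$ farr L h = eps d $$D$$ g" .
  then have "farr L h = g"
   by (rule L.cod.iso_mono[OF counit_iso[OF assms(2) d], rotated 3])
    (use h gg g d in \<open>auto simp: in_Hom\<close>)
  then show "EX x:Hom C c (R$d). g = farr L x" using h by blast
 qed (use d L.farr_in in auto)
 moreover have "isomorphic D (L$(R$d)) d" if d: "d : Obj D" for d
  unfolding isomorphic_def using counit_iso[OF assms(2) d] d
  by (intro bexI[of _ "eps d"]) (auto simp: in_Hom)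
 ultimately show ?thesis
  unfolding reflective_localization_def using L.cat_functor_axioms by blast
qed

lemma left_adjoint_of_universal:
 assumes R: "cat_functor D C R" and C: "category C"
  and l: "!!c. c : Obj C ==> l c : Obj D" and h: "!!c. c : Obj C ==> h c : Hom C c (R$(l c))"
  and univ: "!!c d g. d : Obj D ==> g : Hom C c (R$d) ==> EX! u. u : Hom D (l c) d & farr R u $$C$$ h c = g"
 obtains L where "adjoint C D L R" "!!c. c : Obj C ==> L$c = l c"
  "!!f. f : Arr C ==> farr R (farr L f) $$C$$ h (Dom C f) = h (Cod C f) $$C$$ f"
proof -
 interpret R: cat_functor D C R by (rule R)
 define up where "up c d g = (THE u. u : Hom D (l c) d & farr R u $$C$$ h c = g)" for c d g
 have up: "up c d g : Hom D (l c) d & farr R (up c d g) $$C$$ h c = g"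
  if "d : Obj D" "g : Hom C c (R$d)" for c d g
  unfolding up_def by (rule theI'[OF univ[OF that]])
 have uniq: "u = v" if "c : Obj C" and u: "u : Hom D (l c) d" and v: "v : Hom D (l c) d"
  and eq: "farr R u $$C$$ h c = farr R v $$C$$ h c" for c d u v
 proof -
  have "farr R v $$C$$ h c : Hom C c (R$d)" by (rule R.cod.comp_in[OF h[OF that(1)] R.farr_in[OF v]])
  from univ[OF R.dom.Hom_obj(2)[OF u] this] show ?thesis using u v eq by blast
 qed
 note hs [simp] = HomD[OF h] l
 define La where "La f = up (Dom C f) (l (Cod C f)) (h (Cod C f) $$C$$ f)" for f
 have La': "La f : Hom D (l (Dom C f)) (l (Cod C f)) & farr R (La f) $$C$$ h (Dom C f) = h (Cod C f) $$C$$ f"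
  if f: "f : Arr C" for f
  unfolding La_def by (rule up) (use f in \<open>simp_all add: in_Hom\<close>)
 have La [simp]: "La f : Arr D" "Dom D (La f) = l (Dom C f)" "Cod D (La f) = l (Cod C f)"
  and La_eq: "farr R (La f) $$C$$ h (Dom C f) = h (Cod C f) $$C$$ f" if "f : Arr C" for f
  using La'[OF that] by (simp_all add: in_Hom)
 define L where "L = Funct (restrict l (Obj C)) (restrict La (Arr C))"
 have Ls [simp]: "c : Obj C ==> L$c = l c" "f : Arr C ==> farr L f = La f" for c f
  by (simp_all add: L_def)
 have Lf: "cat_functor C D L"
 proof (unfold_locales)
  show "farr L (Ident C c) = Ident D (L$c)" if c: "c : Obj C" for c
  proof -
   have "La (Ident C c) = Ident D (l c)"
    by (rule uniq[OF c, of _ "l c"]) (use c La_eq[of "Ident C c"] in \<open>auto simp: in_Hom\<close>)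
   then show ?thesis using c by simp
  qed
 next
  fix f g a b c assume fg: "f : Hom C a b" "g : Hom C b c"
  note s = HomD[OF fg(1)] HomD[OF fg(2)]
  have o: "a : Obj C" "b : Obj C" "c : Obj C" using s by auto
  have "La (g $$C$$ f) = La g $$D$$ La f"
  proof (rule uniq[OF o(1), of _ "l c"])
   have "farr R (La (g $$C$$ f)) $$C$$ h a = (h c $$C$$ g) $$C$$ f"
    using La_eq[of "g $$C$$ f"] s o by simp
   also have "\<dots> = farr R (La g) $$C$$ (h b $$C$$ f)"
    using La_eq[of g] s o by (metis R.cod.assoc_simp La R.arr_simps hs)
   also have "\<dots> = farr R (La g) $$C$$ (farr R (La f) $$C$$ h a)"
    using La_eq[of f] s by simp
   also have "\<dots> = farr R (La g $$D$$ La f) $$C$$ h a" using s o by simp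
   finally show "farr R (La (g $$C$$ f)) $$C$$ h a = farr R (La g $$D$$ La f) $$C$$ h a" .
  qed (use s in \<open>auto simp: in_Hom\<close>)
  then show "farr L (g $$C$$ f) = farr L g $$D$$ farr L f" using s by simp
 qed (auto simp: L_def in_Hom)
 interpret L: cat_functor C D L by (rule Lf)
 define eps where "eps = (\<lambda>d\<in>Obj D. up (R$d) d (Ident C (R$d)))"
 have eps': "eps d : Hom D (l (R$d)) d & farr R (eps d) $$C$$ h (R$d) = Ident C (R$d)"
  if "d : Obj D" for d
 proof -
  have "Ident C (R$d) : Hom C (R$d) (R$d)" using that by (simp add: in_Hom)
  from up[OF that this] show ?thesis using that by (simp add: eps_def)
 qed
 have eps [simp]: "eps d : Arr D" "Dom D (eps d) = l (R$d)" "Cod D (eps d) = d"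
  and eps_eq: "farr R (eps d) $$C$$ h (R$d) = Ident C (R$d)" if "d : Obj D" for d
  using eps'[OF that] by (simp_all add: in_Hom)
 have "adjunction C D L R (restrict h (Obj C)) eps"
 proof unfold_locales
  show "nat_trans C C (id_funct C) (comp_funct C R L) (restrict h (Obj C))"
   unfolding nat_trans_def
   by (auto simp: in_Hom cat_functor_id C cat_functor_comp[OF Lf R] La_eq)
  show "nat_trans D D (comp_funct D L R) (id_funct D) eps"
   unfolding nat_trans_def
  proof (intro conjI ballI)
   fix u assume u: "u : Arr D"
   let ?a = "Dom D u" and ?b = "Cod D u"
   have "eps ?b $$D$$ La (farr R u) = u $$D$$ eps ?a"
   proof (rule uniq[of "R$?a" _ ?b])
    have "farr R (eps ?b $$D$$ La (farr R u)) $$C$$ h (R$?a) = farr R (eps ?b) $$C$$ (farr R (La (farr R u)) $$C$$ h (R$?a))"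
     using u by simp
    also have "\<dots> = farr R (eps ?b) $$C$$ (h (R$?b) $$C$$ farr R u)"
     using La_eq[of "farr R u"] u by simp
    also have "\<dots> = (farr R (eps ?b) $$C$$ h (R$?b)) $$C$$ farr R u" using u by simp
    also have "\<dots> = farr R u $$C$$ (farr R (eps ?a) $$C$$ h (R$?a))" using u eps_eq by simp
    also have "\<dots> = farr R (u $$D$$ eps ?a) $$C$$ h (R$?a)" using u by simp
    finally show "farr R (eps ?b $$D$$ La (farr R u)) $$C$$ h (R$?a) = farr R (u $$D$$ eps ?a) $$C$$ h (R$?a)" .
   qed (use u in \<open>auto simp: in_Hom\<close>)
   then show "eps ?b $$D$$ farr (comp_funct D L R) u = farr (id_funct D) u $$D$$ eps ?a" using u by simp
  next
   show "eps : extensional (Obj D)" by (simp add: eps_def)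
  qed (auto simp: in_Hom cat_functor_id R.dom.category_axioms cat_functor_comp[OF R Lf])
  show "eps (L$c) $$D$$ farr L (restrict h (Obj C) c) = Ident D (L$c)" if c: "c : Obj C" for c
  proof -
   have "eps (l c) $$D$$ La (h c) = Ident D (l c)"
   proof (rule uniq[OF c, of _ "l c"])
    have "farr R (eps (l c) $$D$$ La (h c)) $$C$$ h c = farr R (eps (l c)) $$C$$ (h (R$(l c)) $$C$$ h c)"
     using c La_eq[of "h c"] by simp
    also have "\<dots> = (farr R (eps (l c)) $$C$$ h (R$(l c))) $$C$$ h c" using c by simp
    finally show "farr R (eps (l c) $$D$$ La (h c)) $$C$$ h c = farr R (Ident D (l c)) $$C$$ h c"
     using c eps_eq[of "l c"] by simp
   qed (use c in \<open>auto simp: in_Hom\<close>)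
   then show ?thesis using c by simp
  qed
  show "farr R (eps d) $$C$$ restrict h (Obj C) (R$d) = Ident C (R$d)" if "d : Obj D" for d
   using eps_eq[OF that] that by simp
 qed
 then have "adjoint C D L R" by (auto simp: adjoint_iff)
 then show thesis by (rule that) (simp_all add: La_eq)
qed

lemma localization_right_adjoint:
 assumes "reflective_localization C D L"
 obtains R where "adjoint C D L R" "fully_faithful D C R"
proof -
 interpret L: cat_functor C D L using assms by (simp add: reflective_localization_def)
 have "ALL d:Obj D. EX x. local_object C D L (fst x) & snd x : Hom D (L$(fst x)) d & is_iso D (snd x)"
  using assms by (fastforce simp: reflective_localization_def isomorphic_def)
 from bchoice[OF this] obtain x where x: "!!d. d : Obj D ==>
   local_object C D L (fst (x d)) & snd (x d) : Hom D (L$(fst (x d))) d & is_iso D (snd (x d))"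
  by blast
 define r where "r d = fst (x d)" for d
 define e where "e d = snd (x d)" for d
 have loc: "local_object C D L (r d)" and e: "e d : Hom D (L$(r d)) d" and eiso: "is_iso D (e d)"
  if "d : Obj D" for d
  using x[OF that] by (simp_all add: r_def e_def)
 have es [simp]: "r d : Obj C" "e d : Arr D" "Dom D (e d) = L$(r d)" "Cod D (e d) = d"
  if "d : Obj D" for d
  using e[OF that] loc[OF that] by (auto simp: in_Hom local_object_def)
 have "EX h. h : Hom C c (r d) & e d $$D$$ farr L h = g"
  if c: "c : Obj C" and d: "d : Obj D" and g: "g : Hom D (L$c) d" for c d g
 proof -
  obtain e' where e': "e' : Hom D d (L$(r d))" "e d $$D$$ e' = Ident D d"
   using L.cod.is_isoE[OF eiso[OF d] e[OF d]] by blast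
  have "e' $$D$$ g : Hom D (L$c) (L$(r d))" using e' g by (auto simp: in_Hom)
  then obtain h where h: "h : Hom C c (r d)" "farr L h = e' $$D$$ g"
   using loc[OF d] c unfolding local_object_def bij_betw_def by (metis imageE)
  have "e d $$D$$ (e' $$D$$ g) = g"
   by (rule L.cod.cancel_left[OF e'(2,1) e[OF d] g])
  with h show ?thesis by auto
 qed
 then obtain up where up: "!!c d g. c : Obj C ==> d : Obj D ==> g : Hom D (L$c) d ==>
   up c d g : Hom C c (r d) & e d $$D$$ farr L (up c d g) = g"
  by metis
 have uniq: "h = h'" if "d : Obj D" "h : Hom C c (r d)" "h' : Hom C c (r d)"
   "e d $$D$$ farr L h = e d $$D$$ farr L h'" for c d h h'
 proof -
  have "farr L h = farr L h'"
   by (rule L.cod.iso_mono[OF eiso[OF that(1)] e[OF that(1)] L.farr_in L.farr_in]) (use that in auto)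
  then show ?thesis
   using loc[OF that(1)] that(2,3) L.dom.Hom_obj(1)[OF that(2)]
   unfolding local_object_def bij_betw_def by (meson inj_onD)
 qed
 obtain R where R': "adjoint (opposite D) (opposite C) R L" and Ro: "!!d. d : Obj (opposite D) ==> R$d = r d"
  and Ra: "!!u. u : Arr (opposite D) ==> farr L (farr R u) $$opposite D$$ e (Dom (opposite D) u) = e (Cod (opposite D) u) $$opposite D$$ u"
 proof (rule left_adjoint_of_universal[of "opposite C" "opposite D" L r e])
  fix c d g assume c: "c : Obj (opposite C)" and g: "g : Hom (opposite D) d (L$c)"
  have d: "d : Obj D" using L.cod.Hom_obj[of g] g by auto
  show "EX! u. u : Hom (opposite C) (r d) c & farr L u $$opposite D$$ e d = g"
   using up[of c d g] uniq[OF d] c d g by auto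
 qed (use L.cat_functor_axioms category_opposite[OF L.cod.category_axioms] e in auto)
 have adj: "adjoint C D L R" by (rule adjoint_of_opposite[OF R'])
 interpret R: cat_functor D C R using adj by (simp add: adjoint_def)
 have Ra_eq: "e (Cod D u) $$D$$ farr L (farr R u) = u $$D$$ e (Dom D u)" if "u : Arr D" for u
  using Ra[of u] that by simp
 have ff: "fully_faithful D C R"
  unfolding fully_faithful_def
 proof (intro conjI ballI bij_betwI' R.cat_functor_axioms)
  fix a b f g assume ab: "a : Obj D" "b : Obj D" and fg: "f : Hom D a b" "g : Hom D a b"
  note fg' = HomD[OF fg(1)] HomD[OF fg(2)]
  show "farr R f = farr R g <-> f = g"
  proof
   assume "farr R f = farr R g"
   then have "f $$D$$ e a = g $$D$$ e a" using Ra_eq[of f] Ra_eq[of g] fg' by simp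
   then show "f = g" using L.cod.iso_epi[OF eiso e fg] ab by blast
  qed simp
 next
  fix a b h assume ab: "a : Obj D" "b : Obj D" and "h : Hom C (R$a) (R$b)"
  then have h: "h : Hom C (r a) (r b)" using Ro ab by simp
  note h' = HomD[OF h]
  obtain e' where e': "e' : Hom D a (L$(r a))" "e' $$D$$ e a = Ident D (L$(r a))"
   using L.cod.is_isoE[OF eiso[OF ab(1)] e[OF ab(1)]] by blast
  note e'' = HomD[OF e'(1)]
  define u where "u = (e b $$D$$ farr L h) $$D$$ e'"
  have u: "u : Hom D a b" using h' e'' ab by (auto simp: in_Hom u_def)
  note u' = HomD[OF u]
  have "farr R u = h"
  proof (rule uniq[OF ab(2) _ h])
   have "u $$D$$ e a = e b $$D$$ (farr L h $$D$$ (e' $$D$$ e a))"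
    using h' e'' ab by (simp add: u_def)
   also have "\<dots> = e b $$D$$ farr L h" using h' e'' ab e'(2) by simp
   finally show "e b $$D$$ farr L (farr R u) = e b $$D$$ farr L h"
    using Ra_eq[of u] u' by simp
  qed (use R.farr_in[OF u] Ro ab in auto)
  then show "EX x:Hom D a b. h = farr R x" using u u' by (intro bexI[of _ u]) auto
 qed (rule R.farr_in)
 show thesis using that adj ff .
qed


lemma bij_betw_comp:
 assumes "bij_betw f A B" "bij_betw g B C"
 shows "bij_betw (%x. g (f x)) A C"
 using bij_betw_trans[OF assms] by (simp add: comp_def)

lemma limit_factor:
 assumes "is_limit J C D c p" "is_cone J C D x q"
 obtains u where "u : Hom C x c" "!!j. j : Obj J ==> p j $$C$$ u = q j"
  "!!v. v : Hom C x c ==> (ALL j:Obj J. p j $$C$$ v = q j) ==> v = u"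
proof -
 have "EX! u. u : Hom C x c & (ALL j:Obj J. p j $$C$$ u = q j)"
  using assms unfolding is_limit_def by blast
 then show thesis by (elim ex1E) (rule that, blast+)
qed

lemma colimit_factor:
 assumes "is_colimit J C D c i" "is_cocone J C D x q"
 obtains u where "u : Hom C c x" "!!j. j : Obj J ==> u $$C$$ i j = q j"
  "!!v. v : Hom C c x ==> (ALL j:Obj J. v $$C$$ i j = q j) ==> v = u"
proof -
 have "EX! u. u : Hom C c x & (ALL j:Obj J. u $$C$$ i j = q j)"
  using assms unfolding is_colimit_def by blast
 then show thesis by (elim ex1E) (rule that, blast+)
qed

section \<open>Equivalences\<close>

lemma equivalenceD:
 assumes "equivalence C D F"
 shows "fully_faithful C D F" "essentially_surjective C D F"
proof -
 obtain G tht \<psi> where G: "cat_functor D C G"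
   and tht: "nat_trans C C (comp_funct C G F) (id_funct C) tht" "ALL a:Obj C. is_iso C (tht a)"
   and \<psi>: "nat_trans D D (comp_funct D F G) (id_funct D) \<psi>" "ALL d:Obj D. is_iso D (\<psi> d)"
  using assms by (auto simp: equivalence_def naturally_isomorphic_def)
 have F: "cat_functor C D F" using assms by (simp add: equivalence_def)
 interpret F: cat_functor C D F by (rule F)
 interpret G: cat_functor D C G by (rule G)
 have thts: "tht a : Hom C (G$(F$a)) a" if "a : Obj C" for a
  using nat_transD[OF tht(1)] that by (simp add: in_Hom)
 have \<psi>s: "\<psi> d : Hom D (F$(G$d)) d" if "d : Obj D" for d
  using nat_transD[OF \<psi>(1)] that by (simp add: in_Hom)
 have thtn: "tht b $$C$$ farr G (farr F f) = f $$C$$ tht a" if "f : Hom C a b" for f a b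
  using nat_transD(6)[OF tht(1), of f] that by (auto simp: in_Hom)
 have \<psi>n: "\<psi> b $$D$$ farr F (farr G f) = f $$D$$ \<psi> a" if "f : Hom D a b" for f a b
  using nat_transD(6)[OF \<psi>(1), of f] that by (auto simp: in_Hom)
 have faithful: "f = g" if fg: "f : Hom C a b" "g : Hom C a b" "farr F f = farr F g" for f g a b
 proof -
  have "f $$C$$ tht a = g $$C$$ tht a" using thtn[OF fg(1)] thtn[OF fg(2)] fg(3) by metis
  then show ?thesis
   using F.dom.iso_epi[OF _ thts fg(1,2)] tht(2) F.dom.Hom_obj[OF fg(1)] by blast
 qed
 have faithful': "f = g" if fg: "f : Hom D a b" "g : Hom D a b" "farr G f = farr G g" for f g a b
 proof -
  have "f $$D$$ \<psi> a = g $$D$$ \<psi> a" using \<psi>n[OF fg(1)] \<psi>n[OF fg(2)] fg(3) by metis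
  then show ?thesis
   using F.cod.iso_epi[OF _ \<psi>s fg(1,2)] \<psi>(2) F.cod.Hom_obj[OF fg(1)] by blast
 qed
 have full: "EX f:Hom C a b. k = farr F f"
  if ab: "a : Obj C" "b : Obj C" and k: "k : Hom D (F$a) (F$b)" for a b k
 proof -
  obtain tht' where tht': "tht' : Hom C a (G$(F$a))" "tht' $$C$$ tht a = Ident C (G$(F$a))"
   using F.dom.is_isoE[OF _ thts[OF ab(1)]] tht(2) ab(1) by metis
  define f where "f = (tht b $$C$$ farr G k) $$C$$ tht'"
  have m: "tht b $$C$$ farr G k : Hom C (G$(F$a)) b"
   using F.dom.comp_in[OF G.farr_in[OF k] thts[OF ab(2)]] .
  have f: "f : Hom C a b"
   unfolding f_def by (rule F.dom.comp_in[OF tht'(1) m])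
  have "f $$C$$ tht a = tht b $$C$$ farr G k"
   unfolding f_def by (rule F.dom.cancel_right[OF tht'(2,1) thts[OF ab(1)] m])
  then have "tht b $$C$$ farr G (farr F f) = tht b $$C$$ farr G k" using thtn[OF f] by simp
  then have "farr G (farr F f) = farr G k"
   using F.dom.iso_mono[OF _ thts[OF ab(2)] G.farr_in[OF F.farr_in[OF f]] G.farr_in[OF k]] tht(2) ab(2)
   by blast
  then have "farr F f = k" using faithful'[OF F.farr_in[OF f] k] by blast
  then show ?thesis using f by blast
 qed
 show "fully_faithful C D F"
  unfolding fully_faithful_def
 proof (intro conjI ballI bij_betwI' F)
  fix a b f g assume "a : Obj C" "b : Obj C" "f : Hom C a b" "g : Hom C a b"
  then show "farr F f = farr F g <-> f = g" using faithful by blast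
 next
  fix a b k assume "a : Obj C" "b : Obj C" "k : Hom D (F$a) (F$b)"
  then show "EX f:Hom C a b. k = farr F f" by (rule full)
 qed (rule F.farr_in)
 show "essentially_surjective C D F"
  unfolding essentially_surjective_def isomorphic_def using \<psi>s \<psi>(2) G.fobj_in by blast
qed

lemma ff_cancel:
 assumes "fully_faithful C D F" "f : Hom C a b" "g : Hom C a b" "farr F f = farr F g"
 shows "f = g"
proof -
 interpret cat_functor C D F using assms by (simp add: fully_faithful_def)
 have "inj_on (farr F) (Hom C a b)"
  using assms(1) dom.Hom_obj[OF assms(2)] unfolding fully_faithful_def bij_betw_def by blast
 then show ?thesis using assms by (meson inj_onD)
qed

lemma ff_lift:
 assumes "fully_faithful C D F" "a : Obj C" "b : Obj C" "k : Hom D (F$a) (F$b)"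
 obtains f where "f : Hom C a b" "farr F f = k"
 using assms unfolding fully_faithful_def bij_betw_def by (metis imageE)

lemma ff_reflects_iso:
 assumes "fully_faithful C D F" "f : Hom C a b" "is_iso D (farr F f)"
 shows "is_iso C f"
proof -
 interpret cat_functor C D F using assms by (simp add: fully_faithful_def)
 note ab = dom.Hom_obj[OF assms(2)]
 obtain k where k: "k : Hom D (F$b) (F$a)" "k $$D$$ farr F f = Ident D (F$a)"
   "farr F f $$D$$ k = Ident D (F$b)"
  using cod.is_isoE[OF assms(3) farr_in[OF assms(2)]] .
 obtain g where g: "g : Hom C b a" "farr F g = k" using ff_lift[OF assms(1) ab(2,1) k(1)] .
 have "g $$C$$ f = Ident C a"
  by (rule ff_cancel[OF assms(1) dom.comp_in[OF assms(2) g(1)] dom.id_in[OF ab(1)]])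
   (use farr_comp[OF assms(2) g(1)] g k ab in simp)
 moreover have "f $$C$$ g = Ident C b"
  by (rule ff_cancel[OF assms(1) dom.comp_in[OF g(1) assms(2)] dom.id_in[OF ab(2)]])
   (use farr_comp[OF g(1) assms(2)] g k ab in simp)
 ultimately show ?thesis using dom.is_isoI[OF assms(2) g(1)] by blast
qed

lemma local_object_ff:
 assumes "fully_faithful C D F" "c : Obj C"
 shows "local_object C D F c"
 using assms by (simp add: fully_faithful_def local_object_def)

lemma localization_of_ff:
 assumes "fully_faithful C D F" "essentially_surjective C D F"
 shows "reflective_localization C D F"
 unfolding reflective_localization_def
 using assms(2) local_object_ff[OF assms(1)] assms(1)
 unfolding fully_faithful_def essentially_surjective_def by blast

lemma preserves_colimits_of_couniversal:
 assumes L: "cat_functor C D L"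
  and couniv: "!!x. x : Obj D ==> EX r e. r : Obj C & e : Hom D (L$r) x \<and>
   (ALL a:Obj C. bij_betw (%h. e $$D$$ farr L h) (Hom C a r) (Hom D (L$a) x))"
 shows "preserves_colimits_of_shape J C D L"
 unfolding preserves_colimits_of_shape_def
proof (intro allI impI)
 fix Dg c i assume Dg: "cat_functor J C Dg" and colim: "is_colimit J C Dg c i"
 interpret L: cat_functor C D L by (rule L)
 interpret Dg: cat_functor J C Dg by (rule Dg)
 have cc: "is_cocone J C Dg c i" using colim by (simp add: is_colimit_def)
 then have c: "c : Obj C" and i: "!!j. j : Obj J ==> i j : Hom C (Dg$j) c" by (auto simp: is_cocone_def)
 show "is_colimit J D (comp_funct J L Dg) (L$c) (%j. farr L (i j))"
  unfolding is_colimit_def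
 proof (intro conjI allI impI cocone_image[OF L Dg cc])
  fix x q assume cocone: "is_cocone J D (comp_funct J L Dg) x q"
  then have x: "x : Obj D" and q: "!!j. j : Obj J ==> q j : Hom D (L$(Dg$j)) x"
   and qn: "!!k. k : Arr J ==> q (Cod J k) $$D$$ farr L (farr Dg k) = q (Dom J k)"
   by (auto simp: is_cocone_def)
  obtain r e where r: "r : Obj C" and e: "e : Hom D (L$r) x"
   and bij: "!!a. a : Obj C ==> bij_betw (%h. e $$D$$ farr L h) (Hom C a r) (Hom D (L$a) x)"
   using couniv[OF x] by (elim exE conjE) (rule that, auto)
  have lift: "EX h. h : Hom C a r & e $$D$$ farr L h = k" if "a : Obj C" "k : Hom D (L$a) x" for a k
  proof -
   have "k : (%h. e $$D$$ farr L h) ` Hom C a r" using bij_betw_imp_surj_on[OF bij[OF that(1)]] that(2) by simp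
   then show ?thesis by blast
  qed
  have inj: "h = h'" if "h : Hom C a r" "h' : Hom C a r" "e $$D$$ farr L h = e $$D$$ farr L h'" for a h h'
   by (rule inj_onD[OF bij_betw_imp_inj_on[OF bij[OF L.dom.Hom_obj(1)[OF that(1)]]] that(3,1,2)])
  have assoc: "e $$D$$ farr L (h $$C$$ k) = (e $$D$$ farr L h) $$D$$ farr L k" if "k : Hom C a b" "h : Hom C b r" for h k a b
   using L.cod.assoc[OF L.farr_in[OF that(1)] L.farr_in[OF that(2)] e] L.farr_comp[OF that] by simp
  have "ALL j:Obj J. EX h. h : Hom C (Dg$j) r & e $$D$$ farr L h = q j"
   using lift[OF Dg.fobj_in q] by blast
  from bchoice[OF this] obtain q' where q': "!!j. j : Obj J ==> q' j : Hom C (Dg$j) r"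
    and Lq': "!!j. j : Obj J ==> e $$D$$ farr L (q' j) = q j"
   by blast
  have "is_cocone J C Dg r q'"
   unfolding is_cocone_def
  proof (intro conjI ballI r)
   fix k assume k: "k : Arr J"
   then have d: "Dom J k : Obj J" "Cod J k : Obj J" by auto
   note Dk = Dg.farr_Hom[OF k]
   show "q' (Cod J k) $$C$$ farr Dg k = q' (Dom J k)"
    by (rule inj[OF L.dom.comp_in[OF Dk q'[OF d(2)]] q'[OF d(1)]])
     (simp add: assoc[OF Dk q'[OF d(2)]] Lq' d qn[OF k])
  qed (use q' in auto)
  from colimit_factor[OF colim this] obtain u where u: "u : Hom C c r" "!!j. j : Obj J ==> u $$C$$ i j = q' j"
    and uu: "!!v. v : Hom C c r ==> (ALL j:Obj J. v $$C$$ i j = q' j) ==> v = u"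
   by blast
  show "EX! v. v : Hom D (L$c) x & (ALL j:Obj J. v $$D$$ farr L (i j) = q j)"
  proof (rule ex1I[of _ "e $$D$$ farr L u"])
   show "e $$D$$ farr L u : Hom D (L$c) x & (ALL j:Obj J. (e $$D$$ farr L u) $$D$$ farr L (i j) = q j)"
    using L.cod.comp_in[OF L.farr_in[OF u(1)] e] assoc[OF i u(1)] u(2) Lq' by simp
   fix v assume v: "v : Hom D (L$c) x & (ALL j:Obj J. v $$D$$ farr L (i j) = q j)"
   obtain w where w: "w : Hom C c r" "e $$D$$ farr L w = v" using lift[OF c, of v] v by blast
   have "w $$C$$ i j = q' j" if j: "j : Obj J" for j
    by (rule inj[OF L.dom.comp_in[OF i[OF j] w(1)] q'[OF j]])
     (use assoc[OF i[OF j] w(1)] w(2) v Lq'[OF j] j in simp)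
   then show "v = e $$D$$ farr L u" using uu[OF w(1)] w(2) by simp
  qed
 qed
qed

lemma localization_preserves_colimits:
 assumes "reflective_localization C D L"
 shows "preserves_colimits_of_shape J C D L"
proof (rule preserves_colimits_of_couniversal)
 show "cat_functor C D L" using assms by (simp add: reflective_localization_def)
 then interpret L: cat_functor C D L .
 fix x assume "x : Obj D"
 then obtain r e where loc: "local_object C D L r" and e: "e : Hom D (L$r) x" "is_iso D e"
  using assms by (auto simp: reflective_localization_def isomorphic_def)
 obtain e' where e': "e' : Hom D x (L$r)" "e $$D$$ e' = Ident D x" using L.cod.is_isoE[OF e(2,1)] .
 have "bij_betw (%h. e $$D$$ farr L h) (Hom C a r) (Hom D (L$a) x)" if a: "a : Obj C" for a
 proof (rule bij_betw_comp[where f = "farr L" and g = "%k. e $$D$$ k"])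
  show "bij_betw (farr L) (Hom C a r) (Hom D (L$a) (L$r))" using loc a by (simp add: local_object_def)
  show "bij_betw (%k. e $$D$$ k) (Hom D (L$a) (L$r)) (Hom D (L$a) x)"
  proof (rule bij_betwI')
   fix k assume k: "k : Hom D (L$a) x"
   show "EX h:Hom D (L$a) (L$r). k = e $$D$$ h"
    using L.cod.cancel_left[OF e'(2,1) e(1) k] L.cod.comp_in[OF k e'(1)] by (intro bexI[of _ "e' $$D$$ k"]) simp_all
  next
   show "e $$D$$ h = e $$D$$ h' <-> h = h'" if "h : Hom D (L$a) (L$r)" "h' : Hom D (L$a) (L$r)" for h h'
    using L.cod.iso_mono[OF e(2,1) that] by blast
  next
   show "e $$D$$ h : Hom D (L$a) x" if "h : Hom D (L$a) (L$r)" for h by (rule L.cod.comp_in[OF that e(1)])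
  qed
 qed
 then show "EX r e. r : Obj C & e : Hom D (L$r) x \<and>
   (ALL a:Obj C. bij_betw (%h. e $$D$$ farr L h) (Hom C a r) (Hom D (L$a) x))"
  using e(1) loc unfolding local_object_def by blast
qed

lemma preserves_limits_of_ff:
 assumes "fully_faithful C D F" "essentially_surjective C D F"
 shows "preserves_limits_of_shape J C D F"
proof -
 interpret F: cat_functor C D F using assms(1) by (simp add: fully_faithful_def)
 have "isomorphic (opposite D) a b" if "isomorphic D a b" for a b
  using F.cod.isomorphic_sym[OF that] by (simp add: isomorphic_def)
 then have es: "essentially_surjective (opposite C) (opposite D) F"
  using assms(2) unfolding essentially_surjective_def opposite_simps by blast
 have "fully_faithful (opposite C) (opposite D) F" using assms(1) by (simp add: fully_faithful_def)
 from localization_preserves_colimits[OF localization_of_ff[OF this es]] show ?thesis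
  by (simp add: preserves_limits_opposite)
qed

lemma equivalence_of_ff:
 assumes ff: "fully_faithful C D F" and es: "essentially_surjective C D F"
 shows "equivalence C D F" "EX G. adjoint C D F G & fully_faithful D C G" "left_exact C D F"
proof -
 obtain G where G: "adjoint C D F G" "fully_faithful D C G"
  using localization_right_adjoint[OF localization_of_ff[OF assms]] .
 then show "EX G. adjoint C D F G & fully_faithful D C G" by blast
 obtain eta eps where "adjunction C D F G eta eps" using G(1) by (auto simp: adjoint_iff)
 then interpret adjunction C D F G eta eps .
 have "is_iso C (eta c)" if c: "c : Obj C" for c
 proof (rule ff_reflects_iso[OF ff])
  show e: "eta c : Hom C c (G$(F$c))" using c by (simp add: in_Hom)
  have eps: "eps (F$c) : Hom D (F$(G$(F$c))) (F$c)" using c by (simp add: in_Hom)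
  have iso: "is_iso D (eps (F$c))" using counit_iso[OF G(2)] c by simp
  obtain g where g: "g : Hom D (F$c) (F$(G$(F$c)))" "is_iso D g"
    "eps (F$c) $$D$$ g = Ident D (F$c)"
   using L.cod.iso_inverse[OF iso eps] .
  have "farr F (eta c) = g"
   by (rule L.cod.iso_mono[OF iso eps L.farr_in[OF e] g(1)]) (simp add: triangle_left c g(3))
  then show "is_iso D (farr F (eta c))" using g by simp
 qed
 then have "naturally_isomorphic C C (id_funct C) (comp_funct C G F)"
  using unit by (auto simp: naturally_isomorphic_def)
 then have 1: "naturally_isomorphic C C (comp_funct C G F) (id_funct C)"
  by (rule naturally_isomorphic_sym)
 have 2: "naturally_isomorphic D D (comp_funct D F G) (id_funct D)"
  using counit counit_iso[OF G(2)] by (auto simp: naturally_isomorphic_def)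
 show "equivalence C D F"
  unfolding equivalence_def using 1 2 L.cat_functor_axioms R.cat_functor_axioms by blast
 show "left_exact C D F"
  unfolding left_exact_def using L.cat_functor_axioms preserves_limits_of_ff[OF assms] by blast
qed

section \<open>Cancellation of localizations and equivalences\<close>

definition conservative ::
 "('o, 'a) category => ('p, 'b) category => ('o, 'a, 'p, 'b) funct => bool" where
 "conservative C D F <-> (ALL f:Arr C. is_iso D (farr F f) --> is_iso C f)"

lemma local_object_isomorphic:
 assumes "cat_functor C D L" "local_object C D L r" "isomorphic C r s" "s : Obj C"
 shows "local_object C D L s"
proof -
 interpret cat_functor C D L by fact
 have "isomorphic C c c" if "c : Obj C" for c
  using dom.iso_ident[OF that] dom.id_in[OF that] by (auto simp: isomorphic_def)
 then show ?thesis
  using assms bij_on_Hom_transport[of _ _ r s] unfolding local_object_def by blast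
qed

lemma bij_betw_comp_left:
 assumes "bij_betw f A B" "bij_betw (%x. g (f x)) A C"
 shows "bij_betw g B C"
 using bij_betw_comp_iff[OF assms(1), of g C] assms(2) by (simp add: comp_def)

lemma local_object_comp:
 assumes F: "cat_functor A B F" and r: "local_object A B F r" and G: "local_object B D G (F$r)"
 shows "local_object A D (comp_funct A G F) r"
 unfolding local_object_def
proof (intro conjI ballI)
 interpret F: cat_functor A B F by (rule F)
 show rA: "r : Obj A" using r by (simp add: local_object_def)
 fix c assume c: "c : Obj A"
 have "bij_betw (%f. farr G (farr F f)) (Hom A c r) (Hom D (G$(F$c)) (G$(F$r)))"
  by (rule bij_betw_comp) (use r G c in \<open>auto simp: local_object_def\<close>)
 then have "bij_betw (farr (comp_funct A G F)) (Hom A c r) (Hom D (G$(F$c)) (G$(F$r)))"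
  by (rule bij_betw_cong[THEN iffD1, rotated]) (simp add: in_Hom)
 then show "bij_betw (farr (comp_funct A G F)) (Hom A c r) (Hom D ((comp_funct A G F)$c) ((comp_funct A G F)$r))"
  using c rA by simp
qed

text \<open>
 In both lemmas below \<open>K \<circ> eps = N \<circ> i\<close> with \<open>eps\<close> an equivalence and \<open>i\<close> a localization.
 Pre- and postcomposing with equivalences does not affect being a localization.
\<close>

lemma localization_precomp_equivalence:
 assumes eps: "fully_faithful A C eps" "essentially_surjective A C eps"
  and K: "cat_functor C D K" and M: "reflective_localization A D (comp_funct A K eps)"
 shows "reflective_localization C D K"
 unfolding reflective_localization_def
proof (intro conjI K ballI)
 interpret K: cat_functor C D K by (rule K)
 interpret eps: cat_functor A C eps using eps by (simp add: fully_faithful_def)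
 fix d assume "d : Obj D"
 then obtain a where loc: "local_object A D (comp_funct A K eps) a"
   and iso: "isomorphic D ((comp_funct A K eps)$a) d"
  using M by (auto simp: reflective_localization_def)
 have a: "a : Obj A" using loc by (simp add: local_object_def)
 have "local_object C D K (eps$a)"
  unfolding local_object_def
 proof (intro conjI ballI)
  fix c assume c: "c : Obj C"
  obtain c' where c': "c' : Obj A" "isomorphic C (eps$c') c"
   using eps(2) c by (auto simp: essentially_surjective_def)
  have "bij_betw (farr (comp_funct A K eps)) (Hom A c' a) (Hom D (K$(eps$c')) (K$(eps$a)))"
   using loc c' a by (auto simp: local_object_def)
  then have "bij_betw (%f. farr K (farr eps f)) (Hom A c' a) (Hom D (K$(eps$c')) (K$(eps$a)))"
   by (rule bij_betw_cong[THEN iffD1, rotated]) (simp add: in_Hom)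
  then have "bij_betw (farr K) (Hom C (eps$c') (eps$a)) (Hom D (K$(eps$c')) (K$(eps$a)))"
   by (rule bij_betw_comp_left[rotated]) (use eps(1) c' a in \<open>auto simp: fully_faithful_def\<close>)
  moreover have "isomorphic C c (eps$c')" using c' K.dom.isomorphic_sym by blast
  moreover have "isomorphic C (eps$a) (eps$a)"
   using K.dom.iso_ident[of "eps$a"] K.dom.id_in[of "eps$a"] a by (auto simp: isomorphic_def)
  ultimately show "bij_betw (farr K) (Hom C c (eps$a)) (Hom D (K$c) (K$(eps$a)))"
   by (meson K.bij_on_Hom_transport)
 qed (use a in simp)
 then show "EX r. local_object C D K r & isomorphic D (K$r) d" using iso a by auto
qed

lemma localization_postcomp_equivalence:
 assumes N: "fully_faithful B D N" "essentially_surjective B D N"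
  and i: "reflective_localization A B i"
 shows "reflective_localization A D (comp_funct A N i)"
 unfolding reflective_localization_def
proof (intro conjI ballI)
 interpret N: cat_functor B D N using N by (simp add: fully_faithful_def)
 interpret i: cat_functor A B i using i by (simp add: reflective_localization_def)
 show "cat_functor A D (comp_funct A N i)"
  using cat_functor_comp[OF i.cat_functor_axioms N.cat_functor_axioms] .
 fix d assume d: "d : Obj D"
 obtain b where b: "b : Obj B" "isomorphic D (N$b) d"
  using N(2) d by (auto simp: essentially_surjective_def)
 obtain r where r: "local_object A B i r" "isomorphic B (i$r) b"
  using i b by (auto simp: reflective_localization_def)
 have rA: "r : Obj A" using r(1) by (simp add: local_object_def)
 have "local_object A D (comp_funct A N i) r"
  by (rule local_object_comp[OF i.cat_functor_axioms r(1) local_object_ff[OF N(1)]]) (use rA in simp)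
 moreover have "isomorphic D ((comp_funct A N i)$r) d"
  using N.cod.isomorphic_trans[OF N.preserves_isomorphic[OF r(2)] b(2)] rA by simp
 ultimately show "EX r. local_object A D (comp_funct A N i) r & isomorphic D ((comp_funct A N i)$r) d"
  by blast
qed

lemma localization_comp_equivalence:
 assumes eps: "fully_faithful A C eps" "essentially_surjective A C eps" and K: "reflective_localization C D K"
 shows "reflective_localization A D (comp_funct A K eps)"
 unfolding reflective_localization_def
proof (intro conjI ballI)
 interpret eps: cat_functor A C eps using eps by (simp add: fully_faithful_def)
 interpret K: cat_functor C D K using K by (simp add: reflective_localization_def)
 show "cat_functor A D (comp_funct A K eps)"
  using cat_functor_comp[OF eps.cat_functor_axioms K.cat_functor_axioms] .
 fix d assume d: "d : Obj D"
 obtain g where g: "local_object C D K g" "isomorphic D (K$g) d"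
  using K d by (auto simp: reflective_localization_def)
 have gC: "g : Obj C" using g(1) by (simp add: local_object_def)
 obtain a where a: "a : Obj A" "isomorphic C (eps$a) g"
  using eps(2) gC by (auto simp: essentially_surjective_def)
 have loc: "local_object C D K (eps$a)"
  using local_object_isomorphic[OF K.cat_functor_axioms g(1) eps.cod.isomorphic_sym[OF a(2)]] a(1) by simp
 have "local_object A D (comp_funct A K eps) a"
  by (rule local_object_comp[OF eps.cat_functor_axioms local_object_ff[OF eps(1) a(1)] loc])
 moreover have "isomorphic D ((comp_funct A K eps)$a) d"
  using K.cod.isomorphic_trans[OF K.preserves_isomorphic[OF a(2)] g(2)] a(1) by simp
 ultimately show "EX r. local_object A D (comp_funct A K eps) r & isomorphic D ((comp_funct A K eps)$r) d"
  by blast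
qed

text \<open>
 A localization is determined by the arrows that it inverts. If \<open>N\<close> is conservative, then
 \<open>N \<circ> i\<close> and \<open>i\<close> invert the same arrows, hence have the same local objects, and \<open>N\<close> is
 bijective on hom-sets between the images of these.
\<close>

lemma ff_of_conservative_localization:
 assumes i: "reflective_localization A B i" and M: "reflective_localization A D (comp_funct A N i)"
  and N: "cat_functor B D N" "conservative B D N"
 shows "fully_faithful B D N" "essentially_surjective B D N"
proof -
 let ?M = "comp_funct A N i"
 interpret N: cat_functor B D N by (rule N(1))
 interpret i: cat_functor A B i using i by (simp add: reflective_localization_def)
 interpret M: cat_functor A D ?M using M by (simp add: reflective_localization_def)
 show "essentially_surjective B D N"
  unfolding essentially_surjective_def
 proof
  fix d assume "d : Obj D"
  then obtain r where "local_object A D ?M r" "isomorphic D (?M$r) d"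
   using M by (auto simp: reflective_localization_def)
  then show "EX c:Obj B. isomorphic D (N$c) d"
   by (intro bexI[of _ "i$r"]) (auto simp: local_object_def)
 qed
 have local: "local_object A D ?M r" if r: "local_object A B i r" for r
 proof -
  have rA: "r : Obj A" using r by (simp add: local_object_def)
  obtain s where s: "local_object A D ?M s" "isomorphic D (?M$s) (?M$r)"
   using M M.fobj_in[OF rA] unfolding reflective_localization_def by blast
  have sA: "s : Obj A" using s by (simp add: local_object_def)
  obtain g where g: "g : Hom D (?M$r) (?M$s)" "is_iso D g"
   using N.cod.isomorphic_sym[OF s(2)] by (auto simp: isomorphic_def)
  obtain h where h: "h : Hom A r s" "farr ?M h = g"
   using s(1) g rA unfolding local_object_def bij_betw_def by (metis imageE)
  have ih: "farr i h : Hom B (i$r) (i$s)" using i.farr_in[OF h(1)] .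
  have "is_iso D (farr N (farr i h))" using h g(2) HomD[OF h(1)] by auto
  then have "is_iso B (farr i h)" using N(2) ih by (auto simp: conservative_def in_Hom)
  then obtain k' where k': "k' : Hom B (i$s) (i$r)" "k' $$B$$ farr i h = Ident B (i$r)"
    "farr i h $$B$$ k' = Ident B (i$s)"
   using N.dom.is_isoE ih by blast
  obtain k where k: "k : Hom A s r" "farr i k = k'"
   using r k'(1) sA unfolding local_object_def bij_betw_def by (metis imageE)
  note hk = HomD[OF h(1)] HomD[OF k(1)]
  have "farr i (k $$A$$ h) = farr i (Ident A r)" using hk k'(2) k(2) rA by simp
  moreover have "k $$A$$ h : Hom A r r" "Ident A r : Hom A r r" using hk rA by (auto simp: in_Hom)
  ultimately have 1: "k $$A$$ h = Ident A r"
   using r rA unfolding local_object_def bij_betw_def by (meson inj_onD)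
  have "farr ?M (h $$A$$ k) = farr N (farr i h $$B$$ k')" using hk k(2) by simp
  also have "\<dots> = farr ?M (Ident A s)" using k'(3) sA by simp
  finally have "farr ?M (h $$A$$ k) = farr ?M (Ident A s)" .
  moreover have "h $$A$$ k : Hom A s s" "Ident A s : Hom A s s" using hk sA by (auto simp: in_Hom)
  ultimately have 2: "h $$A$$ k = Ident A s"
   using s(1) sA unfolding local_object_def bij_betw_def by (meson inj_onD)
  have "isomorphic A s r" unfolding isomorphic_def using k i.dom.is_isoI[OF k(1) h(1) 2 1] by blast
  then show ?thesis using local_object_isomorphic[OF M.cat_functor_axioms s(1) _ rA] by blast
 qed
 show "fully_faithful B D N"
  unfolding fully_faithful_def
 proof (intro conjI ballI N)
  fix a b assume ab: "a : Obj B" "b : Obj B"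
  obtain c where c: "local_object A B i c" "isomorphic B (i$c) a"
   using i ab by (auto simp: reflective_localization_def)
  obtain r where r: "local_object A B i r" "isomorphic B (i$r) b"
   using i ab by (auto simp: reflective_localization_def)
  have cr: "c : Obj A" "r : Obj A" using c r by (auto simp: local_object_def)
  have "bij_betw (farr ?M) (Hom A c r) (Hom D (N$(i$c)) (N$(i$r)))"
   using local[OF r(1)] cr by (auto simp: local_object_def)
  then have "bij_betw (%f. farr N (farr i f)) (Hom A c r) (Hom D (N$(i$c)) (N$(i$r)))"
   by (rule bij_betw_cong[THEN iffD1, rotated]) (simp add: in_Hom)
  then have "bij_betw (farr N) (Hom B (i$c) (i$r)) (Hom D (N$(i$c)) (N$(i$r)))"
   by (rule bij_betw_comp_left[rotated]) (use r(1) cr in \<open>auto simp: local_object_def\<close>)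
  then show "bij_betw (farr N) (Hom B a b) (Hom D (N$a) (N$b))"
   using N.bij_on_Hom_transport[OF N.dom.isomorphic_sym[OF c(2)] r(2)] by blast
 qed
qed

section \<open>Composition of left exact functors\<close>

lemma preserves_colimits_comp:
 assumes F: "cat_functor C D F" "preserves_colimits_of_shape J C D F"
  and G: "cat_functor D E G" "preserves_colimits_of_shape J D E G"
 shows "preserves_colimits_of_shape J C E (comp_funct C G F)"
 unfolding preserves_colimits_of_shape_def
proof (intro allI impI)
 fix Dg c p assume Dg: "cat_functor J C Dg" and lim: "is_colimit J C Dg c p"
 interpret Dg: cat_functor J C Dg by (rule Dg)
 have c: "c : Obj C" and p: "!!j. j : Obj J ==> p j : Arr C"
  using lim by (auto simp: is_colimit_def is_cocone_def in_Hom)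
 have "is_colimit J E (comp_funct J G (comp_funct J F Dg)) (G$(F$c)) (%j. farr G (farr F (p j)))"
  using F(2) G(2) Dg lim cat_functor_comp[OF Dg F(1)] unfolding preserves_colimits_of_shape_def by blast
 moreover have "comp_funct J G (comp_funct J F Dg) = comp_funct J (comp_funct C G F) Dg"
  by (auto simp: comp_funct_def fun_eq_iff restrict_def)
 ultimately show "is_colimit J E (comp_funct J (comp_funct C G F) Dg) ((comp_funct C G F)$c)
   (%j. farr (comp_funct C G F) (p j))"
  using c p by (simp add: is_colimit_def is_cocone_def cong: ball_cong)
qed

lemma preserves_limits_comp:
 assumes F: "cat_functor C D F" "preserves_limits_of_shape J C D F"
  and G: "cat_functor D E G" "preserves_limits_of_shape J D E G"
 shows "preserves_limits_of_shape J C E (comp_funct C G F)"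
 using preserves_colimits_comp[of "opposite C" "opposite D" F "opposite J" "opposite E" G] assms
 by (simp add: preserves_limits_opposite)

lemma left_exact_comp:
 assumes "left_exact C D F" "left_exact D E G"
 shows "left_exact C E (comp_funct C G F)"
 using assms cat_functor_comp preserves_limits_comp unfolding left_exact_def by blast

lemma preserves_limits_iso:
 assumes \<sigma>: "nat_trans C D F F' \<sigma>" "!!a. a : Obj C ==> is_iso D (\<sigma> a)"
  and F: "preserves_limits_of_shape J C D F"
 shows "preserves_limits_of_shape J C D F'"
 unfolding preserves_limits_of_shape_def
proof (intro allI impI)
 fix Dg c p assume Dg: "cat_functor J C Dg" and lim: "is_limit J C Dg c p"
 note N = nat_transD[OF \<sigma>(1)]
 obtain \<tau> where \<tau>: "nat_trans C D F' F \<tau>" and \<tau>\<sigma>: "!!a. a : Obj C ==> \<tau> a $$D$$ \<sigma> a = Ident D (F$a)"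
  and \<sigma>\<tau>: "!!a. a : Obj C ==> \<sigma> a $$D$$ \<tau> a = Ident D (F'$a)" by (rule inverse_nat_trans[OF \<sigma>], assumption, rule that)
 note T = nat_transD[OF \<tau>]
 interpret F: cat_functor C D F by (rule N(1))
 interpret F': cat_functor C D F' by (rule N(2))
 interpret Dg: cat_functor J C Dg by (rule Dg)
 have cone: "is_cone J C Dg c p" using lim by (simp add: is_limit_def)
 then have c: "c : Obj C" and p: "!!j. j : Obj J ==> p j : Arr C & Dom C (p j) = c & Cod C (p j) = Dg$j"
  by (auto simp: is_cone_def in_Hom)
 have lim': "is_limit J D (comp_funct J F Dg) (F$c) (%j. farr F (p j))"
  using F Dg lim unfolding preserves_limits_of_shape_def by blast
 show "is_limit J D (comp_funct J F' Dg) (F'$c) (%j. farr F' (p j))"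
  unfolding is_limit_def
 proof (intro conjI allI impI cone_image[OF N(2) Dg cone])
  fix x q assume qc: "is_cone J D (comp_funct J F' Dg) x q"
  have x: "x : Obj D" and q: "!!j. j : Obj J ==> q j : Arr D & Dom D (q j) = x & Cod D (q j) = F'$(Dg$j)"
   and qk: "!!k. k : Arr J ==> farr F' (farr Dg k) $$D$$ q (Dom J k) = q (Cod J k)"
   using qc by (auto simp: is_cone_def in_Hom)
  have "is_cone J D (comp_funct J F Dg) x (%j. \<tau> (Dg$j) $$D$$ q j)"
   unfolding is_cone_def
  proof (intro conjI ballI x)
   fix k assume k: "k : Arr J"
   have "farr F (farr Dg k) $$D$$ (\<tau> (Dg$(Dom J k)) $$D$$ q (Dom J k)) = (farr F (farr Dg k) $$D$$ \<tau> (Dg$(Dom J k))) $$D$$ q (Dom J k)"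
    using k T(3-5) q[of "Dom J k"] by simp
   also have "\<dots> = \<tau> (Dg$(Cod J k)) $$D$$ q (Cod J k)"
    using k T(3-5) T(6)[of "farr Dg k", symmetric] q[of "Dom J k"] qk[OF k] by simp
   finally show "farr (comp_funct J F Dg) k $$D$$ (\<tau> (Dg$(Dom J k)) $$D$$ q (Dom J k)) = \<tau> (Dg$(Cod J k)) $$D$$ q (Cod J k)"
    using k by simp
  qed (use T(3-5) q in \<open>simp add: in_Hom\<close>)
  from limit_factor[OF lim' this] obtain u where u: "u : Hom D x (F$c)"
   and pu: "!!j. j : Obj J ==> farr F (p j) $$D$$ u = \<tau> (Dg$j) $$D$$ q j"
   and uu: "!!v. v : Hom D x (F$c) ==> (ALL j:Obj J. farr F (p j) $$D$$ v = \<tau> (Dg$j) $$D$$ q j) ==> v = u" by blast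
  note us = HomD[OF u]
  have H: "\<sigma> a : Hom D (F$a) (F'$a)" "\<tau> a : Hom D (F'$a) (F$a)" if "a : Obj C" for a
   using N(3-5) T(3-5) that by (simp_all add: in_Hom)
  show "EX! v. v : Hom D x (F'$c) & (ALL j:Obj J. farr F' (p j) $$D$$ v = q j)"
  proof (rule ex1I[of _ "\<sigma> c $$D$$ u"])
   have "farr F' (p j) $$D$$ (\<sigma> c $$D$$ u) = q j" if j: "j : Obj J" for j
   proof -
    have "farr F' (p j) $$D$$ (\<sigma> c $$D$$ u) = (\<sigma> (Dg$j) $$D$$ farr F (p j)) $$D$$ u"
     using N(6)[of "p j"] N(3-5) us p[OF j] c by simp
    also have "\<dots> = \<sigma> (Dg$j) $$D$$ (\<tau> (Dg$j) $$D$$ q j)"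
     using N(3-5) us p[OF j] pu[OF j] j by simp
    also have "\<dots> = q j"
     using F.cod.cancel_left[OF \<sigma>\<tau> H(2) H(1), of "Dg$j" "q j" x] q[OF j] j by (simp add: in_Hom)
    finally show ?thesis .
   qed
   then show "\<sigma> c $$D$$ u : Hom D x (F'$c) & (ALL j:Obj J. farr F' (p j) $$D$$ (\<sigma> c $$D$$ u) = q j)"
    using F.cod.comp_in[OF u H(1)[OF c]] by blast
   fix v assume v: "v : Hom D x (F'$c) & (ALL j:Obj J. farr F' (p j) $$D$$ v = q j)"
   then have vH: "v : Hom D x (F'$c)" by blast
   note vs = HomD[OF vH]
   have "farr F (p j) $$D$$ (\<tau> c $$D$$ v) = \<tau> (Dg$j) $$D$$ q j" if j: "j : Obj J" for j
   proof -
    have "farr F (p j) $$D$$ (\<tau> c $$D$$ v) = (\<tau> (Dg$j) $$D$$ farr F' (p j)) $$D$$ v"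
     using T(6)[of "p j"] T(3-5) vs p[OF j] c by simp
    also have "\<dots> = \<tau> (Dg$j) $$D$$ q j" using T(3-5) vs p[OF j] v j by simp
    finally show ?thesis .
   qed
   then have "\<tau> c $$D$$ v = u" using uu[OF F.cod.comp_in[OF vH H(2)[OF c]]] by blast
   then show "v = \<sigma> c $$D$$ u"
    using F.cod.cancel_left[OF \<sigma>\<tau>[OF c] H(2)[OF c] H(1)[OF c] vH] by simp
  qed
 qed
qed

lemma left_exact_precomp_equivalence:
 assumes eps: "fully_faithful A C eps" "essentially_surjective A C eps"
  and K: "cat_functor C D K" and M: "left_exact A D (comp_funct A K eps)"
 shows "left_exact C D K"
 unfolding left_exact_def
proof (intro conjI K allI impI)
 fix J :: "(nat, nat) category" assume J: "finite_category J"
 obtain G tht \<psi> where G: "cat_functor C A G"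
   and tht: "naturally_isomorphic A A (comp_funct A G eps) (id_funct A)"
   and \<psi>n: "naturally_isomorphic C C (comp_funct C eps G) (id_funct C)"
   and \<psi>: "nat_trans C C (comp_funct C eps G) (id_funct C) \<psi>" "ALL c:Obj C. is_iso C (\<psi> c)"
  using equivalence_of_ff(1)[OF eps] unfolding equivalence_def naturally_isomorphic_def by blast
 interpret K: cat_functor C D K by (rule K)
 interpret G: cat_functor C A G by (rule G)
 interpret eps: cat_functor A C eps using eps by (simp add: fully_faithful_def)
 have eq: "equivalence C A G"
  unfolding equivalence_def using G eps.cat_functor_axioms tht \<psi>n by blast
 note N = nat_transD(3-6)[OF \<psi>(1)]
 let ?M = "comp_funct A K eps"
 have MG: "preserves_limits_of_shape J C D (comp_funct C ?M G)"
  by (rule preserves_limits_comp[OF G preserves_limits_of_ff[OF equivalenceD[OF eq]]])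
   (use M J in \<open>auto simp: left_exact_def\<close>)
 have nt: "nat_trans C D (comp_funct C ?M G) K (\<lambda>c\<in>Obj C. farr K (\<psi> c))"
  unfolding nat_trans_def
 proof (intro conjI ballI)
  show "cat_functor C D (comp_funct C ?M G)" using M by (intro cat_functor_comp[OF G]) (simp add: left_exact_def)
  fix f assume f: "f : Arr C"
  have "farr K (\<psi> (Cod C f)) $$D$$ farr K (farr eps (farr G f)) = farr K (\<psi> (Cod C f) $$C$$ farr eps (farr G f))"
   using N(1-3) f by simp
  also have "\<dots> = farr K f $$D$$ farr K (\<psi> (Dom C f))" using N(4)[OF f] N(1-3) f by simp
  finally show "restrict (%c. farr K (\<psi> c)) (Obj C) (Cod C f) $$D$$ farr (comp_funct C ?M G) f
    = farr K f $$D$$ restrict (%c. farr K (\<psi> c)) (Obj C) (Dom C f)" using f by simp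
 qed (use N(1-3) K in \<open>auto simp: in_Hom\<close>)
 show "preserves_limits_of_shape J C D K"
  by (rule preserves_limits_iso[OF nt _ MG]) (use \<psi>(2) K.preserves_iso in simp)
qed

section \<open>Small sets\<close>

definition smaller_than :: "'u itself => 'b set => bool" where
 "smaller_than U A <-> A \<prec> (UNIV :: 'u set)"

locale universe =
 fixes U :: "'u itself"
 assumes univ: "grothendieck_universe TYPE('u)"
begin

abbreviation tiny :: "'b set => bool" where
 "tiny \<equiv> smaller_than U"

lemma tiny_def: "tiny A <-> A \<prec> (UNIV :: 'u set)"
 by (simp add: smaller_than_def)

lemma tiny_subset: "A \<subseteq> B ==> tiny B ==> tiny A"
 unfolding tiny_def by (meson subset_imp_lepoll lesspoll_trans1)

lemma tiny_lepoll: "A \<lesssim> B ==> tiny B ==> tiny A"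
 unfolding tiny_def by (meson lesspoll_trans1)

lemma tiny_image: "tiny A ==> tiny (f ` A)"
 unfolding tiny_def by (meson image_lepoll lesspoll_trans1)

lemma tiny_nat: "tiny (UNIV :: nat set)"
 using univ by (simp add: grothendieck_universe_def tiny_def)

lemma small_set_UN:
 fixes A :: "'u set" and B :: "'u => 'u set"
 assumes "small_set A" "!!a. a : A ==> small_set (B a)"
 shows "small_set (UN a:A. B a)"
proof -
 have "ALL (A :: 'u set) B. small_set A --> (ALL a:A. small_set (B a)) --> small_set (UN a:A. B a :: 'u set)"
  using univ by (simp add: grothendieck_universe_def)
 with assms show ?thesis by metis
qed

lemma infinite_universe: "infinite (UNIV :: 'u set)"
 using tiny_nat unfolding tiny_def by (simp add: infinite_le_lepoll lesspoll_imp_lepoll)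

lemma tiny_finite: "finite A ==> tiny A"
 using infinite_universe by (simp add: tiny_def finite_lesspoll_infinite)

lemma small_set_tiny: "small_set (A :: 'u set) <-> tiny A"
 by (simp only: small_set_def tiny_def)

lemma encode:
 assumes "tiny A"
 obtains e :: "'b => 'u" where "inj_on e A" "small_set (e ` A)"
proof -
 obtain e :: "'b => 'u" where e: "inj_on e A"
  using assms lesspoll_imp_lepoll unfolding tiny_def lepoll_def by blast
 have "small_set (e ` A)" using tiny_image[OF assms] small_set_tiny by blast
 with e that show thesis by blast
qed

lemma pairing: obtains pr :: "'u \<times> 'u => 'u" where "inj pr"
proof -
 have "EX f :: 'u \<times> 'u => 'u. bij_betw f (UNIV \<times> UNIV) UNIV"
  using card_of_Times_same_infinite[OF infinite_universe] card_of_ordIso by blast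
 then show thesis using that by (auto simp: bij_betw_def)
qed

lemma tiny_Sigma:
 assumes "tiny I" "!!i. i : I ==> tiny (B i)"
 shows "tiny (Sigma I B)"
proof -
 obtain f :: "_ => 'u" where f: "inj_on f I" "small_set (f ` I)" using encode[OF assms(1)] .
 have "ALL i:I. EX g :: _ => 'u. inj_on g (B i) & small_set (g ` B i)"
 proof
  fix i assume "i : I"
  from encode[OF assms(2)[OF this]] show "EX g :: _ => 'u. inj_on g (B i) & small_set (g ` B i)" by blast
 qed
 from bchoice[OF this] obtain g :: "_ => _ => 'u"
  where g: "!!i. i : I ==> inj_on (g i) (B i) & small_set (g i ` B i)" by blast
 obtain pr :: "'u \<times> 'u => 'u" where pr: "inj pr" using pairing .
 define h where "h p = pr (f (fst p), g (fst p) (snd p))" for p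
 have "inj_on h (Sigma I B)"
 proof (rule inj_onI)
  fix p q assume pq: "p : Sigma I B" "q : Sigma I B" "h p = h q"
  then have "f (fst p) = f (fst q)" "g (fst p) (snd p) = g (fst q) (snd q)"
   using injD[OF pr pq(3)[unfolded h_def]] by auto
  moreover from this(1) have "fst p = fst q" using f(1) pq(1,2) by (auto dest: inj_onD)
  moreover have "inj_on (g (fst p)) (B (fst p))" using g pq(1) by auto
  ultimately show "p = q" using pq(1,2) by (intro prod_eqI) (auto dest: inj_onD)
 qed
 moreover have "h ` Sigma I B \<subseteq> (UN a:f ` I. pr ` ({a} \<times> (let i = inv_into I f a in g i ` B i)))"
  using f(1) by (auto simp: h_def Let_def)
 moreover have "small_set (UN a:f ` I. pr ` ({a} \<times> (let i = inv_into I f a in g i ` B i)) :: 'u set)"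
 proof -
  have "small_set (pr ` ({a} \<times> (let i = inv_into I f a in g i ` B i)))" if "a : f ` I" for a
  proof -
   have "tiny (g (inv_into I f a) ` B (inv_into I f a))"
    using g[OF inv_into_into[OF that]] by (simp only: small_set_tiny)
   then have "tiny ((%b. pr (a, b)) ` (g (inv_into I f a) ` B (inv_into I f a)))" by (rule tiny_image)
   moreover have "pr ` ({a} \<times> (let i = inv_into I f a in g i ` B i)) = (%b. pr (a, b)) ` (g (inv_into I f a) ` B (inv_into I f a))"
    by (auto simp: Let_def image_def)
   ultimately show ?thesis by (simp only: small_set_tiny)
  qed
  then show ?thesis by (rule small_set_UN[OF f(2)])
 qed
 ultimately have "Sigma I B \<lesssim> (UN a:f ` I. pr ` ({a} \<times> (let i = inv_into I f a in g i ` B i)))"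
  "tiny (UN a:f ` I. pr ` ({a} \<times> (let i = inv_into I f a in g i ` B i)))"
  unfolding lepoll_def by (blast, simp only: small_set_tiny)
 then show ?thesis by (rule tiny_lepoll)
qed

lemma tiny_Times: "tiny A ==> tiny B ==> tiny (A \<times> B)"
 by (rule tiny_Sigma)

lemma tiny_UN:
 assumes "tiny I" "!!i. i : I ==> tiny (B i)"
 shows "tiny (UN i:I. B i)"
proof -
 have "(UN i:I. B i) = snd ` Sigma I B" by force
 then show ?thesis using tiny_image[OF tiny_Sigma[OF assms]] by simp
qed

lemma tiny_Pow:
 assumes "tiny A"
 shows "tiny (Pow A)"
proof -
 obtain f :: "_ => 'u" where f: "inj_on f A" "small_set (f ` A)" using encode[OF assms] .
 have "inj_on ((`) f) (Pow A)" using f(1) by (meson inj_on_image_Pow)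
 then have "Pow A \<lesssim> Pow (f ` A)" unfolding lepoll_def by blast
 moreover have "tiny (Pow (f ` A))" using univ f(2) by (simp add: grothendieck_universe_def tiny_def)
 ultimately show ?thesis by (rule tiny_lepoll)
qed

lemma tiny_PiE:
 assumes "tiny A" "!!a. a : A ==> tiny (B a)"
 shows "tiny (PiE A B)"
proof -
 have "inj_on (%f. (%a. (a, f a)) ` A) (PiE A B)"
 proof (rule inj_onI)
  fix f g assume fg: "f : PiE A B" "g : PiE A B" "(%a. (a, f a)) ` A = (%a. (a, g a)) ` A"
  have "f a = g a" if a: "a : A" for a
  proof -
   have "(a, f a) : (%a. (a, g a)) ` A" using a fg(3) by blast
   then show ?thesis by blast
  qed
  then show "f = g" using PiE_ext[OF fg(1,2)] by blast
 qed
 moreover have "(%f. (%a. (a, f a)) ` A) ` PiE A B \<subseteq> Pow (Sigma A B)" by auto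
 ultimately have "PiE A B \<lesssim> Pow (Sigma A B)" unfolding lepoll_def by blast
 then show ?thesis using tiny_Pow[OF tiny_Sigma[OF assms]] by (rule tiny_lepoll)
qed

lemma small_Pair_set: "small_set {a, b :: 'u}"
 by (simp add: small_set_tiny tiny_finite)

lemma two_elements: obtains a b :: 'u where "a \<noteq> b"
 using infinite_universe by (metis (full_types) UNIV_I ex_new_if_finite finite.simps insertI1)

end

section \<open>Sets and set-valued functors\<close>

lemma set_category_simps [simp]:
 "Obj Sets = {A. small_set A}" "Dom Sets = src" "Cod Sets = tgt"
 by (simp_all add: set_category_def)

lemma in_Hom_set:
 "f : Hom Sets A B <->
  small_set A & small_set B & src f = A & tgt f = B & body f : A \<rightarrow>\<^sub>E B"
 by (auto simp: in_Hom set_category_def)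

lemma set_comp_simps [simp]:
 "src (g $$Sets$$ f) = src f" "tgt (g $$Sets$$ f) = tgt g"
 "x : src f ==> body (g $$Sets$$ f) x = body g (body f x)"
 by (simp_all add: set_category_def)

lemma set_ident_simps [simp]:
 "src (Ident Sets A) = A" "tgt (Ident Sets A) = A"
 "x : A ==> body (Ident Sets A) x = x"
 by (simp_all add: set_category_def)

lemma set_arrow_eqI:
 assumes "f : Hom Sets A B" "g : Hom Sets A B" "!!x. x : A ==> body f x = body g x"
 shows "f = g"
proof -
 have "body f = body g"
  by (rule PiE_ext[of _ A "%_. B"]) (use assms in \<open>auto simp: in_Hom_set\<close>)
 then show ?thesis using assms(1,2) by (cases f; cases g) (simp add: in_Hom_set)
qed

definition set_map :: "'u set => ('u => 'u) => 'u set => 'u set_arrow" where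
 "set_map A g B = Arrow A (restrict g A) B"

lemma set_map_simps [simp]:
 "src (set_map A g B) = A" "tgt (set_map A g B) = B" "x : A ==> body (set_map A g B) x = g x"
 by (simp_all add: set_map_def)

lemma set_map_in_Hom:
 "small_set A ==> small_set B ==> (!!x. x : A ==> g x : B) ==> set_map A g B : Hom Sets A B"
 by (auto simp: in_Hom_set set_map_def)

lemma set_arrow_in: "f : Hom Sets A B ==> x : A ==> body f x : B"
 by (auto simp: in_Hom_set)

lemma set_comp_eq:
 "g $$Sets$$ f = Arrow (src f) (\<lambda>x\<in>src f. body g (body f x)) (tgt g)"
 by (simp add: set_category_def)

lemma set_ident_eq: "Ident Sets A = Arrow A (\<lambda>x\<in>A. x) A"
 by (simp add: set_category_def)

lemma set_comp_in:
 "f : Hom Sets A B ==> g : Hom Sets B C ==> g $$Sets$$ f : Hom Sets A C"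
 by (auto simp: in_Hom_set set_comp_eq)

lemma set_comp_apply: "f : Hom Sets A B ==> x : A ==> body (g $$Sets$$ f) x = body g (body f x)"
 by (simp add: in_Hom_set)

lemma set_ident_in: "small_set A ==> Ident Sets A : Hom Sets A A"
 by (auto simp: in_Hom_set set_ident_eq)

lemma set_category_category: "category Sets"
proof unfold_locales
 fix f a b g c assume fg: "f : Hom Sets a b" "g : Hom Sets b c"
 then show "g $$Sets$$ f : Hom Sets a c" by (rule set_comp_in)
next
 fix f a b g c h d
 assume fgh: "f : Hom Sets a b" "g : Hom Sets b c" "h : Hom Sets c d"
 show "h $$Sets$$ g $$Sets$$ f = h $$Sets$$ (g $$Sets$$ f)"
  by (rule set_arrow_eqI[OF set_comp_in[OF fgh(1) set_comp_in[OF fgh(2,3)]] set_comp_in[OF set_comp_in[OF fgh(1,2)] fgh(3)]])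
   (simp add: set_comp_apply[OF fgh(1)] set_comp_apply[OF fgh(2)] set_comp_apply[OF set_comp_in[OF fgh(1,2)]] set_arrow_in[OF fgh(1)])
next
 fix f a b assume f: "f : Hom Sets a b"
 then have ab: "small_set a" "small_set b" by (auto simp: in_Hom_set)
 show "Ident Sets b $$Sets$$ f = f"
  by (rule set_arrow_eqI[OF set_comp_in[OF f set_ident_in[OF ab(2)]] f])
   (simp add: set_comp_apply[OF f] set_arrow_in[OF f])
 show "f $$Sets$$ Ident Sets a = f"
  by (rule set_arrow_eqI[OF set_comp_in[OF set_ident_in[OF ab(1)] f] f])
   (simp add: set_comp_apply[OF set_ident_in[OF ab(1)]])
qed (auto simp: in_Hom_set set_ident_eq, auto simp: set_category_def)

interpretation set_cat: category Sets by (rule set_category_category)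

lemma is_iso_set_iff:
 assumes f: "f : Hom Sets A B"
 shows "is_iso Sets f <-> bij_betw (body f) A B"
proof
 assume "is_iso Sets f"
 then obtain g where g: "g : Hom Sets B A" "g $$Sets$$ f = Ident Sets A"
   "f $$Sets$$ g = Ident Sets B"
  using set_cat.is_isoE f by blast
 have "body g (body f x) = x" if "x : A" for x
  using arg_cong[OF g(2), of "%h. body h x"] set_comp_apply[OF f that, of g] that by simp
 moreover have "body f (body g x) = x" if "x : B" for x
  using arg_cong[OF g(3), of "%h. body h x"] set_comp_apply[OF g(1) that, of f] that by simp
 ultimately show "bij_betw (body f) A B"
  using set_arrow_in[OF f] set_arrow_in[OF g(1)] by (intro bij_betw_byWitness[of A "body g"]) auto
next
 assume bij: "bij_betw (body f) A B"
 let ?g = "set_map B (inv_into A (body f)) A"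
 have g: "?g : Hom Sets B A"
  using f bij by (intro set_map_in_Hom) (auto simp: in_Hom_set bij_betw_def inv_into_into)
 show "is_iso Sets f"
 proof (rule set_cat.is_isoI[OF f g])
  have fb: "!!x. x : A ==> body f x : B" using set_arrow_in[OF f] .
  show "?g $$Sets$$ f = Ident Sets A"
   by (rule set_arrow_eqI[OF set_cat.comp_in[OF f g] set_cat.id_in])
    (use f bij fb in \<open>auto simp: in_Hom_set bij_betw_def\<close>)
  show "f $$Sets$$ ?g = Ident Sets B"
   by (rule set_arrow_eqI[OF set_cat.comp_in[OF g f] set_cat.id_in])
    (use f bij in \<open>auto simp: in_Hom_set bij_betw_def f_inv_into_f\<close>)
 qed
qed

definition act :: "('o, 'a, 'u) set_funct => 'a => 'u => 'u" where
 "act F f x = body (farr F f) x"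

definition set_funct :: "('o, 'a) category => ('o => 'u set) => ('a => 'u => 'u) => ('o, 'a, 'u) set_funct" where
 "set_funct C A t = Funct (restrict A (Obj C))
  (\<lambda>f\<in>Arr C. set_map (A (Dom C f)) (t f) (A (Cod C f)))"

definition app :: "('o, 'a, 'u) set_nat => 'o => 'u => 'u" where
 "app alp a x = body (body alp a) x"

definition set_nat ::
 "('o, 'a) category => ('o, 'a, 'u) set_funct => ('o => 'u => 'u) => ('o, 'a, 'u) set_funct => ('o, 'a, 'u) set_nat" where
 "set_nat C F t G = Arrow F (\<lambda>a\<in>Obj C. set_map (F$a) (t a) (G$a)) G"

locale set_functor = cat_functor C Sets F
 for C :: "('o, 'a) category" and F :: "('o, 'a, 'u) set_funct"
begin

lemma small: "a : Obj C ==> small_set (F$a)"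
 using fobj_in by simp

lemma act_in: "f : Arr C ==> x : F$(Dom C f) ==> act F f x : F$(Cod C f)"
 using farr_in[of f "Dom C f" "Cod C f"] by (auto simp: in_Hom act_def intro: set_arrow_in)

lemma act_id [simp]: "a : Obj C ==> x : F$a ==> act F (Ident C a) x = x"
 by (simp add: act_def)

lemma act_comp [simp]:
 assumes "f : Arr C" "g : Arr C" "Dom C g = Cod C f" "x : F$(Dom C f)"
 shows "act F (g $$C$$ f) x = act F g (act F f x)"
 using arr_simps(2)[OF assms(1)] assms by (simp add: act_def)

end

lemma set_funct_simps [simp]:
 "a : Obj C ==> (set_funct C A t)$a = A a"
 "f : Arr C ==> farr (set_funct C A t) f = set_map (A (Dom C f)) (t f) (A (Cod C f))"
 "f : Arr C ==> x : A (Dom C f) ==> act (set_funct C A t) f x = t f x"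
 by (simp_all add: set_funct_def act_def)

lemma set_functor_set_funct:
 assumes "category C" "!!a. a : Obj C ==> small_set (A a)"
  and t: "!!f x. f : Arr C ==> x : A (Dom C f) ==> t f x : A (Cod C f)"
  and tid: "!!a x. a : Obj C ==> x : A a ==> t (Ident C a) x = x"
  and tcomp: "!!f g x. f : Arr C ==> g : Arr C ==> Dom C g = Cod C f ==> x : A (Dom C f) ==>
   t (g $$C$$ f) x = t g (t f x)"
 shows "set_functor C (set_funct C A t)"
proof -
 interpret category C by fact
 show ?thesis
 proof unfold_locales
  show h: "farr (set_funct C A t) f : Hom Sets ((set_funct C A t)$a) ((set_funct C A t)$b)"
   if "f : Hom C a b" for f a b
  proof -
   note ab = Hom_obj[OF that] HomD[OF that]
   have "set_map (A a) (t f) (A b) : Hom Sets (A a) (A b)"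
    by (rule set_map_in_Hom) (use assms(2) t[of f] ab in auto)
   then show ?thesis using ab by simp
  qed
  show "farr (set_funct C A t) (Ident C a) = Ident Sets ((set_funct C A t)$a)"
   if a: "a : Obj C" for a
   by (rule set_arrow_eqI[OF h[OF id_in[OF a]] set_cat.id_in]) (use a assms(2) tid in auto)
  show "farr (set_funct C A t) (g $$C$$ f) = farr (set_funct C A t) g $$Sets$$ farr (set_funct C A t) f"
   if fg: "f : Hom C a b" "g : Hom C b c" for f g a b c
  proof (rule set_arrow_eqI[OF h[OF comp_in[OF fg]] set_cat.comp_in[OF h[OF fg(1)] h[OF fg(2)]]])
   fix x assume "x : (set_funct C A t)$a"
   then have "x : A a" using Hom_obj[OF fg(1)] by simp
   then show "body (farr (set_funct C A t) (g $$C$$ f)) x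
     = body (farr (set_funct C A t) g $$Sets$$ farr (set_funct C A t) f) x"
    using HomD[OF fg(1)] HomD[OF fg(2)] tcomp[of f g x] t[of f x] by simp
  qed
 qed (use assms(2) in \<open>auto simp: set_funct_def\<close>)
qed

lemma set_functor_eqI:
 assumes "set_functor C F" "set_functor C G" "!!a. a : Obj C ==> F$a = G$a"
  and "!!f x. f : Arr C ==> x : F$(Dom C f) ==> act F f x = act G f x"
 shows "F = G"
proof -
 interpret F: set_functor C F by fact
 interpret G: set_functor C G by fact
 show ?thesis
 proof (rule cat_functor_eqI[OF F.cat_functor_axioms G.cat_functor_axioms assms(3)])
  fix f assume f: "f : Arr C"
  then have ff: "f : Hom C (Dom C f) (Cod C f)" by (simp add: in_Hom)
  show "farr F f = farr G f"
   by (rule set_arrow_eqI[OF F.farr_in[OF ff]]) (use G.farr_in[OF ff] assms(3,4) f in \<open>auto simp: act_def\<close>)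
 qed auto
qed

section \<open>Functor categories\<close>

lemma functor_category_simps [simp]:
 "Obj (functor_category C D) = {F. cat_functor C D F}"
 "Dom (functor_category C D) = src" "Cod (functor_category C D) = tgt"
 by (simp_all add: functor_category_def)

lemma in_Hom_functor_category:
 "alp : Hom (functor_category C D) F G <-> src alp = F & tgt alp = G & nat_trans C D F G (body alp)"
 by (auto simp: in_Hom functor_category_def)

lemma nat_transI:
 assumes "cat_functor C D F" "cat_functor C D G" "eta : extensional (Obj C)"
  and "!!a. a : Obj C ==> eta a : Hom D (F$a) (G$a)"
  and "!!f a b. f : Hom C a b ==> eta b $$D$$ farr F f = farr G f $$D$$ eta a"
 shows "nat_trans C D F G eta"
 using assms unfolding nat_trans_def by (auto simp: in_Hom)

lemma nat_trans_in: "nat_trans C D F G eta ==> a : Obj C ==> eta a : Hom D (F$a) (G$a)"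
 by (simp add: nat_trans_def)

lemma nat_trans_natural: "nat_trans C D F G eta ==> f : Hom C a b ==> eta b $$D$$ farr F f = farr G f $$D$$ eta a"
 by (auto simp: nat_trans_def in_Hom)

lemma category_functor_category: "category (functor_category C D)"
proof unfold_locales
 fix F assume "F : Obj (functor_category C D)"
 then interpret cat_functor C D F by simp
 show "Ident (functor_category C D) F : Hom (functor_category C D) F F"
  unfolding in_Hom_functor_category
  by (auto simp: functor_category_def in_Hom intro!: nat_transI cat_functor_axioms)
next
 fix alp F G bet H
 assume alp: "alp : Hom (functor_category C D) F G" and bet: "bet : Hom (functor_category C D) G H"
 then have a: "nat_trans C D F G (body alp)" and b: "nat_trans C D G H (body bet)"
  by (simp_all add: in_Hom_functor_category)
 interpret F: cat_functor C D F using nat_transD(1)[OF a] .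
 interpret G: cat_functor C D G using nat_transD(2)[OF a] .
 interpret H: cat_functor C D H using nat_transD(2)[OF b] .
 have "nat_trans C D F H (\<lambda>x\<in>Obj C. body bet x $$D$$ body alp x)"
 proof (rule nat_transI[OF F.cat_functor_axioms H.cat_functor_axioms])
  fix x assume x: "x : Obj C"
  show "(\<lambda>x\<in>Obj C. body bet x $$D$$ body alp x) x : Hom D (F$x) (H$x)"
   using F.cod.comp_in[OF nat_trans_in[OF a x] nat_trans_in[OF b x]] x by simp
 next
  fix f x y assume f: "f : Hom C x y"
  note xy = F.dom.Hom_obj[OF f]
  note ax = nat_trans_in[OF a xy(1)] and ay = nat_trans_in[OF a xy(2)]
   and bx = nat_trans_in[OF b xy(1)] and byy = nat_trans_in[OF b xy(2)]
  have "(body bet y $$D$$ body alp y) $$D$$ farr F f = body bet y $$D$$ (body alp y $$D$$ farr F f)"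
   by (rule F.cod.assoc[OF F.farr_in[OF f] ay byy])
  also have "\<dots> = body bet y $$D$$ (farr G f $$D$$ body alp x)" by (simp only: nat_trans_natural[OF a f])
  also have "\<dots> = (body bet y $$D$$ farr G f) $$D$$ body alp x"
   by (rule F.cod.assoc[OF ax G.farr_in[OF f] byy, symmetric])
  also have "\<dots> = (farr H f $$D$$ body bet x) $$D$$ body alp x" by (simp only: nat_trans_natural[OF b f])
  also have "\<dots> = farr H f $$D$$ (body bet x $$D$$ body alp x)"
   by (rule F.cod.assoc[OF ax bx H.farr_in[OF f]])
  finally show "(\<lambda>x\<in>Obj C. body bet x $$D$$ body alp x) y $$D$$ farr F f
    = farr H f $$D$$ (\<lambda>x\<in>Obj C. body bet x $$D$$ body alp x) x"
   using xy by simp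
 qed simp
 then show "bet $$functor_category C D$$ alp : Hom (functor_category C D) F H"
  using alp bet unfolding in_Hom_functor_category by (simp add: functor_category_def)
next
 fix alp F G assume alp: "alp : Hom (functor_category C D) F G"
 then have a: "nat_trans C D F G (body alp)" and st: "src alp = F" "tgt alp = G"
  by (simp_all add: in_Hom_functor_category)
 interpret F: cat_functor C D F using nat_transD(1)[OF a] .
 have ext: "body alp : extensional (Obj C)" using a by (simp add: nat_trans_def)
 have "(\<lambda>x\<in>Obj C. (\<lambda>a\<in>Obj C. Ident D (G$a)) x $$D$$ body alp x) = body alp"
  using F.cod.id_left[OF nat_trans_in[OF a]] by (intro extensionalityI[OF _ ext]) auto
 then show "Ident (functor_category C D) G $$functor_category C D$$ alp = alp"
  using st by (cases alp) (simp add: functor_category_def)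
 have "(\<lambda>x\<in>Obj C. body alp x $$D$$ (\<lambda>a\<in>Obj C. Ident D (F$a)) x) = body alp"
  using F.cod.id_right[OF nat_trans_in[OF a]] by (intro extensionalityI[OF _ ext]) auto
 then show "alp $$functor_category C D$$ Ident (functor_category C D) F = alp"
  using st by (cases alp) (simp add: functor_category_def)
next
 fix alp F G bet H \<gamma> K
 assume "alp : Hom (functor_category C D) F G" "bet : Hom (functor_category C D) G H"
  "\<gamma> : Hom (functor_category C D) H K"
 then have a: "nat_trans C D F G (body alp)" and b: "nat_trans C D G H (body bet)"
  and c: "nat_trans C D H K (body \<gamma>)"
  by (simp_all add: in_Hom_functor_category)
 interpret F: cat_functor C D F using nat_transD(1)[OF a] .
 have "(body \<gamma> x $$D$$ body bet x) $$D$$ body alp x = body \<gamma> x $$D$$ (body bet x $$D$$ body alp x)" if "x : Obj C" for x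
  using F.cod.assoc[OF nat_trans_in[OF a that] nat_trans_in[OF b that] nat_trans_in[OF c that]] .
 then show "\<gamma> $$functor_category C D$$ bet $$functor_category C D$$ alp
   = \<gamma> $$functor_category C D$$ (bet $$functor_category C D$$ alp)"
  by (auto simp: functor_category_def fun_eq_iff restrict_def)
qed (auto simp: functor_category_def nat_trans_def)

interpretation functor_cat: category "functor_category C D" for C D
 by (rule category_functor_category)

lemma functor_category_comp:
 "a : Obj C ==> body (bet $$functor_category C D$$ alp) a = body bet a $$D$$ body alp a"
 by (simp add: functor_category_def)

lemma functor_category_ident: "a : Obj C ==> body (Ident (functor_category C D) F) a = Ident D (F$a)"
 by (simp add: functor_category_def)

lemma nat_body_in:
 "alp : Hom (functor_category C D) F G ==> a : Obj C ==> body alp a : Hom D (F$a) (G$a)"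
 by (auto simp: in_Hom_functor_category nat_trans_def)

lemma nat_functors:
 assumes "alp : Hom (set_power C) F G"
 shows "set_functor C F" "set_functor C G"
 using assms by (auto simp: in_Hom_functor_category nat_trans_def set_functor_def)

lemma app_in:
 assumes "alp : Hom (set_power C) F G" "a : Obj C" "x : F$a"
 shows "app alp a x : G$a"
 using set_arrow_in[OF nat_body_in[OF assms(1,2)] assms(3)] by (simp add: app_def)

lemma app_natural:
 assumes "alp : Hom (set_power C) F G" "f : Arr C" "x : F$(Dom C f)"
 shows "app alp (Cod C f) (act F f x) = act G f (app alp (Dom C f) x)"
proof -
 have n: "nat_trans C Sets F G (body alp)" using assms(1) by (simp add: in_Hom_functor_category)
 interpret F: set_functor C F using nat_functors[OF assms(1)] by blast
 have f: "f : Hom C (Dom C f) (Cod C f)" using assms(2) by (simp add: in_Hom)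
 have "body (body alp (Cod C f) $$Sets$$ farr F f) x = body (farr G f $$Sets$$ body alp (Dom C f)) x"
  using nat_trans_natural[OF n f] by simp
 then show ?thesis
  using set_comp_apply[OF F.farr_in[OF f] assms(3)]
   set_comp_apply[OF nat_trans_in[OF n, of "Dom C f"] assms(3)] assms(2)
  by (simp add: app_def act_def)
qed

lemma app_comp:
 assumes "alp : Hom (set_power C) F G" "a : Obj C" "x : F$a"
 shows "app (bet $$set_power C$$ alp) a x = app bet a (app alp a x)"
 using set_comp_apply[OF nat_body_in[OF assms(1,2)] assms(3)] assms(2)
 by (simp add: app_def functor_category_comp)

lemma app_ident: "a : Obj C ==> x : F$a ==> app (Ident (set_power C) F) a x = x"
 by (simp add: app_def functor_category_ident)

lemma set_nat_eqI:
 assumes "alp : Hom (set_power C) F G" "bet : Hom (set_power C) F G"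
  and "!!a x. a : Obj C ==> x : F$a ==> app alp a x = app bet a x"
 shows "alp = bet"
proof -
 have "body alp = body bet"
 proof (rule extensionalityI[of _ "Obj C"])
  fix a assume a: "a : Obj C"
  show "body alp a = body bet a"
   by (rule set_arrow_eqI[OF nat_body_in[OF assms(1) a] nat_body_in[OF assms(2) a]])
    (use assms(3) a in \<open>auto simp: app_def\<close>)
 qed (use assms in \<open>auto simp: in_Hom_functor_category nat_trans_def\<close>)
 then show ?thesis using assms(1,2) by (cases alp; cases bet) (simp add: in_Hom_functor_category)
qed

lemma app_set_nat [simp]: "a : Obj C ==> x : F$a ==> app (set_nat C F t G) a x = t a x"
 by (simp add: app_def set_nat_def)

lemma set_nat_in_Hom:
 assumes "set_functor C F" "set_functor C G"
  and t: "!!a x. a : Obj C ==> x : F$a ==> t a x : G$a"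
  and nat: "!!f x. f : Arr C ==> x : F$(Dom C f) ==> t (Cod C f) (act F f x) = act G f (t (Dom C f) x)"
 shows "set_nat C F t G : Hom (set_power C) F G"
proof -
 interpret F: set_functor C F by fact
 interpret G: set_functor C G by fact
 have tm: "set_map (F$a) (t a) (G$a) : Hom Sets (F$a) (G$a)" if "a : Obj C" for a
  using F.small[OF that] G.small[OF that] t[OF that] by (rule set_map_in_Hom)
 have "nat_trans C Sets F G (\<lambda>a\<in>Obj C. set_map (F$a) (t a) (G$a))"
 proof (rule nat_transI[OF F.cat_functor_axioms G.cat_functor_axioms])
  fix f a b assume f: "f : Hom C a b"
  note ab = F.dom.Hom_obj[OF f] and f' = HomD[OF f]
  have "set_map (F$b) (t b) (G$b) $$Sets$$ farr F f
    = farr G f $$Sets$$ set_map (F$a) (t a) (G$a)"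
  proof (rule set_arrow_eqI[OF set_cat.comp_in[OF F.farr_in[OF f] tm[OF ab(2)]]
      set_cat.comp_in[OF tm[OF ab(1)] G.farr_in[OF f]]])
   fix x assume x: "x : F$a"
   have "body (farr F f) x : F$b" using set_arrow_in[OF F.farr_in[OF f] x] .
   then show "body (set_map (F$b) (t b) (G$b) $$Sets$$ farr F f) x
    = body (farr G f $$Sets$$ set_map (F$a) (t a) (G$a)) x"
    using set_comp_apply[OF F.farr_in[OF f] x] set_comp_apply[OF tm[OF ab(1)] x] nat[of f x] f' x
    by (simp add: act_def)
  qed
  then show "(\<lambda>a\<in>Obj C. set_map (F$a) (t a) (G$a)) b $$Sets$$ farr F f
    = farr G f $$Sets$$ (\<lambda>a\<in>Obj C. set_map (F$a) (t a) (G$a)) a"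
   using ab by simp
 qed (use tm in auto)
 then show ?thesis by (simp add: in_Hom_functor_category set_nat_def)
qed

lemma is_iso_set_power_iff:
 assumes alp: "alp : Hom (set_power C) F G"
 shows "is_iso (set_power C) alp <-> (ALL a:Obj C. bij_betw (app alp a) (F$a) (G$a))"
proof
 assume "is_iso (set_power C) alp"
 then obtain bet where bet: "bet : Hom (set_power C) G F" "bet $$set_power C$$ alp = Ident (set_power C) F"
   "alp $$set_power C$$ bet = Ident (set_power C) G"
  using functor_cat.is_isoE alp by blast
 show "ALL a:Obj C. bij_betw (app alp a) (F$a) (G$a)"
 proof
  fix a assume a: "a : Obj C"
  show "bij_betw (app alp a) (F$a) (G$a)"
  proof (rule bij_betw_byWitness[of _ "app bet a"])
   show "ALL x:fobj F a. app bet a (app alp a x) = x"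
    using app_comp[OF alp a, of _ bet] bet(2) app_ident[OF a] by metis
   show "ALL x:fobj G a. app alp a (app bet a x) = x"
    using app_comp[OF bet(1) a, of _ alp] bet(3) app_ident[OF a] by metis
  qed (use app_in[OF alp a] app_in[OF bet(1) a] in auto)
 qed
next
 assume bij: "ALL a:Obj C. bij_betw (app alp a) (F$a) (G$a)"
 interpret F: set_functor C F using nat_functors[OF alp] by blast
 interpret G: set_functor C G using nat_functors[OF alp] by blast
 define s where "s a = inv_into (F$a) (app alp a)" for a
 have s1: "s a x : F$a" "app alp a (s a x) = x" if "a : Obj C" "x : G$a" for a x
  using bij that unfolding s_def bij_betw_def by (auto intro: inv_into_into f_inv_into_f)
 have s2: "s a (app alp a x) = x" if "a : Obj C" "x : F$a" for a x
  using bij that unfolding s_def bij_betw_def by auto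
 let ?bet = "set_nat C G s F"
 have bet: "?bet : Hom (set_power C) G F"
 proof (rule set_nat_in_Hom)
  fix f x assume f: "f : Arr C" and x: "x : G$(Dom C f)"
  let ?y = "s (Dom C f) x"
  have y: "?y : F$(Dom C f)" "app alp (Dom C f) ?y = x" using s1 f x by auto
  have "s (Cod C f) (act G f x) = s (Cod C f) (app alp (Cod C f) (act F f ?y))"
   using app_natural[OF alp f y(1)] y(2) by simp
  also have "\<dots> = act F f ?y" using s2 F.act_in[OF f y(1)] f by simp
  finally show "s (Cod C f) (act G f x) = act F f ?y" .
 qed (use s1 F.set_functor_axioms G.set_functor_axioms in auto)
 show "is_iso (set_power C) alp"
 proof (rule functor_cat.is_isoI[OF alp bet])
  have FO: "F : Obj (set_power C)" "G : Obj (set_power C)"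
   using F.cat_functor_axioms G.cat_functor_axioms by auto
  show "?bet $$set_power C$$ alp = Ident (set_power C) F"
   by (rule set_nat_eqI[OF functor_cat.comp_in[OF alp bet] functor_cat.id_in[OF FO(1)]])
    (simp add: app_comp[OF alp] app_ident app_in[OF alp] s2)
  show "alp $$set_power C$$ ?bet = Ident (set_power C) G"
   by (rule set_nat_eqI[OF functor_cat.comp_in[OF bet alp] functor_cat.id_in[OF FO(2)]])
    (simp add: app_comp[OF bet] app_ident s1)
 qed
qed

section \<open>Limits of sets\<close>

definition compatible_family ::
 "('j, 'k) category => ('j => 'u set) => ('k => 'u => 'u) => ('j => 'u) => bool" where
 "compatible_family J A t x <-> (ALL j:Obj J. x j : A j) & (ALL k:Arr J. t k (x (Dom J k)) = x (Cod J k))"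

definition elementwise_limit ::
 "('j, 'k) category => ('j => 'u set) => ('k => 'u => 'u) => 'u set => ('j => 'u => 'u) => bool" where
 "elementwise_limit J A t c p <->
  (ALL x. compatible_family J A t x --> (EX! z. z : c & (ALL j:Obj J. p j z = x j)))"

lemma set_limitI:
 assumes D: "cat_functor J Sets D" and cone: "is_cone J Sets D c p"
  and elem: "elementwise_limit J (fobj D) (act D) c (%j. body (p j))"
 shows "is_limit J Sets D c p"
 unfolding is_limit_def
proof (intro conjI allI impI cone)
 interpret D: set_functor J D using D by (simp add: set_functor_def)
 fix x q assume "is_cone J Sets D x q"
 then have x: "small_set x" and q: "!!j. j : Obj J ==> q j : Hom Sets x (D$j)"
  and qn: "!!k. k : Arr J ==> farr D k $$Sets$$ q (Dom J k) = q (Cod J k)"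
  by (auto simp: is_cone_def)
 have c: "small_set c" and p: "!!j. j : Obj J ==> p j : Hom Sets c (D$j)"
  using cone by (auto simp: is_cone_def)
 have "compatible_family J (fobj D) (act D) (%j. body (q j) s)" if s: "s : x" for s
  unfolding compatible_family_def
 proof (intro conjI ballI)
  show "body (q j) s : D$j" if "j : Obj J" for j using set_arrow_in[OF q[OF that] s] .
  fix k assume k: "k : Arr J"
  then have d: "Dom J k : Obj J" by simp
  show "act D k (body (q (Dom J k)) s) = body (q (Cod J k)) s"
   using set_comp_apply[OF q[OF d] s, of "farr D k"] qn[OF k] by (simp add: act_def)
 qed
 then have ex: "EX! z. z : c & (ALL j:Obj J. body (p j) z = body (q j) s)" if "s : x" for s
  using elem that unfolding elementwise_limit_def by blast
 define u where "u s = (THE z. z : c & (ALL j:Obj J. body (p j) z = body (q j) s))" for s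
 have u: "u s : c" "!!j. j : Obj J ==> body (p j) (u s) = body (q j) s" if "s : x" for s
  using theI'[OF ex[OF that]] unfolding u_def by auto
 have uH: "set_map x u c : Hom Sets x c" by (rule set_map_in_Hom[OF x c u(1)])
 show "EX! v. v : Hom Sets x c & (ALL j:Obj J. p j $$Sets$$ v = q j)"
 proof (rule ex1I[of _ "set_map x u c"])
  have "p j $$Sets$$ set_map x u c = q j" if j: "j : Obj J" for j
   by (rule set_arrow_eqI[OF set_comp_in[OF uH p[OF j]] q[OF j]])
    (simp add: set_comp_apply[OF uH] u j)
  then show "set_map x u c : Hom Sets x c & (ALL j:Obj J. p j $$Sets$$ set_map x u c = q j)"
   using uH by blast
 next
  fix v assume v: "v : Hom Sets x c & (ALL j:Obj J. p j $$Sets$$ v = q j)"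
  then have vH: "v : Hom Sets x c" by blast
  show "v = set_map x u c"
  proof (rule set_arrow_eqI[OF vH uH])
   fix s assume s: "s : x"
   have "body (p j) (body v s) = body (q j) s" if "j : Obj J" for j
    using set_comp_apply[OF vH s, of "p j"] v that by simp
   then have "body v s = u s" using ex[OF s] u[OF s] set_arrow_in[OF vH s] by blast
   then show "body v s = body (set_map x u c) s" using s by simp
  qed
 qed
qed

text \<open>Limits in a functor category may be computed pointwise.\<close>

lemma power_limitI:
 assumes D: "cat_functor J (set_power C) D" and cone: "is_cone J (set_power C) D c p"
  and elem: "!!a. a : Obj C ==> elementwise_limit J (%j. D$j$a) (%k. app (farr D k) a)
   (c$a) (%j. app (p j) a)"
 shows "is_limit J (set_power C) D c p"
 unfolding is_limit_def
proof (intro conjI allI impI cone)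
 interpret D: cat_functor J "set_power C" D by fact
 fix x q assume "is_cone J (set_power C) D x q"
 then have x: "cat_functor C Sets x" and q: "!!j. j : Obj J ==> q j : Hom (set_power C) x (D$j)"
  and qn: "!!k. k : Arr J ==> farr D k $$set_power C$$ q (Dom J k) = q (Cod J k)"
  by (auto simp: is_cone_def)
 have c: "cat_functor C Sets c" and p: "!!j. j : Obj J ==> p j : Hom (set_power C) c (D$j)"
  using cone by (auto simp: is_cone_def)
 interpret x: set_functor C x using x by (simp add: set_functor_def)
 interpret c: set_functor C c using c by (simp add: set_functor_def)
 have "compatible_family J (%j. D$j$a) (%k. app (farr D k) a) (%j. app (q j) a s)"
  if a: "a : Obj C" and s: "s : x$a" for a s
  unfolding compatible_family_def
 proof (intro conjI ballI)
  show "app (q j) a s : D$j$a" if "j : Obj J" for j using app_in[OF q[OF that] a s] .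
  fix k assume k: "k : Arr J"
  then have d: "Dom J k : Obj J" by simp
  show "app (farr D k) a (app (q (Dom J k)) a s) = app (q (Cod J k)) a s"
   using app_comp[OF q[OF d] a s, of "farr D k"] qn[OF k] by simp
 qed
 then have ex: "EX! z. z : c$a & (ALL j:Obj J. app (p j) a z = app (q j) a s)"
  if "a : Obj C" "s : x$a" for a s
  using elem that unfolding elementwise_limit_def by blast
 define u where "u a s = (THE z. z : c$a & (ALL j:Obj J. app (p j) a z = app (q j) a s))" for a s
 have u: "u a s : c$a" "!!j. j : Obj J ==> app (p j) a (u a s) = app (q j) a s"
  if "a : Obj C" "s : x$a" for a s
  using theI'[OF ex[OF that]] unfolding u_def by auto
 have uH: "set_nat C x u c : Hom (set_power C) x c"
 proof (rule set_nat_in_Hom[OF x.set_functor_axioms c.set_functor_axioms u(1)])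
  fix f s assume f: "f : Arr C" and s: "s : x$(Dom C f)"
  have s': "act x f s : x$(Cod C f)" using x.act_in[OF f s] .
  have ab: "Dom C f : Obj C" "Cod C f : Obj C" using f by auto
  have "app (p j) (Cod C f) (act c f (u (Dom C f) s)) = app (q j) (Cod C f) (act x f s)" if j: "j : Obj J" for j
   using app_natural[OF p[OF j] f u(1)[OF ab(1) s]] app_natural[OF q[OF j] f s] u(2)[OF ab(1) s j] by simp
  moreover have "act c f (u (Dom C f) s) : c$(Cod C f)" using c.act_in[OF f u(1)[OF ab(1) s]] .
  ultimately show "u (Cod C f) (act x f s) = act c f (u (Dom C f) s)"
   using ex[OF ab(2) s'] u[OF ab(2) s'] by blast
 qed
 show "EX! v. v : Hom (set_power C) x c & (ALL j:Obj J. p j $$set_power C$$ v = q j)"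
 proof (rule ex1I[of _ "set_nat C x u c"])
  have "p j $$set_power C$$ set_nat C x u c = q j" if j: "j : Obj J" for j
   by (rule set_nat_eqI[OF functor_cat.comp_in[OF uH p[OF j]] q[OF j]])
    (simp add: app_comp[OF uH] u j)
  then show "set_nat C x u c : Hom (set_power C) x c & (ALL j:Obj J. p j $$set_power C$$ set_nat C x u c = q j)"
   using uH by blast
 next
  fix v assume v: "v : Hom (set_power C) x c & (ALL j:Obj J. p j $$set_power C$$ v = q j)"
  then have vH: "v : Hom (set_power C) x c" by blast
  show "v = set_nat C x u c"
  proof (rule set_nat_eqI[OF vH uH])
   fix a s assume a: "a : Obj C" and s: "s : x$a"
   have "app (p j) a (app v a s) = app (q j) a s" if "j : Obj J" for j
    using app_comp[OF vH a s, of "p j"] v that by simp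
   then have "app v a s = u a s" using ex[OF a s] u[OF a s] app_in[OF vH a s] by blast
   then show "app v a s = app (set_nat C x u c) a s" using a s by simp
  qed
 qed
qed

context universe
begin

lemma small_singleton: "small_set {a :: 'u}"
 by (simp add: small_set_tiny tiny_finite)

text \<open>The elements of a set are the maps from a singleton.\<close>

lemma set_limitD:
 fixes D :: "('j, 'k, 'u) set_funct"
 assumes D: "cat_functor J Sets D" and lim: "is_limit J Sets D c p"
 shows "elementwise_limit J (fobj D) (act D) c (%j. body (p j))"
 unfolding elementwise_limit_def
proof (intro allI impI)
 interpret D: set_functor J D using D by (simp add: set_functor_def)
 fix x assume x: "compatible_family J (fobj D) (act D) x"
 let ?S = "{undefined :: 'u}"
 have c: "small_set c" and p: "!!j. j : Obj J ==> p j : Hom Sets c (D$j)"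
  using lim by (auto simp: is_limit_def is_cone_def)
 define q where "q j = set_map ?S (%_. x j) (D$j)" for j
 have q: "q j : Hom Sets ?S (D$j)" if "j : Obj J" for j
  unfolding q_def by (rule set_map_in_Hom[OF small_singleton D.small[OF that]])
   (use x that in \<open>auto simp: compatible_family_def\<close>)
 have "is_cone J Sets D ?S q"
  unfolding is_cone_def
 proof (intro conjI ballI q)
  fix k assume k: "k : Arr J"
  then have Dk: "farr D k : Hom Sets (D$(Dom J k)) (D$(Cod J k))"
   and d: "Dom J k : Obj J" "Cod J k : Obj J" by (rule D.farr_Hom, simp_all)
  show "farr D k $$Sets$$ q (Dom J k) = q (Cod J k)"
   by (rule set_arrow_eqI[OF set_comp_in[OF q[OF d(1)] Dk] q[OF d(2)]])
    (use x k in \<open>auto simp: set_comp_apply[OF q[OF d(1)]] q_def compatible_family_def act_def\<close>)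
 qed (simp add: small_singleton)
 from limit_factor[OF lim this] obtain u where u: "u : Hom Sets ?S c"
   "!!j. j : Obj J ==> p j $$Sets$$ u = q j"
   and uu: "!!v. v : Hom Sets ?S c ==> (ALL j:Obj J. p j $$Sets$$ v = q j) ==> v = u"
  by blast
 show "EX! z. z : c & (ALL j:Obj J. body (p j) z = x j)"
 proof (rule ex1I[of _ "body u undefined"])
  have "body (p j) (body u undefined) = x j" if "j : Obj J" for j
   using set_comp_apply[OF u(1), of undefined "p j"] u(2)[OF that] by (simp add: q_def)
  then show "body u undefined : c & (ALL j:Obj J. body (p j) (body u undefined) = x j)"
   using set_arrow_in[OF u(1)] by blast
 next
  fix z assume z: "z : c & (ALL j:Obj J. body (p j) z = x j)"
  let ?v = "set_map ?S (%_. z) c"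
  have v: "?v : Hom Sets ?S c" by (rule set_map_in_Hom[OF small_singleton c]) (use z in auto)
  have "p j $$Sets$$ ?v = q j" if j: "j : Obj J" for j
   by (rule set_arrow_eqI[OF set_comp_in[OF v p[OF j]] q[OF j]])
    (use z j in \<open>auto simp: set_comp_apply[OF v] q_def\<close>)
  then have "?v = u" using uu[OF v] by blast
  then have "body ?v undefined = body u undefined" by (rule arg_cong)
  then show "z = body u undefined" by simp
 qed
qed

text \<open>
 Otherwise the constant map and a map distinguishing the joint image would be two different
 factorizations of the same cocone.
\<close>

lemma set_colimit_jointly_surjective:
 fixes D :: "('j, 'k, 'u) set_funct"
 assumes D: "cat_functor J Sets D" and colim: "is_colimit J Sets D c i" and z: "z : c"
 shows "EX j:Obj J. EX x:fobj D j. body (i j) x = z"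
proof -
 interpret D: set_functor J D using D by (simp add: set_functor_def)
 have c: "small_set c" and i: "!!j. j : Obj J ==> i j : Hom Sets (D$j) c"
  and i_n: "!!k. k : Arr J ==> i (Cod J k) $$Sets$$ farr D k = i (Dom J k)"
  using colim by (auto simp: is_colimit_def is_cocone_def)
 obtain a b :: 'u where ab: "a \<noteq> b" using two_elements .
 let ?im = "{z. EX j:Obj J. EX x:fobj D j. body (i j) x = z}"
 let ?v = "set_map c (%_. a) {a, b}" and ?w = "set_map c (%z. if z : ?im then a else b) {a, b}"
 have v: "?v : Hom Sets c {a, b}" and w: "?w : Hom Sets c {a, b}"
  by (rule set_map_in_Hom[OF c small_Pair_set]; simp)+
 have Dk: "farr D k : Hom Sets (D$(Dom J k)) (D$(Cod J k))" if "k : Arr J" for k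
  using that by (rule D.farr_Hom)
 have cocone: "is_cocone J Sets D {a, b} (%j. ?v $$Sets$$ i j)"
  unfolding is_cocone_def
 proof (intro conjI ballI)
  fix k assume k: "k : Arr J"
  then have "Cod J k : Obj J" by simp
  then show "(?v $$Sets$$ i (Cod J k)) $$Sets$$ farr D k = ?v $$Sets$$ i (Dom J k)"
   using set_cat.assoc[OF Dk[OF k] i v] i_n[OF k] by simp
 qed (use set_comp_in[OF i v] small_Pair_set in auto)
 have "?v $$Sets$$ i j = ?w $$Sets$$ i j" if j: "j : Obj J" for j
  by (rule set_arrow_eqI[OF set_comp_in[OF i[OF j] v] set_comp_in[OF i[OF j] w]])
   (use j set_arrow_in[OF i[OF j]] in \<open>auto simp: set_comp_apply[OF i[OF j]]\<close>)
 then have "ALL j:Obj J. ?w $$Sets$$ i j = ?v $$Sets$$ i j" by simp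
 then have "?v = ?w"
  using colim cocone v w unfolding is_colimit_def by blast
 then have "body ?v z = body ?w z" by (rule arg_cong)
 then have "z : ?im" using z ab by (auto split: if_splits)
 then show ?thesis by blast
qed

end

section \<open>Directed colimits of sets\<close>

lemma directed_posetD:
 assumes "directed_poset P r"
 shows "r \<subseteq> P \<times> P" "!!x. x : P ==> (x, x) : r" "!!x y z. (x, y) : r ==> (y, z) : r ==> (x, z) : r"
  "P \<noteq> {}" "!!x y. x : P ==> y : P ==> EX z:P. (x, z) : r & (y, z) : r"
proof -
 have "refl_on P r" "trans r" "r \<subseteq> P \<times> P"
  using assms by (auto simp: directed_poset_def dest: partial_order_onD)
 then show "r \<subseteq> P \<times> P" "!!x. x : P ==> (x, x) : r" "!!x y z. (x, y) : r ==> (y, z) : r ==> (x, z) : r"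
  by (auto dest: refl_onD transD)
qed (use assms in \<open>simp_all add: directed_poset_def\<close>)

lemma poset_category_simps [simp]:
 "Obj (poset_category P r) = P" "Arr (poset_category P r) = r" "Dom (poset_category P r) = fst"
 "Cod (poset_category P r) = snd" "Ident (poset_category P r) x = (x, x)"
 "g $$poset_category P r$$ f = (fst f, snd g)"
 by (simp_all add: poset_category_def)

lemma category_poset_category: "directed_poset P r ==> category (poset_category P r)"
proof -
 assume "directed_poset P r"
 note d = directed_posetD[OF this]
 show ?thesis
  by unfold_locales (use d(1,2) in \<open>auto simp: in_Hom intro: d(3)\<close>)
qed

lemma directed_finite_bound:
 assumes "directed_poset P r" "finite M" "M \<subseteq> P"
 shows "EX z:P. ALL m:M. (m, z) : r"
 using assms(2,3)
proof (induction M)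
 case empty
 then show ?case using directed_posetD(4)[OF assms(1)] by blast
next
 case (insert m M)
 then obtain z where z: "z : P" "ALL m:M. (m, z) : r" by blast
 obtain w where "w : P" "(m, w) : r" "(z, w) : r"
  using directed_posetD(5)[OF assms(1), of m z] insert z by blast
 then show ?case using z directed_posetD(3)[OF assms(1)] by blast
qed

definition elementwise_colimit ::
 "'u set => 'u rel => ('u => 'v set) => ('u \<times> 'u => 'v => 'v) => 'v set => ('u => 'v => 'v) => bool" where
 "elementwise_colimit P r A t c i <->
  (ALL z:c. EX l:P. EX x:A l. i l x = z) \<and>
  (ALL l:P. ALL x:A l. ALL y:A l. i l x = i l y --> (EX m. (l, m) : r & t (l, m) x = t (l, m) y))"

definition colimit_desc ::
 "'u set => ('u => 'v set) => ('u => 'v => 'v) => ('u => 'v => 'w) => 'v => 'w" where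
 "colimit_desc P A i k z = (SOME w. EX l:P. EX x:A l. i l x = z & w = k l x)"

locale directed_sets =
 fixes P :: "'u set" and r :: "'u rel" and A :: "'u => 'v set" and t :: "'u \<times> 'u => 'v => 'v"
 assumes directed: "directed_poset P r"
  and t_in: "(l, m) : r ==> x : A l ==> t (l, m) x : A m"
  and t_id: "l : P ==> x : A l ==> t (l, l) x = x"
  and t_comp: "(l, m) : r ==> (m, n) : r ==> x : A l ==> t (l, n) x = t (m, n) (t (l, m) x)"
begin

lemmas dirD = directed_posetD[OF directed]

lemma in_P: "(l, m) : r ==> l : P" "(l, m) : r ==> m : P"
 using dirD(1) by auto

lemma equal_later:
 assumes ec: "elementwise_colimit P r A t c i"
  and cocone: "!!l m x. (l, m) : r ==> x : A l ==> i m (t (l, m) x) = i l x"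
  and x: "l : P" "x : A l" and y: "m : P" "y : A m" and eq: "i l x = i m y"
 shows "EX n. (l, n) : r & (m, n) : r & t (l, n) x = t (m, n) y"
proof -
 obtain n where n: "(l, n) : r" "(m, n) : r" using dirD(5)[OF x(1) y(1)] by blast
 have "i n (t (l, n) x) = i n (t (m, n) y)" using cocone n x y eq by simp
 then obtain n' where n': "(n, n') : r" "t (n, n') (t (l, n) x) = t (n, n') (t (m, n) y)"
  using ec t_in n x y in_P unfolding elementwise_colimit_def by blast
 then show ?thesis using t_comp[OF n(1) n'(1) x(2)] t_comp[OF n(2) n'(1) y(2)] n dirD(3) by metis
qed

lemma colimit_desc:
 assumes ec: "elementwise_colimit P r A t c i"
  and cocone: "!!l m x. (l, m) : r ==> x : A l ==> i m (t (l, m) x) = i l x"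
  and k: "!!l m x. (l, m) : r ==> x : A l ==> k m (t (l, m) x) = k l x"
  and x: "l : P" "x : A l"
 shows "colimit_desc P A i k (i l x) = k l x"
 unfolding colimit_desc_def
proof (rule some_equality)
 fix w assume "EX m:P. EX y:A m. i m y = i l x & w = k m y"
 then obtain m y where y: "m : P" "y : A m" "i m y = i l x" "w = k m y" by blast
 obtain n where "(l, n) : r" "(m, n) : r" "t (l, n) x = t (m, n) y"
  using equal_later[OF ec cocone x y(1,2)] y(3) by metis
 then show "w = k l x" using k[of l n x] k[of m n y] x y by simp
qed (use x in blast)

end

context universe
begin

lemma directed_colimit_exists:
 assumes "directed_sets P r A (t :: 'u \<times> 'u => 'u => 'u)" and P: "small_set P"
  and A: "!!l. l : P ==> small_set (A l)"
 shows "EX c i. small_set c & (ALL l:P. ALL x:A l. i l x : c) \<and>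
  (ALL l m x. (l, m) : r --> x : A l --> i m (t (l, m) x) = i l x) & elementwise_colimit P r A t c i"
proof -
 interpret directed_sets P r A t by fact
 define cls where "cls l x = {(m, y). m : P & y : A m & (EX n. (l, n) : r & (m, n) : r & t (l, n) x = t (m, n) y)}"
  for l x
 have "tiny (Pow (Sigma P A))"
  by (intro tiny_Pow tiny_Sigma) (use P A in \<open>auto simp: small_set_tiny\<close>)
 then obtain e :: "('u \<times> 'u) set => 'u" where e: "inj_on e (Pow (Sigma P A))" "small_set (e ` Pow (Sigma P A))"
  using encode by blast
 have cls_sub: "cls l x : Pow (Sigma P A)" for l x by (auto simp: cls_def)
 have push: "cls l x \<subseteq> cls l' x'"
  if l: "l : P" "x : A l" "l' : P" "x' : A l'" and n: "(l, n) : r" "(l', n) : r" "t (l, n) x = t (l', n) x'"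
  for l x l' x' n
 proof (clarsimp simp: cls_def)
  fix m y n' assume m: "m : P" "y : A m" "(l, n') : r" "(m, n') : r" "t (l, n') x = t (m, n') y"
  obtain k where k: "(n, k) : r" "(n', k) : r" using dirD(5)[of n n'] in_P n m by blast
  have "t (l', k) x' = t (n, k) (t (l, n) x)" using t_comp[OF n(2) k(1) l(4)] n(3) by simp
  also have "\<dots> = t (n', k) (t (l, n') x)" using t_comp[OF n(1) k(1) l(2)] t_comp[OF m(3) k(2) l(2)] by simp
  also have "\<dots> = t (m, k) y" using t_comp[OF m(4) k(2) m(2)] m(5) by simp
  finally show "EX n. (l', n) : r & (m, n) : r & t (l', n) x' = t (m, n) y"
   using n k m dirD(3) by blast
 qed
 have cls_eqI: "cls l x = cls l' x'"
  if l: "l : P" "x : A l" "l' : P" "x' : A l'" and n: "(l, n) : r" "(l', n) : r" "t (l, n) x = t (l', n) x'"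
  for l x l' x' n
  using push[OF l n] push[OF l(3,4,1,2) n(2,1) n(3)[symmetric]] by blast
 define i where "i l x = e (cls l x)" for l x
 define c where "c = {i l x | l x. l : P & x : A l}"
 have "c \<subseteq> e ` Pow (Sigma P A)" unfolding c_def i_def using cls_sub by auto
 then have c: "small_set c" using e(2) tiny_subset small_set_tiny by blast
 have cocone: "i m (t (l, m) x) = i l x" if "(l, m) : r" "x : A l" for l m x
 proof -
  have "cls m (t (l, m) x) = cls l x"
   by (rule cls_eqI[of _ _ _ _ m]) (use that in_P t_in dirD(2) t_id in auto)
  then show ?thesis by (simp add: i_def)
 qed
 have "EX m. (l, m) : r & t (l, m) x = t (l, m) y" if l: "l : P" "x : A l" "y : A l" "i l x = i l y" for l x y
 proof -
  have "cls l x = cls l y" using l(4) e(1) cls_sub unfolding i_def by (meson inj_onD)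
  moreover have "(l, y) : cls l y" using l dirD(2) by (auto simp: cls_def)
  ultimately have "(l, y) : cls l x" by simp
  then show ?thesis unfolding cls_def by blast
 qed
 then have "elementwise_colimit P r A t c i"
  unfolding elementwise_colimit_def c_def by blast
 then show ?thesis using c cocone by (intro exI[of _ c] exI[of _ i]) (auto simp: c_def)
qed

lemma directed_sets_of_functor:
 fixes D :: "('u, 'u \<times> 'u, 'u) set_funct"
 assumes dir: "directed_poset P r" and D: "cat_functor (poset_category P r) Sets D"
 shows "directed_sets P r (fobj D) (act D)"
proof -
 interpret D: set_functor "poset_category P r" D using D by (simp add: set_functor_def)
 note d = directed_posetD[OF dir]
 show ?thesis
 proof (unfold_locales, rule dir)
  show "act D (l, m) x : D$m" if "(l, m) : r" "x : D$l" for l m x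
   using D.act_in[of "(l, m)" x] that by simp
  show "act D (l, l) x = x" if "l : P" "x : D$l" for l x
   using D.act_id[of l x] that by simp
  show "act D (l, n) x = act D (m, n) (act D (l, m) x)" if "(l, m) : r" "(m, n) : r" "x : D$l" for l m n x
   using D.act_comp[of "(l, m)" "(m, n)" x] that by simp
 qed
qed

lemma set_directed_colimitI:
 fixes D :: "('u, 'u \<times> 'u, 'u) set_funct"
 assumes dir: "directed_poset P r" and D: "cat_functor (poset_category P r) Sets D"
  and cocone: "is_cocone (poset_category P r) Sets D c i"
  and elem: "elementwise_colimit P r (fobj D) (act D) c (%l. body (i l))"
 shows "is_colimit (poset_category P r) Sets D c i"
 unfolding is_colimit_def
proof (intro conjI allI impI cocone)
 interpret D: set_functor "poset_category P r" D using D by (simp add: set_functor_def)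
 interpret directed_sets P r "fobj D" "act D" by (rule directed_sets_of_functor[OF dir D])
 have elts: "!!l m x. (l, m) : r ==> x : D$l ==> body (j m) (act D (l, m) x) = body (j l) x"
  if "is_cocone (poset_category P r) Sets D x j" for x j
 proof -
  fix l m y assume lm: "(l, m) : r" and y: "y : D$l"
  have Dk: "farr D (l, m) : Hom Sets (D$l) (D$m)"
   using D.farr_in[of "(l, m)" l m] lm by (simp add: in_Hom)
  have "j m $$Sets$$ farr D (l, m) = j l" using that lm by (force simp: is_cocone_def)
  then show "body (j m) (act D (l, m) y) = body (j l) y"
   using set_comp_apply[OF Dk y, of "j m"] by (simp add: act_def)
 qed
 have c: "small_set c" and i: "!!l. l : P ==> i l : Hom Sets (D$l) c"
  using cocone by (auto simp: is_cocone_def)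
 fix x q assume qc: "is_cocone (poset_category P r) Sets D x q"
 then have x: "small_set x" and q: "!!l. l : P ==> q l : Hom Sets (D$l) x"
  by (auto simp: is_cocone_def)
 define u where "u = colimit_desc P (fobj D) (%l. body (i l)) (%l. body (q l))"
 have u: "u (body (i l) s) = body (q l) s" if "l : P" "s : D$l" for l s
  unfolding u_def by (rule colimit_desc[OF elem elts[OF cocone] elts[OF qc] that])
 have surj: "EX l:P. EX s:fobj D l. body (i l) s = z" if "z : c" for z
  using elem that by (auto simp: elementwise_colimit_def)
 have u_in: "u z : x" if z: "z : c" for z
 proof -
  obtain l s where ls: "l : P" "s : D$l" "body (i l) s = z" using surj[OF z] by blast
  then show ?thesis using u[OF ls(1,2)] set_arrow_in[OF q ls(2)] by simp
 qed
 have uH: "set_map c u x : Hom Sets c x"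
  by (rule set_map_in_Hom[OF c x u_in])
 show "EX! v. v : Hom Sets c x & (ALL l:Obj (poset_category P r). v $$Sets$$ i l = q l)"
 proof (rule ex1I[of _ "set_map c u x"])
  have "set_map c u x $$Sets$$ i l = q l" if l: "l : P" for l
   by (rule set_arrow_eqI[OF set_comp_in[OF i[OF l] uH] q[OF l]])
    (simp add: set_comp_apply[OF i[OF l]] set_arrow_in[OF i[OF l]] u l)
  then show "set_map c u x : Hom Sets c x & (ALL l:Obj (poset_category P r). set_map c u x $$Sets$$ i l = q l)"
   using uH by simp
 next
  fix v assume v: "v : Hom Sets c x & (ALL l:Obj (poset_category P r). v $$Sets$$ i l = q l)"
  then have vH: "v : Hom Sets c x" by blast
  show "v = set_map c u x"
  proof (rule set_arrow_eqI[OF vH uH])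
   fix z assume z: "z : c"
   then obtain l s where ls: "l : P" "s : D$l" "body (i l) s = z" using surj by blast
   then have "body v z = body (q l) s" using set_comp_apply[OF i[OF ls(1)] ls(2), of v] v by simp
   then show "body v z = body (set_map c u x) z" using u[OF ls(1,2)] ls z by simp
  qed
 qed
qed

lemma set_directed_colimitD:
 fixes D :: "('u, 'u \<times> 'u, 'u) set_funct"
 assumes P: "small_set P" and dir: "directed_poset P r"
  and D: "cat_functor (poset_category P r) Sets D"
  and colim: "is_colimit (poset_category P r) Sets D c i"
 shows "elementwise_colimit P r (fobj D) (act D) c (%l. body (i l))"
proof -
 interpret D: set_functor "poset_category P r" D using D by (simp add: set_functor_def)
 interpret directed_sets P r "fobj D" "act D" by (rule directed_sets_of_functor[OF dir D])
 obtain c' i' where c': "small_set c'" and i': "!!l x. l : P ==> x : D$l ==> i' l x : c'"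
   and coc: "!!l m x. (l, m) : r ==> x : D$l ==> i' m (act D (l, m) x) = i' l x"
   and ec: "elementwise_colimit P r (fobj D) (act D) c' i'"
  using directed_colimit_exists[OF directed_sets_axioms P] D.small by (auto; metis)
 let ?j = "%l. set_map (D$l) (i' l) c'"
 have jH: "?j l : Hom Sets (D$l) c'" if "l : P" for l
  by (rule set_map_in_Hom) (use D.small c' i' that in auto)
 have "is_cocone (poset_category P r) Sets D c' ?j"
  unfolding is_cocone_def
 proof (intro conjI ballI)
  fix k assume k: "k : Arr (poset_category P r)"
  obtain l m where lm: "k = (l, m)" by (cases k)
  have r: "(l, m) : r" using k lm by simp
  have Dk: "farr D (l, m) : Hom Sets (D$l) (D$m)"
   using D.farr_in[of "(l, m)" l m] r by (simp add: in_Hom)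
  have "?j m $$Sets$$ farr D (l, m) = ?j l"
   by (rule set_arrow_eqI[OF set_comp_in[OF Dk jH] jH])
    (use in_P[OF r] coc[OF r] set_arrow_in[OF Dk] in \<open>auto simp: set_comp_apply[OF Dk] act_def\<close>)
  then show "?j (Cod (poset_category P r) k) $$Sets$$ farr D k = ?j (Dom (poset_category P r) k)"
   using lm by simp
 qed (use c' jH in auto)
 from colimit_factor[OF colim this] obtain u where u: "u : Hom Sets c c'"
   "!!l. l : P ==> u $$Sets$$ i l = ?j l"
  unfolding poset_category_simps by blast
 have i: "!!l. l : P ==> i l : Hom Sets (D$l) c"
  using colim by (auto simp: is_colimit_def is_cocone_def)
 have "EX m. (l, m) : r & act D (l, m) x = act D (l, m) y"
  if l: "l : P" "x : D$l" "y : D$l" "body (i l) x = body (i l) y" for l x y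
 proof -
  have "i' l x = i' l y"
   using set_comp_apply[OF i[OF l(1)] l(2), of u] set_comp_apply[OF i[OF l(1)] l(3), of u] u(2)[OF l(1)] l
   by simp
  then show ?thesis using ec l unfolding elementwise_colimit_def by blast
 qed
 then show ?thesis
  unfolding elementwise_colimit_def using set_colimit_jointly_surjective[OF D colim] by auto
qed

end

section \<open>Directed colimits of points\<close>

lemma points_simps [simp]:
 "Obj (points U E) = {p. cat_functor E Sets p & cocontinuous U E Sets p \<and>
  left_exact E Sets p}"
 "Dom (points U E) = src" "Cod (points U E) = tgt"
 "Ident (points U E) = Ident (set_power E)" "Comp (points U E) = Comp (set_power E)"
 by (auto simp: points_def)

lemma Hom_points:
 "p : Obj (points U E) ==> q : Obj (points U E) ==> Hom (points U E) p q = Hom (set_power E) p q"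
 by (simp add: points_def)

lemma Hom_pointsD: "alp : Hom (points U E) p q ==> alp : Hom (set_power E) p q"
 by (auto simp: points_def in_Hom)

lemma category_points: "category (points U E)"
 unfolding points_def by (rule category_full_subcategory[OF category_functor_category])

lemma point_functor: "p : Obj (points U E) ==> set_functor E p"
 by (simp add: set_functor_def)

text \<open>
 The value at an object is computed pointwise, so the functor that is evaluated there preserves
 directed colimits as soon as the pointwise colimit is a point.
\<close>

definition pointwise_colimit ::
 "'u set => 'u rel => ('o, 'a) category => ('u, 'u \<times> 'u, ('o, 'a, 'u) set_funct, ('o, 'a, 'u) set_nat) funct
  => ('o, 'a, 'u) set_funct => ('u => ('o, 'a, 'u) set_nat) => bool" where
 "pointwise_colimit P r E D p i <-> (ALL e:Obj E.
  elementwise_colimit P r (%l. D$l$e) (%k. app (farr D k) e) (p$e) (%l. app (i l) e))"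

lemma power_diagram:
 assumes D: "cat_functor J (points U E) D"
 shows "!!j. j : Obj J ==> D$j : Obj (points U E)" "!!j. j : Obj J ==> set_functor E (D$j)"
  "!!k. k : Arr J ==> farr D k : Hom (set_power E) (D$(Dom J k)) (D$(Cod J k))"
proof -
 interpret D: cat_functor J "points U E" D by fact
 show "!!j. j : Obj J ==> D$j : Obj (points U E)" by (rule D.fobj_in)
 then show "!!j. j : Obj J ==> set_functor E (D$j)" by (rule point_functor)
 show "!!k. k : Arr J ==> farr D k : Hom (set_power E) (D$(Dom J k)) (D$(Cod J k))"
  using D.farr_Hom Hom_pointsD by blast
qed

lemma directed_sets_at:
 assumes dir: "directed_poset P r" and D: "cat_functor (poset_category P r) (points U E) D" and e: "e : Obj E"
 shows "directed_sets P r (%l. D$l$e) (%k. app (farr D k) e)"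
proof -
 interpret D: cat_functor "poset_category P r" "points U E" D by fact
 note d = directed_posetD[OF dir] and pd = power_diagram[OF D]
 have H: "farr D (l, m) : Hom (set_power E) (D$l) (D$m)" if "(l, m) : r" for l m
  using pd(3)[of "(l, m)"] that by simp
 show ?thesis
 proof (unfold_locales, rule dir)
  show "app (farr D (l, m)) e x : D$m$e" if "(l, m) : r" "x : D$l$e" for l m x
   using app_in[OF H[OF that(1)] e that(2)] .
  show "app (farr D (l, l)) e x = x" if "l : P" "x : D$l$e" for l x
   using D.farr_id[of l] that e by (simp add: app_ident)
  show "app (farr D (l, n)) e x = app (farr D (m, n)) e (app (farr D (l, m)) e x)"
   if lm: "(l, m) : r" "(m, n) : r" "x : D$l$e" for l m n x
  proof -
   have "farr D (l, n) = farr D (m, n) $$set_power E$$ farr D (l, m)"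
    using D.fcomp_simp[of "(l, m)" "(m, n)"] lm by simp
   then show ?thesis using app_comp[OF H[OF lm(1)] e lm(3)] by simp
  qed
 qed
qed

lemma cocone_at:
 assumes D: "cat_functor (poset_category P r) (points U E) D"
  and cocone: "is_cocone (poset_category P r) (points U E) D p i"
 shows "p : Obj (points U E)" "!!l. l : P ==> i l : Hom (set_power E) (D$l) p"
  "!!e l m x. r \<subseteq> P \<times> P ==> e : Obj E ==> (l, m) : r ==> x : D$l$e ==>
   app (i m) e (app (farr D (l, m)) e x) = app (i l) e x"
proof -
 note pd = power_diagram[OF D]
 show "p : Obj (points U E)" using cocone by (auto simp: is_cocone_def)
 show i: "!!l. l : P ==> i l : Hom (set_power E) (D$l) p"
  using cocone Hom_pointsD by (fastforce simp: is_cocone_def)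
 fix e l m x assume rP: "r \<subseteq> P \<times> P" and e: "e : Obj E" and lm: "(l, m) : r" and x: "x : D$l$e"
 have H: "farr D (l, m) : Hom (set_power E) (D$l) (D$m)"
  using pd(3)[of "(l, m)"] lm by simp
 have "ALL k:r. i (snd k) $$set_power E$$ farr D k = i (fst k)" using cocone by (simp add: is_cocone_def)
 then have "i m $$set_power E$$ farr D (l, m) = i l" using lm by force
 then show "app (i m) e (app (farr D (l, m)) e x) = app (i l) e x"
  using app_comp[OF H e x, of "i m"] by simp
qed

lemma points_colimitI:
 assumes dir: "directed_poset P r" and D: "cat_functor (poset_category P r) (points U E) D"
  and cocone: "is_cocone (poset_category P r) (points U E) D p i"
  and pw: "pointwise_colimit P r E D p i"
 shows "is_colimit (poset_category P r) (points U E) D p i"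
 unfolding is_colimit_def
proof (intro conjI allI impI cocone)
 note pd = power_diagram[OF D] and dd = directed_posetD[OF dir] and c = cocone_at[OF D cocone]
 fix x q assume qc: "is_cocone (poset_category P r) (points U E) D x q"
 note qq = cocone_at[OF D qc]
 interpret p: set_functor E p using point_functor[OF c(1)] .
 interpret x: set_functor E x using point_functor[OF qq(1)] .
 define u where "u e = colimit_desc P (%l. D$l$e) (%l. app (i l) e) (%l. app (q l) e)" for e
 have ec: "elementwise_colimit P r (%l. D$l$e) (%k. app (farr D k) e) (p$e) (%l. app (i l) e)"
  if "e : Obj E" for e using pw that by (simp add: pointwise_colimit_def)
 have u: "u e (app (i l) e s) = app (q l) e s" if e: "e : Obj E" and l: "l : P" "s : D$l$e" for e l s
 proof -
  interpret directed_sets P r "%l. D$l$e" "%k. app (farr D k) e"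
   by (rule directed_sets_at[OF dir D e])
  show ?thesis
   unfolding u_def
   by (rule colimit_desc[OF ec[OF e] c(3)[OF dd(1) e] qq(3)[OF dd(1) e] l])
 qed
 have surj: "EX l:P. EX s:fobj (D$l) e. app (i l) e s = z" if "e : Obj E" "z : p$e" for e z
  using ec that by (auto simp: elementwise_colimit_def)
 have uH: "set_nat E p u x : Hom (set_power E) p x"
 proof (rule set_nat_in_Hom[OF p.set_functor_axioms x.set_functor_axioms])
  fix e z assume e: "e : Obj E" and z: "z : p$e"
  obtain l s where ls: "l : P" "s : D$l$e" "app (i l) e s = z" using surj[OF e z] by blast
  then show "u e z : x$e" using u[OF e ls(1,2)] app_in[OF qq(2)[OF ls(1)] e ls(2)] by simp
 next
  fix f z assume f: "f : Arr E" and z: "z : p$(Dom E f)"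
  have ab: "Dom E f : Obj E" "Cod E f : Obj E" using f by auto
  obtain l s where ls: "l : P" "s : D$l$(Dom E f)" "app (i l) (Dom E f) s = z"
   using surj[OF ab(1) z] by blast
  interpret Dl: set_functor E "D$l" using pd(2) ls(1) by simp
  have "act p f z = app (i l) (Cod E f) (act (D$l) f s)"
   using app_natural[OF c(2)[OF ls(1)] f ls(2)] ls(3) by simp
  then have "u (Cod E f) (act p f z) = app (q l) (Cod E f) (act (D$l) f s)"
   using u[OF ab(2) ls(1) Dl.act_in[OF f ls(2)]] by simp
  also have "\<dots> = act x f (u (Dom E f) z)"
   using app_natural[OF qq(2)[OF ls(1)] f ls(2)] u[OF ab(1) ls(1,2)] ls(3) by simp
  finally show "u (Cod E f) (act p f z) = act x f (u (Dom E f) z)" .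
 qed
 have comp: "v $$set_power E$$ i l = q l <-> (ALL e:Obj E. ALL s:fobj (D$l) e. app v e (app (i l) e s) = app (q l) e s)"
  if v: "v : Hom (set_power E) p x" and l: "l : P" for v l
 proof
  assume eq: "v $$set_power E$$ i l = q l"
  then show "ALL e:Obj E. ALL s:fobj (D$l) e. app v e (app (i l) e s) = app (q l) e s"
   using app_comp[OF c(2)[OF l], of _ _ v] by metis
 next
  assume eq: "ALL e:Obj E. ALL s:fobj (D$l) e. app v e (app (i l) e s) = app (q l) e s"
  show "v $$set_power E$$ i l = q l"
   by (rule set_nat_eqI[OF functor_cat.comp_in[OF c(2)[OF l] v] qq(2)[OF l]])
    (use eq in \<open>simp add: app_comp[OF c(2)[OF l]]\<close>)
 qed
 show "EX! v. v : Hom (points U E) p x & (ALL l:Obj (poset_category P r). v $$points U E$$ i l = q l)"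
 proof (rule ex1I[of _ "set_nat E p u x"])
  have "set_nat E p u x $$set_power E$$ i l = q l" if l: "l : P" for l
   using comp[OF uH l] app_in[OF c(2)[OF l]] u[OF _ l] by simp
  then show "set_nat E p u x : Hom (points U E) p x & (ALL l:Obj (poset_category P r). set_nat E p u x $$points U E$$ i l = q l)"
   using uH Hom_points[OF c(1) qq(1)] by simp
 next
  fix v assume v: "v : Hom (points U E) p x & (ALL l:Obj (poset_category P r). v $$points U E$$ i l = q l)"
  then have vH: "v : Hom (set_power E) p x" using Hom_pointsD by blast
  show "v = set_nat E p u x"
  proof (rule set_nat_eqI[OF vH uH])
   fix e z assume e: "e : Obj E" and z: "z : p$e"
   obtain l s where ls: "l : P" "s : D$l$e" "app (i l) e s = z" using surj[OF e z] by blast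
   have "app v e (app (i l) e s) = app (q l) e s"
    using comp[OF vH ls(1)] v ls(1,2) e by simp
   then show "app v e z = app (set_nat E p u x) e z" using u[OF e ls(1,2)] ls(3) e z by simp
  qed
 qed
qed

context universe
begin

text \<open>
 The pointwise colimit of points is left exact because a compatible family indexed by a finite
 category already lives, and is already compatible, at some stage of the directed colimit.
\<close>

lemma directed_colimit_left_exact:
 fixes D :: "('u, 'u \<times> 'u, ('o, 'a, 'u) set_funct, ('o, 'a, 'u) set_nat) funct"
 assumes dir: "directed_poset P r" and D: "cat_functor (poset_category P r) (points U E) D"
  and p: "set_functor E p" and i: "!!l. l : P ==> i l : Hom (set_power E) (D$l) p"
  and coc: "!!e l m x. e : Obj E ==> (l, m) : r ==> x : D$l$e ==>
   app (i m) e (app (farr D (l, m)) e x) = app (i l) e x"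
  and pw: "pointwise_colimit P r E D p i"
 shows "left_exact E Sets p"
 unfolding left_exact_def preserves_limits_of_shape_def
proof (intro conjI allI impI)
 interpret p: set_functor E p by fact
 note pd = power_diagram[OF D] and dd = directed_posetD[OF dir]
 show "cat_functor E Sets p" by (rule p.cat_functor_axioms)
 fix J :: "(nat, nat) category" and Dg c \<pi>
 assume J: "finite_category J" and Dg: "cat_functor J E Dg" and lim: "is_limit J E Dg c \<pi>"
 interpret Dg: cat_functor J E Dg by (rule Dg)
 have finJ: "finite (Obj J)" "finite (Arr J)" using J by (auto simp: finite_category_def)
 have cone: "is_cone J E Dg c \<pi>" using lim by (simp add: is_limit_def)
 then have c: "c : Obj E" and \<pi>: "!!j. j : Obj J ==> \<pi> j : Arr E" "!!j. j : Obj J ==> Dom E (\<pi> j) = c"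
   "!!j. j : Obj J ==> Cod E (\<pi> j) = Dg$j"
  by (auto simp: is_cone_def in_Hom)
 have lex: "elementwise_limit J (fobj (comp_funct J (D$l) Dg)) (act (comp_funct J (D$l) Dg))
   (D$l$c) (%j. body (farr (D$l) (\<pi> j)))" if l: "l : P" for l
 proof (rule set_limitD)
  have "D$l : Obj (points U E)" using pd(1) l by simp
  then show "cat_functor J Sets (comp_funct J (D$l) Dg)"
    "is_limit J Sets (comp_funct J (D$l) Dg) (D$l$c) (%j. farr (D$l) (\<pi> j))"
   using lim J Dg cat_functor_comp[OF Dg] by (auto simp: left_exact_def preserves_limits_of_shape_def)
 qed
 have nat: "app (i l) (Dg$j) (act (D$l) (\<pi> j) s) = act p (\<pi> j) (app (i l) c s)"
  if "l : P" "j : Obj J" "s : D$l$c" for l j s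
  using app_natural[OF i[OF that(1)] \<pi>(1)[OF that(2)], of s] \<pi> that by simp
 have natk: "app (i l) (Dg$(Cod J k)) (act (D$l) (farr Dg k) s) = act p (farr Dg k) (app (i l) (Dg$(Dom J k)) s)"
  if "l : P" "k : Arr J" "s : D$l$(Dg$(Dom J k))" for l k s
  using app_natural[OF i[OF that(1)], of "farr Dg k" s] that by simp
 have ec: "elementwise_colimit P r (%l. D$l$e) (%k. app (farr D k) e) (p$e) (%l. app (i l) e)"
  if "e : Obj E" for e using pw that by (simp add: pointwise_colimit_def)
 have dirs: "directed_sets P r (%l. D$l$e) (%k. app (farr D k) e)" if "e : Obj E" for e
  by (rule directed_sets_at[OF dir D that])
 have trn: "app (farr D (l, m)) (Cod E f) (act (D$l) f s) = act (D$m) f (app (farr D (l, m)) (Dom E f) s)"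
  if "(l, m) : r" "f : Arr E" "s : D$l$(Dom E f)" for l m f s
  using app_natural[OF pd(3)[of "(l, m)"], of f s] that by simp
 have Din: "act (D$l) f s : D$l$(Cod E f)"
  if "l : P" "f : Arr E" "s : D$l$(Dom E f)" for l f s
  using set_functor.act_in[OF pd(2)] that by simp
 show "is_limit J Sets (comp_funct J p Dg) (p$c) (%j. farr p (\<pi> j))"
 proof (rule set_limitI[OF cat_functor_comp[OF Dg p.cat_functor_axioms] cone_image[OF p.cat_functor_axioms Dg cone]])
  show "elementwise_limit J (fobj (comp_funct J p Dg)) (act (comp_funct J p Dg)) (p$c) (%j. body (farr p (\<pi> j)))"
   unfolding elementwise_limit_def
  proof (intro allI impI)
   fix x assume "compatible_family J (fobj (comp_funct J p Dg)) (act (comp_funct J p Dg)) x"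
   then have x: "!!j. j : Obj J ==> x j : p$(Dg$j)"
    and xk: "!!k. k : Arr J ==> act p (farr Dg k) (x (Dom J k)) = x (Cod J k)"
    by (auto simp: compatible_family_def act_def)
   have "ALL j:Obj J. EX ls. fst ls : P & snd ls : D$(fst ls)$(Dg$j) & app (i (fst ls)) (Dg$j) (snd ls) = x j"
   proof
    fix j assume j: "j : Obj J"
    then obtain l s where "l : P" "s : D$l$(Dg$j)" "app (i l) (Dg$j) s = x j"
     using ec[of "Dg$j"] x[OF j] unfolding elementwise_colimit_def by auto
    then show "EX ls. fst ls : P & snd ls : D$(fst ls)$(Dg$j) & app (i (fst ls)) (Dg$j) (snd ls) = x j"
     by (intro exI[of _ "(l, s)"]) simp
   qed
   from bchoice[OF this] obtain ls where ls: "!!j. j : Obj J ==> fst (ls j) : P \<and>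
     snd (ls j) : (D$(fst (ls j)))$(Dg$j) & app (i (fst (ls j))) (Dg$j) (snd (ls j)) = x j"
    by blast
   obtain m where m: "m : P" "!!j. j : Obj J ==> (fst (ls j), m) : r"
    using directed_finite_bound[OF dir, of "(%j. fst (ls j)) ` Obj J"] finJ ls by auto
   define y where "y j = app (farr D (fst (ls j), m)) (Dg$j) (snd (ls j))" for j
   have y: "y j : D$m$(Dg$j)" "app (i m) (Dg$j) (y j) = x j" if j: "j : Obj J" for j
   proof -
    interpret directed_sets P r "%l. D$l$(Dg$j)" "%k. app (farr D k) (Dg$j)"
     by (rule dirs) (use j in simp)
    show "y j : D$m$(Dg$j)" unfolding y_def using t_in m(2)[OF j] ls[OF j] by blast
    show "app (i m) (Dg$j) (y j) = x j" unfolding y_def using coc[of "Dg$j"] m(2)[OF j] ls[OF j] j by simp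
   qed
   have "ALL k:Arr J. EX n. (m, n) : r & app (farr D (m, n)) (Dg$(Cod J k)) (act (D$m) (farr Dg k) (y (Dom J k)))
     = app (farr D (m, n)) (Dg$(Cod J k)) (y (Cod J k))"
   proof
    fix k assume k: "k : Arr J"
    have d: "Dom J k : Obj J" "Cod J k : Obj J" using k by auto
    have "app (i m) (Dg$(Cod J k)) (act (D$m) (farr Dg k) (y (Dom J k))) = app (i m) (Dg$(Cod J k)) (y (Cod J k))"
     using natk[OF m(1) k y(1)[OF d(1)]] y(2)[OF d(1)] y(2)[OF d(2)] xk[OF k] by simp
    moreover have "act (D$m) (farr Dg k) (y (Dom J k)) : D$m$(Dg$(Cod J k))"
     using Din[OF m(1), of "farr Dg k" "y (Dom J k)"] y(1)[OF d(1)] k by simp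
    ultimately show "EX n. (m, n) : r & app (farr D (m, n)) (Dg$(Cod J k)) (act (D$m) (farr Dg k) (y (Dom J k)))
     = app (farr D (m, n)) (Dg$(Cod J k)) (y (Cod J k))"
     using ec[OF Dg.fobj_in[OF d(2)]] m(1) y(1)[OF d(2)] unfolding elementwise_colimit_def by blast
   qed
   from bchoice[OF this] obtain n where n: "!!k. k : Arr J ==> (m, n k) : r"
     "!!k. k : Arr J ==> app (farr D (m, n k)) (Dg$(Cod J k)) (act (D$m) (farr Dg k) (y (Dom J k)))
      = app (farr D (m, n k)) (Dg$(Cod J k)) (y (Cod J k))"
    by blast
   obtain n' where n': "n' : P" "(m, n') : r" "!!k. k : Arr J ==> (n k, n') : r"
   proof -
    have "insert m (n ` Arr J) \<subseteq> P" using n(1) m(1) dd(1) by blast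
    then obtain h where "h : P" "ALL x:insert m (n ` Arr J). (x, h) : r"
     using directed_finite_bound[OF dir, of "insert m (n ` Arr J)"] finJ by auto
    then show thesis by (intro that) auto
   qed
   define w where "w j = app (farr D (m, n')) (Dg$j) (y j)" for j
   have w: "w j : D$n'$(Dg$j)" "app (i n') (Dg$j) (w j) = x j" if j: "j : Obj J" for j
   proof -
    interpret directed_sets P r "%l. D$l$(Dg$j)" "%k. app (farr D k) (Dg$j)"
     by (rule dirs) (use j in simp)
    show "w j : D$n'$(Dg$j)" unfolding w_def using t_in[OF n'(2)] y[OF j] by blast
    show "app (i n') (Dg$j) (w j) = x j" unfolding w_def using coc[of "Dg$j"] n'(2) y[OF j] j by simp
   qed
   have "act (D$n') (farr Dg k) (w (Dom J k)) = w (Cod J k)" if k: "k : Arr J" for k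
   proof -
    have d: "Dom J k : Obj J" "Cod J k : Obj J" using k by auto
    interpret directed_sets P r "%l. D$l$(Dg$(Cod J k))" "%q. app (farr D q) (Dg$(Cod J k))"
     by (rule dirs) (use d in simp)
    have yk: "act (D$m) (farr Dg k) (y (Dom J k)) : D$m$(Dg$(Cod J k))"
     using Din[OF m(1), of "farr Dg k" "y (Dom J k)"] y(1)[OF d(1)] k by simp
    have "act (D$n') (farr Dg k) (w (Dom J k))
      = app (farr D (m, n')) (Dg$(Cod J k)) (act (D$m) (farr Dg k) (y (Dom J k)))"
     unfolding w_def using trn[OF n'(2), of "farr Dg k" "y (Dom J k)"] y(1)[OF d(1)] k by simp
    also have "\<dots> = app (farr D (n k, n')) (Dg$(Cod J k)) (app (farr D (m, n k)) (Dg$(Cod J k)) (act (D$m) (farr Dg k) (y (Dom J k))))"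
     by (rule t_comp[OF n(1)[OF k] n'(3)[OF k] yk])
    also have "\<dots> = w (Cod J k)"
     unfolding w_def n(2)[OF k] by (rule t_comp[OF n(1)[OF k] n'(3)[OF k] y(1)[OF d(2)], symmetric])
    finally show ?thesis .
   qed
   then have "compatible_family J (fobj (comp_funct J (D$n') Dg)) (act (comp_funct J (D$n') Dg)) w"
    using w(1) by (auto simp: compatible_family_def act_def)
   then obtain z where z: "z : D$n'$c" "!!j. j : Obj J ==> act (D$n') (\<pi> j) z = w j"
    using lex[OF n'(1)] unfolding elementwise_limit_def act_def by blast
   show "EX! z. z : p$c & (ALL j:Obj J. body (farr p (\<pi> j)) z = x j)"
   proof (rule ex1I[of _ "app (i n') c z"])
    have "body (farr p (\<pi> j)) (app (i n') c z) = x j" if j: "j : Obj J" for j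
     using nat[OF n'(1) j z(1)] z(2)[OF j] w(2)[OF j] by (simp add: act_def)
    then show "app (i n') c z : p$c & (ALL j:Obj J. body (farr p (\<pi> j)) (app (i n') c z) = x j)"
     using app_in[OF i[OF n'(1)] c z(1)] by blast
   next
    fix v assume v: "v : p$c & (ALL j:Obj J. body (farr p (\<pi> j)) v = x j)"
    then obtain l s where lsv: "l : P" "s : D$l$c" "app (i l) c s = v"
     using ec[OF c] unfolding elementwise_colimit_def by blast
    obtain k where k: "k : P" "(l, k) : r" "(n', k) : r" using dd(5)[OF lsv(1) n'(1)] by blast
    interpret dc: directed_sets P r "%l. D$l$c" "%k. app (farr D k) c" by (rule dirs[OF c])
    define s' where "s' = app (farr D (l, k)) c s"
    define z' where "z' = app (farr D (n', k)) c z"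
    have s': "s' : D$k$c" "app (i k) c s' = v"
     unfolding s'_def using dc.t_in[OF k(2) lsv(2)] coc[OF c k(2) lsv(2)] lsv(3) by auto
    have z': "z' : D$k$c" "app (i k) c z' = app (i n') c z"
     unfolding z'_def using dc.t_in[OF k(3) z(1)] coc[OF c k(3) z(1)] by auto
    have "ALL j:Obj J. EX n. (k, n) : r & app (farr D (k, n)) (Dg$j) (act (D$k) (\<pi> j) s')
      = app (farr D (k, n)) (Dg$j) (act (D$k) (\<pi> j) z')"
    proof
     fix j assume j: "j : Obj J"
     have "app (i k) (Dg$j) (act (D$k) (\<pi> j) s') = x j"
      using nat[OF k(1) j s'(1)] s'(2) v j by (simp add: act_def)
     moreover have "app (i k) (Dg$j) (act (D$k) (\<pi> j) z') = x j"
      using nat[OF k(1) j z'(1)] z'(2) nat[OF n'(1) j z(1)] z(2)[OF j] w(2)[OF j] by simp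
     moreover have "act (D$k) (\<pi> j) s' : D$k$(Dg$j)" "act (D$k) (\<pi> j) z' : D$k$(Dg$j)"
      using Din[OF k(1) \<pi>(1)[OF j]] s'(1) z'(1) \<pi>(2,3)[OF j] by auto
     ultimately show "EX n. (k, n) : r & app (farr D (k, n)) (Dg$j) (act (D$k) (\<pi> j) s')
      = app (farr D (k, n)) (Dg$j) (act (D$k) (\<pi> j) z')"
      using ec[OF Dg.fobj_in[OF j]] k(1) unfolding elementwise_colimit_def by metis
    qed
    from bchoice[OF this] obtain g where g: "!!j. j : Obj J ==> (k, g j) : r"
      "!!j. j : Obj J ==> app (farr D (k, g j)) (Dg$j) (act (D$k) (\<pi> j) s')
      = app (farr D (k, g j)) (Dg$j) (act (D$k) (\<pi> j) z')"
     by blast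
    obtain h where h: "h : P" "(k, h) : r" "!!j. j : Obj J ==> (g j, h) : r"
    proof -
     have "insert k (g ` Obj J) \<subseteq> P" using g(1) k(1) dd(1) by blast
     then obtain h where "h : P" "ALL x:insert k (g ` Obj J). (x, h) : r"
      using directed_finite_bound[OF dir, of "insert k (g ` Obj J)"] finJ by auto
     then show thesis by (intro that) auto
    qed
    define s'' where "s'' = app (farr D (k, h)) c s'"
    define z'' where "z'' = app (farr D (k, h)) c z'"
    have sz: "s'' : D$h$c" "z'' : D$h$c"
     unfolding s''_def z''_def using dc.t_in[OF h(2)] s' z' by auto
    have eq: "act (D$h) (\<pi> j) s'' = act (D$h) (\<pi> j) z''" if j: "j : Obj J" for j
    proof -
     interpret directed_sets P r "%l. D$l$(Dg$j)" "%q. app (farr D q) (Dg$j)"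
      by (rule dirs) (use j in simp)
     have m: "act (D$k) (\<pi> j) s' : D$k$(Dg$j)" "act (D$k) (\<pi> j) z' : D$k$(Dg$j)"
      using Din[OF k(1) \<pi>(1)[OF j]] s'(1) z'(1) \<pi>(2,3)[OF j] by auto
     have "act (D$h) (\<pi> j) s'' = app (farr D (k, h)) (Dg$j) (act (D$k) (\<pi> j) s')"
      using trn[OF h(2) \<pi>(1)[OF j], of s'] s'(1) \<pi>(2,3)[OF j] by (simp add: s''_def)
     also have "\<dots> = app (farr D (k, h)) (Dg$j) (act (D$k) (\<pi> j) z')"
      using t_comp[OF g(1)[OF j] h(3)[OF j] m(1)] t_comp[OF g(1)[OF j] h(3)[OF j] m(2)] g(2)[OF j] by simp
     also have "\<dots> = act (D$h) (\<pi> j) z''"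
      using trn[OF h(2) \<pi>(1)[OF j], of z'] z'(1) \<pi>(2,3)[OF j] by (simp add: z''_def)
     finally show ?thesis .
    qed
    have "compatible_family J (fobj (comp_funct J (D$h) Dg)) (act (comp_funct J (D$h) Dg)) (%j. act (D$h) (\<pi> j) z'')"
     unfolding compatible_family_def
    proof (intro conjI ballI)
     show "act (D$h) (\<pi> j) z'' : (comp_funct J (D$h) Dg)$j" if j: "j : Obj J" for j
      using Din[OF h(1) \<pi>(1)[OF j]] sz(2) \<pi>(2,3)[OF j] j by auto
     fix q assume q: "q : Arr J"
     interpret Dh: set_functor E "D$h" using pd(2) h(1) by simp
     have "farr Dg q $$E$$ \<pi> (Dom J q) = \<pi> (Cod J q)" using cone q by (simp add: is_cone_def)
     then show "act (comp_funct J (D$h) Dg) q (act (D$h) (\<pi> (Dom J q)) z'') = act (D$h) (\<pi> (Cod J q)) z''"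
      using Dh.act_comp[of "\<pi> (Dom J q)" "farr Dg q" z''] \<pi>[of "Dom J q"] sz(2) q by (simp add: act_def)
    qed
    then have "s'' = z''"
     using lex[OF h(1)] sz eq unfolding elementwise_limit_def act_def by blast
    then show "v = app (i n') c z"
     using coc[OF c h(2) s'(1)] coc[OF c h(2) z'(1)] s'(2) z'(2) by (simp add: s''_def z''_def)
   qed
  qed
 qed
qed

text \<open>Colimits commute with colimits, whatever the shape.\<close>

lemma directed_colimit_cocontinuous:
 fixes D :: "('u, 'u \<times> 'u, ('o, 'a, 'u) set_funct, ('o, 'a, 'u) set_nat) funct"
 assumes dir: "directed_poset P r" and D: "cat_functor (poset_category P r) (points U E) D"
  and p: "set_functor E p" and i: "!!l. l : P ==> i l : Hom (set_power E) (D$l) p"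
  and coc: "!!e l m x. e : Obj E ==> (l, m) : r ==> x : D$l$e ==>
   app (i m) e (app (farr D (l, m)) e x) = app (i l) e x"
  and pw: "pointwise_colimit P r E D p i"
 shows "cocontinuous U E Sets p"
 unfolding cocontinuous_def preserves_colimits_of_shape_def
proof (intro conjI allI impI)
 interpret p: set_functor E p by fact
 note pd = power_diagram[OF D] and dd = directed_posetD[OF dir]
 show "cat_functor E Sets p" by (rule p.cat_functor_axioms)
 fix J :: "('u, 'u) category" and Dg c \<iota>
 assume J: "small_category J" and Dg: "cat_functor J E Dg" and colim: "is_colimit J E Dg c \<iota>"
 interpret Dg: cat_functor J E Dg by (rule Dg)
 have cocone: "is_cocone J E Dg c \<iota>" using colim by (simp add: is_colimit_def)
 then have c: "c : Obj E" and \<iota>: "!!j. j : Obj J ==> \<iota> j : Arr E" "!!j. j : Obj J ==> Cod E (\<iota> j) = c"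
   "!!j. j : Obj J ==> Dom E (\<iota> j) = Dg$j"
   and \<iota>H: "!!j. j : Obj J ==> \<iota> j : Hom E (Dg$j) c"
  by (auto simp: is_cocone_def in_Hom)
 have Dl: "is_colimit J Sets (comp_funct J (D$l) Dg) (D$l$c) (%j. farr (D$l) (\<iota> j))"
  if l: "l : P" for l
  using pd(1)[of l] l colim J Dg by (auto simp: cocontinuous_def preserves_colimits_of_shape_def)
 have ec: "elementwise_colimit P r (%l. D$l$e) (%k. app (farr D k) e) (p$e) (%l. app (i l) e)"
  if "e : Obj E" for e using pw that by (simp add: pointwise_colimit_def)
 interpret dc: directed_sets P r "%l. D$l$c" "%k. app (farr D k) c"
  by (rule directed_sets_at[OF dir D c])
 have ib: "body (i l) e : Hom Sets (D$l$e) (p$e)" if "l : P" "e : Obj E" for l e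
  using nat_body_in[OF i[OF that(1)] that(2)] .
 have D\<iota>: "farr (D$l) (\<iota> j) : Hom Sets (D$l$(Dg$j)) (D$l$c)"
  if "l : P" "j : Obj J" for l j
  using cat_functor.farr_in[OF _ \<iota>H[OF that(2)]] pd(2)[of l] that(1) by (simp add: set_functor_def)
 show "is_colimit J Sets (comp_funct J p Dg) (p$c) (%j. farr p (\<iota> j))"
  unfolding is_colimit_def
 proof (intro conjI allI impI cocone_image[OF p.cat_functor_axioms Dg cocone])
  fix x q assume qc: "is_cocone J Sets (comp_funct J p Dg) x q"
  then have x: "small_set x" and q: "!!j. j : Obj J ==> q j : Hom Sets (p$(Dg$j)) x"
   and qn: "!!k. k : Arr J ==> q (Cod J k) $$Sets$$ farr p (farr Dg k) = q (Dom J k)"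
   by (auto simp: is_cocone_def)
  let ?q = "%l j. q j $$Sets$$ body (i l) (Dg$j)"
  have qH: "?q l j : Hom Sets (D$l$(Dg$j)) x" if "l : P" "j : Obj J" for l j
   using set_comp_in[OF ib q] that by simp
  have "is_cocone J Sets (comp_funct J (D$l) Dg) x (?q l)" if l: "l : P" for l
   unfolding is_cocone_def
  proof (intro conjI ballI)
   fix k assume k: "k : Arr J"
   have d: "Dom J k : Obj J" "Cod J k : Obj J" using k by auto
   have fk: "farr Dg k : Hom E (Dg$(Dom J k)) (Dg$(Cod J k))" using Dg.farr_Hom[OF k] .
   have n: "body (i l) (Dg$(Cod J k)) $$Sets$$ farr (D$l) (farr Dg k)
     = farr p (farr Dg k) $$Sets$$ body (i l) (Dg$(Dom J k))"
    using i[OF l] nat_trans_natural[OF _ fk] by (auto simp: in_Hom_functor_category)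
   have Dk: "farr (D$l) (farr Dg k) : Hom Sets (D$l$(Dg$(Dom J k))) (D$l$(Dg$(Cod J k)))"
    using cat_functor.farr_in[OF _ fk] pd(2)[of l] l by (simp add: set_functor_def)
   have "?q l (Cod J k) $$Sets$$ farr (D$l) (farr Dg k)
     = q (Cod J k) $$Sets$$ (farr p (farr Dg k) $$Sets$$ body (i l) (Dg$(Dom J k)))"
    using set_cat.assoc[OF Dk ib q] l d n by simp
   also have "\<dots> = ?q l (Dom J k)"
    using set_cat.assoc[OF ib p.farr_in[OF fk] q, of l] l d qn[OF k] by simp
   finally show "?q l (Cod J k) $$Sets$$ farr (comp_funct J (D$l) Dg) k = ?q l (Dom J k)"
    using k by simp
  qed (use x qH[OF l] in auto)
  then have "ALL l:P. EX u. u : Hom Sets (D$l$c) x \<and>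
    (ALL j:Obj J. u $$Sets$$ farr (D$l) (\<iota> j) = ?q l j)"
   using Dl unfolding is_colimit_def by blast
  from bchoice[OF this] obtain u where u: "!!l. l : P ==> u l : Hom Sets (D$l$c) x"
    and uq: "!!l j. l : P ==> j : Obj J ==> u l $$Sets$$ farr (D$l) (\<iota> j) = ?q l j"
   by blast
  have uniq: "v = w" if l: "l : P" and v: "v : Hom Sets (D$l$c) x" "w : Hom Sets (D$l$c) x"
   and eq: "!!j s. j : Obj J ==> s : D$l$(Dg$j) ==>
    body v (act (D$l) (\<iota> j) s) = body w (act (D$l) (\<iota> j) s)" for l v w
  proof (rule set_arrow_eqI[OF v])
   fix z assume z: "z : D$l$c"
   have "cat_functor J Sets (comp_funct J (D$l) Dg)"
    using cat_functor_comp[OF Dg] pd(2)[of l] l by (simp add: set_functor_def)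
   from set_colimit_jointly_surjective[OF this Dl[OF l] z]
   obtain j s where "j : Obj J" "s : D$l$(Dg$j)" "act (D$l) (\<iota> j) s = z"
    by (auto simp: act_def)
   then show "body v z = body w z" using eq by blast
  qed
  have u\<iota>: "body (u l) (act (D$l) (\<iota> j) s) = body (q j) (app (i l) (Dg$j) s)"
   if "l : P" "j : Obj J" "s : D$l$(Dg$j)" for l j s
   using set_comp_apply[OF D\<iota>[OF that(1,2)] that(3), of "u l"] uq[OF that(1,2)]
    set_comp_apply[OF ib[OF that(1) Dg.fobj_in[OF that(2)]] that(3), of "q j"]
   by (simp add: act_def app_def)
  have Dr: "farr D (l, m) : Hom (set_power E) (D$l) (D$m)" if "(l, m) : r" for l m
   using pd(3)[of "(l, m)"] that by simp
  have ucomp: "body (u m) (app (farr D (l, m)) c s) = body (u l) s" if lm: "(l, m) : r" and s: "s : D$l$c" for l m s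
  proof -
   have lP: "l : P" "m : P" using lm dd(1) by auto
   note bD = nat_body_in[OF Dr[OF lm] c]
   have "u m $$Sets$$ body (farr D (l, m)) c = u l"
   proof (rule uniq[OF lP(1) set_comp_in[OF bD u[OF lP(2)]] u[OF lP(1)]])
    fix j s assume j: "j : Obj J" and s: "s : D$l$(Dg$j)"
    have s1: "act (D$l) (\<iota> j) s : D$l$c"
     using set_arrow_in[OF D\<iota>[OF lP(1) j] s] by (simp add: act_def)
    have s2: "app (farr D (l, m)) (Dg$j) s : D$m$(Dg$j)"
     using app_in[OF Dr[OF lm] Dg.fobj_in[OF j] s] .
    have "body (u m $$Sets$$ body (farr D (l, m)) c) (act (D$l) (\<iota> j) s)
      = body (u m) (app (farr D (l, m)) c (act (D$l) (\<iota> j) s))"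
     using set_comp_apply[OF bD s1, of "u m"] by (simp add: app_def)
    also have "\<dots> = body (u m) (act (D$m) (\<iota> j) (app (farr D (l, m)) (Dg$j) s))"
     using app_natural[OF Dr[OF lm] \<iota>(1)[OF j], of s] \<iota>(2,3)[OF j] s by simp
    also have "\<dots> = body (q j) (app (i l) (Dg$j) s)"
     using u\<iota>[OF lP(2) j s2] coc[OF Dg.fobj_in[OF j] lm s] by simp
    finally show "body (u m $$Sets$$ body (farr D (l, m)) c) (act (D$l) (\<iota> j) s) = body (u l) (act (D$l) (\<iota> j) s)"
     using u\<iota>[OF lP(1) j s] by simp
   qed
   then show ?thesis using set_comp_apply[OF bD s, of "u m"] by (simp add: app_def)
  qed
  define v where "v = colimit_desc P (%l. D$l$c) (%l. app (i l) c) (%l. body (u l))"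
  have v: "v (app (i l) c s) = body (u l) s" if "l : P" "s : D$l$c" for l s
   unfolding v_def by (rule dc.colimit_desc[OF ec[OF c] coc[OF c] ucomp that])
  have surj: "EX l:P. EX s:fobj (D$l) e. app (i l) e s = z" if "e : Obj E" "z : p$e" for e z
   using ec that by (auto simp: elementwise_colimit_def)
  have v_in: "v z : x" if z: "z : p$c" for z
  proof -
   obtain l s where ls: "l : P" "s : D$l$c" "app (i l) c s = z" using surj[OF c z] by blast
   then show ?thesis using v[OF ls(1,2)] set_arrow_in[OF u[OF ls(1)] ls(2)] by simp
  qed
  have vH: "set_map (p$c) v x : Hom Sets (p$c) x"
   by (rule set_map_in_Hom[OF p.small[OF c] x v_in])
  have p\<iota>: "farr p (\<iota> j) : Hom Sets (p$(Dg$j)) (p$c)" if "j : Obj J" for j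
   using p.farr_in[OF \<iota>H[OF that]] .
  have inat: "body (farr p (\<iota> j)) (app (i l) (Dg$j) s) = app (i l) c (act (D$l) (\<iota> j) s)"
   if "l : P" "j : Obj J" "s : D$l$(Dg$j)" for l j s
   using app_natural[OF i[OF that(1)] \<iota>(1)[OF that(2)], of s] \<iota>(2,3)[OF that(2)] that(3) by (simp add: act_def)
  show "EX! w. w : Hom Sets (p$c) x & (ALL j:Obj J. w $$Sets$$ farr p (\<iota> j) = q j)"
  proof (rule ex1I[of _ "set_map (p$c) v x"])
   have "set_map (p$c) v x $$Sets$$ farr p (\<iota> j) = q j" if j: "j : Obj J" for j
   proof (rule set_arrow_eqI[OF set_comp_in[OF p\<iota>[OF j] vH] q[OF j]])
    fix z assume z: "z : p$(Dg$j)"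
    obtain l s where ls: "l : P" "s : D$l$(Dg$j)" "app (i l) (Dg$j) s = z"
     using surj[OF Dg.fobj_in[OF j] z] by blast
    have s1: "act (D$l) (\<iota> j) s : D$l$c"
     using set_arrow_in[OF D\<iota>[OF ls(1) j] ls(2)] by (simp add: act_def)
    have "body (set_map (p$c) v x $$Sets$$ farr p (\<iota> j)) z = v (body (farr p (\<iota> j)) z)"
     using set_comp_apply[OF p\<iota>[OF j] z] set_arrow_in[OF p\<iota>[OF j] z] by simp
    also have "\<dots> = body (u l) (act (D$l) (\<iota> j) s)" using inat[OF ls(1) j ls(2)] ls(3) v[OF ls(1) s1] by simp
    also have "\<dots> = body (q j) z" using u\<iota>[OF ls(1) j ls(2)] ls(3) by simp
    finally show "body (set_map (p$c) v x $$Sets$$ farr p (\<iota> j)) z = body (q j) z" .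
   qed
   then show "set_map (p$c) v x : Hom Sets (p$c) x \<and>
     (ALL j:Obj J. set_map (p$c) v x $$Sets$$ farr p (\<iota> j) = q j)"
    using vH by blast
  next
   fix w assume w: "w : Hom Sets (p$c) x & (ALL j:Obj J. w $$Sets$$ farr p (\<iota> j) = q j)"
   then have wH: "w : Hom Sets (p$c) x" by blast
   have wu: "w $$Sets$$ body (i l) c = u l" if l: "l : P" for l
   proof (rule uniq[OF l set_comp_in[OF ib[OF l c] wH] u[OF l]])
    fix j s assume j: "j : Obj J" and s: "s : D$l$(Dg$j)"
    have s1: "act (D$l) (\<iota> j) s : D$l$c"
     using set_arrow_in[OF D\<iota>[OF l j] s] by (simp add: act_def)
    have s2: "app (i l) (Dg$j) s : p$(Dg$j)" using app_in[OF i[OF l] Dg.fobj_in[OF j] s] .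
    have "body (w $$Sets$$ body (i l) c) (act (D$l) (\<iota> j) s) = body w (app (i l) c (act (D$l) (\<iota> j) s))"
     using set_comp_apply[OF ib[OF l c] s1, of w] by (simp add: app_def)
    also have "\<dots> = body w (body (farr p (\<iota> j)) (app (i l) (Dg$j) s))" using inat[OF l j s] by simp
    also have "\<dots> = body (q j) (app (i l) (Dg$j) s)" using set_comp_apply[OF p\<iota>[OF j] s2, of w] w j by simp
    finally show "body (w $$Sets$$ body (i l) c) (act (D$l) (\<iota> j) s) = body (u l) (act (D$l) (\<iota> j) s)"
     using u\<iota>[OF l j s] by simp
   qed
   show "w = set_map (p$c) v x"
   proof (rule set_arrow_eqI[OF wH vH])
    fix z assume z: "z : p$c"
    obtain l s where ls: "l : P" "s : D$l$c" "app (i l) c s = z" using surj[OF c z] by blast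
    have "body w (app (i l) c s) = body (u l) s"
     using set_comp_apply[OF ib[OF ls(1) c] ls(2), of w] wu[OF ls(1)] by (simp add: app_def)
    then show "body w z = body (set_map (p$c) v x) z" using v[OF ls(1,2)] ls(3) z by simp
   qed
  qed
 qed
qed

lemma points_directed_colimit_exists:
 fixes D :: "('u, 'u \<times> 'u, ('o, 'a, 'u) set_funct, ('o, 'a, 'u) set_nat) funct"
 assumes E: "category E" and P: "small_set P" and dir: "directed_poset P r"
  and D: "cat_functor (poset_category P r) (points U E) D"
 shows "EX p i. is_cocone (poset_category P r) (points U E) D p i & pointwise_colimit P r E D p i"
proof -
 interpret E: category E by fact
 note pd = power_diagram[OF D] and dd = directed_posetD[OF dir]
 have Df: "set_functor E (D$l)" if "l : P" for l using pd(2) that by simp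
 have Dr: "farr D (l, m) : Hom (set_power E) (D$l) (D$m)" if "(l, m) : r" for l m
  using pd(3)[of "(l, m)"] that by simp
 have "ALL e:Obj E. EX ci. small_set (fst ci) & (ALL l:P. ALL x:fobj (D$l) e. snd ci l x : fst ci) \<and>
   (ALL l m x. (l, m) : r --> x : D$l$e --> snd ci m (app (farr D (l, m)) e x) = snd ci l x) \<and>
   elementwise_colimit P r (%l. D$l$e) (%k. app (farr D k) e) (fst ci) (snd ci)"
 proof
  fix e assume e: "e : Obj E"
  from directed_colimit_exists[OF directed_sets_at[OF dir D e] P set_functor.small[OF Df e]]
  show "EX ci. small_set (fst ci) & (ALL l:P. ALL x:fobj (D$l) e. snd ci l x : fst ci) \<and>
   (ALL l m x. (l, m) : r --> x : D$l$e --> snd ci m (app (farr D (l, m)) e x) = snd ci l x) \<and>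
   elementwise_colimit P r (%l. D$l$e) (%k. app (farr D k) e) (fst ci) (snd ci)"
   by auto
 qed
 from bchoice[OF this] obtain ci where ci: "ALL e:Obj E. small_set (fst (ci e)) & (ALL l:P. ALL x:fobj (D$l) e. snd (ci e) l x : fst (ci e)) \<and>
   (ALL l m x. (l, m) : r --> x : D$l$e --> snd (ci e) m (app (farr D (l, m)) e x) = snd (ci e) l x) \<and>
   elementwise_colimit P r (%l. D$l$e) (%k. app (farr D k) e) (fst (ci e)) (snd (ci e))"
  by blast
 define c where "c e = fst (ci e)" for e
 define j where "j e = snd (ci e)" for e
 have c: "small_set (c e)" and j: "!!l x. l : P ==> x : D$l$e ==> j e l x : c e"
  and coc: "!!l m x. (l, m) : r ==> x : D$l$e ==> j e m (app (farr D (l, m)) e x) = j e l x"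
  and ec: "elementwise_colimit P r (%l. D$l$e) (%k. app (farr D k) e) (c e) (j e)"
  if "e : Obj E" for e
  using ci that unfolding c_def j_def by blast+
 have surj: "EX l:P. EX s:fobj (D$l) e. j e l s = z" if "e : Obj E" "z : c e" for e z
  using ec that by (auto simp: elementwise_colimit_def)
 have Din: "act (D$l) f s : D$l$(Cod E f)"
  if "l : P" "f : Arr E" "s : D$l$(Dom E f)" for l f s
  using set_functor.act_in[OF Df] that by blast
 define t where "t f = colimit_desc P (%l. D$l$(Dom E f)) (j (Dom E f)) (%l s. j (Cod E f) l (act (D$l) f s))" for f
 have t: "t f (j (Dom E f) l s) = j (Cod E f) l (act (D$l) f s)"
  if f: "f : Arr E" and l: "l : P" "s : D$l$(Dom E f)" for f l s
 proof -
  have ab: "Dom E f : Obj E" "Cod E f : Obj E" using f by auto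
  interpret directed_sets P r "%l. D$l$(Dom E f)" "%k. app (farr D k) (Dom E f)"
   by (rule directed_sets_at[OF dir D ab(1)])
  show ?thesis
   unfolding t_def
  proof (rule colimit_desc[OF ec[OF ab(1)] coc[OF ab(1)] _ l])
   fix l m x assume lm: "(l, m) : r" and x: "x : D$l$(Dom E f)"
   have lP: "l : P" using lm dd(1) by auto
   show "j (Cod E f) m (act (D$m) f (app (farr D (l, m)) (Dom E f) x)) = j (Cod E f) l (act (D$l) f x)"
    using app_natural[OF Dr[OF lm] f x] coc[OF ab(2) lm Din[OF lP f x]] by simp
  qed
 qed
 define p where "p = set_funct E c t"
 have p: "set_functor E p"
  unfolding p_def
 proof (rule set_functor_set_funct[OF E c])
  fix f z assume f: "f : Arr E" and z: "z : c (Dom E f)"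
  have ab: "Dom E f : Obj E" "Cod E f : Obj E" using f by auto
  obtain l s where ls: "l : P" "s : D$l$(Dom E f)" "j (Dom E f) l s = z" using surj[OF ab(1) z] by blast
  show "t f z : c (Cod E f)" using t[OF f ls(1,2)] ls(3) j[OF ab(2) ls(1) Din[OF ls(1) f ls(2)]] by simp
 next
  fix e z assume e: "e : Obj E" and z: "z : c e"
  obtain l s where ls: "l : P" "s : D$l$e" "j e l s = z" using surj[OF e z] by blast
  show "t (Ident E e) z = z"
   using t[of "Ident E e" l s] ls e set_functor.act_id[OF Df[OF ls(1)] e ls(2)] by simp
 next
  fix f g z assume f: "f : Arr E" and g: "g : Arr E" and fg: "Dom E g = Cod E f" and z: "z : c (Dom E f)"
  have ab: "Dom E f : Obj E" using f by auto
  obtain l s where ls: "l : P" "s : D$l$(Dom E f)" "j (Dom E f) l s = z" using surj[OF ab z] by blast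
  have "t g (t f z) = j (Cod E g) l (act (D$l) g (act (D$l) f s))"
   using t[OF f ls(1,2)] t[OF g ls(1), of "act (D$l) f s"] Din[OF ls(1) f ls(2)] fg ls(3) by simp
  then show "t (g $$E$$ f) z = t g (t f z)"
   using t[of "g $$E$$ f" l s] f g fg ls set_functor.act_comp[OF Df[OF ls(1)] f g fg ls(2)] by simp
 qed
 interpret p: set_functor E p by (rule p)
 have pc: "p$e = c e" if "e : Obj E" for e using that by (simp add: p_def)
 define i where "i l = set_nat E (D$l) (%e. j e l) p" for l
 have app_i: "app (i l) e x = j e l x" if "e : Obj E" "x : D$l$e" for l e x
  using that by (simp add: i_def)
 have iH: "i l : Hom (set_power E) (D$l) p" if l: "l : P" for l
  unfolding i_def
 proof (rule set_nat_in_Hom[OF Df[OF l] p])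
  fix f x assume f: "f : Arr E" and x: "x : D$l$(Dom E f)"
  then show "j (Cod E f) l (act (D$l) f x) = act p f (j (Dom E f) l x)"
   using t[OF f l x] j[OF _ l x] by (simp add: p_def)
 qed (use j l pc in auto)
 have coc': "app (i m) e (app (farr D (l, m)) e x) = app (i l) e x"
  if "e : Obj E" "(l, m) : r" "x : D$l$e" for e l m x
  using app_i[OF that(1)] coc[OF that] app_in[OF Dr[OF that(2)] that(1,3)] that(3) by simp
 have pw: "pointwise_colimit P r E D p i"
  unfolding pointwise_colimit_def
 proof
  fix e assume e: "e : Obj E"
  show "elementwise_colimit P r (%l. D$l$e) (%k. app (farr D k) e) (p$e) (%l. app (i l) e)"
   using ec[OF e] unfolding elementwise_colimit_def pc[OF e] by (simp add: app_i[OF e] cong: bex_cong ball_cong)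
 qed
 have pO: "p : Obj (points U E)"
  using directed_colimit_left_exact[OF dir D p iH coc' pw] directed_colimit_cocontinuous[OF dir D p iH coc' pw]
   p.cat_functor_axioms by simp
 have "is_cocone (poset_category P r) (points U E) D p i"
  unfolding is_cocone_def
 proof (intro conjI ballI pO)
  fix l assume "l : Obj (poset_category P r)"
  then have l: "l : P" by simp
  show "i l : Hom (points U E) (D$l) p" using iH[OF l] Hom_points[OF pd(1) pO] l by simp
 next
  fix k assume k: "k : Arr (poset_category P r)"
  obtain l m where lm: "k = (l, m)" by (cases k)
  have r: "(l, m) : r" using k lm by simp
  have lP: "l : P" "m : P" using r dd(1) by auto
  have "i m $$set_power E$$ farr D (l, m) = i l"
   by (rule set_nat_eqI[OF functor_cat.comp_in[OF Dr[OF r] iH[OF lP(2)]] iH[OF lP(1)]])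
    (simp add: app_comp[OF Dr[OF r]] coc'[OF _ r])
  then show "i (Cod (poset_category P r) k) $$points U E$$ farr D k = i (Dom (poset_category P r) k)"
   using lm by simp
 qed
 then show ?thesis using pw by blast
qed

lemma points_colimitD:
 fixes D :: "('u, 'u \<times> 'u, ('o, 'a, 'u) set_funct, ('o, 'a, 'u) set_nat) funct"
 assumes E: "category E" and P: "small_set P" and dir: "directed_poset P r"
  and D: "cat_functor (poset_category P r) (points U E) D"
  and colim: "is_colimit (poset_category P r) (points U E) D p i"
 shows "pointwise_colimit P r E D p i"
proof -
 note pd = power_diagram[OF D] and dd = directed_posetD[OF dir]
 have coc: "is_cocone (poset_category P r) (points U E) D p i" using colim by (simp add: is_colimit_def)
 note c = cocone_at[OF D coc]
 obtain p' i' where coc': "is_cocone (poset_category P r) (points U E) D p' i'" and pw: "pointwise_colimit P r E D p' i'"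
  using points_directed_colimit_exists[OF E P dir D] by blast
 note c' = cocone_at[OF D coc']
 obtain u where u: "u : Hom (points U E) p p'" "!!l. l : P ==> u $$set_power E$$ i l = i' l"
  using colimit_factor[OF colim coc'] unfolding poset_category_simps points_simps by blast
 obtain v where v: "v : Hom (points U E) p' p" "!!l. l : P ==> v $$set_power E$$ i' l = i l"
  using colimit_factor[OF points_colimitI[OF dir D coc' pw] coc] unfolding poset_category_simps points_simps by blast
 note uH = Hom_pointsD[OF u(1)] and vH = Hom_pointsD[OF v(1)]
 have "v $$set_power E$$ u = Ident (set_power E) p"
 proof -
  have vu: "v $$set_power E$$ u : Hom (points U E) p p"
   using category.comp_in[OF category_points u(1) v(1)] by simp
  have idp: "Ident (set_power E) p : Hom (points U E) p p"
   using category.id_in[OF category_points c(1)] by simp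
  have "(v $$set_power E$$ u) $$set_power E$$ i l = i l" if "l : P" for l
   using functor_cat.assoc[OF c(2)[OF that] uH vH] u(2)[OF that] v(2)[OF that] by simp
  moreover have "Ident (set_power E) p $$set_power E$$ i l = i l" if "l : P" for l
   using functor_cat.id_left[OF c(2)[OF that]] .
  ultimately show ?thesis
   using vu idp colim coc unfolding is_colimit_def poset_category_simps points_simps(5) by blast
 qed
 then have vu: "app v e (app u e z) = z" if "e : Obj E" "z : p$e" for e z
  using app_comp[OF uH that, of v] app_ident[OF that] by simp
 show ?thesis
  unfolding pointwise_colimit_def elementwise_colimit_def
 proof (intro ballI conjI impI)
  fix e z assume e: "e : Obj E" and z: "z : p$e"
  have "app u e z : p'$e" using app_in[OF uH e z] .
  then obtain l x where lx: "l : P" "x : D$l$e" "app (i' l) e x = app u e z"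
   using pw e unfolding pointwise_colimit_def elementwise_colimit_def by blast
  have "app (i l) e x = app v e (app (i' l) e x)"
   using app_comp[OF c'(2)[OF lx(1)] e lx(2), of v] v(2)[OF lx(1)] by simp
  then have "app (i l) e x = z" using vu[OF e z] lx(3) by simp
  then show "EX l:P. EX x:fobj (D$l) e. app (i l) e x = z" using lx by blast
 next
  fix e l x y assume e: "e : Obj E" and l: "l : P" and x: "x : D$l$e" and y: "y : D$l$e"
   and eq: "app (i l) e x = app (i l) e y"
  have "app (i' l) e x = app (i' l) e y"
   using app_comp[OF c(2)[OF l] e x, of u] app_comp[OF c(2)[OF l] e y, of u] u(2)[OF l] eq by simp
  then show "EX m. (l, m) : r & app (farr D (l, m)) e x = app (farr D (l, m)) e y"
   using pw e l x y unfolding pointwise_colimit_def elementwise_colimit_def by blast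
 qed
qed

end

section \<open>Filtered categories and directed posets\<close>

definition filtered :: "('o, 'a) category => bool" where
 "filtered K <-> category K & Obj K \<noteq> {} \<and>
  (ALL a:Obj K. ALL b:Obj K. EX c. Hom K a c \<noteq> {} & Hom K b c \<noteq> {}) \<and>
  (ALL a b. ALL f:Hom K a b. ALL g:Hom K a b. EX c. EX h:Hom K b c. h $$K$$ f = h $$K$$ g)"

lemma filtered_object_bound:
 assumes "filtered K" "finite N" "N \<subseteq> Obj K"
 shows "EX v:Obj K. ALL w:N. Hom K w v \<noteq> {}"
 using assms(2,3)
proof (induction N)
 case empty
 then show ?case using assms(1) by (auto simp: filtered_def)
next
 case (insert a N)
 interpret category K using assms(1) by (simp add: filtered_def)
 obtain v where v: "v : Obj K" "ALL w:N. Hom K w v \<noteq> {}" using insert by blast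
 obtain c where "Hom K a c \<noteq> {}" "Hom K v c \<noteq> {}"
  using assms(1) v(1) insert.prems unfolding filtered_def by blast
 then obtain f g where f: "f : Hom K a c" and g: "g : Hom K v c" by blast
 have "Hom K w c \<noteq> {}" if "w : N" for w
  using v(2) that comp_in[OF _ g] by blast
 then show ?case using f Hom_obj[OF f] by blast
qed

lemma filtered_cocone:
 assumes "filtered K" "finite N" "N \<subseteq> Obj K" "finite M" "M \<subseteq> Arr K"
  and "!!m. m : M ==> Dom K m : N & Cod K m : N"
 shows "EX v l. v : Obj K & (ALL w:N. l w : Hom K w v) & (ALL m:M. l (Cod K m) $$K$$ m = l (Dom K m))"
 using assms(4-6)
proof (induction M)
 case empty
 obtain v where v: "v : Obj K" "ALL w:N. Hom K w v \<noteq> {}"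
  using filtered_object_bound[OF assms(1-3)] by blast
 have "ALL w:N. EX f. f : Hom K w v" using v(2) by blast
 from bchoice[OF this] obtain l where "ALL w:N. l w : Hom K w v" by blast
 then show ?case using v(1) by blast
next
 case (insert m M)
 interpret category K using assms(1) by (simp add: filtered_def)
 have ih: "EX v l. v : Obj K & (ALL w:N. l w : Hom K w v) & (ALL m:M. l (Cod K m) $$K$$ m = l (Dom K m))"
  using insert.IH insert.prems by blast
 then obtain v l where v: "v : Obj K" and l: "!!w. w : N ==> l w : Hom K w v"
   and c: "!!m. m : M ==> l (Cod K m) $$K$$ m = l (Dom K m)"
  by blast
 have m: "m : Hom K (Dom K m) (Cod K m)" "Dom K m : N" "Cod K m : N"
  using insert.prems by (auto simp: in_Hom)
 have "l (Cod K m) $$K$$ m : Hom K (Dom K m) v" using comp_in[OF m(1) l[OF m(3)]] .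
 then obtain v' h where h: "h : Hom K v v'" "h $$K$$ (l (Cod K m) $$K$$ m) = h $$K$$ l (Dom K m)"
  using assms(1) l[OF m(2)] unfolding filtered_def by blast
 have "(h $$K$$ l (Cod K n)) $$K$$ n = h $$K$$ l (Dom K n)" if n: "n : insert m M" for n
 proof -
  have nH: "n : Hom K (Dom K n) (Cod K n)" "Cod K n : N" using n insert.prems by (auto simp: in_Hom)
  have "(h $$K$$ l (Cod K n)) $$K$$ n = h $$K$$ (l (Cod K n) $$K$$ n)"
   using assoc[OF nH(1) l[OF nH(2)] h(1)] .
  then show ?thesis using n c h(2) by auto
 qed
 then show ?case
  using comp_in[OF l h(1)] Hom_obj[OF h(1)]
  by (intro exI[of _ v'] exI[of _ "%w. h $$K$$ l w"]) auto
qed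

text \<open>
 Arrows that are not identities raise the level, so this category has no loops other than the
 identities and above every finite set of objects there are objects outside the set.
\<close>

definition levelled :: "('o, 'a) category => ('o \<times> nat, 'a \<times> nat \<times> nat) category" where
 "levelled K =
  \<lparr>Obj = Obj K \<times> UNIV,
   Arr = {(k, n, m). k : Arr K & (n < m \<or> n = m & k = Ident K (Dom K k))},
   Dom = (%(k, n, m). (Dom K k, n)),
   Cod = (%(k, n, m). (Cod K k, m)),
   Ident = (%(a, n). (Ident K a, n, n)),
   Comp = (%h k. (fst h $$K$$ fst k, fst (snd k), snd (snd h)))\<rparr>"

lemma levelled_simps [simp]:
 "Obj (levelled K) = Obj K \<times> UNIV"
 "(k, n, m) : Arr (levelled K) <-> k : Arr K & (n < m \<or> n = m & k = Ident K (Dom K k))"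
 "Dom (levelled K) (k, n, m) = (Dom K k, n)" "Cod (levelled K) (k, n, m) = (Cod K k, m)"
 "Ident (levelled K) (a, n) = (Ident K a, n, n)"
 "(h, n', m') $$levelled K$$ (k, n, m) = (h $$K$$ k, n, m')"
 by (simp_all add: levelled_def)

lemma category_levelled:
 assumes "category K"
 shows "category (levelled K)"
proof -
 interpret category K by fact
 show ?thesis
 proof unfold_locales
  fix f a b g c assume fg: "f : Hom (levelled K) a b" "g : Hom (levelled K) b c"
  obtain f' n m g' n' m' where f': "f = (f', n, m)" "g = (g', n', m')" by (cases f; cases g) auto
  have arr: "f' : Arr K" "g' : Arr K" "Dom K g' = Cod K f'" "n' = m"
   using fg f' by (auto simp: in_Hom)
  have "n < m' \<or> n = m' & g' $$K$$ f' = Ident K (Dom K f')"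
  proof (cases "n < m'")
   case False
   then have "n = m" "m = m'" "f' = Ident K (Dom K f')" "g' = Ident K (Dom K g')" using fg f' arr by (auto simp: in_Hom)
   moreover from this(3) have "Cod K f' = Dom K f'" using arr(1) by (metis ident_simps(3) obj_simps(1))
   ultimately show ?thesis using arr by (metis id_simps(1))
  qed simp
  then show "g $$levelled K$$ f : Hom (levelled K) a c"
   using arr fg f' by (auto simp: in_Hom)
 next
  fix f a b g c h d
  assume fgh: "f : Hom (levelled K) a b" "g : Hom (levelled K) b c" "h : Hom (levelled K) c d"
  obtain f' n m g' n' m' h' n'' m'' where f': "f = (f', n, m)" "g = (g', n', m')" "h = (h', n'', m'')"
   by (cases f; cases g; cases h) auto
  show "h $$levelled K$$ g $$levelled K$$ f = h $$levelled K$$ (g $$levelled K$$ f)"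
   using fgh f' by (auto simp: in_Hom)
 qed (auto simp: in_Hom)
qed

lemma levelled_strict:
 assumes "category K" "f : Hom (levelled K) v w" "g : Hom (levelled K) w v"
 shows "v = w" "f = Ident (levelled K) v"
proof -
 interpret category K by fact
 obtain f' n m g' n' m' where f': "f = (f', n, m)" "g = (g', n', m')" by (cases f; cases g) auto
 have *: "n = m" "f' = Ident K (Dom K f')" "f' : Arr K" "v = (Dom K f', n)" "w = (Cod K f', m)"
  using assms(2,3) f' by (auto simp: in_Hom)
 moreover have "Cod K f' = Dom K f'" using *(2,3) by (metis ident_simps(3) obj_simps(1))
 ultimately show "v = w" "f = Ident (levelled K) v" using f' by auto
qed

text \<open>
 A finite diagram of arrows together with a cocone on it that is itself part of the diagram.
 Inclusions between such diagrams induce arrows between the vertices of their cocones.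
\<close>

definition top_of :: "('o, 'a) category => 'a set => 'o => bool" where
 "top_of T M v <-> finite M & M \<subseteq> Arr T & v : Obj T & Ident T v : M \<and>
  (ALL w:Dom T ` M \<union> Cod T ` M. EX! l. l : M & Dom T l = w & Cod T l = v) \<and>
  (ALL m:M. ALL l:M. Cod T l = v --> Dom T l = Cod T m --> l $$T$$ m : M)"

lemma top_of_extend:
 assumes "category K" and fin: "finite M" and M: "M \<subseteq> Arr (levelled K)" and v: "v : Obj (levelled K)"
  and N: "N = Dom (levelled K) ` M \<union> Cod (levelled K) ` M"
  and high: "!!w. w : N ==> snd w < snd v" and l: "!!w. w : N ==> l w : Hom (levelled K) w v"
  and c: "!!m. m : M ==> l (Cod (levelled K) m) $$levelled K$$ m = l (Dom (levelled K) m)"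
 shows "top_of (levelled K) (M \<union> l ` N \<union> {Ident (levelled K) v}) v"
proof -
 let ?T = "levelled K"
 interpret T: category ?T using category_levelled[OF assms(1)] .
 have vN: "v \<notin> N" using high by blast
 have lw: "l w : Arr ?T" "Dom ?T (l w) = w" "Cod ?T (l w) = v" if "w : N" for w
  using l[OF that] by (auto simp: in_Hom)
 have MN: "Dom ?T m : N" "Cod ?T m : N" if "m : M" for m using that N by auto
 have notv: "Cod ?T m \<noteq> v" "Dom ?T m \<noteq> v" if "m : M" for m using MN[OF that] vN by auto
 have idv: "Dom ?T (Ident ?T v) = v" "Cod ?T (Ident ?T v) = v" "Ident ?T v : Arr ?T" using v by (auto simp del: levelled_simps)
 let ?M = "M \<union> l ` N \<union> {Ident ?T v}"
 have into_v: "x = Ident ?T v \<or> (EX w:N. x = l w)" if "x : ?M" "Cod ?T x = v" for x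
  using that notv by blast
 show ?thesis
  unfolding top_of_def
 proof (intro conjI ballI impI)
  show "finite ?M" using fin N by simp
  show "?M \<subseteq> Arr ?T" using M lw(1) idv(3) by blast
 next
  fix w assume "w : Dom ?T ` ?M \<union> Cod ?T ` ?M"
  then obtain q where q: "q : ?M" "w = Dom ?T q \<or> w = Cod ?T q" by blast
  then consider "q : M" | w' where "w' : N" "q = l w'" | "q = Ident ?T v" by blast
  then have w: "w : N \<or> w = v"
  proof cases
   case 1
   then show ?thesis using MN q(2) by metis
  next
   case 2
   then show ?thesis using lw q(2) by metis
  next
   case 3
   then show ?thesis using idv q(2) by metis
  qed
  show "EX! x. x : ?M & Dom ?T x = w & Cod ?T x = v"
  proof (cases "w = v")
   case True
   show ?thesis
   proof (rule ex1I[of _ "Ident ?T v"])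
    show "x = Ident ?T v" if "x : ?M & Dom ?T x = w & Cod ?T x = v" for x
     using into_v[of x] that True lw(2) vN by metis
   qed (use True idv in blast)
  next
   case False
   then have wN: "w : N" using w by blast
   show ?thesis
   proof (rule ex1I[of _ "l w"])
    show "x = l w" if "x : ?M & Dom ?T x = w & Cod ?T x = v" for x
     using into_v[of x] that False lw(2) idv(1) by metis
   qed (use wN lw[OF wN] in blast)
  qed
 next
  fix m x assume m: "m : ?M" and x: "x : ?M" "Cod ?T x = v" "Dom ?T x = Cod ?T m"
  show "x $$?T$$ m : ?M"
  proof (cases "m : M")
   case True
   then have "x = l (Cod ?T m)" using into_v[OF x(1,2)] x(3) notv[OF True] lw(2) idv(1) by metis
   then show ?thesis using c[OF True] MN[OF True] by auto
  next
   case False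
   then have "Cod ?T m = v" using m lw idv by blast
   then have "x = Ident ?T v" using into_v[OF x(1,2)] x(3) lw(2) vN by metis
   moreover have "m : Arr ?T" using m M lw(1) idv(3) by blast
   ultimately have "x $$?T$$ m = m" using \<open>Cod ?T m = v\<close> T.id_simps(1) by metis
   then show ?thesis using m by simp
  qed
 qed (use v in auto)
qed

text \<open>
 Every small filtered category receives a cofinal functor from a small directed poset: the
 finite diagrams with a top, ordered by inclusion.
\<close>

lemma (in universe) filtered_directed_cover:
 assumes K: "filtered K" and small: "tiny (Obj K)" "tiny (Arr K)"
 shows "EX (P :: 'u set) r d dd. small_set P & directed_poset P r \<and>
  (ALL l:P. d l : Obj K & dd (l, l) = Ident K (d l)) \<and>
  (ALL l m. (l, m) : r --> dd (l, m) : Hom K (d l) (d m)) \<and>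
  (ALL l m n. (l, m) : r --> (m, n) : r --> dd (l, n) = dd (m, n) $$K$$ dd (l, m)) \<and>
  (ALL c:Obj K. EX l:P. Hom K c (d l) \<noteq> {}) \<and>
  (ALL l:P. ALL c. ALL k:Hom K (d l) c. EX m. (l, m) : r & (EX h:Hom K c (d m). h $$K$$ k = dd (l, m)))"
proof -
 let ?T = "levelled K"
 have catK: "category K" using K by (simp add: filtered_def)
 interpret K: category K by (rule catK)
 interpret T: category ?T by (rule category_levelled[OF catK])
 define L where "L = {M. EX v. top_of ?T M v}"
 define top where "top M = (SOME v. top_of ?T M v)" for M
 have top: "top_of ?T M (top M)" if "M : L" for M
  using that unfolding L_def top_def by (auto intro: someI)
 have fin: "finite M" and MT: "M \<subseteq> Arr ?T" and topT: "top M : Obj ?T" and idM: "Ident ?T (top M) : M"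
  and leg_ex: "!!w. w : Dom ?T ` M \<union> Cod ?T ` M ==> EX! l. l : M & Dom ?T l = w & Cod ?T l = top M"
  and closed: "!!m l. m : M ==> l : M ==> Cod ?T l = top M ==> Dom ?T l = Cod ?T m ==> l $$?T$$ m : M"
  if "M : L" for M
  using top[OF that] unfolding top_of_def by blast+
 have node: "top M : Dom ?T ` M' \<union> Cod ?T ` M'" if "M : L" "M \<subseteq> M'" for M M'
 proof -
  have "Dom ?T (Ident ?T (top M)) = top M" using topT[OF that(1)] by (rule T.ident_simps(2))
  then show ?thesis using idM[OF that(1)] that(2) by (metis UnI1 image_eqI subsetD)
 qed
 define leg where "leg M w = (THE l. l : M & Dom ?T l = w & Cod ?T l = top M)" for M w
 have leg: "leg M w : M" "Dom ?T (leg M w) = w" "Cod ?T (leg M w) = top M"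
  if "M : L" "w : Dom ?T ` M \<union> Cod ?T ` M" for M w
  using theI'[OF leg_ex[OF that]] unfolding leg_def by auto
 have leg_eq: "l = leg M (Dom ?T l)" if "M : L" "l : M" "Cod ?T l = top M" for M l
 proof -
  have "Dom ?T l : Dom ?T ` M \<union> Cod ?T ` M" using that(2) by blast
  then show ?thesis using leg_ex[OF that(1)] leg[OF that(1)] that(2,3) by metis
 qed
 have legH: "leg M w : Hom ?T w (top M)" if "M : L" "w : Dom ?T ` M \<union> Cod ?T ` M" for M w
  using leg[OF that] MT[OF that(1)] by (auto simp: in_Hom)
 have unique_top: "v = top M" if M: "M : L" and v: "top_of ?T M v" for M v
 proof -
  have vO: "v : Obj ?T" and vM: "Ident ?T v : M"
   and ex: "!!w. w : Dom ?T ` M \<union> Cod ?T ` M ==> EX! l. l : M & Dom ?T l = w & Cod ?T l = v"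
   using v unfolding top_of_def by blast+
  have "Dom ?T (Ident ?T v) = v" using vO by (rule T.ident_simps(2))
  then have "v : Dom ?T ` M \<union> Cod ?T ` M" using vM by (metis UnI1 image_eqI)
  then have 1: "leg M v : Hom ?T v (top M)" by (rule legH[OF M])
  obtain l where "l : M" "Dom ?T l = top M" "Cod ?T l = v" using ex[OF node[OF M subset_refl]] by blast
  then have "l : Hom ?T (top M) v" using MT[OF M] by (auto simp: in_Hom)
  with 1 show ?thesis using levelled_strict(1)[OF catK] by blast
 qed
 define tr where "tr M M' = leg M' (top M)" for M M'
 have trH: "tr M M' : Hom ?T (top M) (top M')" and trM: "tr M M' : M'"
  if "M : L" "M' : L" "M \<subseteq> M'" for M M'
  using legH[OF that(2) node[OF that(1,3)]] leg(1)[OF that(2) node[OF that(1,3)]] unfolding tr_def by auto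
 have tr_id: "tr M M = Ident ?T (top M)" if "M : L" for M
  using levelled_strict(2)[OF catK trH trH] that by blast
 have tr_comp: "tr M M'' = tr M' M'' $$?T$$ tr M M'"
  if M: "M : L" "M' : L" "M'' : L" "M \<subseteq> M'" "M' \<subseteq> M''" for M M' M''
 proof -
  note h = trH[OF M(1,2,4)] and h' = trH[OF M(2,3,5)]
  have "tr M M' : M''" "tr M' M'' : M''" using trM[OF M(1,2,4)] trM[OF M(2,3,5)] M(5) by blast+
  then have "tr M' M'' $$?T$$ tr M M' : M''"
   using closed[OF M(3)] HomD[OF h] HomD[OF h'] by simp
  from leg_eq[OF M(3) this HomD(3)[OF T.comp_in[OF h h']]]
  have "tr M' M'' $$?T$$ tr M M' = leg M'' (top M)"
   unfolding HomD(2)[OF T.comp_in[OF h h']] .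
  then show ?thesis by (simp add: tr_def)
 qed
 have extend: "EX M':L. M \<subseteq> M' & top M' = v & (ALL w:Dom ?T ` M \<union> Cod ?T ` M. leg M' w = l w)"
  if h: "finite M" "M \<subseteq> Arr ?T" "v : Obj ?T" "!!w. w : Dom ?T ` M \<union> Cod ?T ` M ==> snd w < snd v"
   "!!w. w : Dom ?T ` M \<union> Cod ?T ` M ==> l w : Hom ?T w v"
   "!!m. m : M ==> l (Cod ?T m) $$?T$$ m = l (Dom ?T m)"
  for M v l
 proof -
  let ?M' = "M \<union> l ` (Dom ?T ` M \<union> Cod ?T ` M) \<union> {Ident ?T v}"
  have t: "top_of ?T ?M' v" by (rule top_of_extend[OF catK h(1-3) refl h(4-6)])
  then have inL: "?M' : L" unfolding L_def by blast
  have tv: "top ?M' = v" using unique_top[OF inL t] by simp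
  have lg: "leg ?M' w = l w" if w: "w : Dom ?T ` M \<union> Cod ?T ` M" for w
  proof -
   note lw = HomD[OF h(5)[OF w]]
   have "l w = leg ?M' (Dom ?T (l w))"
    by (rule leg_eq[OF inL]) (use w in blast, simp only: lw(3) tv)
   then show ?thesis using lw(2) by metis
  qed
  show ?thesis
  proof (rule bexI[OF _ inL], intro conjI ballI)
   show "M \<subseteq> ?M'" by blast
   show "top ?M' = v" by (rule tv)
  qed (rule lg)
 qed
 have bound: "EX N. ALL w:Dom ?T ` M \<union> Cod ?T ` M. snd w < N" if "finite M" for M
 proof -
  have "finite (snd ` (Dom ?T ` M \<union> Cod ?T ` M))" using that by simp
  then obtain N where "ALL n:snd ` (Dom ?T ` M \<union> Cod ?T ` M). n < N"
   using finite_nat_set_iff_bounded by blast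
  then show ?thesis by blast
 qed
 have directed: "EX M'':L. M \<subseteq> M'' & M' \<subseteq> M''" if M: "M : L" "M' : L" for M M'
 proof -
  let ?M = "M \<union> M'"
  let ?N = "Dom ?T ` ?M \<union> Cod ?T ` ?M"
  have fM: "finite ?M" "?M \<subseteq> Arr ?T" using fin MT M by auto
  have NO: "?N \<subseteq> Obj ?T" using fM(2) T.obj_simps by blast
  have "EX v l. v : Obj K & (ALL w:fst ` ?N. l w : Hom K w v) & (ALL m:fst ` ?M. l (Cod K m) $$K$$ m = l (Dom K m))"
  proof (rule filtered_cocone[OF K])
   show "finite (fst ` ?N)" "finite (fst ` ?M)" using fM by auto
   show "fst ` ?N \<subseteq> Obj K" using NO by auto
   show "fst ` ?M \<subseteq> Arr K" using fM(2) by auto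
   fix m assume "m : fst ` ?M"
   then obtain q where q: "q : ?M" "m = fst q" by blast
   have "fst (Dom ?T q) = Dom K m" "fst (Cod ?T q) = Cod K m" using q(2) by (cases q; simp)+
   moreover have "Dom ?T q : ?N" "Cod ?T q : ?N" using q(1) by blast+
   ultimately show "Dom K m : fst ` ?N & Cod K m : fst ` ?N" by (metis imageI)
  qed
  then obtain v l where v: "v : Obj K" and l': "ALL w:fst ` ?N. l w : Hom K w v"
    and lc': "ALL m:fst ` ?M. l (Cod K m) $$K$$ m = l (Dom K m)"
   by (elim exE conjE)
  have l: "l (fst w) : Hom K (fst w) v" if "w : ?N" for w
   using bspec[OF l' imageI[OF that]] .
  have lc: "l (Cod K (fst m)) $$K$$ fst m = l (Dom K (fst m))" if "m : ?M" for m
   using bspec[OF lc' imageI[OF that]] .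
  obtain N where N: "!!w. w : ?N ==> snd w < N" using bound[OF fM(1)] by blast
  have "EX M'':L. ?M \<subseteq> M'' & top M'' = (v, N) & (ALL w:?N. leg M'' w = (l (fst w), snd w, N))"
  proof (rule extend[OF fM])
   show "(v, N) : Obj ?T" using v by simp
   show "snd w < snd (v, N)" if "w : ?N" for w using N[OF that] by simp
   show "(l (fst w), snd w, N) : Hom ?T w (v, N)" if "w : ?N" for w
    using l[OF that] N[OF that] by (cases w) (simp add: in_Hom)
   fix m assume m: "m : ?M"
   obtain k a b where mk: "m = (k, a, b)" by (cases m)
   show "(l (fst (Cod ?T m)), snd (Cod ?T m), N) $$?T$$ m = (l (fst (Dom ?T m)), snd (Dom ?T m), N)"
    using lc[OF m] mk by simp
  qed
  then show ?thesis by blast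
 qed
 have cover: "EX M:L. fst (top M) = c" if c: "c : Obj K" for c
 proof -
  have "EX M':L. {} \<subseteq> M' & top M' = (c, 0) & (ALL w:Dom ?T ` {} \<union> Cod ?T ` {}. leg M' w = undefined)"
   by (rule extend) (use c in auto)
  then obtain M where "M : L" "top M = (c, 0)" by blast
  then show ?thesis by (intro bexI[of _ M]) simp_all
 qed
 have absorb: "EX M':L. M \<subseteq> M' & fst (top M') = c & fst (tr M M') = k"
  if M: "M : L" and k: "k : Hom K (fst (top M)) c" for M c k
 proof -
  let ?N = "Dom ?T ` M \<union> Cod ?T ` M"
  obtain a n where an: "top M = (a, n)" by (cases "top M")
  have le: "snd w \<le> n" if "w : ?N" for w
  proof -
   obtain q i j where q: "leg M w = (q, i, j)" by (cases "leg M w")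
   show ?thesis using legH[OF M that] q an by (auto simp: in_Hom)
  qed
  have \<kappa>: "(k, n, Suc n) : Hom ?T (top M) (c, Suc n)" using k an by (simp add: in_Hom)
  have "EX M':L. M \<subseteq> M' & top M' = (c, Suc n) & (ALL w:?N. leg M' w = (k, n, Suc n) $$?T$$ leg M w)"
  proof (rule extend[OF fin[OF M] MT[OF M]])
   show "(c, Suc n) : Obj ?T" using T.Hom_obj[OF \<kappa>] by blast
   show "snd w < snd (c, Suc n)" if "w : ?N" for w using le[OF that] by simp
   show "(k, n, Suc n) $$?T$$ leg M w : Hom ?T w (c, Suc n)" if "w : ?N" for w
    by (rule T.comp_in[OF legH[OF M that] \<kappa>])
   fix m assume m: "m : M"
   have mH: "m : Hom ?T (Dom ?T m) (Cod ?T m)" using MT[OF M] m by (auto simp: in_Hom)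
   have cN: "Cod ?T m : ?N" using m by blast
   note lH = legH[OF M cN]
   have "leg M (Cod ?T m) $$?T$$ m : M" using closed[OF M m leg(1)[OF M cN]] leg(2,3)[OF M cN] by blast
   from leg_eq[OF M this HomD(3)[OF T.comp_in[OF mH lH]]]
   have "leg M (Cod ?T m) $$?T$$ m = leg M (Dom ?T m)"
    unfolding HomD(2)[OF T.comp_in[OF mH lH]] .
   then show "((k, n, Suc n) $$?T$$ leg M (Cod ?T m)) $$?T$$ m = (k, n, Suc n) $$?T$$ leg M (Dom ?T m)"
    using T.assoc[OF mH lH \<kappa>] by simp
  qed
  then obtain M' where M': "M' : L" "M \<subseteq> M'" "top M' = (c, Suc n)"
    "ALL w:?N. leg M' w = (k, n, Suc n) $$?T$$ leg M w" by (elim bexE conjE)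
  have "tr M M' = (k, n, Suc n) $$?T$$ tr M M"
   using bspec[OF M'(4) node[OF M subset_refl]] by (simp only: tr_def)
  also have "\<dots> = (k, n, Suc n)"
   using tr_id[OF M] T.id_right[OF \<kappa>] by simp
  finally have "fst (tr M M') = k" by simp
  then show ?thesis using M'(1-3) by (intro bexI[of _ M']) simp_all
 qed
 have "Arr ?T \<subseteq> Arr K \<times> (UNIV \<times> UNIV)" by (auto simp: levelled_def)
 then have "tiny (Arr ?T)"
  by (rule tiny_subset) (intro tiny_Times small tiny_nat)
 moreover have "L \<subseteq> Pow (Arr ?T)" using MT by blast
 ultimately have "tiny L" using tiny_subset tiny_Pow by blast
 then obtain e :: "_ => 'u" where e: "inj_on e L" "small_set (e ` L)" using encode by blast
 define dec where "dec = inv_into L e"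
 have dec: "dec l : L" "e (dec l) = l" if "l : e ` L" for l
  using that unfolding dec_def by (auto intro: inv_into_into f_inv_into_f)
 have dec_e: "dec (e M) = M" if "M : L" for M using that e(1) by (simp add: dec_def)
 define r where "r = {(l, m). l : e ` L & m : e ` L & dec l \<subseteq> dec m}"
 define d where "d l = fst (top (dec l))" for l
 define dd where "dd lm = fst (tr (dec (fst lm)) (dec (snd lm)))" for lm
 have fst_Hom: "fst x : Hom K (fst v) (fst w)" if "x : Hom ?T v w" for x v w
  using that by (cases x) (auto simp: in_Hom)
 show ?thesis
 proof (rule exI[of _ "e ` L"], rule exI[of _ r], rule exI[of _ d], rule exI[of _ dd], intro conjI ballI allI impI)
  show "small_set (e ` L)" by (rule e(2))
  show "directed_poset (e ` L) r"
   unfolding directed_poset_def partial_order_on_def preorder_on_def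
  proof (intro conjI ballI)
   show "r \<subseteq> e ` L \<times> e ` L" by (auto simp: r_def)
   show "refl_on (e ` L) r" by (auto simp: r_def refl_on_def)
   show "trans r" by (auto simp: r_def trans_def)
   show "antisym r" unfolding antisym_def r_def using dec(2) by (metis (no_types, lifting) case_prodD mem_Collect_eq subset_antisym)
   obtain c where "c : Obj K" using K by (auto simp: filtered_def)
   then show "e ` L \<noteq> {}" using cover by blast
   fix x y assume xy: "x : e ` L" "y : e ` L"
   obtain M where "M : L" "dec x \<subseteq> M" "dec y \<subseteq> M" using directed[OF dec(1)[OF xy(1)] dec(1)[OF xy(2)]] by blast
   then show "EX z:e ` L. (x, z) : r & (y, z) : r"
    using xy dec_e by (intro bexI[of _ "e M"]) (auto simp: r_def)
  qed
 next
  fix l assume l: "l : e ` L"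
  show "d l : Obj K" using topT[OF dec(1)[OF l]] by (auto simp: d_def)
  show "dd (l, l) = Ident K (d l)" using tr_id[OF dec(1)[OF l]] by (cases "top (dec l)") (simp add: dd_def d_def)
 next
  fix l m assume "(l, m) : r"
  then have "tr (dec l) (dec m) : Hom ?T (top (dec l)) (top (dec m))" using trH dec(1) by (auto simp: r_def)
  then show "dd (l, m) : Hom K (d l) (d m)" using fst_Hom by (simp add: dd_def d_def)
 next
  fix l m n assume "(l, m) : r" "(m, n) : r"
  then have "tr (dec l) (dec n) = tr (dec m) (dec n) $$?T$$ tr (dec l) (dec m)" using tr_comp dec(1) by (auto simp: r_def)
  then show "dd (l, n) = dd (m, n) $$K$$ dd (l, m)" by (simp add: dd_def levelled_def)
 next
  fix c assume c: "c : Obj K"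
  then obtain M where M: "M : L" "fst (top M) = c" using cover by blast
  have "Ident K c : Hom K c (d (e M))" using K.id_in[OF c] M by (simp add: d_def dec_e)
  then show "EX l:e ` L. Hom K c (d l) \<noteq> {}" using M(1) by blast
 next
  fix l c k assume l: "l : e ` L" and k: "k : Hom K (d l) c"
  obtain M where M: "M : L" "dec l \<subseteq> M" "fst (top M) = c" "fst (tr (dec l) M) = k"
   using absorb[OF dec(1)[OF l]] k by (auto simp: d_def)
  have "(l, e M) : r" using l M dec_e by (simp add: r_def)
  moreover have "Ident K c : Hom K c (d (e M))" "Ident K c $$K$$ k = dd (l, e M)"
   using K.id_in K.Hom_obj(2)[OF k] K.id_left[OF k] M by (auto simp: d_def dd_def dec_e)
  ultimately show "EX m. (l, m) : r & (EX h:Hom K c (d m). h $$K$$ k = dd (l, m))" by blast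
 qed
qed

section \<open>Evaluation functors\<close>

definition evaluation ::
 "(('o, 'a, 'u) set_funct, ('o, 'a, 'u) set_nat) category => 'o
  => (('o, 'a, 'u) set_funct, ('o, 'a, 'u) set_nat, 'u) set_funct" where
 "evaluation Q e = Funct (\<lambda>p\<in>Obj Q. p$e) (\<lambda>alp\<in>Arr Q. body alp e)"

lemma evaluation_simps [simp]:
 "p : Obj Q ==> (evaluation Q e)$p = p$e"
 "alp : Arr Q ==> farr (evaluation Q e) alp = body alp e"
 "alp : Arr Q ==> act (evaluation Q e) alp z = app alp e z"
 by (simp_all add: evaluation_def act_def app_def)

lemma evaluation_functor:
 assumes "Q = full_subcategory (set_power E) R" "e : Obj E"
 shows "set_functor Q (evaluation Q e)"
proof -
 have H: "alp : Hom (set_power E) p q" "p : Obj Q" "q : Obj Q" "alp : Arr Q" if "alp : Hom Q p q" for alp p q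
  using that functor_cat.obj_simps[of alp E Sets] unfolding assms(1) by (auto simp: in_Hom)
 have "category Q" unfolding assms(1) by (rule category_full_subcategory[OF category_functor_category])
 interpret Q: category Q by fact
 show ?thesis
 proof unfold_locales
  show "(evaluation Q e)$a : Obj Sets" if "a : Obj Q" for a
  proof -
   interpret a: set_functor E a using that assms(1) by (simp add: set_functor_def)
   show ?thesis using a.small[OF assms(2)] that by simp
  qed
  show "farr (evaluation Q e) f : Hom Sets ((evaluation Q e)$a) ((evaluation Q e)$b)"
   if "f : Hom Q a b" for f a b
   using nat_body_in[OF H(1)[OF that] assms(2)] H[OF that] by simp
  show "farr (evaluation Q e) (Ident Q a) = Ident Sets ((evaluation Q e)$a)" if "a : Obj Q" for a
   using that Q.ident_simps(1)[OF that] assms by (simp add: functor_category_ident)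
  show "farr (evaluation Q e) (g $$Q$$ f) = farr (evaluation Q e) g $$Sets$$ farr (evaluation Q e) f"
   if fg: "f : Hom Q a b" "g : Hom Q b c" for f a b g c
  proof -
   have "body (g $$Q$$ f) e = body g e $$Sets$$ body f e"
    using assms by (simp add: functor_category_comp)
   moreover have "g $$Q$$ f : Arr Q" using Q.comp_in[OF fg] by (simp add: in_Hom)
   ultimately show ?thesis using H(4)[OF fg(1)] H(4)[OF fg(2)] by simp
  qed
 qed (auto simp: evaluation_def)
qed

lemma full_subcategory_True: "full_subcategory C (%_. True) = C"
 by (simp add: full_subcategory_def)

section \<open>Yoneda\<close>

locale small_index = universe U + category X for U :: "'u itself" and X :: "('u, 'u) category" (structure) +
 assumes small_X: "small_category X"
begin

lemma tiny_X: "tiny (Obj X)" "tiny (Arr X)"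
 using small_X by (simp_all add: small_category_def small_set_tiny)

lemma small_Hom: "small_set (Hom X a b)"
 unfolding small_set_tiny by (rule tiny_subset[OF _ tiny_X(2)]) (auto simp: in_Hom)

definition yon :: "'u => 'u psh" where
 "yon x = set_funct X (Hom X x) (%f g. f \<cdot> g)"

lemma yon_simps [simp]:
 "z : Obj X ==> (yon x)$z = Hom X x z"
 "f : Arr X ==> g : Hom X x (Dom X f) ==> act (yon x) f g = f \<cdot> g"
 by (simp_all add: yon_def)

lemma set_functor_yon: "x : Obj X ==> set_functor X (yon x)"
 unfolding yon_def
 by (rule set_functor_set_funct[OF category_axioms small_Hom]) (auto simp: in_Hom)

lemma yon_obj: "x : Obj X ==> yon x : Obj (set_power X)"
 using set_functor_yon by (simp add: set_functor_def)

definition hat :: "'u => 'u => 'u psh => 'u psh_map" where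
 "hat x h H = set_nat X (yon x) (%z g. act H g h) H"

lemma app_hat [simp]: "g : Hom X x z ==> app (hat x h H) z g = act H g h"
 using Hom_obj[of g x z] by (simp add: hat_def)

lemma hat_in:
 assumes "set_functor X H" "x : Obj X" "h : H$x"
 shows "hat x h H : Hom (set_power X) (yon x) H"
proof -
 interpret H: set_functor X H by fact
 show ?thesis
  unfolding hat_def
 proof (rule set_nat_in_Hom[OF set_functor_yon[OF assms(2)] assms(1)])
  show "act H g h : H$z" if "z : Obj X" "g : (yon x)$z" for z g
   using that H.act_in[of g h] assms(3) by (auto simp: in_Hom)
  show "act H (act (yon x) f g) h = act H f (act H g h)" if "f : Arr X" "g : (yon x)$(Dom X f)" for f g
   using that assms(3) by (auto simp: in_Hom)
 qed
qed

lemma hat_unique: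
 assumes "\<tau> : Hom (set_power X) (yon x) H" "x : Obj X"
 shows "app \<tau> x (Ident X x) : H$x" "\<tau> = hat x (app \<tau> x (Ident X x)) H"
proof -
 note H = nat_functors(2)[OF assms(1)]
 show 1: "app \<tau> x (Ident X x) : H$x"
  using app_in[OF assms(1,2)] id_in[OF assms(2)] assms(2) by simp
 show "\<tau> = hat x (app \<tau> x (Ident X x)) H"
 proof (rule set_nat_eqI[OF assms(1) hat_in[OF H assms(2) 1]])
  fix z g assume z: "z : Obj X" "g : (yon x)$z"
  then have g: "g : Hom X x z" by simp
  note g' = HomD[OF g]
  have "app \<tau> z (act (yon x) g (Ident X x)) = act H g (app \<tau> x (Ident X x))"
   using app_natural[OF assms(1) g'(1), of "Ident X x"] g' id_in[OF assms(2)] assms(2) by simp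
  then show "app \<tau> z g = app (hat x (app \<tau> x (Ident X x)) H) z g"
   using g g' id_in[OF assms(2)] by simp
 qed
qed

lemma hat_eq_iff:
 assumes "set_functor X H" "x : Obj X" "h : H$x" "h' : H$x" "hat x h H = hat x h' H"
 shows "h = h'"
proof -
 interpret H: set_functor X H by fact
 have "app (hat x h H) x (Ident X x) = app (hat x h' H) x (Ident X x)" using assms(5) by simp
 then show ?thesis using id_in[OF assms(2)] assms(2-4) by simp
qed

lemma comp_hat:
 assumes alp: "alp : Hom (set_power X) H H'" and x: "x : Obj X" "h : H$x"
 shows "alp $$set_power X$$ hat x h H = hat x (app alp x h) H'"
proof -
 note HH = nat_functors[OF alp] and h = hat_in[OF nat_functors(1)[OF alp] x]
 note h' = hat_in[OF HH(2) x(1) app_in[OF alp x]]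
 show ?thesis
 proof (rule set_nat_eqI[OF functor_cat.comp_in[OF h alp] h'])
  fix z g assume z: "z : Obj X" "g : (yon x)$z"
  then have g: "g : Hom X x z" by simp
  then show "app (alp $$set_power X$$ hat x h H) z g = app (hat x (app alp x h) H') z g"
   using app_comp[OF h z, of alp] app_natural[OF alp HomD(1)[OF g], of h] HomD[OF g] x(2) by simp
 qed
qed

definition yarr :: "'u => 'u psh_map" where
 "yarr f = hat (Cod X f) f (yon (Dom X f))"

lemma yarr_in: "f : Hom X a b ==> yarr f : Hom (set_power X) (yon b) (yon a)"
 unfolding yarr_def using hat_in[OF set_functor_yon, of a b f] Hom_obj[of f a b] HomD[of f X a b] by auto

lemma app_yarr: "f : Hom X a b ==> g : Hom X b z ==> app (yarr f) z g = g \<cdot> f"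
 by (auto simp: yarr_def in_Hom)

lemma hat_yarr:
 assumes "set_functor X H" "f : Hom X a b" "h : H$a"
 shows "hat a h H $$set_power X$$ yarr f = hat b (act H f h) H"
proof -
 note ab = Hom_obj[OF assms(2)] and f = HomD[OF assms(2)]
 have "hat a h H $$set_power X$$ hat b f (yon a) = hat b (app (hat a h H) b f) H"
  by (rule comp_hat[OF hat_in[OF assms(1) ab(1) assms(3)] ab(2)]) (use assms(2) ab in simp)
 then show ?thesis using f assms(2) by (simp add: yarr_def)
qed

lemma yarr_comp:
 assumes "f : Hom X a b" "g : Hom X b c"
 shows "yarr (g \<cdot> f) = yarr f $$set_power X$$ yarr g"
proof -
 note ab = Hom_obj[OF assms(1)] and bc = Hom_obj[OF assms(2)]
 have "yarr f $$set_power X$$ yarr g = hat c (act (yon a) g f) (yon a)"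
  using hat_yarr[OF set_functor_yon[OF ab(1)] assms(2), of f] assms(1) ab HomD[OF assms(1)]
  by (simp add: yarr_def)
 then show ?thesis using assms comp_in[OF assms] by (simp add: yarr_def in_Hom)
qed

lemma yarr_ident: "x : Obj X ==> yarr (Ident X x) = Ident (set_power X) (yon x)"
 by (rule set_nat_eqI[OF yarr_in[OF id_in] functor_cat.id_in[OF yon_obj]])
  (auto simp: app_yarr[OF id_in] app_ident in_Hom)

text \<open>By Yoneda the value at an object is represented, so limits are computed pointwise.\<close>

lemma power_limitD:
 fixes D :: "('j, 'k, 'u psh, 'u psh_map) funct"
 assumes D: "cat_functor J (set_power X) D" and lim: "is_limit J (set_power X) D c p" and x: "x : Obj X"
 shows "elementwise_limit J (%j. D$j$x) (%k. app (farr D k) x) (c$x) (%j. app (p j) x)"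
 unfolding elementwise_limit_def
proof (intro allI impI)
 interpret D: cat_functor J "set_power X" D by fact
 have Dj: "set_functor X (D$j)" if "j : Obj J" for j using D.fobj_in[OF that] by (simp add: set_functor_def)
 have c: "set_functor X c" and p: "!!j. j : Obj J ==> p j : Hom (set_power X) c (D$j)"
  using lim by (auto simp: is_limit_def is_cone_def set_functor_def)
 fix z assume z: "compatible_family J (%j. D$j$x) (%k. app (farr D k) x) z"
 then have zj: "!!j. j : Obj J ==> z j : D$j$x" by (simp add: compatible_family_def)
 have q: "hat x (z j) (D$j) : Hom (set_power X) (yon x) (D$j)" if "j : Obj J" for j
  by (rule hat_in[OF Dj[OF that] x zj[OF that]])
 have "is_cone J (set_power X) D (yon x) (%j. hat x (z j) (D$j))"
  unfolding is_cone_def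
 proof (intro conjI ballI q yon_obj[OF x])
  fix k assume k: "k : Arr J"
  then have d: "Dom J k : Obj J" by simp
  show "farr D k $$set_power X$$ hat x (z (Dom J k)) (D$(Dom J k)) = hat x (z (Cod J k)) (D$(Cod J k))"
   using comp_hat[OF D.farr_Hom[OF k] x zj[OF d]] z k by (simp add: compatible_family_def)
 qed
 from limit_factor[OF lim this] obtain u where u: "u : Hom (set_power X) (yon x) c"
   "!!j. j : Obj J ==> p j $$set_power X$$ u = hat x (z j) (D$j)"
   and uu: "!!v. v : Hom (set_power X) (yon x) c ==> (ALL j:Obj J. p j $$set_power X$$ v = hat x (z j) (D$j)) ==> v = u"
  by blast
 let ?w = "app u x (Ident X x)"
 note w = hat_unique[OF u(1) x]
 show "EX! w. w : c$x & (ALL j:Obj J. app (p j) x w = z j)"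
 proof (rule ex1I[of _ ?w])
  have "app (p j) x ?w = z j" if j: "j : Obj J" for j
  proof (rule hat_eq_iff[OF Dj[OF j] x app_in[OF p[OF j] x w(1)] zj[OF j]])
   show "hat x (app (p j) x ?w) (D$j) = hat x (z j) (D$j)"
    using comp_hat[OF p[OF j] x w(1)] w(2) u(2)[OF j] by simp
  qed
  then show "?w : c$x & (ALL j:Obj J. app (p j) x ?w = z j)" using w(1) by blast
 next
  fix v assume v: "v : c$x & (ALL j:Obj J. app (p j) x v = z j)"
  have "p j $$set_power X$$ hat x v c = hat x (z j) (D$j)" if j: "j : Obj J" for j
   using comp_hat[OF p[OF j] x, of v] v j by simp
  then have "hat x v c = u" using uu[OF hat_in[OF c x]] v by blast
  then have "hat x v c = hat x ?w c" using w(2) by simp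
  then show "v = ?w" using hat_eq_iff[OF c x _ w(1)] v by blast
 qed
qed

section \<open>Evaluations at representing objects are points\<close>

abbreviation ev :: "'u => 'u psh_funct" where
 "ev x \<equiv> evaluation (set_power X) x"

lemma set_functor_ev: "x : Obj X ==> set_functor (set_power X) (ev x)"
 by (rule evaluation_functor[of _ X "%_. True"]) (simp_all add: full_subcategory_True)

lemma ev_left_exact:
 assumes x: "x : Obj X"
 shows "left_exact (set_power X) Sets (ev x)"
 unfolding left_exact_def preserves_limits_of_shape_def
proof (intro conjI allI impI)
 interpret ev: set_functor "set_power X" "ev x" by (rule set_functor_ev[OF x])
 show "cat_functor (set_power X) Sets (ev x)" by (rule ev.cat_functor_axioms)
 fix J :: "(nat, nat) category" and D :: "(nat, nat, 'u psh, 'u psh_map) funct" and c p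
 assume D: "cat_functor J (set_power X) D" and lim: "is_limit J (set_power X) D c p"
 interpret D: cat_functor J "set_power X" D by (rule D)
 have cone: "is_cone J (set_power X) D c p" using lim by (simp add: is_limit_def)
 have e: "elementwise_limit J (%j. D$j$x) (%k. app (farr D k) x) (c$x) (%j. app (p j) x)"
  by (rule power_limitD[OF D lim x])
 have c: "c : Obj (set_power X)" and p: "!!j. j : Obj J ==> p j : Arr (set_power X)"
  using cone by (auto simp: is_cone_def in_Hom)
 show "is_limit J Sets (comp_funct J (ev x) D) ((ev x)$c) (%j. farr (ev x) (p j))"
 proof (rule set_limitI[OF cat_functor_comp[OF D ev.cat_functor_axioms] cone_image[OF ev.cat_functor_axioms D cone]])
  have Da: "farr D k : Arr (set_power X)" if "k : Arr J" for k using that by (rule D.arr_simps)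
  have Do: "D$j : Obj (set_power X)" if "j : Obj J" for j using that by (rule D.fobj_in)
  have 1: "(comp_funct J (ev x) D)$j = D$j$x" if "j : Obj J" for j
   using Do[OF that] that by (simp only: comp_funct_simps evaluation_simps)
  have 2: "act (comp_funct J (ev x) D) k = app (farr D k) x" if "k : Arr J" for k
   using Da[OF that] that by (auto simp: act_def app_def fun_eq_iff)
  have 3: "body (farr (ev x) (p j)) = app (p j) x" if "j : Obj J" for j
   using p[OF that] by (auto simp: app_def fun_eq_iff)
  show "elementwise_limit J (fobj (comp_funct J (ev x) D)) (act (comp_funct J (ev x) D)) ((ev x)$c) (%j. body (farr (ev x) (p j)))"
   using e c unfolding elementwise_limit_def compatible_family_def
   by (simp add: 1 2 3 cong: ball_cong del: functor_category_simps comp_funct_simps)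
 qed
qed

text \<open>
 Evaluation at \<open>x\<close> has a right adjoint, which sends a set \<open>A\<close> to \<open>y \<mapsto> A\<^bsup>Hom(y, x)\<^esup>\<close>.
 Its values are encoded as sets of elements of \<open>'u\<close>.
\<close>

lemma ev_cocontinuous:
 assumes x: "x : Obj X"
 shows "cocontinuous U (set_power X) Sets (ev x)"
 unfolding cocontinuous_def
proof (intro conjI allI impI preserves_colimits_of_couniversal)
 show evf: "cat_functor (set_power X) Sets (ev x)" using set_functor_ev[OF x] by (simp add: set_functor_def)
 then show "cat_functor (set_power X) Sets (ev x)" .
 interpret ev: cat_functor "set_power X" Sets "ev x" by (rule evf)
 fix S :: "'u set" assume "S : Obj Sets"
 then have S: "small_set S" by simp
 have idx: "Ident X x : Hom X x x" by (rule id_in[OF x])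
 define W where "W = (UN y:Obj X. Hom X y x \<rightarrow>\<^sub>E S)"
 have "tiny W"
  unfolding W_def by (intro tiny_UN tiny_PiE tiny_X) (use S small_Hom in \<open>simp_all add: small_set_tiny\<close>)
 then obtain enc :: "('u => 'u) => 'u" where enc: "inj_on enc W" "small_set (enc ` W)" using encode by blast
 define dec where "dec = inv_into W enc"
 have dec: "dec (enc phi) = phi" if "y : Obj X" "phi : Hom X y x \<rightarrow>\<^sub>E S" for y phi
  unfolding dec_def by (rule inv_into_f_f[OF enc(1)]) (use that in \<open>auto simp: W_def\<close>)
 define sh where "sh f u = enc (\<lambda>g\<in>Hom X (Cod X f) x. dec u (g \<cdot> f))" for f u
 define R where "R = set_funct X (%y. enc ` (Hom X y x \<rightarrow>\<^sub>E S)) sh"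
 have sh: "sh f (enc phi) = enc (\<lambda>g\<in>Hom X b x. phi (g \<cdot> f)) & (\<lambda>g\<in>Hom X b x. phi (g \<cdot> f)) : Hom X b x \<rightarrow>\<^sub>E S"
  if f: "f : Hom X a b" and phi: "phi : Hom X a x \<rightarrow>\<^sub>E S" for f a b phi
 proof -
  have "g \<cdot> f : Hom X a x" if "g : Hom X b x" for g by (rule comp_in[OF f that])
  then have "(\<lambda>g\<in>Hom X b x. phi (g \<cdot> f)) : Hom X b x \<rightarrow>\<^sub>E S" using phi by (auto simp: PiE_iff)
  then show ?thesis using dec[OF Hom_obj(1)[OF f] phi] HomD[OF f] by (simp add: sh_def)
 qed
 have R: "set_functor X R"
  unfolding R_def
 proof (rule set_functor_set_funct[OF category_axioms])
  show "small_set (enc ` (Hom X a x \<rightarrow>\<^sub>E S))" if "a : Obj X" for a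
   using enc(2) tiny_subset[of "enc ` (Hom X a x \<rightarrow>\<^sub>E S)" "enc ` W"] that by (auto simp: small_set_tiny W_def)
  show "sh f u : enc ` (Hom X (Cod X f) x \<rightarrow>\<^sub>E S)" if f: "f : Arr X" and u: "u : enc ` (Hom X (Dom X f) x \<rightarrow>\<^sub>E S)" for f u
  proof -
   obtain phi where phi: "phi : Hom X (Dom X f) x \<rightarrow>\<^sub>E S" "u = enc phi" using u by blast
   have "f : Hom X (Dom X f) (Cod X f)" using f by (simp add: in_Hom)
   from sh[OF this phi(1)] show ?thesis using phi(2) by simp
  qed
  show "sh (Ident X a) u = u" if a: "a : Obj X" and u: "u : enc ` (Hom X a x \<rightarrow>\<^sub>E S)" for a u
  proof -
   obtain phi where phi: "phi : Hom X a x \<rightarrow>\<^sub>E S" "u = enc phi" using u by blast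
   have "(\<lambda>g\<in>Hom X a x. phi (g \<cdot> Ident X a)) = phi"
    by (rule extensionalityI[of _ "Hom X a x"]) (use phi(1) in \<open>auto simp: PiE_iff in_Hom\<close>)
   then show ?thesis using sh[OF id_in[OF a] phi(1)] phi(2) by simp
  qed
  show "sh (g \<cdot> f) u = sh g (sh f u)"
   if fg: "f : Arr X" "g : Arr X" "Dom X g = Cod X f" and u: "u : enc ` (Hom X (Dom X f) x \<rightarrow>\<^sub>E S)" for f g u
  proof -
   obtain phi where phi: "phi : Hom X (Dom X f) x \<rightarrow>\<^sub>E S" "u = enc phi" using u by blast
   have f: "f : Hom X (Dom X f) (Cod X f)" and g: "g : Hom X (Cod X f) (Cod X g)" using fg by (simp_all add: in_Hom)
   have "(\<lambda>h\<in>Hom X (Cod X g) x. phi (h \<cdot> (g \<cdot> f))) = (\<lambda>h\<in>Hom X (Cod X g) x. (\<lambda>h\<in>Hom X (Cod X f) x. phi (h \<cdot> f)) (h \<cdot> g))"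
    by (rule restrict_ext) (use comp_in[OF g] assoc[OF f g] in simp)
   then show ?thesis
    using sh[OF comp_in[OF f g] phi(1)] sh[OF f phi(1)] sh[OF g, of "\<lambda>h\<in>Hom X (Cod X f) x. phi (h \<cdot> f)"] phi(2) by simp
  qed
 qed
 have Ro: "R$y = enc ` (Hom X y x \<rightarrow>\<^sub>E S)" if "y : Obj X" for y using that by (simp add: R_def)
 have evo: "(ev x)$H = H$x" if "set_functor X H" for H using that by (intro evaluation_simps(1)) (simp add: set_functor_def)
 define e where "e = set_map (R$x) (%u. dec u (Ident X x)) S"
 have e: "e : Hom Sets ((ev x)$R) S"
  unfolding e_def evo[OF R]
 proof (rule set_map_in_Hom[OF set_functor.small[OF R x] S])
  show "dec u (Ident X x) : S" if "u : R$x" for u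
   using that dec[OF x] idx by (auto simp: Ro[OF x])
 qed
 have ap: "body (e $$Sets$$ farr (ev x) alp) s = dec (app alp x s) (Ident X x)"
  if alp: "alp : Hom (set_power X) a R" and s: "s : a$x" for alp a s
  using set_comp_apply[OF ev.farr_in[OF alp], of s e] s evo[OF nat_functors(1)[OF alp]] evaluation_simps(3)[OF HomD(1)[OF alp], of x s]
   app_in[OF alp x s] by (simp add: e_def act_def)
 have key: "app alp y s = enc (\<lambda>g\<in>Hom X y x. dec (app alp x (act a g s)) (Ident X x))"
  if alp: "alp : Hom (set_power X) a R" and y: "y : Obj X" and s: "s : a$y" for alp a y s
 proof -
  obtain phi where phi: "phi : Hom X y x \<rightarrow>\<^sub>E S" "app alp y s = enc phi" using app_in[OF alp y s] Ro[OF y] by auto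
  have "dec (app alp x (act a g s)) (Ident X x) = phi g" if g: "g : Hom X y x" for g
  proof -
   have "app alp x (act a g s) = sh g (enc phi)"
    using app_natural[OF alp, of g s] HomD[OF g] s phi Ro[OF y] by (simp add: R_def)
   also have "\<dots> = enc (\<lambda>h\<in>Hom X x x. phi (h \<cdot> g))" using sh[OF g phi(1)] by simp
   finally show ?thesis using dec[OF x conjunct2[OF sh[OF g phi(1)]]] idx HomD[OF g] by simp
  qed
  then have "phi = (\<lambda>g\<in>Hom X y x. dec (app alp x (act a g s)) (Ident X x))"
   by (intro extensionalityI[of _ "Hom X y x"]) (use phi(1) in \<open>auto simp: PiE_iff\<close>)
  then show ?thesis using phi(2) by simp
 qed
 have "bij_betw (%alp. e $$Sets$$ farr (ev x) alp) (Hom (set_power X) a R) (Hom Sets ((ev x)$a) S)"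
  if "a : Obj (set_power X)" for a
 proof (rule bij_betwI')
  have a: "set_functor X a" using that by (simp add: set_functor_def)
  show "e $$Sets$$ farr (ev x) alp : Hom Sets ((ev x)$a) S" if "alp : Hom (set_power X) a R" for alp
   by (rule set_comp_in[OF ev.farr_in[OF that] e])
  show "e $$Sets$$ farr (ev x) alp = e $$Sets$$ farr (ev x) bet <-> alp = bet"
   if alp: "alp : Hom (set_power X) a R" and bet: "bet : Hom (set_power X) a R" for alp bet
  proof
   assume eq: "e $$Sets$$ farr (ev x) alp = e $$Sets$$ farr (ev x) bet"
   have eq': "dec (app alp x s) (Ident X x) = dec (app bet x s) (Ident X x)" if "s : a$x" for s
    using ap[OF alp that] ap[OF bet that] eq by simp
   show "alp = bet"
   proof (rule set_nat_eqI[OF alp bet])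
    fix y s assume y: "y : Obj X" and s: "s : a$y"
    have "act a g s : a$x" if "g : Hom X y x" for g
     using set_functor.act_in[OF a, of g s] HomD[OF that] s by simp
    then show "app alp y s = app bet y s"
     unfolding key[OF alp y s] key[OF bet y s] using eq' by (intro arg_cong[of _ _ enc] restrict_ext) simp
   qed
  qed simp
  fix k assume k: "k : Hom Sets ((ev x)$a) S"
  define t where "t y s = (\<lambda>g\<in>Hom X y x. body k (act a g s))" for y s
  have ag: "act a g s : a$z" if "g : Hom X y z" "s : a$y" for g y z s
   using set_functor.act_in[OF a, of g s] HomD[OF that(1)] that(2) by simp
  have kS: "body k s : S" if "s : a$x" for s using set_arrow_in[OF k] evo[OF a] that by simp
  have t: "t y s : Hom X y x \<rightarrow>\<^sub>E S" if "s : a$y" for y s using kS ag that by (auto simp: t_def)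
  have alp: "set_nat X a (%y s. enc (t y s)) R : Hom (set_power X) a R"
  proof (rule set_nat_in_Hom[OF a R])
   show "enc (t y s) : R$y" if "y : Obj X" "s : a$y" for y s using t that Ro by simp
   fix f s assume f: "f : Arr X" and s: "s : a$(Dom X f)"
   have ff: "f : Hom X (Dom X f) (Cod X f)" using f by (simp add: in_Hom)
   have "act a g (act a f s) = act a (g \<cdot> f) s" if "g : Hom X (Cod X f) x" for g
    using set_functor.act_comp[OF a, of f g s] f s HomD[OF that] by simp
   then have "t (Cod X f) (act a f s) = (\<lambda>g\<in>Hom X (Cod X f) x. t (Dom X f) s (g \<cdot> f))"
    unfolding t_def by (intro restrict_ext) (use comp_in[OF ff] in simp)
   moreover have "act R f (enc (t (Dom X f) s)) = sh f (enc (t (Dom X f) s))" using f t[OF s] by (simp add: R_def)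
   ultimately show "enc (t (Cod X f) (act a f s)) = act R f (enc (t (Dom X f) s))" using sh[OF ff t[OF s]] by simp
  qed
  have "e $$Sets$$ farr (ev x) (set_nat X a (%y s. enc (t y s)) R) = k"
  proof (rule set_arrow_eqI[OF set_comp_in[OF ev.farr_in[OF alp] e] k])
   fix s assume "s : (ev x)$a"
   then have s: "s : a$x" using evo[OF a] by simp
   have "dec (enc (t x s)) (Ident X x) = body k s"
    using dec[OF x t[OF s]] idx set_functor.act_id[OF a x s] by (simp add: t_def)
   then show "body (e $$Sets$$ farr (ev x) (set_nat X a (%y s. enc (t y s)) R)) s = body k s"
    using ap[OF alp s] x s by simp
  qed
  with alp show "EX alp:Hom (set_power X) a R. k = e $$Sets$$ farr (ev x) alp" by blast
 qed
 then show "EX r e. r : Obj (set_power X) & e : Hom Sets ((ev x)$r) S \<and>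
   (ALL a:Obj (set_power X). bij_betw (%alp. e $$Sets$$ farr (ev x) alp) (Hom (set_power X) a r) (Hom Sets ((ev x)$a) S))"
  using e R by (intro exI[of _ R] exI[of _ e]) (simp add: set_functor_def)
qed

lemma ev_point: "x : Obj X ==> ev x : Obj (points U (set_power X))"
 using ev_left_exact ev_cocontinuous by (simp add: left_exact_def)

end

section \<open>Points of presheaf topoi as directed colimits of evaluations\<close>

context small_index
begin

lemma comp_hat_app:
 assumes p: "set_functor (set_power X) p" and alp: "alp : Hom (set_power X) H H'"
  and x: "x : Obj X" "h : H$x" and t: "t : p$(yon x)"
 shows "act p alp (act p (hat x h H) t) = act p (hat x (app alp x h) H') t"
proof -
 interpret p: set_functor "set_power X" p by fact
 note h = hat_in[OF nat_functors(1)[OF alp] x]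
 show ?thesis
  using p.act_comp[of "hat x h H" alp t] comp_hat[OF alp x] HomD[OF h] HomD[OF alp] t by simp
qed

lemma act_hat_in:
 assumes p: "set_functor (set_power X) p" and H: "set_functor X H" and x: "x : Obj X" "h : H$x"
  and t: "t : p$(yon x)"
 shows "act p (hat x h H) t : p$H"
 using set_functor.act_in[OF p, of "hat x h H" t] hat_in[OF H x] t by (simp add: in_Hom)

lemma hat_yarr_app:
 assumes p: "set_functor (set_power X) p" and H: "set_functor X H" and f: "f : Hom X a b" and h: "h : H$a"
  and t: "t : p$(yon b)"
 shows "act p (hat a h H) (act p (yarr f) t) = act p (hat b (act H f h) H) t"
proof -
 interpret p: set_functor "set_power X" p by fact
 note y = yarr_in[OF f] and hh = hat_in[OF H Hom_obj(1)[OF f] h]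
 show ?thesis
  using p.act_comp[of "yarr f" "hat a h H" t] hat_yarr[OF H f h] HomD[OF hh] HomD[OF y] t by simp
qed

lemma act_yarr_in:
 assumes p: "set_functor (set_power X) p" and f: "f : Hom X a b" and t: "t : p$(yon b)"
 shows "act p (yarr f) t : p$(yon a)"
 using set_functor.act_in[OF p, of "yarr f" t] HomD[OF yarr_in[OF f]] t by simp

text \<open>
 Every functor is the colimit of representable functors over its category of elements, whose
 objects and arrows are encoded as pairs. A cocontinuous functor preserves this colimit, and the
 legs of a colimit of sets are jointly surjective.
\<close>

lemma covered_by_representables:
 fixes p :: "'u psh_funct"
 assumes p: "cocontinuous U (set_power X) Sets p" and H: "set_functor X H" and z: "z : p$H"
 shows "EX x:Obj X. EX h:fobj H x. EX t:fobj p (yon x). act p (hat x h H) t = z"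
proof -
 interpret H: set_functor X H by (rule H)
 have pf: "cat_functor (set_power X) Sets p" using p by (simp add: cocontinuous_def)
 obtain pr :: "'u \<times> 'u => 'u" where pr: "inj pr" using pairing .
 define p1 where "p1 a = fst (inv pr a)" for a
 define p2 where "p2 a = snd (inv pr a)" for a
 have pr_simps [simp]: "p1 (pr (a, b)) = a" "p2 (pr (a, b)) = b" for a b
  using pr by (simp_all add: p1_def p2_def)
 have pr_eq [simp]: "pr u = pr v <-> u = v" for u v using pr by (simp add: inj_eq)
 define J where "J = \<lparr>Obj = pr ` (Sigma (Obj X) (fobj H)), Arr = pr ` (Sigma (Arr X) (%f. H$(Dom X f))),
   Dom = (%a. pr (Cod X (p1 a), act H (p1 a) (p2 a))), Cod = (%a. pr (Dom X (p1 a), p2 a)),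
   Ident = (%a. pr (Ident X (p1 a), p2 a)), Comp = (%b a. pr (p1 a \<cdot> p1 b, p2 b))\<rparr>"
 have J_simps [simp]: "Obj J = pr ` (Sigma (Obj X) (fobj H))" "Arr J = pr ` (Sigma (Arr X) (%f. H$(Dom X f)))"
   "Dom J (pr (f, h)) = pr (Cod X f, act H f h)" "Cod J (pr (f, h)) = pr (Dom X f, h)"
   "Ident J (pr (x, h)) = pr (Ident X x, h)" "pr (f', h') $$J$$ pr (f, h) = pr (f \<cdot> f', h')"
  for f h x f' h' by (simp_all add: J_def)
 have Jcat: "category J"
 proof unfold_locales
  fix f assume "f : Arr J" then show "Dom J f : Obj J" "Cod J f : Obj J" by (auto intro: H.act_in)
 next
  fix a assume "a : Obj J" then show "Ident J a : Hom J a a" by (auto simp: in_Hom)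
 next
  fix f a b g c assume "f : Hom J a b" "g : Hom J b c"
  then show "g $$J$$ f : Hom J a c" by (auto simp: in_Hom)
 next
  fix f a b assume "f : Hom J a b"
  then show "Ident J b $$J$$ f = f" "f $$J$$ Ident J a = f" by (auto simp: in_Hom)
 next
  fix f a b g c h d assume "f : Hom J a b" "g : Hom J b c" "h : Hom J c d"
  then show "h $$J$$ g $$J$$ f = h $$J$$ (g $$J$$ f)" by (auto simp: in_Hom)
 qed
 have Jsmall: "small_category J"
  unfolding small_category_def small_set_tiny
 proof (intro conjI Jcat)
  have "tiny (H$x)" if "x : Obj X" for x using H.small[OF that] by (simp add: small_set_tiny)
  then show "tiny (Obj J)" "tiny (Arr J)"
   by (auto intro!: tiny_image tiny_Sigma tiny_X)
 qed
 define D where "D = Funct (\<lambda>a\<in>Obj J. yon (p1 a)) (\<lambda>a\<in>Arr J. yarr (p1 a))"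
 have D_simps: "D$(pr (x, h)) = yon x" if "x : Obj X" "h : H$x" for x h
  using that by (simp add: D_def)
 have Da_simps: "farr D (pr (f, h)) = yarr f" if "f : Arr X" "h : H$(Dom X f)" for f h
  using that by (simp add: D_def)
 have yH: "yarr f : Hom (set_power X) (yon (Cod X f)) (yon (Dom X f))" if "f : Arr X" for f
  by (rule yarr_in) (use that in \<open>simp add: in_Hom\<close>)
 have D: "cat_functor J (set_power X) D"
 proof (intro cat_functor.intro Jcat category_functor_category cat_functor_axioms.intro)
  fix o' assume "o' : Obj J"
  then obtain x h where x: "o' = pr (x, h)" "x : Obj X" "h : H$x" by auto
  then show "D$o' : Obj (set_power X)" using D_simps yon_obj by simp
  have "Ident X x : Arr X" "h : H$(Dom X (Ident X x))" using x by simp_all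
  then show "farr D (Ident J o') = Ident (set_power X) (D$o')"
   using x D_simps[OF x(2,3)] Da_simps[of "Ident X x" h] yarr_ident[OF x(2)] by simp
 next
  fix a o1 o2 assume a: "a : Hom J o1 o2"
  then obtain f h where f: "a = pr (f, h)" "f : Arr X" "h : H$(Dom X f)" by (auto simp: in_Hom)
  have o: "o1 = pr (Cod X f, act H f h)" "o2 = pr (Dom X f, h)" using a f(1) by (auto simp: in_Hom)
  show "farr D a : Hom (set_power X) (D$o1) (D$o2)"
   using D_simps[of "Cod X f" "act H f h"] D_simps[of "Dom X f" h] Da_simps[OF f(2,3)] f o yH[OF f(2)] H.act_in[OF f(2,3)]
   by simp
 next
  fix a o1 o2 b o3 assume ab: "a : Hom J o1 o2" "b : Hom J o2 o3"
  then obtain f h f' h' where f: "a = pr (f, h)" "f : Arr X" "h : H$(Dom X f)"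
    and f': "b = pr (f', h')" "f' : Arr X" "h' : H$(Dom X f')" by (auto simp: in_Hom)
  have eq: "Cod X f' = Dom X f" using ab f f' by (auto simp: in_Hom)
  have "yarr (f \<cdot> f') = yarr f' $$set_power X$$ yarr f"
   using yarr_comp[of f' "Dom X f'" "Dom X f" f "Cod X f"] f f' eq by (simp add: in_Hom)
  then show "farr D (b $$J$$ a) = farr D b $$set_power X$$ farr D a"
   using f f' eq Da_simps[of "f \<cdot> f'" h'] Da_simps[OF f(2,3)] Da_simps[OF f'(2,3)] by simp
 qed (auto simp: D_def)
 define leg where "leg o' = hat (p1 o') (p2 o') H" for o'
 have HO: "H : Obj (set_power X)" using H.cat_functor_axioms by simp
 have colim: "is_colimit J (set_power X) D H leg"
  unfolding is_colimit_def
 proof (intro conjI allI impI)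
  show "is_cocone J (set_power X) D H leg"
   unfolding is_cocone_def
  proof (intro conjI ballI HO)
   fix o' assume "o' : Obj J"
   then obtain x h where x: "o' = pr (x, h)" "x : Obj X" "h : H$x" by auto
   then show "leg o' : Hom (set_power X) (D$o') H" using D_simps hat_in[OF H] by (simp add: leg_def)
  next
   fix k assume "k : Arr J"
   then obtain f h where f: "k = pr (f, h)" "f : Arr X" "h : H$(Dom X f)" by auto
   show "leg (Cod J k) $$set_power X$$ farr D k = leg (Dom J k)"
    using hat_yarr[OF H, of f "Dom X f" "Cod X f" h] f Da_simps[OF f(2,3)] by (simp add: leg_def in_Hom)
  qed
 next
  fix Z q assume qc: "is_cocone J (set_power X) D Z q"
  then have Z: "set_functor X Z" by (auto simp: is_cocone_def set_functor_def)
  interpret Z: set_functor X Z by (rule Z)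
  have q: "q (pr (x, h)) : Hom (set_power X) (yon x) Z" if "x : Obj X" "h : H$x" for x h
  proof -
   have "pr (x, h) : Obj J" using that by simp
   then have "q (pr (x, h)) : Hom (set_power X) (D$(pr (x, h))) Z" using qc unfolding is_cocone_def by blast
   then show ?thesis by (simp only: D_simps[OF that])
  qed
  have qn: "q (pr (Dom X f, h)) $$set_power X$$ yarr f = q (pr (Cod X f, act H f h))"
   if "f : Arr X" "h : H$(Dom X f)" for f h
  proof -
   have "ALL k:Arr J. q (Cod J k) $$set_power X$$ farr D k = q (Dom J k)" using qc by (simp add: is_cocone_def)
   moreover have "pr (f, h) : Arr J" using that by simp
   ultimately have "q (Cod J (pr (f, h))) $$set_power X$$ farr D (pr (f, h)) = q (Dom J (pr (f, h)))" by blast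
   then show ?thesis using Da_simps[OF that] by simp
  qed
  define u where "u x h = app (q (pr (x, h))) x (Ident X x)" for x h
  have u: "u x h : Z$x" "q (pr (x, h)) = hat x (u x h) Z" if "x : Obj X" "h : H$x" for x h
   using hat_unique[OF q[OF that] that(1)] by (simp_all add: u_def)
  have uH: "set_nat X H u Z : Hom (set_power X) H Z"
  proof (rule set_nat_in_Hom[OF H Z u(1)])
   fix f h assume f: "f : Arr X" and h: "h : H$(Dom X f)"
   have ab: "Dom X f : Obj X" "Cod X f : Obj X" using f by auto
   have ff: "f : Hom X (Dom X f) (Cod X f)" using f by (simp add: in_Hom)
   have "hat (Cod X f) (u (Cod X f) (act H f h)) Z = hat (Cod X f) (act Z f (u (Dom X f) h)) Z"
    using qn[OF f h] u(2)[OF ab(1) h] u(2)[OF ab(2) H.act_in[OF f h]] hat_yarr[OF Z ff u(1)[OF ab(1) h]] by simp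
   then show "u (Cod X f) (act H f h) = act Z f (u (Dom X f) h)"
    using hat_eq_iff[OF Z ab(2) u(1)[OF ab(2) H.act_in[OF f h]] Z.act_in[OF f u(1)[OF ab(1) h]]] by blast
  qed
  show "EX! v. v : Hom (set_power X) H Z & (ALL j:Obj J. v $$set_power X$$ leg j = q j)"
  proof (rule ex1I[of _ "set_nat X H u Z"])
   have "set_nat X H u Z $$set_power X$$ leg j = q j" if "j : Obj J" for j
   proof -
    obtain x h where x: "j = pr (x, h)" "x : Obj X" "h : H$x" using \<open>j : Obj J\<close> by auto
    then show ?thesis using comp_hat[OF uH x(2,3)] u(2)[OF x(2,3)] by (simp add: leg_def)
   qed
   then show "set_nat X H u Z : Hom (set_power X) H Z & (ALL j:Obj J. set_nat X H u Z $$set_power X$$ leg j = q j)"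
    using uH by blast
  next
   fix v assume v: "v : Hom (set_power X) H Z & (ALL j:Obj J. v $$set_power X$$ leg j = q j)"
   then have vH: "v : Hom (set_power X) H Z" by blast
   show "v = set_nat X H u Z"
   proof (rule set_nat_eqI[OF vH uH])
    fix x h assume x: "x : Obj X" "h : H$x"
    have "pr (x, h) : Obj J" using x by simp
    then have "v $$set_power X$$ leg (pr (x, h)) = q (pr (x, h))" using v by blast
    then have "hat x (app v x h) Z = hat x (u x h) Z"
     using comp_hat[OF vH x] u(2)[OF x] by (simp add: leg_def)
    then have "app v x h = u x h" using hat_eq_iff[OF Z x(1) app_in[OF vH x] u(1)[OF x]] by blast
    then show "app v x h = app (set_nat X H u Z) x h" using x by simp
   qed
  qed
 qed
 have "is_colimit J Sets (comp_funct J p D) (p$H) (%j. farr p (leg j))"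
  using p Jsmall D colim unfolding cocontinuous_def preserves_colimits_of_shape_def by blast
 from set_colimit_jointly_surjective[OF cat_functor_comp[OF D pf] this z]
 obtain j t where "j : Obj J" "t : (comp_funct J p D)$j" "body (farr p (leg j)) t = z" by blast
 moreover from this(1) obtain x h where x: "j = pr (x, h)" "x : Obj X" "h : H$x" by auto
 ultimately have "t : p$(yon x)" "act p (hat x h H) t = z"
  using D_simps[OF x(2,3)] by (simp_all add: leg_def act_def)
 then show ?thesis using x by blast
qed

text \<open>
 A left exact functor turns pointwise finite limits into limits of sets, whose elements can be
 described as compatible families.
\<close>

lemma left_exact_elementwise:
 fixes p :: "'u psh_funct"
 assumes p: "left_exact (set_power X) Sets p" and J: "finite_category (J :: (nat, nat) category)"
  and D: "cat_functor J (set_power X) D" and cone: "is_cone J (set_power X) D c \<pi>"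
  and elem: "!!a. a : Obj X ==> elementwise_limit J (%j. D$j$a) (%k. app (farr D k) a)
   (c$a) (%j. app (\<pi> j) a)"
  and x: "!!j. j : Obj J ==> x j : p$(D$j)" "!!k. k : Arr J ==> act p (farr D k) (x (Dom J k)) = x (Cod J k)"
 shows "EX z:fobj p c. ALL j:Obj J. act p (\<pi> j) z = x j"
proof -
 have pf: "cat_functor (set_power X) Sets p" using p by (simp add: left_exact_def)
 have "is_limit J Sets (comp_funct J p D) (p$c) (%j. farr p (\<pi> j))"
  using p J D power_limitI[OF D cone elem] unfolding left_exact_def preserves_limits_of_shape_def by blast
 from set_limitD[OF cat_functor_comp[OF D pf] this]
 have "elementwise_limit J (fobj (comp_funct J p D)) (act (comp_funct J p D)) (p$c) (%j. body (farr p (\<pi> j)))" .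
 moreover have "compatible_family J (fobj (comp_funct J p D)) (act (comp_funct J p D)) x"
  using x by (simp add: compatible_family_def act_def)
 ultimately show ?thesis unfolding elementwise_limit_def act_def by blast
qed

definition parallel_pair :: "(nat, nat) category" where
 "parallel_pair = \<lparr>Obj = {0, 1}, Arr = {0, 1, 2, 3}, Dom = (%a. if a = 1 then 1 else 0),
  Cod = (%a. if a = 0 then 0 else 1), Ident = (%a. a), Comp = (%g f. if g < 2 then f else g)\<rparr>"

definition discrete_pair :: "(nat, nat) category" where
 "discrete_pair = \<lparr>Obj = {0, 1}, Arr = {0, 1}, Dom = (%a. a), Cod = (%a. a), Ident = (%a. a), Comp = (%g f. f)\<rparr>"

definition empty_category :: "(nat, nat) category" where
 "empty_category = \<lparr>Obj = {}, Arr = {}, Dom = (%a. a), Cod = (%a. a), Ident = (%a. a), Comp = (%g f. f)\<rparr>"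

lemma Hom_parallel_pair:
 "f : Hom parallel_pair a b <->
  f = 0 & a = 0 & b = 0 \<or> f = 1 & a = 1 & b = 1 \<or> (f = 2 \<or> f = 3) & a = 0 & b = 1"
 by (auto simp: parallel_pair_def in_Hom)

lemma comp_parallel_pair: "g $$parallel_pair$$ f = (if g < 2 then f else g)"
 by (simp add: parallel_pair_def)

lemma finite_shapes: "finite_category parallel_pair" "finite_category discrete_pair" "finite_category empty_category"
proof -
 have "category parallel_pair"
 proof unfold_locales
  fix f a b g c assume "f : Hom parallel_pair a b" "g : Hom parallel_pair b c"
  then show "g $$parallel_pair$$ f : Hom parallel_pair a c"
   unfolding Hom_parallel_pair comp_parallel_pair by (elim disjE conjE) simp_all
 next
  fix f a b assume "f : Hom parallel_pair a b"
  then show "Ident parallel_pair b $$parallel_pair$$ f = f" "f $$parallel_pair$$ Ident parallel_pair a = f"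
   unfolding Hom_parallel_pair comp_parallel_pair by (elim disjE conjE; simp add: parallel_pair_def)+
 qed (auto simp: parallel_pair_def in_Hom)
 then show "finite_category parallel_pair" by (simp add: finite_category_def parallel_pair_def)
 have "category discrete_pair"
  by unfold_locales (auto simp: discrete_pair_def in_Hom)
 then show "finite_category discrete_pair" by (simp add: finite_category_def discrete_pair_def)
 have "category empty_category"
  by unfold_locales (auto simp: empty_category_def in_Hom)
 then show "finite_category empty_category" by (simp add: finite_category_def empty_category_def)
qed

context
 fixes p :: "'u psh_funct"
 assumes point: "p : Obj (points U (set_power X))"
begin

lemma pf: "set_functor (set_power X) p" using point by (simp add: set_functor_def)

lemma lex: "left_exact (set_power X) Sets p" using point by simp

lemma cocont: "cocontinuous U (set_power X) Sets p" using point by simp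

text \<open>Elements of \<open>p\<close> that two maps identify factor through their equalizer.\<close>

lemma equalizing_element:
 assumes d: "d : Obj X" and alp: "alp : Hom (set_power X) (yon d) H" and bet: "bet : Hom (set_power X) (yon d) H"
  and t: "t : p$(yon d)" and eq: "act p alp t = act p bet t"
 shows "EX w. EX k:Hom X d w. EX s:fobj p (yon w). act p (yarr k) s = t & app alp w k = app bet w k"
proof -
 interpret p: set_functor "set_power X" p by (rule pf)
 have H: "set_functor X H" using nat_functors[OF alp] by blast
 interpret H: set_functor X H by (rule H)
 interpret y: set_functor X "yon d" by (rule set_functor_yon[OF d])
 let ?J = parallel_pair
 define Q where "Q = set_funct X (%z. {k : Hom X d z. app alp z k = app bet z k}) (%f g. f \<cdot> g)"
 have nat: "app \<gamma> (Cod X f) (f \<cdot> k) = act H f (app \<gamma> (Dom X f) k)"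
  if "\<gamma> : Hom (set_power X) (yon d) H" "f : Arr X" "k : Hom X d (Dom X f)" for \<gamma> f k
  using app_natural[OF that(1,2), of k] that by simp
 have Q: "set_functor X Q"
  unfolding Q_def
 proof (rule set_functor_set_funct[OF category_axioms])
  show "small_set {k : Hom X d a. app alp a k = app bet a k}" for a
   unfolding small_set_tiny by (rule tiny_subset[OF _ small_Hom[unfolded small_set_tiny]]) auto
  fix f k assume f: "f : Arr X" and k: "k : {k : Hom X d (Dom X f). app alp (Dom X f) k = app bet (Dom X f) k}"
  then show "f \<cdot> k : {k : Hom X d (Cod X f). app alp (Cod X f) k = app bet (Cod X f) k}"
   using nat[OF alp f] nat[OF bet f] by (auto simp: in_Hom)
 qed (auto simp: in_Hom)
 interpret Q: set_functor X Q by (rule Q)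
 have Qo: "Q$z = {k : Hom X d z. app alp z k = app bet z k}" if "z : Obj X" for z
  using that by (simp add: Q_def)
 have Qa: "act Q f k = f \<cdot> k" if "f : Arr X" "k : Q$(Dom X f)" for f k
  using that Qo[of "Dom X f"] by (simp add: Q_def)
 define \<iota> where "\<iota> = set_nat X Q (%z k. k) (yon d)"
 have \<iota>: "\<iota> : Hom (set_power X) Q (yon d)"
  unfolding \<iota>_def by (rule set_nat_in_Hom[OF Q set_functor_yon[OF d]]) (auto simp: Qo Qa)
 have \<iota>a: "app \<iota> z k = k" if "z : Obj X" "k : Q$z" for z k using that by (simp add: \<iota>_def)
 define D where "D = Funct (\<lambda>j\<in>Obj ?J. if j = 0 then yon d else H)
   (\<lambda>k\<in>Arr ?J. if k = 0 then Ident (set_power X) (yon d) else if k = 1 then Ident (set_power X) H else if k = 2 then alp else bet)"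
 have objs: "yon d : Obj (set_power X)" "H : Obj (set_power X)"
  using yon_obj[OF d] H.cat_functor_axioms by auto
 note ids = functor_cat.id_in[OF objs(1)] functor_cat.id_in[OF objs(2)]
 have D: "cat_functor ?J (set_power X) D"
 proof (intro cat_functor.intro cat_functor_axioms.intro category_functor_category)
  show "category ?J" using finite_shapes(1) by (simp add: finite_category_def)
  show "D$j : Obj (set_power X)" if "j : Obj ?J" for j using that objs by (auto simp: D_def parallel_pair_def)
  show arr: "farr D k : Hom (set_power X) (D$i) (D$j)" if "k : Hom ?J i j" for k i j
   using that alp bet ids by (auto simp: D_def parallel_pair_def in_Hom split: if_splits)
  show "farr D (Ident ?J j) = Ident (set_power X) (D$j)" if "j : Obj ?J" for j
   using that by (auto simp: D_def parallel_pair_def)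
  fix f g i j k assume f: "f : Hom ?J i j" and g: "g : Hom ?J j k"
  have Df: "farr D f : Hom (set_power X) (D$i) (D$j)" and Dg: "farr D g : Hom (set_power X) (D$j) (D$k)"
   using arr f g by blast+
  show "farr D (g $$?J$$ f) = farr D g $$set_power X$$ farr D f"
  proof (cases "g < 2")
   case True
   then have "g = j & k = j & (j = 0 \<or> j = 1)" using g unfolding Hom_parallel_pair by auto
   then have "farr D g = Ident (set_power X) (D$j)" by (auto simp: D_def parallel_pair_def)
   then show ?thesis using functor_cat.id_left[OF Df] True by (simp add: comp_parallel_pair)
  next
   case False
   then have "f = 0 & i = 0 & j = 0" using f g unfolding Hom_parallel_pair by auto
   then have "farr D f = Ident (set_power X) (D$j)" by (simp add: D_def parallel_pair_def)
   then show ?thesis using functor_cat.id_right[OF Dg] False by (simp add: comp_parallel_pair)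
  qed
 qed (auto simp: D_def)
 define \<pi> where "\<pi> j = (if j = (0 :: nat) then \<iota> else alp $$set_power X$$ \<iota>)" for j
 have eqs: "alp $$set_power X$$ \<iota> = bet $$set_power X$$ \<iota>"
  by (rule set_nat_eqI[OF functor_cat.comp_in[OF \<iota> alp] functor_cat.comp_in[OF \<iota> bet]])
   (auto simp: app_comp[OF \<iota>] \<iota>a Qo)
 note alp\<iota> = functor_cat.comp_in[OF \<iota> alp]
 have QO: "Q : Obj (set_power X)" using Q.cat_functor_axioms by simp
 have cone: "is_cone ?J (set_power X) D Q \<pi>"
  unfolding is_cone_def
  using QO \<iota> alp\<iota> eqs functor_cat.id_left[OF \<iota>] functor_cat.id_left[OF alp\<iota>]
  by (auto simp: D_def parallel_pair_def \<pi>_def)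
 have elem: "elementwise_limit ?J (%j. D$j$a) (%k. app (farr D k) a) (Q$a) (%j. app (\<pi> j) a)"
  if a: "a : Obj X" for a
  unfolding elementwise_limit_def
 proof (intro allI impI)
  fix x assume "compatible_family ?J (%j. D$j$a) (%k. app (farr D k) a) x"
  then have x: "x 0 : Hom X d a" "app alp a (x 0) = x 1" "app bet a (x 0) = x 1"
   using a by (auto simp: compatible_family_def D_def parallel_pair_def)
  then have x0: "x 0 : Q$a" using Qo[OF a] by simp
  have \<pi>1: "app (\<pi> 1) a k = app alp a k" if "k : Q$a" for k
   using app_comp[OF \<iota> a that, of alp] \<iota>a[OF a that] by (simp add: \<pi>_def)
  have \<pi>0: "app (\<pi> 0) a k = k" if "k : Q$a" for k using \<iota>a[OF a that] by (simp add: \<pi>_def)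
  show "EX! z. z : Q$a & (ALL j:Obj ?J. app (\<pi> j) a z = x j)"
  proof (rule ex1I[of _ "x 0"])
   show "x 0 : Q$a & (ALL j:Obj ?J. app (\<pi> j) a (x 0) = x j)"
    using x0 \<pi>0[OF x0] \<pi>1[OF x0] x by (auto simp: parallel_pair_def)
   show "z = x 0" if "z : Q$a & (ALL j:Obj ?J. app (\<pi> j) a z = x j)" for z
    using that \<pi>0[of z] by (auto simp: parallel_pair_def)
  qed
 qed
 have at: "act p alp t : p$H" using p.act_in[of alp t] alp t by (simp add: in_Hom)
 have "EX z:fobj p Q. ALL j:Obj ?J. act p (\<pi> j) z = (if j = 0 then t else act p alp t)"
  by (rule left_exact_elementwise[OF lex finite_shapes(1) D cone elem])
   (use t at eq objs in \<open>auto simp: D_def parallel_pair_def simp del: functor_category_simps(1)\<close>)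
 then obtain z where z: "z : p$Q" "act p \<iota> z = t" by (auto simp: parallel_pair_def \<pi>_def)
 obtain w k s where w: "w : Obj X" "k : Q$w" "s : p$(yon w)" "act p (hat w k Q) s = z"
  using covered_by_representables[OF cocont Q z(1)] by blast
 have k: "k : Hom X d w" "app alp w k = app bet w k" using w Qo by auto
 have "act p \<iota> (act p (hat w k Q) s) = act p (hat w k (yon d)) s"
  using comp_hat_app[OF pf \<iota> w(1-3)] \<iota>a[OF w(1,2)] by simp
 then have "act p (yarr k) s = t" using w(4) z(2) k(1) by (simp add: yarr_def in_Hom)
 then show ?thesis using k w(3) by blast
qed

lemma pairing_element:
 assumes x: "x : Obj X" "x' : Obj X" and t: "t : p$(yon x)" "t' : p$(yon x')"
 shows "EX w. EX f:Hom X x w. EX g:Hom X x' w. EX s:fobj p (yon w). act p (yarr f) s = t & act p (yarr g) s = t'"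
proof -
 interpret p: set_functor "set_power X" p by (rule pf)
 interpret y: set_functor X "yon x" by (rule set_functor_yon[OF x(1)])
 interpret y': set_functor X "yon x'" by (rule set_functor_yon[OF x(2)])
 let ?J = discrete_pair
 obtain pr :: "'u \<times> 'u => 'u" where pr: "inj pr" using pairing .
 define p1 where "p1 a = fst (inv pr a)" for a
 define p2 where "p2 a = snd (inv pr a)" for a
 have pr_simps [simp]: "p1 (pr (a, b)) = a" "p2 (pr (a, b)) = b" for a b
  using pr by (simp_all add: p1_def p2_def)
 define Q where "Q = set_funct X (%z. pr ` (Hom X x z \<times> Hom X x' z)) (%f k. pr (f \<cdot> p1 k, f \<cdot> p2 k))"
 have Q: "set_functor X Q"
  unfolding Q_def
 proof (rule set_functor_set_funct[OF category_axioms])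
  show "small_set (pr ` (Hom X x a \<times> Hom X x' a))" for a
   using small_Hom unfolding small_set_tiny by (intro tiny_image tiny_Times) auto
 qed (auto simp: in_Hom)
 interpret Q: set_functor X Q by (rule Q)
 have Qo: "Q$z = pr ` (Hom X x z \<times> Hom X x' z)" if "z : Obj X" for z using that by (simp add: Q_def)
 have Qa: "act Q f k = pr (f \<cdot> p1 k, f \<cdot> p2 k)" if "f : Arr X" "k : Q$(Dom X f)" for f k
  using that Qo[of "Dom X f"] by (simp add: Q_def)
 define \<pi> where "\<pi> j = (if j = (0 :: nat) then set_nat X Q (%z. p1) (yon x) else set_nat X Q (%z. p2) (yon x'))" for j
 have \<pi>: "\<pi> 0 : Hom (set_power X) Q (yon x)" "\<pi> 1 : Hom (set_power X) Q (yon x')"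
  unfolding \<pi>_def
  by (auto intro!: set_nat_in_Hom[OF Q] set_functor_yon x simp: Qo Qa)
 have \<pi>a: "app (\<pi> 0) z k = p1 k" "app (\<pi> 1) z k = p2 k" if "z : Obj X" "k : Q$z" for z k
  using that by (simp_all add: \<pi>_def)
 have objs: "yon x : Obj (set_power X)" "yon x' : Obj (set_power X)" "Q : Obj (set_power X)"
  using yon_obj x Q.cat_functor_axioms by auto
 note ids = functor_cat.id_in[OF objs(1)] functor_cat.id_in[OF objs(2)]
 define D where "D = Funct (\<lambda>j\<in>Obj ?J. if j = 0 then yon x else yon x')
   (\<lambda>k\<in>Arr ?J. if k = 0 then Ident (set_power X) (yon x) else Ident (set_power X) (yon x'))"
 have D: "cat_functor ?J (set_power X) D"
 proof (intro cat_functor.intro cat_functor_axioms.intro category_functor_category)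
  show "category ?J" using finite_shapes(2) by (simp add: finite_category_def)
  show "D$j : Obj (set_power X)" if "j : Obj ?J" for j using that objs by (auto simp: D_def discrete_pair_def)
  show "farr D k : Hom (set_power X) (D$i) (D$j)" if "k : Hom ?J i j" for k i j
   using that ids by (auto simp: D_def discrete_pair_def in_Hom split: if_splits)
  show "farr D (Ident ?J j) = Ident (set_power X) (D$j)" if "j : Obj ?J" for j
   using that by (auto simp: D_def discrete_pair_def)
  show "farr D (g $$?J$$ f) = farr D g $$set_power X$$ farr D f" if "f : Hom ?J i j" "g : Hom ?J j k" for f g i j k
   using that functor_cat.id_left[OF ids(1)] functor_cat.id_left[OF ids(2)]
   by (auto simp: D_def discrete_pair_def in_Hom split: if_splits)
 qed (auto simp: D_def)
 have cone: "is_cone ?J (set_power X) D Q \<pi>"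
  unfolding is_cone_def
  using objs(3) \<pi> functor_cat.id_left[OF \<pi>(1)] functor_cat.id_left[OF \<pi>(2)]
  by (auto simp: D_def discrete_pair_def)
 have elem: "elementwise_limit ?J (%j. D$j$a) (%k. app (farr D k) a) (Q$a) (%j. app (\<pi> j) a)"
  if a: "a : Obj X" for a
  unfolding elementwise_limit_def
 proof (intro allI impI)
  fix z assume "compatible_family ?J (%j. D$j$a) (%k. app (farr D k) a) z"
  then have z: "z 0 : Hom X x a" "z 1 : Hom X x' a"
   using a by (auto simp: compatible_family_def D_def discrete_pair_def)
  then have z0: "pr (z 0, z 1) : Q$a" using Qo[OF a] by simp
  show "EX! v. v : Q$a & (ALL j:Obj ?J. app (\<pi> j) a v = z j)"
  proof (rule ex1I[of _ "pr (z 0, z 1)"])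
   show "pr (z 0, z 1) : Q$a & (ALL j:Obj ?J. app (\<pi> j) a (pr (z 0, z 1)) = z j)"
    using z0 \<pi>a[OF a z0] by (auto simp: discrete_pair_def)
   show "v = pr (z 0, z 1)" if v: "v : Q$a & (ALL j:Obj ?J. app (\<pi> j) a v = z j)" for v
   proof -
    have "p1 v = z 0" "p2 v = z 1" using v \<pi>a[OF a, of v] by (auto simp: discrete_pair_def)
    moreover obtain g h where "v = pr (g, h)" using v Qo[OF a] by auto
    ultimately show ?thesis by simp
   qed
  qed
 qed
 have "EX z:fobj p Q. ALL j:Obj ?J. act p (\<pi> j) z = (if j = 0 then t else t')"
  by (rule left_exact_elementwise[OF lex finite_shapes(2) D cone elem])
   (use t objs p.act_id in \<open>auto simp: D_def discrete_pair_def simp del: functor_category_simps(1)\<close>)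
 then obtain z where z: "z : p$Q" "act p (\<pi> 0) z = t" "act p (\<pi> 1) z = t'" by (auto simp: discrete_pair_def)
 obtain w k s where w: "w : Obj X" "k : Q$w" "s : p$(yon w)" "act p (hat w k Q) s = z"
  using covered_by_representables[OF cocont Q z(1)] by blast
 obtain f g where fg: "k = pr (f, g)" "f : Hom X x w" "g : Hom X x' w" using w Qo by auto
 have "act p (hat w f (yon x)) s = t" "act p (hat w g (yon x')) s = t'"
  using comp_hat_app[OF pf \<pi>(1) w(1-3)] comp_hat_app[OF pf \<pi>(2) w(1-3)] \<pi>a[OF w(1,2)] w(4) z(2,3) fg(1) by auto
 then have "act p (yarr f) s = t" "act p (yarr g) s = t'"
  using HomD[OF fg(2)] HomD[OF fg(3)] by (simp_all add: yarr_def)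
 then show ?thesis using fg(2,3) w(3) by blast
qed

lemma element_exists: "EX x:Obj X. EX t. t : p$(yon x)"
proof -
 interpret p: set_functor "set_power X" p by (rule pf)
 let ?J = empty_category
 define Q where "Q = set_funct X (%_. {undefined :: 'u}) (%_ k. k)"
 have Q: "set_functor X Q"
  unfolding Q_def by (rule set_functor_set_funct[OF category_axioms small_singleton]) auto
 interpret Q: set_functor X Q by (rule Q)
 define D :: "(nat, nat, 'u psh, 'u psh_map) funct" where "D = Funct (%_. undefined) (%_. undefined)"
 have D: "cat_functor ?J (set_power X) D"
  using finite_shapes(3)
  by (intro cat_functor.intro cat_functor_axioms.intro category_functor_category)
   (auto simp: D_def empty_category_def finite_category_def in_Hom)
 have "Q : Obj (set_power X)" using Q.cat_functor_axioms by simp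
 then have cone: "is_cone ?J (set_power X) D Q (%_. undefined)" by (simp add: is_cone_def empty_category_def)
 have elem: "elementwise_limit ?J (%j. D$j$a) (%k. app (farr D k) a) (Q$a) (%j. app undefined a)"
  if a: "a : Obj X" for a
  using a by (auto simp: elementwise_limit_def empty_category_def Q_def)
 have "EX z:fobj p Q. ALL j:Obj ?J. act p ((%_. undefined) j) z = undefined"
  by (rule left_exact_elementwise[OF lex finite_shapes(3) D cone elem]) (auto simp: empty_category_def)
 then show ?thesis using covered_by_representables[OF cocont Q] by blast
qed

text \<open>
 The category of elements of \<open>p\<close> is filtered, so that \<open>p\<close> is flat. Replacing it by a directed
 poset exhibits \<open>p\<close> as a directed colimit of evaluations.
\<close>

lemma point_directed_colimit:
 "EX (P :: 'u set) r d dd t. small_set P & directed_poset P r \<and>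
  (ALL l:P. d l : Obj X & dd (l, l) = Ident X (d l) & t l : p$(yon (d l))) \<and>
  (ALL l m. (l, m) : r --> dd (l, m) : Hom X (d l) (d m) & act p (yarr (dd (l, m))) (t m) = t l) \<and>
  (ALL l m n. (l, m) : r --> (m, n) : r --> dd (l, n) = dd (m, n) \<cdot> dd (l, m)) \<and>
  (ALL x:Obj X. ALL s:fobj p (yon x). EX l:P. EX k:Hom X x (d l). act p (yarr k) (t l) = s) \<and>
  (ALL l:P. ALL c. ALL k:Hom X (d l) c. ALL s:fobj p (yon c). act p (yarr k) s = t l -->
   (EX m. (l, m) : r & (EX h:Hom X c (d m). h \<cdot> k = dd (l, m))))"
proof -
 interpret p: set_functor "set_power X" p by (rule pf)
 define K where "K = \<lparr>Obj = Sigma (Obj X) (%x. p$(yon x)), Arr = Sigma (Arr X) (%f. p$(yon (Cod X f))),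
   Dom = (%(f, t). (Dom X f, act p (yarr f) t)), Cod = (%(f, t). (Cod X f, t)),
   Ident = (%(x, t). (Ident X x, t)), Comp = (%b a. (fst b \<cdot> fst a, snd b))\<rparr>"
 have K_simps [simp]: "Obj K = Sigma (Obj X) (%x. p$(yon x))" "Arr K = Sigma (Arr X) (%f. p$(yon (Cod X f)))"
   "Dom K (f, t) = (Dom X f, act p (yarr f) t)" "Cod K (f, t) = (Cod X f, t)"
   "Ident K (x, t) = (Ident X x, t)" "(g, t') $$K$$ (f, t) = (g \<cdot> f, t')"
  for f t x g t' by (simp_all add: K_def)
 have yA: "act p (yarr f) t : p$(yon (Dom X f))" if "f : Arr X" "t : p$(yon (Cod X f))" for f t
  using act_yarr_in[OF pf _ that(2)] that(1) by (simp add: in_Hom)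
 have yC: "act p (yarr (g \<cdot> f)) t = act p (yarr f) (act p (yarr g) t)"
  if "f : Arr X" "g : Arr X" "Dom X g = Cod X f" "t : p$(yon (Cod X g))" for f g t
 proof -
  have fg: "f : Hom X (Dom X f) (Cod X f)" "g : Hom X (Cod X f) (Cod X g)" using that by (auto simp: in_Hom)
  show ?thesis
   using yarr_comp[OF fg] p.act_comp[of "yarr g" "yarr f" t] HomD[OF yarr_in[OF fg(1)]] HomD[OF yarr_in[OF fg(2)]] that
   by simp
 qed
 have yI: "act p (yarr (Ident X x)) t = t" if "x : Obj X" "t : p$(yon x)" for x t
  using yarr_ident[OF that(1)] p.act_id[OF yon_obj[OF that(1)] that(2)] by simp
 have catK: "category K"
 proof unfold_locales
  fix a assume "a : Arr K" then show "Dom K a : Obj K" "Cod K a : Obj K" by (auto intro: yA)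
 next
  fix a assume "a : Obj K" then show "Ident K a : Hom K a a" by (auto simp: in_Hom yI)
 next
  fix f a b g c assume "f : Hom K a b" "g : Hom K b c"
  then show "g $$K$$ f : Hom K a c" by (auto simp: in_Hom yC)
 next
  fix f a b assume "f : Hom K a b"
  then show "Ident K b $$K$$ f = f" "f $$K$$ Ident K a = f" by (auto simp: in_Hom)
 next
  fix f a b g c h d assume "f : Hom K a b" "g : Hom K b c" "h : Hom K c d"
  then show "h $$K$$ g $$K$$ f = h $$K$$ (g $$K$$ f)" by (auto simp: in_Hom)
 qed
 have K_Hom: "(f, t) : Hom K (x, s) (x', t') <-> f : Hom X x x' & t = t' & t : p$(yon x') & act p (yarr f) t = s"
  for f t x s x' t' by (auto simp: in_Hom)
 have "filtered K"
  unfolding filtered_def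
 proof (intro conjI catK ballI allI)
  show "Obj K \<noteq> {}" using element_exists by auto
 next
  fix a b assume "a : Obj K" "b : Obj K"
  then obtain x t x' t' where ab: "a = (x, t)" "b = (x', t')" "x : Obj X" "x' : Obj X" "t : p$(yon x)" "t' : p$(yon x')"
   by auto
  obtain w f g s where "f : Hom X x w" "g : Hom X x' w" "s : p$(yon w)" "act p (yarr f) s = t" "act p (yarr g) s = t'"
   using pairing_element[OF ab(3-6)] by blast
  then have "(f, s) : Hom K a (w, s)" "(g, s) : Hom K b (w, s)" using ab by (simp_all add: K_Hom)
  then show "EX c. Hom K a c \<noteq> {} & Hom K b c \<noteq> {}" by blast
 next
  fix a b u v assume uv: "u : Hom K a b" "v : Hom K a b"
  obtain x s x' t f g where ab: "a = (x, s)" "b = (x', t)" "u = (f, t)" "v = (g, t)"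
   using uv by (cases a; cases b; cases u; cases v) (auto simp: K_Hom)
  have fg: "f : Hom X x x'" "g : Hom X x x'" "t : p$(yon x')" "act p (yarr f) t = s" "act p (yarr g) t = s"
   using uv ab by (auto simp: K_Hom)
  obtain w k s' where k: "k : Hom X x' w" "s' : p$(yon w)" "act p (yarr k) s' = t" "app (yarr f) w k = app (yarr g) w k"
   using equalizing_element[OF Hom_obj(2)[OF fg(1)] yarr_in[OF fg(1)] yarr_in[OF fg(2)] fg(3)] fg(4,5) by auto
  have "k \<cdot> f = k \<cdot> g" using k(4) app_yarr[OF fg(1) k(1)] app_yarr[OF fg(2) k(1)] by simp
  then have "(k, s') : Hom K b (w, s')" "(k, s') $$K$$ u = (k, s') $$K$$ v" using k ab by (simp_all add: K_Hom)
  then show "EX c. EX h:Hom K b c. h $$K$$ u = h $$K$$ v" by blast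
 qed
 moreover have "tiny (Obj K)" "tiny (Arr K)"
 proof -
  have "tiny (p$(yon x))" if "x : Obj X" for x using p.small[OF yon_obj[OF that]] by (simp add: small_set_tiny)
  then show "tiny (Obj K)" "tiny (Arr K)" by (auto intro!: tiny_Sigma tiny_X)
 qed
 ultimately have "EX (P :: 'u set) r d dd. small_set P & directed_poset P r \<and>
  (ALL l:P. d l : Obj K & dd (l, l) = Ident K (d l)) \<and>
  (ALL l m. (l, m) : r --> dd (l, m) : Hom K (d l) (d m)) \<and>
  (ALL l m n. (l, m) : r --> (m, n) : r --> dd (l, n) = dd (m, n) $$K$$ dd (l, m)) \<and>
  (ALL c:Obj K. EX l:P. Hom K c (d l) \<noteq> {}) \<and>
  (ALL l:P. ALL c. ALL k:Hom K (d l) c. EX m. (l, m) : r & (EX h:Hom K c (d m). h $$K$$ k = dd (l, m)))"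
  by (rule filtered_directed_cover)
 then obtain P :: "'u set" and r d dd where P: "small_set P" "directed_poset P r"
   and d': "ALL l:P. d l : Obj K & dd (l, l) = Ident K (d l)"
   and dd': "ALL l m. (l, m) : r --> dd (l, m) : Hom K (d l) (d m)"
   and ddc': "ALL l m n. (l, m) : r --> (m, n) : r --> dd (l, n) = dd (m, n) $$K$$ dd (l, m)"
   and cov': "ALL c:Obj K. EX l:P. Hom K c (d l) \<noteq> {}"
   and abs': "ALL l:P. ALL c. ALL k:Hom K (d l) c. EX m. (l, m) : r & (EX h:Hom K c (d m). h $$K$$ k = dd (l, m))"
  by (elim exE conjE)
 have d: "d l : Obj K" "dd (l, l) = Ident K (d l)" if "l : P" for l using d' that by blast+
 have dd: "dd (l, m) : Hom K (d l) (d m)" if "(l, m) : r" for l m using dd' that by blast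
 have ddc: "dd (l, n) = dd (m, n) $$K$$ dd (l, m)" if "(l, m) : r" "(m, n) : r" for l m n using ddc' that by blast
 have cov: "EX l:P. Hom K c (d l) \<noteq> {}" if "c : Obj K" for c using bspec[OF cov' that] .
 have abs: "EX m. (l, m) : r & (EX h:Hom K c (d m). h $$K$$ k = dd (l, m))" if "l : P" "k : Hom K (d l) c" for l c k
  using abs' that by blast
 have dP: "d l = (fst (d l), snd (d l))" for l by simp
 have d1: "fst (d l) : Obj X" "snd (d l) : p$(yon (fst (d l)))" if "l : P" for l using d(1)[OF that] by auto
 have dd1: "fst (dd (l, m)) : Hom X (fst (d l)) (fst (d m))" "act p (yarr (fst (dd (l, m)))) (snd (d m)) = snd (d l)"
  if "(l, m) : r" for l m
  using dd[OF that] dP[of l] dP[of m] K_Hom[of "fst (dd (l, m))" "snd (dd (l, m))" "fst (d l)" "snd (d l)" "fst (d m)" "snd (d m)"] by auto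
 show ?thesis
 proof (rule exI[of _ P], rule exI[of _ r], rule exI[of _ "%l. fst (d l)"], rule exI[of _ "%q. fst (dd q)"],
   rule exI[of _ "%l. snd (d l)"], intro conjI ballI allI impI P)
  fix l assume l: "l : P"
  show "fst (d l) : Obj X" "snd (d l) : p$(yon (fst (d l)))" using d1[OF l] by auto
  show "fst (dd (l, l)) = Ident X (fst (d l))" using d(2)[OF l] by (cases "d l") simp
 next
  fix l m n assume "(l, m) : r" "(m, n) : r"
  then show "fst (dd (l, n)) = fst (dd (m, n)) \<cdot> fst (dd (l, m))"
   using ddc by (cases "dd (m, n)"; cases "dd (l, m)") simp
 next
  fix x s assume "x : Obj X" "s : p$(yon x)"
  then obtain l k t where l: "l : P" "(k, t) : Hom K (x, s) (d l)" using cov[of "(x, s)"] by fastforce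
  then have "k : Hom X x (fst (d l))" "act p (yarr k) (snd (d l)) = s"
   using K_Hom[of k t x s "fst (d l)" "snd (d l)"] by auto
  then show "EX l:P. EX k:Hom X x (fst (d l)). act p (yarr k) (snd (d l)) = s" using l(1) by blast
 next
  fix l c k s assume l: "l : P" and k: "k : Hom X (fst (d l)) c" "s : p$(yon c)" "act p (yarr k) s = snd (d l)"
  then have "(k, s) : Hom K (d l) (c, s)" using K_Hom[of k s "fst (d l)" "snd (d l)" c s] by simp
  then obtain m h where m: "(l, m) : r" "h : Hom K (c, s) (d m)" "h $$K$$ (k, s) = dd (l, m)" using abs[OF l] by blast
  then have "fst h : Hom X c (fst (d m))" "fst h \<cdot> k = fst (dd (l, m))"
   using K_Hom[of "fst h" "snd h" c s "fst (d m)" "snd (d m)"] by (auto, metis K_simps(6) fst_conv prod.collapse)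
  then show "EX m. (l, m) : r & (EX h:Hom X c (fst (d m)). h \<cdot> k = fst (dd (l, m)))" using m(1) by blast
 qed (use dd1 in auto)
qed

end

end

section \<open>The counit\<close>

lemma scott_simps [simp]:
 "Obj (scott U A) = {G. cat_functor A Sets G & preserves_directed_colimits U A Sets G}"
 "Dom (scott U A) = src" "Cod (scott U A) = tgt"
 "Ident (scott U A) = Ident (set_power A)" "Comp (scott U A) = Comp (set_power A)"
 by (auto simp: scott_def)

lemma Hom_scott:
 "F : Obj (scott U A) ==> G : Obj (scott U A) ==> Hom (scott U A) F G = Hom (set_power A) F G"
 by (simp add: scott_def)

lemma Hom_scottD: "alp : Hom (scott U A) F G ==> alp : Hom (set_power A) F G"
 by (auto simp: scott_def in_Hom)

lemma category_scott: "category (scott U A)"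
 unfolding scott_def by (rule category_full_subcategory[OF category_functor_category])

lemma set_functor_evaluation_points: "e : Obj E ==> set_functor (points U E) (evaluation (points U E) e)"
 by (rule evaluation_functor[OF points_def])

lemma counit_simps:
 "e : Obj E ==> (counit_inverse_image U E)$e = evaluation (points U E) e"
 "u : Arr E ==> farr (counit_inverse_image U E) u =
  Arrow (evaluation (points U E) (Dom E u)) (\<lambda>p\<in>Obj (points U E). farr p u) (evaluation (points U E) (Cod E u))"
 by (simp_all add: counit_inverse_image_def evaluation_def Let_def del: points_simps(1))

lemma app_counit:
 "u : Arr E ==> p : Obj (points U E) ==> app (farr (counit_inverse_image U E) u) p z = act p u z"
 unfolding app_def act_def by (simp add: counit_simps(2) del: points_simps(1))

context universe
begin

lemma evaluation_preserves_directed_colimits: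
 fixes E :: "('o, 'a) category"
 assumes E: "category E" and e: "e : Obj E"
 shows "preserves_directed_colimits U (points U E) Sets
  (evaluation (points U E) e :: (('o, 'a, 'u) set_funct, ('o, 'a, 'u) set_nat, 'u) set_funct)"
 unfolding preserves_directed_colimits_def preserves_colimits_of_shape_def
proof (intro conjI allI impI)
 let ?T = "points U E" and ?e = "evaluation (points U E) e"
 interpret ee: set_functor ?T ?e by (rule set_functor_evaluation_points[OF e])
 show "cat_functor ?T Sets ?e" by (rule ee.cat_functor_axioms)
 fix P :: "'u set" and r D p i
 assume P: "small_set P" and dir: "directed_poset P r" and D: "cat_functor (poset_category P r) ?T D"
  and colim: "is_colimit (poset_category P r) ?T D p i"
 interpret D: cat_functor "poset_category P r" ?T D by (rule D)
 have coc: "is_cocone (poset_category P r) ?T D p i" using colim by (simp add: is_colimit_def)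
 have pw: "elementwise_colimit P r (%l. D$l$e) (%k. app (farr D k) e) (p$e) (%l. app (i l) e)"
  using points_colimitD[OF E P dir D colim] e by (simp add: pointwise_colimit_def)
 have pT: "p : Obj ?T" and iT: "!!l. l : P ==> i l : Arr ?T"
  using coc by (auto simp: is_cocone_def in_Hom)
 have Do: "(comp_funct (poset_category P r) ?e D)$l = D$l$e" if "l : P" for l
  using D.fobj_in[of l] that by (simp del: points_simps(1))
 have Da: "act (comp_funct (poset_category P r) ?e D) k = app (farr D k) e" if "k : r" for k
  using D.arr_simps(1)[of k] that by (auto simp: act_def app_def fun_eq_iff)
 have ia: "body (farr ?e (i l)) = app (i l) e" if "l : P" for l
  using iT[OF that] by (auto simp: app_def fun_eq_iff)
 show "is_colimit (poset_category P r) Sets (comp_funct (poset_category P r) ?e D) (?e$p) (%j. farr ?e (i j))"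
 proof (rule set_directed_colimitI[OF dir cat_functor_comp[OF D ee.cat_functor_axioms] cocone_image[OF ee.cat_functor_axioms D coc]])
  have "r \<subseteq> P \<times> P" using directed_posetD(1)[OF dir] .
  then show "elementwise_colimit P r (fobj (comp_funct (poset_category P r) ?e D)) (act (comp_funct (poset_category P r) ?e D))
    (?e$p) (%l. body (farr ?e (i l)))"
   using pw evaluation_simps(1)[OF pT, of e]
   unfolding elementwise_colimit_def by (simp add: Do Da ia cong: ball_cong bex_cong conj_cong del: comp_funct_simps)
 qed
qed

lemma evaluation_scott:
 "category E ==> e : Obj E ==> evaluation (points U E) e : Obj (scott U (points U E))"
 using evaluation_preserves_directed_colimits[of E e] by (simp add: preserves_directed_colimits_def)

lemma counit_functor:
 fixes E :: "('o, 'a) category"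
 assumes E: "category E"
 shows "cat_functor E (scott U (points U E)) (counit_inverse_image U E)"
proof -
 interpret E: category E by fact
 let ?T = "points U E" and ?eps = "counit_inverse_image U E"
 interpret S: category "scott U ?T" by (rule category_scott)
 have sc: "evaluation ?T e : Obj (scott U ?T)" if "e : Obj E" for e by (rule evaluation_scott[OF E that])
 have H: "farr ?eps u : Hom (set_power ?T) (evaluation ?T a) (evaluation ?T b)" if u: "u : Hom E a b" for u a b
 proof -
  note ab = E.Hom_obj[OF u] and u' = HomD[OF u]
  have "nat_trans ?T Sets (evaluation ?T a) (evaluation ?T b) (\<lambda>p\<in>Obj ?T. farr p u)"
  proof (rule nat_transI)
   show "cat_functor ?T Sets (evaluation ?T a)" "cat_functor ?T Sets (evaluation ?T b)"
    using set_functor_evaluation_points ab by (auto simp: set_functor_def)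
   fix p assume p: "p : Obj ?T"
   interpret p: set_functor E p by (rule point_functor[OF p])
   show "(\<lambda>p\<in>Obj ?T. farr p u) p : Hom Sets ((evaluation ?T a)$p) ((evaluation ?T b)$p)"
    using p.farr_in[OF u] p by (simp del: points_simps(1))
  next
   fix alp p q assume alp: "alp : Hom ?T p q"
   have pq: "p : Obj ?T" "q : Obj ?T" "alp : Arr ?T"
    using category.Hom_obj[OF category_points alp] alp by (auto simp: in_Hom)
   have "nat_trans E Sets p q (body alp)" using Hom_pointsD[OF alp] by (simp add: in_Hom_functor_category)
   from nat_trans_natural[OF this u]
   show "(\<lambda>p\<in>Obj ?T. farr p u) q $$Sets$$ farr (evaluation ?T a) alp
     = farr (evaluation ?T b) alp $$Sets$$ (\<lambda>p\<in>Obj ?T. farr p u) p"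
    using pq by (simp del: points_simps(1))
  qed simp
  then show ?thesis using u' by (simp add: in_Hom_functor_category counit_simps(2) del: points_simps(1))
 qed
 show ?thesis
 proof (intro cat_functor.intro E category_scott cat_functor_axioms.intro)
  show "fobj ?eps : extensional (Obj E)" "farr ?eps : extensional (Arr E)"
   by (simp_all add: counit_inverse_image_def Let_def)
  show "?eps$a : Obj (scott U ?T)" if "a : Obj E" for a using sc[OF that] by (simp only: counit_simps(1)[OF that])
  show "farr ?eps u : Hom (scott U ?T) (?eps$a) (?eps$b)" if "u : Hom E a b" for u a b
   using H[OF that] by (simp only: Hom_scott[OF sc[OF E.Hom_obj(1)[OF that]] sc[OF E.Hom_obj(2)[OF that]]]
    counit_simps(1)[OF E.Hom_obj(1)[OF that]] counit_simps(1)[OF E.Hom_obj(2)[OF that]])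
  show "farr ?eps (Ident E a) = Ident (scott U ?T) (?eps$a)" if a: "a : Obj E" for a
   unfolding scott_simps(4) counit_simps(1)[OF a]
  proof (rule set_nat_eqI[OF H[OF E.id_in[OF a]] functor_cat.id_in])
   show "evaluation ?T a : Obj (set_power ?T)" using sc[OF a] by simp
   fix p z assume p: "p : Obj ?T" and z: "z : (evaluation ?T a)$p"
   then have z': "z : p$a" by (simp del: points_simps(1))
   show "app (farr ?eps (Ident E a)) p z = app (Ident (set_power ?T) (evaluation ?T a)) p z"
    using app_counit[OF E.ident_simps(1)[OF a] p, of z] app_ident[OF p z] set_functor.act_id[OF point_functor[OF p] a z'] by simp
  qed
  show "farr ?eps (v $$E$$ u) = farr ?eps v $$scott U ?T$$ farr ?eps u" if uv: "u : Hom E a b" "v : Hom E b c" for u v a b c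
   unfolding scott_simps(5)
  proof (rule set_nat_eqI[OF H[OF E.comp_in[OF uv]] functor_cat.comp_in[OF H[OF uv(1)] H[OF uv(2)]]])
   fix p z assume p: "p : Obj ?T" and z: "z : (evaluation ?T a)$p"
   then have z': "z : p$(Dom E u)" using HomD[OF uv(1)] by (simp del: points_simps(1))
   show "app (farr ?eps (v $$E$$ u)) p z = app (farr ?eps v $$set_power ?T$$ farr ?eps u) p z"
    using app_comp[OF H[OF uv(1)] p z, of "farr ?eps v"] app_counit[OF HomD(1)[OF uv(1)] p] app_counit[OF HomD(1)[OF uv(2)] p]
     app_counit[OF HomD(1)[OF E.comp_in[OF uv]] p] HomD[OF uv(1)] HomD[OF uv(2)] set_functor.act_comp[OF point_functor[OF p], of u v z] z'
    by simp
  qed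
 qed
qed

end

section \<open>The counit of a presheaf topos\<close>

context small_index
begin

abbreviation T ::
 "('u psh_funct, 'u psh_nat) category"
 where "T \<equiv> points U (set_power X)"

abbreviation eps ::
 "('u psh, 'u psh_map,
  ('u psh_funct, 'u psh_nat, 'u) set_funct,
  ('u psh_funct, 'u psh_nat, 'u) set_nat) funct"
 where "eps \<equiv> counit_inverse_image U (set_power X)"

definition point_hat ::
 "'u => 'u => 'u psh_funct
  => 'u psh_nat" where
 "point_hat x t p = set_nat (set_power X) (ev x) (%H h. act p (hat x h H) t) p"

lemma power_obj: "H : Obj (set_power X) <-> set_functor X H"
 by (simp add: set_functor_def)

lemma fobj_ev: "set_functor X H ==> (ev x)$H = H$x"
 by (rule evaluation_simps(1)) (simp only: power_obj)

lemma app_point_hat: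
 "set_functor X H ==> h : H$x ==> app (point_hat x t p) H h = act p (hat x h H) t"
 unfolding point_hat_def by (rule app_set_nat) (simp_all only: power_obj fobj_ev)

lemma point_hat_in:
 assumes p: "p : Obj T" and x: "x : Obj X" and t: "t : p$(yon x)"
 shows "point_hat x t p : Hom T (ev x) p"
proof -
 have "point_hat x t p : Hom (set_power (set_power X)) (ev x) p"
  unfolding point_hat_def
 proof (rule set_nat_in_Hom[OF set_functor_ev[OF x] point_functor[OF p]])
  fix H h assume "H : Obj (set_power X)" and h: "h : (ev x)$H"
  then have H: "set_functor X H" by (simp only: power_obj)
  have "h : H$x" using h by (simp only: fobj_ev[OF H])
  then show "act p (hat x h H) t : p$H" by (rule act_hat_in[OF point_functor[OF p] H x _ t])
 next
  fix alp h assume alp: "alp : Arr (set_power X)" and h: "h : (ev x)$(Dom (set_power X) alp)"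
  have alpH: "alp : Hom (set_power X) (Dom (set_power X) alp) (Cod (set_power X) alp)" using alp by (simp add: in_Hom)
  have h': "h : (Dom (set_power X) alp)$x" using h fobj_ev[OF nat_functors(1)[OF alpH]] by simp
  show "act p (hat x (act (ev x) alp h) (Cod (set_power X) alp)) t = act p alp (act p (hat x h (Dom (set_power X) alp)) t)"
   using comp_hat_app[OF point_functor[OF p] alpH x h' t] evaluation_simps(3)[OF alp, of x h] by simp
 qed
 then show ?thesis using Hom_points[OF ev_point[OF x] p] by simp
qed

lemma comp_point_hat:
 assumes \<sigma>: "\<sigma> : Hom T p q" and x: "x : Obj X" and t: "t : p$(yon x)"
 shows "\<sigma> $$T$$ point_hat x t p = point_hat x (app \<sigma> (yon x) t) q"
proof -
 have pq: "p : Obj T" "q : Obj T" using category.Hom_obj[OF category_points \<sigma>] by auto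
 note s = Hom_pointsD[OF \<sigma>] and a = Hom_pointsD[OF point_hat_in[OF pq(1) x t]]
 note b = Hom_pointsD[OF point_hat_in[OF pq(2) x app_in[OF s yon_obj[OF x] t]]]
 show ?thesis
  unfolding points_simps(5)
 proof (rule set_nat_eqI[OF functor_cat.comp_in[OF a s] b])
  fix H h assume H: "H : Obj (set_power X)" and h: "h : (ev x)$H"
  have H': "set_functor X H" using H by (simp only: power_obj)
  have h': "h : H$x" using h by (simp only: fobj_ev[OF H'])
  note hh = HomD[OF hat_in[OF H' x h']]
  show "app (\<sigma> $$set_power (set_power X)$$ point_hat x t p) H h = app (point_hat x (app \<sigma> (yon x) t) q) H h"
   using app_comp[OF a H h, of \<sigma>] app_point_hat[OF H' h'] app_natural[OF s hh(1), of t] hh t by simp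
 qed
qed

text \<open>The covariant functor \<open>x \<mapsto> ev x\<close> on arrows.\<close>

definition ev_arr :: "'u => 'u psh_nat" where
 "ev_arr f = point_hat (Dom X f) f (ev (Cod X f))"

lemma fobj_ev_yon: "x : Obj X ==> z : Obj X ==> (ev z)$(yon x) = Hom X x z"
 using fobj_ev[OF set_functor_yon] by simp

lemma ev_arr_in:
 assumes "f : Hom X a b"
 shows "ev_arr f : Hom T (ev a) (ev b)"
proof -
 note ab = Hom_obj[OF assms]
 have "f : (ev b)$(yon a)" using fobj_ev_yon[OF ab] assms by simp
 from point_hat_in[OF ev_point[OF ab(2)] ab(1) this] show ?thesis
  using HomD[OF assms] by (simp add: ev_arr_def)
qed

lemma app_ev_arr:
 assumes f: "f : Hom X a b" and H: "set_functor X H" "h : H$a"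
 shows "app (ev_arr f) H h = act H f h"
proof -
 note ab = Hom_obj[OF f]
 have "app (ev_arr f) H h = act (ev b) (hat a h H) f"
  using app_point_hat[OF H] HomD[OF f] by (simp add: ev_arr_def)
 also have "\<dots> = app (hat a h H) b f"
  by (rule evaluation_simps(3)) (rule HomD(1)[OF hat_in[OF H(1) ab(1) H(2)]])
 finally show ?thesis using app_hat[OF f] by simp
qed

lemma ev_arr_ident: "x : Obj X ==> ev_arr (Ident X x) = Ident T (ev x)"
proof -
 assume x: "x : Obj X"
 note evO = ev_point[OF x]
 have evO': "ev x : Obj (set_power (set_power X))" using evO by simp
 show ?thesis
  unfolding points_simps(4)
 proof (rule set_nat_eqI[OF Hom_pointsD[OF ev_arr_in[OF id_in[OF x]]] functor_cat.id_in[OF evO']])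
  fix H h assume H: "H : Obj (set_power X)" and h: "h : (ev x)$H"
  have H': "set_functor X H" using H by (simp only: power_obj)
  have h': "h : H$x" using h by (simp only: fobj_ev[OF H'])
  show "app (ev_arr (Ident X x)) H h = app (Ident (set_power (set_power X)) (ev x)) H h"
   using app_ev_arr[OF id_in[OF x] H' h'] set_functor.act_id[OF H' x h'] app_ident[OF H h] by simp
 qed
qed

lemma point_hat_yarr:
 assumes p: "p : Obj T" and k: "k : Hom X x c" and s: "s : p$(yon c)"
 shows "point_hat c s p $$T$$ ev_arr k = point_hat x (act p (yarr k) s) p"
proof -
 note xc = Hom_obj[OF k] and k' = HomD[OF k]
 have kk: "k : (ev c)$(yon x)" using fobj_ev_yon[OF xc] k by simp
 have "app (point_hat c s p) (yon x) k = act p (yarr k) s"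
  using app_point_hat[OF set_functor_yon[OF xc(1)], of k c s p] k k' xc by (simp add: yarr_def)
 then show ?thesis
  using comp_point_hat[OF point_hat_in[OF p xc(2) s] xc(1) kk] k' by (simp add: ev_arr_def)
qed

lemma ev_arr_comp:
 assumes "f : Hom X a b" "g : Hom X b c"
 shows "ev_arr (g \<cdot> f) = ev_arr g $$T$$ ev_arr f"
proof -
 note bc = Hom_obj[OF assms(2)] and ab = Hom_obj[OF assms(1)] and f' = HomD[OF assms(1)] and g' = HomD[OF assms(2)]
 have gc: "g : (ev c)$(yon b)" using fobj_ev_yon[OF bc] assms by simp
 have "ev_arr g $$T$$ ev_arr f = point_hat a (act (ev c) (yarr f) g) (ev c)"
  using point_hat_yarr[OF ev_point[OF bc(2)] assms(1) gc] g' by (simp add: ev_arr_def)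
 also have "act (ev c) (yarr f) g = app (yarr f) c g"
  by (rule evaluation_simps(3)[OF HomD(1)[OF yarr_in[OF assms(1)]]])
 also have "\<dots> = g \<cdot> f" by (rule app_yarr[OF assms])
 finally show ?thesis using f' g' by (simp add: ev_arr_def)
qed

lemma eps_functor: "cat_functor (set_power X) (scott U T) eps"
 by (rule counit_functor[OF category_functor_category])

lemma eps_obj: "set_functor X H ==> eps$H = evaluation T H"
 by (rule counit_simps(1)) (simp only: power_obj)

lemma fobj_eps: "set_functor X H ==> p : Obj T ==> eps$H$p = p$H"
 by (simp only: eps_obj evaluation_simps(1))

lemma act_eps: "set_functor X H ==> \<sigma> : Hom T p q ==> act (eps$H) \<sigma> z = app \<sigma> H z"
 by (simp only: eps_obj evaluation_simps(3)[OF HomD(1)])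

lemma app_eps: "alp : Hom (set_power X) H H' ==> p : Obj T ==> app (farr eps alp) p z = act p alp z"
 by (rule app_counit[OF HomD(1)])

text \<open>
 An arrow between evaluation functors on points is determined by its values at the points
 \<open>ev x\<close>, because every element of \<open>p(H)\<close> comes from an element at some \<open>ev x\<close> along a map
 \<open>ev x \<rightarrow> p\<close>.
\<close>

lemma eps_fully_faithful: "fully_faithful (set_power X) (scott U T) eps"
 unfolding fully_faithful_def
proof (intro conjI ballI bij_betwI' eps_functor)
 interpret eps: cat_functor "set_power X" "scott U T" eps by (rule eps_functor)
 fix H H' :: "'u psh"
 assume "H : Obj (set_power X)" "H' : Obj (set_power X)"
 then have H: "set_functor X H" and H': "set_functor X H'" by (simp_all only: power_obj)
 show "farr eps alp : Hom (scott U T) (eps$H) (eps$H')" if "alp : Hom (set_power X) H H'" for alp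
  by (rule eps.farr_in[OF that])
 show "farr eps alp = farr eps bet <-> alp = bet" if alp: "alp : Hom (set_power X) H H'" "bet : Hom (set_power X) H H'" for alp bet
 proof
  assume eq: "farr eps alp = farr eps bet"
  show "alp = bet"
  proof (rule set_nat_eqI[OF alp])
   fix x h assume x: "x : Obj X" and h: "h : H$x"
   have "act (ev x) alp h = act (ev x) bet h"
    using app_eps[OF alp(1) ev_point[OF x], of h] app_eps[OF alp(2) ev_point[OF x], of h] by (simp only: eq)
   then show "app alp x h = app bet x h"
    by (simp only: evaluation_simps(3)[OF HomD(1)[OF alp(1)]] evaluation_simps(3)[OF HomD(1)[OF alp(2)]])
  qed
 qed simp
 fix bet assume "bet : Hom (scott U T) (eps$H) (eps$H')"
 then have bet: "bet : Hom (set_power T) (eps$H) (eps$H')" by (rule Hom_scottD)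
 define alp where "alp = set_nat X H (%x h. app bet (ev x) h) H'"
 have epsev: "eps$K$(ev x) = K$x" if "x : Obj X" "set_functor X K" for x K
  using fobj_eps[OF that(2) ev_point[OF that(1)]] fobj_ev[OF that(2)] by simp
 have alp: "alp : Hom (set_power X) H H'"
  unfolding alp_def
 proof (rule set_nat_in_Hom[OF H H'])
  show "app bet (ev x) h : H'$x" if "x : Obj X" "h : H$x" for x h
   using app_in[OF bet ev_point[OF that(1)], of h] epsev[OF that(1)] H H' that(2) by simp
  fix f h assume f: "f : Arr X" and h: "h : H$(Dom X f)"
  have ff: "f : Hom X (Dom X f) (Cod X f)" using f by (simp add: in_Hom)
  note d = Hom_obj[OF ff]
  note e = ev_arr_in[OF ff] and e' = HomD[OF ev_arr_in[OF ff]]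
  have b: "app bet (ev (Dom X f)) h : H'$(Dom X f)"
   using app_in[OF bet ev_point[OF d(1)], of h] epsev[OF d(1)] H H' h by simp
  have "app bet (ev (Cod X f)) (act (eps$H) (ev_arr f) h) = act (eps$H') (ev_arr f) (app bet (ev (Dom X f)) h)"
   using app_natural[OF bet e'(1), of h] e'(2,3) epsev[OF d(1) H] h by simp
  then show "app bet (ev (Cod X f)) (act H f h) = act H' f (app bet (ev (Dom X f)) h)"
   using act_eps[OF H e] act_eps[OF H' e] app_ev_arr[OF ff H h] app_ev_arr[OF ff H' b] by simp
 qed
 have "farr eps alp = bet"
 proof (rule set_nat_eqI[OF Hom_scottD[OF eps.farr_in[OF alp]] bet])
  fix p z assume p: "p : Obj T" and z: "z : eps$H$p"
  have "z : p$H" using z fobj_eps[OF H p] by simp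
  then obtain x h t where x: "x : Obj X" "h : H$x" "t : p$(yon x)" "act p (hat x h H) t = z"
   using covered_by_representables[OF cocont[OF p] H] by blast
  note ph = point_hat_in[OF p x(1,3)] and ph' = HomD[OF point_hat_in[OF p x(1,3)]]
  have a: "app alp x h = app bet (ev x) h" using x by (simp add: alp_def)
  have b: "app alp x h : H'$x" by (rule app_in[OF alp x(1,2)])
  have "app bet p (act (eps$H) (point_hat x t p) h) = act (eps$H') (point_hat x t p) (app bet (ev x) h)"
   using app_natural[OF bet ph'(1), of h] ph'(2,3) epsev[OF x(1) H] x(2) by simp
  then have "app bet p z = act p (hat x (app alp x h) H') t"
   using act_eps[OF H ph] act_eps[OF H' ph] app_point_hat[OF H x(2)] app_point_hat[OF H' b] a x(4) by simp
  also have "\<dots> = act p alp z" using comp_hat_app[OF point_functor[OF p] alp x(1-3)] x(4) by simp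
  finally show "app (farr eps alp) p z = app bet p z" using app_eps[OF alp p] by simp
 qed
 then show "EX alp:Hom (set_power X) H H'. bet = farr eps alp" using alp by blast
qed

lemma eps_essentially_surjective: "essentially_surjective (set_power X) (scott U T) eps"
 unfolding essentially_surjective_def
proof
 interpret eps: cat_functor "set_power X" "scott U T" eps by (rule eps_functor)
 interpret Tc: category T by (rule category_points)
 fix G assume GO: "G : Obj (scott U T)"
 then have G: "set_functor T G" and Gd: "preserves_directed_colimits U T Sets G" by (simp_all add: set_functor_def)
 interpret G: set_functor T G by (rule G)
 have Gc: "act G (\<tau> $$T$$ \<sigma>) z = act G \<tau> (act G \<sigma> z)"
  if "\<sigma> : Hom T p q" "\<tau> : Hom T q s" "z : G$p" for \<sigma> \<tau> p q s z
  using G.act_comp[of \<sigma> \<tau> z] HomD[OF that(1)] HomD[OF that(2)] that(3) by simp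
 have Gin: "act G \<sigma> z : G$q" if "\<sigma> : Hom T p q" "z : G$p" for \<sigma> p q z
  using G.act_in[of \<sigma> z] HomD[OF that(1)] that(2) by simp
 define H where "H = set_funct X (%x. G$(ev x)) (%f. act G (ev_arr f))"
 have arr: "f : Hom X (Dom X f) (Cod X f)" if "f : Arr X" for f using that by (simp add: in_Hom)
 have H: "set_functor X H"
  unfolding H_def
 proof (rule set_functor_set_funct[OF category_axioms])
  show "small_set (G$(ev a))" if "a : Obj X" for a by (rule G.small[OF ev_point[OF that]])
  show "act G (ev_arr f) z : G$(ev (Cod X f))" if "f : Arr X" "z : G$(ev (Dom X f))" for f z
   by (rule Gin[OF ev_arr_in[OF arr[OF that(1)]] that(2)])
  show "act G (ev_arr (Ident X a)) z = z" if "a : Obj X" "z : G$(ev a)" for a z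
   using ev_arr_ident[OF that(1)] G.act_id[OF ev_point[OF that(1)] that(2)] by simp
  show "act G (ev_arr (g \<cdot> f)) z = act G (ev_arr g) (act G (ev_arr f) z)"
   if f: "f : Arr X" "g : Arr X" "Dom X g = Cod X f" "z : G$(ev (Dom X f))" for f g z
  proof -
   have g: "g : Hom X (Cod X f) (Cod X g)" using f by (simp add: in_Hom)
   show ?thesis
    using ev_arr_comp[OF arr[OF f(1)] g] Gc[OF ev_arr_in[OF arr[OF f(1)]] ev_arr_in[OF g] f(4)] by simp
  qed
 qed
 interpret H: set_functor X H by (rule H)
 have Ho: "H$x = G$(ev x)" if "x : Obj X" for x using that by (simp add: H_def)
 have Ha: "act H f h = act G (ev_arr f) h" if "f : Hom X x y" "h : H$x" for f x y h
  using that Ho[OF Hom_obj(1)[OF that(1)]] HomD[OF that(1)] by (simp add: H_def)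
 \<comment> \<open>Elements of \<open>p(H)\<close> and of \<open>G(p)\<close> have the same names, and the same names are identified.\<close>
 have same_onto: "(ALL x:Obj X. ALL h:fobj H x. ALL t:fobj p (yon x). ALL x':Obj X. ALL h':fobj H x'. ALL t':fobj p (yon x').
    act p (hat x h H) t = act p (hat x' h' H) t' <-> act G (point_hat x t p) h = act G (point_hat x' t' p) h') \<and>
   (ALL z:fobj G p. EX y:Obj X. EX k:fobj H y. EX s:fobj p (yon y). act G (point_hat y s p) k = z)"
  if p: "p : Obj T" for p
 proof -
  have pfun: "set_functor (set_power X) p" by (rule point_functor[OF p])
  obtain P :: "'u set" and r d dd s where P: "small_set P" "directed_poset P r"
   and d': "ALL l:P. d l : Obj X & dd (l, l) = Ident X (d l) & s l : p$(yon (d l))"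
   and dd': "ALL l m. (l, m) : r --> dd (l, m) : Hom X (d l) (d m) & act p (yarr (dd (l, m))) (s m) = s l"
   and ddc': "ALL l m n. (l, m) : r --> (m, n) : r --> dd (l, n) = dd (m, n) \<cdot> dd (l, m)"
   and cov': "ALL x:Obj X. ALL t:fobj p (yon x). EX l:P. EX k:Hom X x (d l). act p (yarr k) (s l) = t"
   and abs': "ALL l:P. ALL c. ALL k:Hom X (d l) c. ALL t:fobj p (yon c). act p (yarr k) t = s l -->
    (EX m. (l, m) : r & (EX h:Hom X c (d m). h \<cdot> k = dd (l, m)))"
   using point_directed_colimit[OF p] by (elim exE conjE)
  note dirD = directed_posetD[OF P(2)]
  have d: "d l : Obj X" "dd (l, l) = Ident X (d l)" "s l : p$(yon (d l))" if "l : P" for l using d' that by blast+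
  have dd: "dd (l, m) : Hom X (d l) (d m)" "act p (yarr (dd (l, m))) (s m) = s l" if "(l, m) : r" for l m using dd' that by blast+
  have rP: "l : P" "m : P" if "(l, m) : r" for l m using dirD(1) that by auto
  \<comment> \<open>Both kinds of elements can be moved along arrows into the directed diagram.\<close>
  have mv: "act p (hat y k H) t = act p (hat (d l) (act H f k) H) (s l)"
    "act G (point_hat y t p) k = act G (point_hat (d l) (s l) p) (act H f k)"
   if l: "l : P" and f: "f : Hom X y (d l)" and k: "k : H$y" and t: "act p (yarr f) (s l) = t" for y k t l f
  proof -
   note y = Hom_obj(1)[OF f] and dl = d[OF l]
   show "act p (hat y k H) t = act p (hat (d l) (act H f k) H) (s l)"
    using hat_yarr_app[OF pfun H f k dl(3)] t by simp
   have k': "k : G$(ev y)" using k Ho[OF y] by simp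
   show "act G (point_hat y t p) k = act G (point_hat (d l) (s l) p) (act H f k)"
    using point_hat_yarr[OF p f dl(3)] Gc[OF ev_arr_in[OF f] point_hat_in[OF p dl(1,3)] k'] Ha[OF f k] t by simp
  qed
  have Hdd: "act H (dd (l, m)) k : H$(d m)" if "(l, m) : r" "k : H$(d l)" for l m k
   using H.act_in[of "dd (l, m)" k] HomD[OF dd(1)[OF that(1)]] that(2) by simp
  define D where "D = Funct (\<lambda>l\<in>P. ev (d l)) (\<lambda>q\<in>r. ev_arr (dd q))"
  have Do: "D$l = ev (d l)" if "l : P" for l using that by (simp add: D_def)
  have Da: "farr D q = ev_arr (dd q)" if "q : r" for q using that by (simp add: D_def)
  have D: "cat_functor (poset_category P r) T D"
  proof (intro cat_functor.intro category_poset_category[OF P(2)] category_points cat_functor_axioms.intro)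
   show "D$a : Obj T" if "a : Obj (poset_category P r)" for a
    using that Do ev_point[OF d(1)] by (simp del: points_simps(1))
   show "farr D q : Hom T (D$a) (D$b)" if "q : Hom (poset_category P r) a b" for q a b
   proof -
    have q: "q = (a, b)" "(a, b) : r" using that by (auto simp: in_Hom)
    show ?thesis using q Da[OF q(2)] Do rP[OF q(2)] ev_arr_in[OF dd(1)[OF q(2)]] by simp
   qed
   show "farr D (Ident (poset_category P r) a) = Ident T (D$a)" if "a : Obj (poset_category P r)" for a
    using that Da[of "(a, a)"] Do d(2) dirD(2) ev_arr_ident[OF d(1)] by simp
   show "farr D (v $$poset_category P r$$ u) = farr D v $$T$$ farr D u"
    if "u : Hom (poset_category P r) a b" "v : Hom (poset_category P r) b c" for u v a b c
   proof -
    have q: "u = (a, b)" "(a, b) : r" "v = (b, c)" "(b, c) : r"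
     using that by (cases u; cases v; auto simp: in_Hom)+
    have "dd (a, c) = dd (b, c) \<cdot> dd (a, b)" using ddc' q by blast
    moreover have "(a, c) : r" using q dirD(3) by blast
    ultimately show ?thesis using q Da ev_arr_comp[OF dd(1)[OF q(2)] dd(1)[OF q(4)]] by simp
   qed
  qed (auto simp: D_def)
  define i where "i l = point_hat (d l) (s l) p" for l
  have iT: "i l : Hom T (ev (d l)) p" if "l : P" for l unfolding i_def by (rule point_hat_in[OF p d(1)[OF that] d(3)[OF that]])
  have cocone: "is_cocone (poset_category P r) T D p i"
   unfolding is_cocone_def
  proof (intro conjI ballI p)
   show "i l : Hom T (D$l) p" if "l : Obj (poset_category P r)" for l using that iT Do by simp
   fix q assume "q : Arr (poset_category P r)"
   then obtain l m where q: "q = (l, m)" "(l, m) : r" by (cases q) auto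
   show "i (Cod (poset_category P r) q) $$T$$ farr D q = i (Dom (poset_category P r) q)"
    using point_hat_yarr[OF p dd(1)[OF q(2)] d(3)[OF rP(2)[OF q(2)]]] dd(2)[OF q(2)] Da[OF q(2)] q
    by (simp add: i_def del: points_simps)
  qed
  have inj: "EX m. (l, m) : r & act K (dd (l, m)) k = act K (dd (l, m)) k'"
   if K: "set_functor X K" and l: "l : P" and k: "k : K$(d l)" "k' : K$(d l)"
    and eq: "act p (hat (d l) k K) (s l) = act p (hat (d l) k' K) (s l)" for K l k k'
  proof -
   interpret K: set_functor X K by (rule K)
   note dl = d[OF l]
   obtain w f u where w: "f : Hom X (d l) w" "u : p$(yon w)" "act p (yarr f) u = s l"
     "app (hat (d l) k K) w f = app (hat (d l) k' K) w f"
    using equalizing_element[OF p dl(1) hat_in[OF K dl(1) k(1)] hat_in[OF K dl(1) k(2)] dl(3) eq] by blast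
   obtain m g where m: "(l, m) : r" "g : Hom X w (d m)" "g \<cdot> f = dd (l, m)" using abs' l w(1-3) by blast
   have "act K f k = act K f k'" using w(4) app_hat[OF w(1)] by simp
   moreover have "act K (dd (l, m)) v = act K g (act K f v)" if "v : K$(d l)" for v
    using K.act_comp[of f g v] HomD[OF w(1)] HomD[OF m(2)] m(3) that by simp
   ultimately show ?thesis using m(1) k by metis
  qed
  have pw: "pointwise_colimit P r (set_power X) D p i"
   unfolding pointwise_colimit_def
  proof
   fix K :: "'u psh" assume "K : Obj (set_power X)"
   then have K: "set_functor X K" by (simp only: power_obj)
   interpret K: set_functor X K by (rule K)
   have DK: "D$l$K = K$(d l)" if "l : P" for l using Do[OF that] fobj_ev[OF K] by simp
   have DaK: "app (farr D (l, m)) K v = act K (dd (l, m)) v" if "(l, m) : r" "v : K$(d l)" for l m v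
    using Da[OF that(1)] app_ev_arr[OF dd(1)[OF that(1)] K that(2)] by simp
   have iK: "app (i l) K v = act p (hat (d l) v K) (s l)" if "l : P" "v : K$(d l)" for l v
    using app_point_hat[OF K that(2)] by (simp add: i_def)
   show "elementwise_colimit P r (%l. D$l$K) (%k. app (farr D k) K) (p$K) (%l. app (i l) K)"
    unfolding elementwise_colimit_def
   proof (intro conjI ballI impI)
    fix z assume "z : p$K"
    then obtain y k t where y: "y : Obj X" "k : K$y" "t : p$(yon y)" "act p (hat y k K) t = z"
     using covered_by_representables[OF cocont[OF p] K] by blast
    obtain l f where l: "l : P" "f : Hom X y (d l)" "act p (yarr f) (s l) = t" using cov' y(1,3) by blast
    have fk: "act K f k : K$(d l)" using K.act_in[of f k] HomD[OF l(2)] y(2) by simp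
    have "app (i l) K (act K f k) = z"
     using iK[OF l(1) fk] hat_yarr_app[OF pfun K l(2) y(2) d(3)[OF l(1)]] l(3) y(4) by simp
    then show "EX l:P. EX x:fobj (D$l) K. app (i l) K x = z" using l(1) fk DK by blast
   next
    fix l k k' assume l: "l : P" and k: "k : D$l$K" "k' : D$l$K" and eq: "app (i l) K k = app (i l) K k'"
    have k': "k : K$(d l)" "k' : K$(d l)" using k DK[OF l] by auto
    obtain m where "(l, m) : r" "act K (dd (l, m)) k = act K (dd (l, m)) k'"
     using inj[OF K l k'] eq iK[OF l] k' by auto
    then show "EX m. (l, m) : r & app (farr D (l, m)) K k = app (farr D (l, m)) K k'" using DaK k' by metis
   qed
  qed
  have "is_colimit (poset_category P r) T D p i" by (rule points_colimitI[OF P(2) D cocone pw])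
  then have colim: "is_colimit (poset_category P r) Sets (comp_funct (poset_category P r) G D) (G$p) (%l. farr G (i l))"
   using Gd P D unfolding preserves_directed_colimits_def preserves_colimits_of_shape_def by blast
  have ec: "elementwise_colimit P r (fobj (comp_funct (poset_category P r) G D)) (act (comp_funct (poset_category P r) G D)) (G$p) (%l. body (farr G (i l)))"
   by (rule set_directed_colimitD[OF P cat_functor_comp[OF D G.cat_functor_axioms] colim])
  have GDo: "(comp_funct (poset_category P r) G D)$l = H$(d l)" if "l : P" for l
   using that Do Ho[OF d(1)] by simp
  have GDa: "act (comp_funct (poset_category P r) G D) (l, m) k = act H (dd (l, m)) k" if "(l, m) : r" "k : H$(d l)" for l m k
   using that Da[OF that(1)] Ha[OF dd(1)[OF that(1)] that(2)] by (simp add: act_def)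
  have Gi: "body (farr G (i l)) = act G (point_hat (d l) (s l) p)" for l by (simp add: act_def i_def fun_eq_iff)
  have loc: "act p (hat (d l) k H) (s l) = act p (hat (d l) k' H) (s l) <->
    act G (point_hat (d l) (s l) p) k = act G (point_hat (d l) (s l) p) k'"
   if l: "l : P" and k: "k : H$(d l)" "k' : H$(d l)" for l k k'
  proof
   assume "act p (hat (d l) k H) (s l) = act p (hat (d l) k' H) (s l)"
   then obtain m where m: "(l, m) : r" "act H (dd (l, m)) k = act H (dd (l, m)) k'" using inj[OF H l k] by blast
   show "act G (point_hat (d l) (s l) p) k = act G (point_hat (d l) (s l) p) k'"
    using mv(2)[OF rP(2)[OF m(1)] dd(1)[OF m(1)] k(1) dd(2)[OF m(1)]] mv(2)[OF rP(2)[OF m(1)] dd(1)[OF m(1)] k(2) dd(2)[OF m(1)]] m(2) by simp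
  next
   assume eq: "act G (point_hat (d l) (s l) p) k = act G (point_hat (d l) (s l) p) k'"
   then obtain m where m: "(l, m) : r" "act (comp_funct (poset_category P r) G D) (l, m) k = act (comp_funct (poset_category P r) G D) (l, m) k'"
    using ec l k GDo[OF l] Gi unfolding elementwise_colimit_def by metis
   have "act H (dd (l, m)) k = act H (dd (l, m)) k'" using m GDa[OF m(1)] k by simp
   then show "act p (hat (d l) k H) (s l) = act p (hat (d l) k' H) (s l)"
    using mv(1)[OF rP(2)[OF m(1)] dd(1)[OF m(1)] k(1) dd(2)[OF m(1)]] mv(1)[OF rP(2)[OF m(1)] dd(1)[OF m(1)] k(2) dd(2)[OF m(1)]] by simp
  qed
  have norm: "EX n:P. (m, n) : r & (EX k':fobj H (d n). act p (hat y k H) t = act p (hat (d n) k' H) (s n) \<and>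
    act G (point_hat y t p) k = act G (point_hat (d n) (s n) p) k')"
   if y: "y : Obj X" "k : H$y" "t : p$(yon y)" and m: "m : P" for y k t m
  proof -
   obtain l f where l: "l : P" "f : Hom X y (d l)" "act p (yarr f) (s l) = t" using cov' y(1,3) by blast
   obtain n where n: "n : P" "(m, n) : r" "(l, n) : r" using dirD(5)[OF m l(1)] by blast
   have fk: "act H f k : H$(d l)" using H.act_in[of f k] HomD[OF l(2)] y(2) by simp
   note a = mv[OF l(1,2) y(2) l(3)] and b = mv[OF n(1) dd(1)[OF n(3)] fk dd(2)[OF n(3)]]
   show ?thesis using n a b Hdd[OF n(3) fk] by metis
  qed
  show ?thesis
  proof (intro conjI ballI)
   fix x h t x' h' t'
   assume x: "x : Obj X" "h : H$x" "t : p$(yon x)"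
    and x': "x' : Obj X" "h' : H$x'" "t' : p$(yon x')"
   obtain m where m: "m : P" using dirD(4) by blast
   obtain l k where l: "l : P" "k : H$(d l)" "act p (hat x h H) t = act p (hat (d l) k H) (s l)"
     "act G (point_hat x t p) h = act G (point_hat (d l) (s l) p) k" using norm[OF x m] by blast
   obtain n k' where n: "n : P" "(l, n) : r" "k' : H$(d n)" "act p (hat x' h' H) t' = act p (hat (d n) k' H) (s n)"
     "act G (point_hat x' t' p) h' = act G (point_hat (d n) (s n) p) k'" using norm[OF x' l(1)] by blast
   note b = mv[OF n(1) dd(1)[OF n(2)] l(2) dd(2)[OF n(2)]]
   show "act p (hat x h H) t = act p (hat x' h' H) t' <-> act G (point_hat x t p) h = act G (point_hat x' t' p) h'"
    using loc[OF n(1) Hdd[OF n(2) l(2)] n(3)] l(3,4) n(4,5) b by simp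
  next
   fix z assume z: "z : G$p"
   obtain l k where "l : P" "k : (comp_funct (poset_category P r) G D)$l" "body (farr G (i l)) k = z"
    using ec z unfolding elementwise_colimit_def by blast
   then show "EX y:Obj X. EX k:fobj H y. EX s:fobj p (yon y). act G (point_hat y s p) k = z"
    using GDo Gi d by metis
  qed
 qed
 have same: "act p (hat x h H) t = act p (hat x' h' H) t' <-> act G (point_hat x t p) h = act G (point_hat x' t' p) h'"
  if "p : Obj T" "x : Obj X" "h : H$x" "t : p$(yon x)" "x' : Obj X" "h' : H$x'" "t' : p$(yon x')"
  for p x h t x' h' t'
  using same_onto[OF that(1), THEN conjunct1] that(2-) by blast
 define tht where "tht p z = (SOME w. EX x h t. x : Obj X & h : H$x & t : p$(yon x) \<and>
   act p (hat x h H) t = z & w = act G (point_hat x t p) h)" for p z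
 have tht: "tht p (act p (hat x h H) t) = act G (point_hat x t p) h"
  if p: "p : Obj T" and x: "x : Obj X" "h : H$x" "t : p$(yon x)" for p x h t
  unfolding tht_def
 proof (rule some_equality)
  fix w assume "EX x' h' t'. x' : Obj X & h' : H$x' & t' : p$(yon x') \<and>
   act p (hat x' h' H) t' = act p (hat x h H) t & w = act G (point_hat x' t' p) h'"
  then obtain x' h' t' where x': "x' : Obj X" "h' : H$x'" "t' : p$(yon x')"
   "act p (hat x' h' H) t' = act p (hat x h H) t" "w = act G (point_hat x' t' p) h'" by blast
  then show "w = act G (point_hat x t p) h" using same[OF p x'(1-3) x] by simp
 qed (use x in blast)
 have cover: "EX x:Obj X. EX h:fobj H x. EX t:fobj p (yon x). act p (hat x h H) t = z" if "p : Obj T" "z : p$H" for p z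
  using covered_by_representables[OF cocont[OF that(1)] H that(2)] .
 have tht_in: "tht p z : G$p" if p: "p : Obj T" and z: "z : p$H" for p z
 proof -
  obtain x h t where x: "x : Obj X" "h : H$x" "t : p$(yon x)" "act p (hat x h H) t = z" using cover[OF p z] by blast
  have "act G (point_hat x t p) h : G$p" by (rule Gin[OF point_hat_in[OF p x(1,3)]]) (use x(2) Ho[OF x(1)] in simp)
  then show ?thesis using tht[OF p x(1-3)] x(4) by simp
 qed
 have epsH: "eps$H : Obj (scott U T)" by (rule eps.fobj_in) (simp only: power_obj H)
 have epsHf: "set_functor T (eps$H)" using epsH by (simp add: set_functor_def)
 let ?tht = "set_nat T (eps$H) tht G"
 have thtH: "?tht : Hom (set_power T) (eps$H) G"
 proof (rule set_nat_in_Hom[OF epsHf G])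
  show "tht p z : G$p" if "p : Obj T" "z : eps$H$p" for p z
   using tht_in that fobj_eps[OF H that(1)] by simp
  fix \<sigma> z assume \<sigma>A: "\<sigma> : Arr T" and z: "z : eps$H$(Dom T \<sigma>)"
  let ?p = "Dom T \<sigma>" and ?q = "Cod T \<sigma>"
  have \<sigma>: "\<sigma> : Hom T ?p ?q" using \<sigma>A by (simp add: in_Hom)
  have pq: "?p : Obj T" "?q : Obj T" using Tc.Hom_obj[OF \<sigma>] by auto
  have "z : ?p$H" using z fobj_eps[OF H pq(1)] by simp
  then obtain x h t where x: "x : Obj X" "h : H$x" "t : ?p$(yon x)" "act ?p (hat x h H) t = z" using cover[OF pq(1)] by blast
  note s = Hom_pointsD[OF \<sigma>] and hh = HomD[OF hat_in[OF H x(1,2)]]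
  have t': "app \<sigma> (yon x) t : ?q$(yon x)" by (rule app_in[OF s yon_obj[OF x(1)] x(3)])
  have "app \<sigma> H z = act ?q (hat x h H) (app \<sigma> (yon x) t)"
   using app_natural[OF s hh(1), of t] hh x(3,4) by simp
  then have "tht ?q (app \<sigma> H z) = act G (point_hat x (app \<sigma> (yon x) t) ?q) h" using tht[OF pq(2) x(1,2) t'] by simp
  also have "\<dots> = act G \<sigma> (act G (point_hat x t ?p) h)"
   using comp_point_hat[OF \<sigma> x(1,3)] Gc[OF point_hat_in[OF pq(1) x(1,3)] \<sigma>, of h] x(2) Ho[OF x(1)] by simp
  also have "\<dots> = act G \<sigma> (tht ?p z)" using tht[OF pq(1) x(1-3)] x(4) by simp
  finally show "tht ?q (act (eps$H) \<sigma> z) = act G \<sigma> (tht ?p z)" using act_eps[OF H \<sigma>] by simp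
 qed
 have bij: "bij_betw (app ?tht p) (eps$H$p) (G$p)" if p: "p : Obj T" for p
 proof (rule bij_betwI')
  have apptht: "app ?tht p z = tht p z" if "z : p$H" for z
   using that app_set_nat[OF p, of z "eps$H" tht G] fobj_eps[OF H p] by simp
  fix z z' assume "z : eps$H$p" "z' : eps$H$p"
  then have z: "z : p$H" "z' : p$H" using fobj_eps[OF H p] by auto
  obtain x h t where x: "x : Obj X" "h : H$x" "t : p$(yon x)" "act p (hat x h H) t = z" using cover[OF p z(1)] by blast
  obtain x' h' t' where x': "x' : Obj X" "h' : H$x'" "t' : p$(yon x')" "act p (hat x' h' H) t' = z'" using cover[OF p z(2)] by blast
  show "app ?tht p z = app ?tht p z' <-> z = z'"
   using same[OF p x(1-3) x'(1-3)] tht[OF p x(1-3)] tht[OF p x'(1-3)] x(4) x'(4) apptht[OF z(1)] apptht[OF z(2)] by simp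
 next
  show "app ?tht p z : G$p" if "z : eps$H$p" for z by (rule app_in[OF thtH p that])
 next
  fix w assume w: "w : G$p"
  have "EX y:Obj X. EX k:fobj H y. EX s:fobj p (yon y). act G (point_hat y s p) k = w"
   using same_onto[OF p, THEN conjunct2] w by blast
  then obtain y k s where y: "y : Obj X" "k : H$y" "s : p$(yon y)" "act G (point_hat y s p) k = w" by blast
  have z: "act p (hat y k H) s : p$H" by (rule act_hat_in[OF point_functor[OF p] H y(1-3)])
  have "app ?tht p (act p (hat y k H) s) = w"
   using tht[OF p y(1-3)] y(4) app_set_nat[OF p, of "act p (hat y k H) s" "eps$H" tht G] fobj_eps[OF H p] z by simp
  then show "EX z:fobj (eps$H) p. w = app ?tht p z" using z fobj_eps[OF H p] by blast
 qed
 have "is_iso (set_power T) ?tht" using is_iso_set_power_iff[OF thtH] bij by blast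
 moreover have thtS: "?tht : Hom (scott U T) (eps$H) G" using Hom_scott[OF epsH GO] thtH by simp
 ultimately have "is_iso (scott U T) ?tht"
  using is_iso_full_subcategory[OF category_functor_category] HomD(1)[OF thtS] unfolding scott_def by blast
 then show "EX c:Obj (set_power X). isomorphic (scott U T) (eps$c) G"
  using thtS unfolding isomorphic_def by (intro bexI[of _ H] bexI[of _ ?tht]) (simp_all only: power_obj H)
qed

end

section \<open>Sheafification\<close>

locale site = universe U + category C for U :: "'u itself" and C :: "('u, 'u) category" (structure) +
 fixes J :: "'u => 'u set set"
 assumes small_C: "small_category C" and topology: "grothendieck_topology C J"
begin

definition locally :: "'u => ('u => bool) => bool" where
 "locally c phi <-> {f : Arr C. Cod C f = c & (ALL g:Arr C. Cod C g = Dom C f --> phi (f \<cdot> g))} : J c"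

lemma at_ident:
 assumes "f : Arr C" "ALL g:Arr C. Cod C g = Dom C f --> phi (f \<cdot> g)"
 shows "phi f"
 using bspec[OF assms(2), of "Ident C (Dom C f)"] assms(1) by simp

lemma locally_trans:
 assumes c: "c : Obj C" and phi: "locally c phi"
  and l: "!!f. f : Arr C ==> Cod C f = c ==> phi f ==> locally (Dom C f) (%g. \<psi> (f \<cdot> g))"
 shows "locally c \<psi>"
proof -
 let ?S = "%d phi. {f : Arr C. Cod C f = d & (ALL g:Arr C. Cod C g = Dom C f --> phi (f \<cdot> g))}"
 have "pullback_sieve C h (?S c \<psi>) : J (Dom C h)" if h: "h : ?S c phi" for h
 proof -
  have "pullback_sieve C h (?S c \<psi>) = ?S (Dom C h) (%g. \<psi> (h \<cdot> g))"
   using h by (auto simp: pullback_sieve_def)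
  moreover have "phi h" using h at_ident[of h phi] by blast
  ultimately show ?thesis using l[of h] h by (simp add: locally_def)
 qed
 moreover have "is_sieve C c (?S c \<psi>)" by (auto simp: is_sieve_def)
 ultimately show ?thesis using topology c phi unfolding grothendieck_topology_def locally_def by blast
qed

lemma locally_all: "c : Obj C ==> (!!f. f : Arr C ==> Cod C f = c ==> phi f) ==> locally c phi"
proof -
 assume c: "c : Obj C" and phi: "!!f. f : Arr C ==> Cod C f = c ==> phi f"
 have "{f : Arr C. Cod C f = c & (ALL g:Arr C. Cod C g = Dom C f --> phi (f \<cdot> g))} = {f : Arr C. Cod C f = c}"
  using phi by auto
 then show ?thesis using topology c by (simp add: locally_def grothendieck_topology_def)
qed

lemma locally_mono:
 assumes c: "c : Obj C" and phi: "locally c phi"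
  and imp: "!!f. f : Arr C ==> Cod C f = c ==> phi f ==> \<psi> f"
 shows "locally c \<psi>"
proof -
 let ?S = "%phi. {f : Arr C. Cod C f = c & (ALL g:Arr C. Cod C g = Dom C f --> phi (f \<cdot> g))}"
 have "pullback_sieve C h (?S \<psi>) = {g : Arr C. Cod C g = Dom C h}" if "h : ?S phi" for h
  using that imp by (auto simp: pullback_sieve_def)
 then have "pullback_sieve C h (?S \<psi>) : J (Dom C h)" if "h : ?S phi" for h
  using that topology by (simp add: grothendieck_topology_def)
 moreover have "is_sieve C c (?S \<psi>)" by (auto simp: is_sieve_def)
 ultimately show ?thesis using topology c phi unfolding grothendieck_topology_def locally_def by blast
qed

lemma locally_pull:
 assumes "h : Hom C d c" "locally c phi"
 shows "locally d (%g. phi (h \<cdot> g))"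
proof -
 let ?S = "%d phi. {f : Arr C. Cod C f = d & (ALL g:Arr C. Cod C g = Dom C f --> phi (f \<cdot> g))}"
 have "pullback_sieve C h (?S c phi) : J d"
  using topology assms unfolding grothendieck_topology_def locally_def in_Hom by blast
 moreover have "pullback_sieve C h (?S c phi) = ?S d (%g. phi (h \<cdot> g))"
  using assms(1) by (auto simp: pullback_sieve_def in_Hom)
 ultimately show ?thesis by (simp add: locally_def)
qed

lemma locally_conj:
 assumes c: "c : Obj C" and "locally c phi" "locally c \<psi>"
 shows "locally c (%f. phi f & \<psi> f)"
proof -
 let ?S = "%phi. %f. ALL g:Arr C. Cod C g = Dom C f --> phi (f \<cdot> g)"
 have phi: "locally c (?S phi)"
 proof -
  have "(ALL g:Arr C. Cod C g = Dom C f --> ?S phi (f \<cdot> g)) <-> ?S phi f" if f: "f : Arr C" for f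
   using f by (intro iffI) (erule at_ident[rotated], assumption, simp)
  then have "{f : Arr C. Cod C f = c & (ALL g:Arr C. Cod C g = Dom C f --> ?S phi (f \<cdot> g))} =
    {f : Arr C. Cod C f = c & ?S phi f}" by (intro Collect_cong) blast
  then show ?thesis using assms(2) by (simp only: locally_def)
 qed
 show ?thesis
 proof (rule locally_trans[OF c phi])
  fix f assume f: "f : Arr C" "Cod C f = c" "?S phi f"
  have "f : Hom C (Dom C f) c" "Dom C f : Obj C" using f by (simp_all add: in_Hom)
  from this(2) locally_pull[OF this(1) assms(3)]
  show "locally (Dom C f) (%g. phi (f \<cdot> g) & \<psi> (f \<cdot> g))" by (rule locally_mono) (use f(3) in simp)
 qed
qed

lemma locally_finite:
 assumes c: "c : Obj C" and "finite K" "!!k. k : K ==> locally c (phi k)"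
 shows "locally c (%f. ALL k:K. phi k f)"
 using assms(2,3)
proof (induction K)
 case empty
 show ?case by (rule locally_all[OF c]) simp
next
 case (insert k K)
 have "locally c (%f. phi k f & (ALL k:K. phi k f))" by (rule locally_conj[OF c]) (use insert in auto)
 then show ?case by simp
qed

abbreviation Psh :: "('u psh, 'u psh_map) category" where
 "Psh \<equiv> set_power (opposite C)"

abbreviation presheaf :: "'u psh => bool" where "presheaf \<equiv> set_functor (opposite C)"

lemma psh_in:
 assumes "presheaf H" "f : Arr C" "x : H$(Cod C f)"
 shows "act H f x : H$(Dom C f)"
 using set_functor.act_in[OF assms(1), of f x] assms by simp

lemma psh_comp:
 assumes "presheaf H" "f : Arr C" "g : Arr C" "Cod C g = Dom C f" "x : H$(Cod C f)"
 shows "act H (f \<cdot> g) x = act H g (act H f x)"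
 using set_functor.act_comp[OF assms(1), of f g x] assms by simp

lemma psh_id: "presheaf H ==> c : Obj C ==> x : H$c ==> act H (Ident C c) x = x"
 using set_functor.act_id[of "opposite C" H c x] by simp

lemma psh_natural:
 assumes "alp : Hom Psh H K" "f : Arr C" "x : H$(Cod C f)"
 shows "app alp (Dom C f) (act H f x) = act K f (app alp (Cod C f) x)"
 using app_natural[OF assms(1), of f x] assms by simp

lemma psh_nat_in: "alp : Hom Psh H K ==> c : Obj C ==> x : H$c ==> app alp c x : K$c"
 using app_in[of alp "opposite C" H K c x] by simp

lemma psh_app_comp:
 "alp : Hom Psh H K ==> c : Obj C ==> x : H$c ==> app (bet $$Psh$$ alp) c x = app bet c (app alp c x)"
 using app_comp[of alp "opposite C" H K c x bet] by simp

lemma psh_nat_eqI: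
 assumes "alp : Hom Psh H K" "bet : Hom Psh H K" "!!c x. c : Obj C ==> x : H$c ==> app alp c x = app bet c x"
 shows "alp = bet"
 by (rule set_nat_eqI[OF assms(1,2)]) (use assms(3) in simp)

abbreviation sheaf :: "'u psh => bool" where "sheaf \<equiv> is_sheaf C J"

lemma sheaf_presheaf: "sheaf A ==> presheaf A"
 by (simp add: is_sheaf_def set_functor_def)

lemma sheaf_separated:
 assumes A: "sheaf A" and c: "c : Obj C" and x: "x : A$c" "y : A$c"
  and l: "locally c (%f. act A f x = act A f y)"
 shows "x = y"
proof -
 note P = sheaf_presheaf[OF A]
 let ?S = "{f : Arr C. Cod C f = c & (ALL g:Arr C. Cod C g = Dom C f --> act A (f \<cdot> g) x = act A (f \<cdot> g) y)}"
 have e: "act A f x = act A f y" if "f : ?S" for f using that at_ident[of f "%f. act A f x = act A f y"] by blast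
 have "matching_family C A ?S (%f. act A f x)"
  unfolding matching_family_def using psh_in[OF P] psh_comp[OF P] x by (auto simp: act_def[symmetric])
 moreover have "?S : J c" using l by (simp add: locally_def)
 ultimately have "EX! z. z : A$c & (ALL f:?S. body (farr A f) z = act A f x)"
  using A c unfolding is_sheaf_def by blast
 moreover have "ALL f:?S. body (farr A f) y = act A f x" using e by (simp add: act_def)
 ultimately show ?thesis using x by (auto simp: act_def)
qed

lemma sheaf_glue:
 assumes A: "sheaf A" and c: "c : Obj C" and l: "locally c phi"
  and z: "!!f. f : Arr C ==> Cod C f = c ==> phi f ==> z f : A$(Dom C f)"
  and zc: "!!f g. f : Arr C ==> Cod C f = c ==> phi f ==> g : Arr C ==> Cod C g = Dom C f ==> phi (f \<cdot> g) & z (f \<cdot> g) = act A g (z f)"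
 shows "EX y:fobj A c. ALL f:Arr C. Cod C f = c --> phi f --> act A f y = z f"
proof -
 let ?S = "{f : Arr C. Cod C f = c & (ALL g:Arr C. Cod C g = Dom C f --> phi (f \<cdot> g))}"
 have "?S = {f : Arr C. Cod C f = c & phi f}" using zc at_ident[of _ phi] by blast
 then have "{f : Arr C. Cod C f = c & phi f} : J c" using l by (simp add: locally_def)
 moreover have "matching_family C A {f : Arr C. Cod C f = c & phi f} z"
  unfolding matching_family_def using z zc by (auto simp: act_def)
 ultimately have "EX! y. y : A$c & (ALL f:{f : Arr C. Cod C f = c & phi f}. body (farr A f) y = z f)"
  using A c unfolding is_sheaf_def by blast
 then show ?thesis by (auto simp: act_def)
qed

definition locally_bijective :: "'u psh => 'u psh => 'u psh_map => bool" where
 "locally_bijective H A eta <-> eta : Hom Psh H A \<and>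
  (ALL c:Obj C. ALL x:fobj H c. ALL y:fobj H c. app eta c x = app eta c y --> locally c (%f. act H f x = act H f y)) \<and>
  (ALL c:Obj C. ALL a:fobj A c. locally c (%f. EX x:fobj H (Dom C f). app eta (Dom C f) x = act A f a))"

lemma locally_bijectiveD:
 assumes "locally_bijective H A eta"
 shows "eta : Hom Psh H A"
  "!!c x y. c : Obj C ==> x : H$c ==> y : H$c ==> app eta c x = app eta c y ==> locally c (%f. act H f x = act H f y)"
  "!!c a. c : Obj C ==> a : A$c ==> locally c (%f. EX x:fobj H (Dom C f). app eta (Dom C f) x = act A f a)"
 using assms unfolding locally_bijective_def by blast+

text \<open>
 A map into a sheaf does not see the difference between elements that agree locally, and it
 can be defined locally. So it extends uniquely along locally bijective maps.
\<close>

lemma sheaf_map_locally: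
 assumes alp: "alp : Hom Psh H B" and B: "sheaf B" and c: "c : Obj C" and x: "x : H$c" "y : H$c"
  and l: "locally c (%f. act H f x = act H f y)"
 shows "app alp c x = app alp c y"
proof (rule sheaf_separated[OF B c psh_nat_in[OF alp c x(1)] psh_nat_in[OF alp c x(2)]])
 note P = nat_functors(2)[OF alp]
 show "locally c (%f. act B f (app alp c x) = act B f (app alp c y))"
 proof (rule locally_mono[OF c l])
  fix f assume f: "f : Arr C" "Cod C f = c" "act H f x = act H f y"
  have e: "app alp (Dom C f) (act H f z) = act B f (app alp c z)" if "z : H$c" for z
   using psh_natural[OF alp f(1), of z] that f(2) by simp
  show "act B f (app alp c x) = act B f (app alp c y)"
   unfolding e[OF x(1), symmetric] e[OF x(2), symmetric] f(3) ..
 qed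
qed

lemma locally_bijective_universal:
 assumes eta: "locally_bijective H A eta" and B: "sheaf B" and alp: "alp : Hom Psh H B"
 shows "EX! bet. bet : Hom Psh A B & bet $$Psh$$ eta = alp"
proof -
 note lb = locally_bijectiveD[OF eta]
 have H: "presheaf H" and A: "presheaf A" using nat_functors[OF lb(1)] by auto
 have PB: "presheaf B" by (rule sheaf_presheaf[OF B])
 have img: "app alp c x = app alp c y" if "c : Obj C" "x : H$c" "y : H$c" "app eta c x = app eta c y" for c x y
  by (rule sheaf_map_locally[OF alp B that(1-3) lb(2)[OF that]])
 define w where "w f a = (SOME v. EX x:fobj H (Dom C f). app eta (Dom C f) x = act A f a & v = app alp (Dom C f) x)" for f a
 have w: "w f a = app alp (Dom C f) x"
  if "f : Arr C" "x : H$(Dom C f)" "app eta (Dom C f) x = act A f a" for f a x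
  unfolding w_def
 proof (rule some_equality)
  fix v assume "EX y:fobj H (Dom C f). app eta (Dom C f) y = act A f a & v = app alp (Dom C f) y"
  then obtain y where y: "y : H$(Dom C f)" "app eta (Dom C f) y = act A f a" "v = app alp (Dom C f) y"
   by (elim bexE conjE)
  have "Dom C f : Obj C" using that(1) by simp
  from img[OF this y(1) that(2)] show "v = app alp (Dom C f) x" using y(2,3) that(3) by (simp only: simp_thms)
 qed (use that in blast)
 have ex: "EX b:fobj B c. ALL f:Arr C. Cod C f = c --> (EX x:fobj H (Dom C f). app eta (Dom C f) x = act A f a) --> act B f b = w f a"
  if c: "c : Obj C" and a: "a : A$c" for c a
 proof (rule sheaf_glue[OF B c lb(3)[OF c a]])
  show "w f a : B$(Dom C f)"
   if "f : Arr C" "Cod C f = c" "EX x:fobj H (Dom C f). app eta (Dom C f) x = act A f a" for f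
   using that(3) w[OF that(1)] psh_nat_in[OF alp, of "Dom C f"] that(1) by auto
  fix f g assume f: "f : Arr C" "Cod C f = c" "EX x:fobj H (Dom C f). app eta (Dom C f) x = act A f a"
   and g: "g : Arr C" "Cod C g = Dom C f"
  obtain x where x: "x : H$(Dom C f)" "app eta (Dom C f) x = act A f a" using f(3) by blast
  have gx: "act H g x : H$(Dom C g)" using psh_in[OF H g(1)] x(1) g(2) by simp
  have e: "app eta (Dom C g) (act H g x) = act A (f \<cdot> g) a"
   using psh_natural[OF lb(1) g(1), of x] x g psh_comp[OF A f(1) g(1,2)] a f(2) by simp
  have "w (f \<cdot> g) a = app alp (Dom C g) (act H g x)" using e w[of "f \<cdot> g" "act H g x" a] f g gx by simp
  then have "w (f \<cdot> g) a = act B g (w f a)"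
   using psh_natural[OF alp g(1), of x] w[OF f(1) x] x(1) g(2) by simp
  moreover have "EX x:fobj H (Dom C (f \<cdot> g)). app eta (Dom C (f \<cdot> g)) x = act A (f \<cdot> g) a"
   using gx e f(1) g by (intro bexI[of _ "act H g x"]) simp_all
  ultimately show "(EX x:fobj H (Dom C (f \<cdot> g)). app eta (Dom C (f \<cdot> g)) x = act A (f \<cdot> g) a) & w (f \<cdot> g) a = act B g (w f a)" by blast
 qed
 define b where "b c a = (SOME v. v : B$c & (ALL f:Arr C. Cod C f = c -->
   (EX x:fobj H (Dom C f). app eta (Dom C f) x = act A f a) --> act B f v = w f a))" for c a
 have b': "b c a : B$c & (ALL f:Arr C. Cod C f = c -->
   (EX x:fobj H (Dom C f). app eta (Dom C f) x = act A f a) --> act B f (b c a) = w f a)"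
  if "c : Obj C" "a : A$c" for c a
  unfolding b_def by (rule someI_ex) (use ex[OF that] in blast)
 have b: "b c a : B$c" if "c : Obj C" "a : A$c" for c a using b'[OF that] by blast
 have bw: "act B f (b c a) = app alp (Dom C f) x"
  if "c : Obj C" "a : A$c" "f : Arr C" "Cod C f = c" "x : H$(Dom C f)" "app eta (Dom C f) x = act A f a" for c a f x
 proof -
  have "act B f (b c a) = w f a" using b'[OF that(1,2)] that(3-6) by blast
  then show ?thesis using w[OF that(3,5,6)] by simp
 qed
 have b_eq: "b c a = v" if c: "c : Obj C" and a: "a : A$c" and v: "v : B$c"
  and vf: "!!f x. f : Arr C ==> Cod C f = c ==> x : H$(Dom C f) ==> app eta (Dom C f) x = act A f a ==> act B f v = app alp (Dom C f) x"
  for c a v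
 proof (rule sheaf_separated[OF B c b[OF c a] v])
  show "locally c (%f. act B f (b c a) = act B f v)"
   by (rule locally_mono[OF c lb(3)[OF c a]]) (use bw[OF c a] vf in auto)
 qed
 let ?bet = "set_nat (opposite C) A b B"
 have bet: "?bet : Hom Psh A B"
 proof (rule set_nat_in_Hom[OF A PB])
  show "b c a : B$c" if "c : Obj (opposite C)" "a : A$c" for c a using b that by simp
  fix g a assume "g : Arr (opposite C)" "a : A$(Dom (opposite C) g)"
  then have g: "g : Arr C" and a: "a : A$(Cod C g)" by simp_all
  have o: "Dom C g : Obj C" "Cod C g : Obj C" using g by auto
  have "b (Dom C g) (act A g a) = act B g (b (Cod C g) a)"
  proof (rule b_eq[OF o(1) psh_in[OF A g a] psh_in[OF PB g b[OF o(2) a]]])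
   fix f x assume f: "f : Arr C" "Cod C f = Dom C g" and x: "x : H$(Dom C f)" "app eta (Dom C f) x = act A f (act A g a)"
   have "app eta (Dom C (g \<cdot> f)) x = act A (g \<cdot> f) a" using psh_comp[OF A g f a] x(2) g f by simp
   then have "act B (g \<cdot> f) (b (Cod C g) a) = app alp (Dom C f) x" using bw[OF o(2) a, of "g \<cdot> f" x] g f x(1) by simp
   then show "act B f (act B g (b (Cod C g) a)) = app alp (Dom C f) x" using psh_comp[OF PB g f b[OF o(2) a]] by simp
  qed
  then show "b (Cod (opposite C) g) (act A g a) = act B g (b (Dom (opposite C) g) a)" by simp
 qed
 show ?thesis
 proof (rule ex1I[of _ ?bet])
  have "?bet $$Psh$$ eta = alp"
  proof (rule psh_nat_eqI[OF functor_cat.comp_in[OF lb(1) bet] alp])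
   fix c x assume c: "c : Obj C" and x: "x : H$c"
   note ex = psh_nat_in[OF lb(1) c x]
   have "b c (app eta c x) = app alp c x"
   proof (rule b_eq[OF c ex psh_nat_in[OF alp c x]])
    fix f y assume f: "f : Arr C" "Cod C f = c" and y: "y : H$(Dom C f)" "app eta (Dom C f) y = act A f (app eta c x)"
    have fx: "act H f x : H$(Dom C f)" using psh_in[OF H f(1)] x f(2) by simp
    have "app eta (Dom C f) y = app eta (Dom C f) (act H f x)" using y(2) psh_natural[OF lb(1) f(1), of x] f(2) x by simp
    then have "app alp (Dom C f) y = app alp (Dom C f) (act H f x)" using img[OF _ y(1) fx] f(1) by simp
    then show "act B f (app alp c x) = app alp (Dom C f) y" using psh_natural[OF alp f(1), of x] f(2) x by simp
   qed
   then show "app (?bet $$Psh$$ eta) c x = app alp c x" using psh_app_comp[OF lb(1) c x] c ex by simp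
  qed
  then show "?bet : Hom Psh A B & ?bet $$Psh$$ eta = alp" using bet by blast
 next
  fix \<gamma> assume \<gamma>: "\<gamma> : Hom Psh A B & \<gamma> $$Psh$$ eta = alp"
  then have \<gamma>H: "\<gamma> : Hom Psh A B" by blast
  show "\<gamma> = ?bet"
  proof (rule psh_nat_eqI[OF \<gamma>H bet])
   fix c a assume c: "c : Obj C" and a: "a : A$c"
   have "b c a = app \<gamma> c a"
   proof (rule b_eq[OF c a psh_nat_in[OF \<gamma>H c a]])
    fix f x assume f: "f : Arr C" "Cod C f = c" and x: "x : H$(Dom C f)" "app eta (Dom C f) x = act A f a"
    have "app alp (Dom C f) x = app \<gamma> (Dom C f) (app eta (Dom C f) x)"
     using psh_app_comp[OF lb(1) _ x(1), of \<gamma>] \<gamma> f(1) by simp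
    then show "act B f (app \<gamma> c a) = app alp (Dom C f) x" using psh_natural[OF \<gamma>H f(1), of a] x(2) a f(2) by simp
   qed
   then show "app \<gamma> c a = app ?bet c a" using c a by simp
  qed
 qed
qed

text \<open>
 Locally bijective maps are closed under finite limits: a compatible family of elements of the
 sheaves locally lifts to a compatible family, because finitely many covers have a common
 refinement.
\<close>

lemma sheaf_finite_limit:
 assumes fin: "finite (Obj I)" "finite (Arr I)" "category I"
  and D: "cat_functor I Psh D" and D': "cat_functor I Psh D'"
  and sheaves: "!!j. j : Obj I ==> sheaf (D'$j)"
  and eta: "!!j. j : Obj I ==> locally_bijective (D$j) (D'$j) (eta j)"
  and nat: "!!k. k : Arr I ==> farr D' k $$Psh$$ eta (Dom I k) = eta (Cod I k) $$Psh$$ farr D k"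
  and cone: "is_cone I Psh D c \<pi>"
  and lim: "!!x. x : Obj C ==> elementwise_limit I (%j. D$j$x) (%k. app (farr D k) x) (c$x) (%j. app (\<pi> j) x)"
  and A: "sheaf A" and eta0: "locally_bijective c A eta0"
  and \<rho>: "!!j. j : Obj I ==> \<rho> j : Hom Psh A (D'$j)" "!!j. j : Obj I ==> \<rho> j $$Psh$$ eta0 = eta j $$Psh$$ \<pi> j"
  and x: "x : Obj C"
 shows "elementwise_limit I (%j. D'$j$x) (%k. app (farr D' k) x) (A$x) (%j. app (\<rho> j) x)"
proof -
 interpret I: category I by (rule fin(3))
 interpret D: cat_functor I Psh D by (rule D)
 interpret D': cat_functor I Psh D' by (rule D')
 note lb0 = locally_bijectiveD[OF eta0] and lb = locally_bijectiveD[OF eta]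
 have \<pi>: "\<pi> j : Hom Psh c (D$j)" if "j : Obj I" for j using cone that by (simp add: is_cone_def)
 have c: "presheaf c" and PA: "presheaf A" using nat_functors[OF lb0(1)] by auto
 have Dj: "presheaf (D$j)" and D'j: "presheaf (D'$j)" if "j : Obj I" for j
  using nat_functors[OF lb(1)[OF that]] by auto
 have Dk: "farr D k : Hom Psh (D$(Dom I k)) (D$(Cod I k))"
  "farr D' k : Hom Psh (D'$(Dom I k)) (D'$(Cod I k))" if "k : Arr I" for k
  using D.farr_Hom[OF that] D'.farr_Hom[OF that] by auto
 have sq: "app (\<rho> j) y (app eta0 y w) = app (eta j) y (app (\<pi> j) y w)" if "j : Obj I" "y : Obj C" "w : c$y" for j y w
  using psh_app_comp[OF lb0(1) that(2,3), of "\<rho> j"] psh_app_comp[OF \<pi>[OF that(1)] that(2,3), of "eta j"] \<rho>(2)[OF that(1)] by simp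
 have sqk: "app (farr D' k) y (app (eta (Dom I k)) y w) = app (eta (Cod I k)) y (app (farr D k) y w)"
  if "k : Arr I" "y : Obj C" "w : D$(Dom I k)$y" for k y w
  using psh_app_comp[OF lb(1)[of "Dom I k"] that(2,3), of "farr D' k"] psh_app_comp[OF Dk(1)[OF that(1)] that(2,3), of "eta (Cod I k)"]
   nat[OF that(1)] that(1) by simp
 have \<pi>k: "app (farr D k) y (app (\<pi> (Dom I k)) y w) = app (\<pi> (Cod I k)) y w"
  if "k : Arr I" "y : Obj C" "w : c$y" for k y w
 proof -
  have "farr D k $$Psh$$ \<pi> (Dom I k) = \<pi> (Cod I k)" using cone that(1) by (simp add: is_cone_def)
  then show ?thesis using psh_app_comp[OF \<pi>[of "Dom I k"] that(2,3), of "farr D k"] that(1) by simp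
 qed
 have c_unique: "w = w'" if y: "y : Obj C" and w: "w : c$y" "w' : c$y"
  and eq: "!!j. j : Obj I ==> app (\<pi> j) y w = app (\<pi> j) y w'" for y w w'
 proof -
  have "compatible_family I (%j. D$j$y) (%k. app (farr D k) y) (%j. app (\<pi> j) y w)"
   unfolding compatible_family_def using psh_nat_in[OF \<pi> y w(1)] \<pi>k[OF _ y w(1)] by blast
  then have "EX! z. z : c$y & (ALL j:Obj I. app (\<pi> j) y z = app (\<pi> j) y w)"
   using lim[OF y] unfolding elementwise_limit_def by blast
  moreover have "w : c$y & (ALL j:Obj I. app (\<pi> j) y w = app (\<pi> j) y w)" using w by blast
  moreover have "w' : c$y & (ALL j:Obj I. app (\<pi> j) y w' = app (\<pi> j) y w)" using w eq by simp
  ultimately show ?thesis by blast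
 qed
 have inj0: "app eta0 y w = app eta0 y w'" if y: "y : Obj C" and w: "w : c$y" "w' : c$y"
  and eq: "!!j. j : Obj I ==> app (eta j) y (app (\<pi> j) y w) = app (eta j) y (app (\<pi> j) y w')" for y w w'
 proof (rule sheaf_map_locally[OF lb0(1) A y w])
  have "locally y (%f. ALL j:Obj I. act (D$j) f (app (\<pi> j) y w) = act (D$j) f (app (\<pi> j) y w'))"
   by (rule locally_finite[OF y fin(1)]) (use lb(2)[OF _ y] psh_nat_in[OF \<pi> y] w eq in blast)
  then show "locally y (%f. act c f w = act c f w')"
  proof (rule locally_mono[OF y _])
   fix f assume f: "f : Arr C" "Cod C f = y"
    and e: "ALL j:Obj I. act (D$j) f (app (\<pi> j) y w) = act (D$j) f (app (\<pi> j) y w')"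
   show "act c f w = act c f w'"
   proof (rule c_unique[of "Dom C f"])
    fix j assume j: "j : Obj I"
    show "app (\<pi> j) (Dom C f) (act c f w) = app (\<pi> j) (Dom C f) (act c f w')"
     using psh_natural[OF \<pi>[OF j] f(1), of w] psh_natural[OF \<pi>[OF j] f(1), of w'] w f(2) e j by simp
   qed (use f w psh_in[OF c f(1)] in auto)
  qed
 qed
 show ?thesis
  unfolding elementwise_limit_def
 proof (intro allI impI)
  fix a assume "compatible_family I (%j. D'$j$x) (%k. app (farr D' k) x) a"
  then have a: "!!j. j : Obj I ==> a j : D'$j$x"
   and ak: "!!k. k : Arr I ==> app (farr D' k) x (a (Dom I k)) = a (Cod I k)"
   by (auto simp: compatible_family_def)
  define lift where "lift f w <-> w : c$(Dom C f) \<and>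
   (ALL j:Obj I. app (eta j) (Dom C f) (app (\<pi> j) (Dom C f) w) = act (D'$j) f (a j))" for f w
  have lift_res: "lift (f \<cdot> g) (act c g w)"
   if f: "f : Arr C" "Cod C f = x" and g: "g : Arr C" "Cod C g = Dom C f" and w: "lift f w" for f g w
  proof -
   have wc: "w : c$(Cod C g)" using w g by (simp add: lift_def)
   have gw: "act c g w : c$(Dom C g)" by (rule psh_in[OF c g(1) wc])
   have "app (eta j) (Dom C g) (app (\<pi> j) (Dom C g) (act c g w)) = act (D'$j) (f \<cdot> g) (a j)" if j: "j : Obj I" for j
   proof -
    have "app (\<pi> j) (Dom C g) (act c g w) = act (D$j) g (app (\<pi> j) (Cod C g) w)"
     by (rule psh_natural[OF \<pi>[OF j] g(1) wc])
    moreover have "app (\<pi> j) (Cod C g) w : D$j$(Cod C g)"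
     using psh_nat_in[OF \<pi>[OF j] _ wc] g(1) by simp
    ultimately have "app (eta j) (Dom C g) (app (\<pi> j) (Dom C g) (act c g w)) = act (D'$j) g (act (D'$j) f (a j))"
     using psh_natural[OF lb(1)[OF j] g(1)] w g(2) j by (simp add: lift_def)
    then show ?thesis using psh_comp[OF D'j[OF j] f(1) g(1,2)] a[OF j] f(2) by simp
   qed
   then show ?thesis using gw f g by (simp add: lift_def)
  qed
  have "locally x (%f. ALL j:Obj I. EX y:fobj (D$j) (Dom C f). app (eta j) (Dom C f) y = act (D'$j) f (a j))"
   by (rule locally_finite[OF x fin(1)]) (use lb(3)[OF _ x] a in blast)
  then have covered: "locally x (%f. EX w. lift f w)"
  proof (rule locally_trans[OF x _])
   fix f assume f: "f : Arr C" "Cod C f = x"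
    and "ALL j:Obj I. EX y:fobj (D$j) (Dom C f). app (eta j) (Dom C f) y = act (D'$j) f (a j)"
   then have "ALL j:Obj I. EX y. y : D$j$(Dom C f) & app (eta j) (Dom C f) y = act (D'$j) f (a j)" by blast
   from bchoice[OF this] obtain y where y: "!!j. j : Obj I ==> y j : D$j$(Dom C f)"
     and ye: "!!j. j : Obj I ==> app (eta j) (Dom C f) (y j) = act (D'$j) f (a j)" by blast
   have d: "Dom C f : Obj C" using f by simp
   have "locally (Dom C f) (%g. ALL k:Arr I. act (D$(Cod I k)) g (app (farr D k) (Dom C f) (y (Dom I k))) = act (D$(Cod I k)) g (y (Cod I k)))"
   proof (rule locally_finite[OF d fin(2)])
    fix k assume k: "k : Arr I"
    have o: "Dom I k : Obj I" "Cod I k : Obj I" using k by auto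
    have "app (eta (Cod I k)) (Dom C f) (app (farr D k) (Dom C f) (y (Dom I k))) = app (farr D' k) (Dom C f) (act (D'$(Dom I k)) f (a (Dom I k)))"
     using sqk[OF k d y[OF o(1)]] ye[OF o(1)] by simp
    also have "\<dots> = act (D'$(Cod I k)) f (a (Cod I k))"
     using psh_natural[OF Dk(2)[OF k] f(1), of "a (Dom I k)"] a[OF o(1)] f(2) ak[OF k] by simp
    finally have "app (eta (Cod I k)) (Dom C f) (app (farr D k) (Dom C f) (y (Dom I k))) = app (eta (Cod I k)) (Dom C f) (y (Cod I k))"
     using ye[OF o(2)] by simp
    then show "locally (Dom C f) (%g. act (D$(Cod I k)) g (app (farr D k) (Dom C f) (y (Dom I k))) = act (D$(Cod I k)) g (y (Cod I k)))"
     by (rule lb(2)[OF o(2) d psh_nat_in[OF Dk(1)[OF k] d y[OF o(1)]] y[OF o(2)]])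
   qed
   then show "locally (Dom C f) (%g. EX w. lift (f \<cdot> g) w)"
   proof (rule locally_mono[OF d])
    fix g assume g: "g : Arr C" "Cod C g = Dom C f"
     and e: "ALL k:Arr I. act (D$(Cod I k)) g (app (farr D k) (Dom C f) (y (Dom I k))) = act (D$(Cod I k)) g (y (Cod I k))"
    have dg: "Dom C g : Obj C" using g by simp
    have y': "y j : D$j$(Cod C g)" if "j : Obj I" for j using y[OF that] g(2) by simp
    have "compatible_family I (%j. D$j$(Dom C g)) (%k. app (farr D k) (Dom C g)) (%j. act (D$j) g (y j))"
     unfolding compatible_family_def
    proof (intro conjI ballI)
     show "act (D$j) g (y j) : D$j$(Dom C g)" if "j : Obj I" for j
      by (rule psh_in[OF Dj[OF that] g(1) y'[OF that]])
     show "app (farr D k) (Dom C g) (act (D$(Dom I k)) g (y (Dom I k))) = act (D$(Cod I k)) g (y (Cod I k))" if k: "k : Arr I" for k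
      using psh_natural[OF Dk(1)[OF k] g(1) y'[of "Dom I k"]] k e g(2) by simp
    qed
    then obtain w where w: "w : c$(Dom C g)" "!!j. j : Obj I ==> app (\<pi> j) (Dom C g) w = act (D$j) g (y j)"
     using lim[OF dg] unfolding elementwise_limit_def by blast
    have "app (eta j) (Dom C g) (app (\<pi> j) (Dom C g) w) = act (D'$j) (f \<cdot> g) (a j)" if j: "j : Obj I" for j
     using w(2)[OF j] psh_natural[OF lb(1)[OF j] g(1) y'[OF j]] ye[OF j] g(2)
      psh_comp[OF D'j[OF j] f(1) g(1,2)] a[OF j] f(2) by simp
    then have "lift (f \<cdot> g) w" using w(1) f g by (simp add: lift_def)
    then show "EX w. lift (f \<cdot> g) w" by blast
   qed
  qed
  have lift_eq: "app eta0 (Dom C f) w = app eta0 (Dom C f) w'" if "f : Arr C" "lift f w" "lift f w'" for f w w'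
   by (rule inj0) (use that in \<open>auto simp: lift_def\<close>)
  define z where "z f = app eta0 (Dom C f) (SOME w. lift f w)" for f
  have z: "z f = app eta0 (Dom C f) w" if "f : Arr C" "lift f w" for f w
   unfolding z_def by (rule lift_eq[OF that(1) someI[of "lift f", OF that(2)] that(2)])
  have "EX s:fobj A x. ALL f:Arr C. Cod C f = x --> (EX w. lift f w) --> act A f s = z f"
  proof (rule sheaf_glue[OF A x covered])
   show "z f : A$(Dom C f)" if f: "f : Arr C" "Cod C f = x" "EX w. lift f w" for f
   proof -
    obtain w where w: "lift f w" using f(3) by blast
    then show ?thesis using z[OF f(1) w] psh_nat_in[OF lb0(1), of "Dom C f" w] f(1) by (simp add: lift_def)
   qed
   fix f g assume f: "f : Arr C" "Cod C f = x" "EX w. lift f w" and g: "g : Arr C" "Cod C g = Dom C f"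
   obtain w where w: "lift f w" using f(3) by blast
   have "z (f \<cdot> g) = app eta0 (Dom C g) (act c g w)" using z[OF _ lift_res[OF f(1,2) g w]] f g by simp
   also have "\<dots> = act A g (z f)"
    using psh_natural[OF lb0(1) g(1), of w] w g(2) z[OF f(1) w] by (simp add: lift_def)
   finally show "(EX w. lift (f \<cdot> g) w) & z (f \<cdot> g) = act A g (z f)" using lift_res[OF f(1,2) g w] by blast
  qed
  then obtain s where s: "s : A$x" "!!f w. f : Arr C ==> Cod C f = x ==> lift f w ==> act A f s = app eta0 (Dom C f) w"
   using z by metis
  show "EX! s. s : A$x & (ALL j:Obj I. app (\<rho> j) x s = a j)"
  proof (rule ex1I[of _ s])
   have "app (\<rho> j) x s = a j" if j: "j : Obj I" for j
   proof (rule sheaf_separated[OF sheaves[OF j] x psh_nat_in[OF \<rho>(1)[OF j] x s(1)] a[OF j]])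
    show "locally x (%f. act (D'$j) f (app (\<rho> j) x s) = act (D'$j) f (a j))"
    proof (rule locally_mono[OF x covered])
     fix f assume f: "f : Arr C" "Cod C f = x" and "EX w. lift f w"
     then obtain w where w: "lift f w" by blast
     have "act (D'$j) f (app (\<rho> j) x s) = app (\<rho> j) (Dom C f) (app eta0 (Dom C f) w)"
      using psh_natural[OF \<rho>(1)[OF j] f(1), of s] s f(2) s(2)[OF f w] by simp
     also have "\<dots> = act (D'$j) f (a j)" using sq[OF j, of "Dom C f" w] w j f(1) by (simp add: lift_def)
     finally show "act (D'$j) f (app (\<rho> j) x s) = act (D'$j) f (a j)" .
    qed
   qed
   then show "s : A$x & (ALL j:Obj I. app (\<rho> j) x s = a j)" using s(1) by blast
  next
   fix s' assume s': "s' : A$x & (ALL j:Obj I. app (\<rho> j) x s' = a j)"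
   then have s'A: "s' : A$x" by blast
   show "s' = s"
   proof (rule sheaf_separated[OF A x s'A s(1)])
    have "locally x (%f. (EX w:fobj c (Dom C f). app eta0 (Dom C f) w = act A f s') & (EX w. lift f w))"
     by (rule locally_conj[OF x lb0(3)[OF x s'A] covered])
    then show "locally x (%f. act A f s' = act A f s)"
    proof (rule locally_mono[OF x _])
     fix f assume f: "f : Arr C" "Cod C f = x" and "(EX w:fobj c (Dom C f). app eta0 (Dom C f) w = act A f s') & (EX w. lift f w)"
     then obtain w w' where w: "w : c$(Dom C f)" "app eta0 (Dom C f) w = act A f s'" and w': "lift f w'" by blast
     have "app (eta j) (Dom C f) (app (\<pi> j) (Dom C f) w) = act (D'$j) f (a j)" if j: "j : Obj I" for j
      using sq[OF j _ w(1)] w(2) psh_natural[OF \<rho>(1)[OF j] f(1), of s'] s' j f by simp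
     then have "lift f w" using w(1) by (simp add: lift_def)
     then show "act A f s' = act A f s" using s(2)[OF f] w(2) by simp
    qed
   qed
  qed
 qed
qed

end

context site
begin

definition local_section :: "'u psh => 'u => ('u \<times> 'u) set => bool" where
 "local_section H c s <->
  s \<subseteq> {(f, x). f : Arr C & Cod C f = c & x : H$(Dom C f)} \<and>
  (ALL f x g. (f, x) : s --> g : Arr C --> Cod C g = Dom C f --> (f \<cdot> g, act H g x) : s) \<and>
  (ALL f x y. (f, x) : s --> (f, y) : s --> locally (Dom C f) (%h. act H h x = act H h y)) \<and>
  (ALL f x. f : Arr C --> Cod C f = c --> x : H$(Dom C f) -->
    locally (Dom C f) (%h. (f \<cdot> h, act H h x) : s) --> (f, x) : s) \<and>
  locally c (%f. EX x. (f, x) : s)"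

definition section_res :: "'u => ('u \<times> 'u) set => ('u \<times> 'u) set" where
 "section_res g s = {(f, x). f : Arr C & Cod C f = Dom C g & (g \<cdot> f, x) : s}"

definition section_of :: "'u psh => 'u => 'u => ('u \<times> 'u) set" where
 "section_of H c x = {(f, y). f : Arr C & Cod C f = c & y : H$(Dom C f) \<and>
  locally (Dom C f) (%h. act H h (act H f x) = act H h y)}"

context
 fixes H :: "'u psh"
 assumes H: "presheaf H"
begin

lemma local_sectionD:
 assumes "local_section H c s"
 shows "!!f x. (f, x) : s ==> f : Arr C & Cod C f = c & x : H$(Dom C f)"
  and "!!f x g. (f, x) : s ==> g : Arr C ==> Cod C g = Dom C f ==> (f \<cdot> g, act H g x) : s"
  and "!!f x y. (f, x) : s ==> (f, y) : s ==> locally (Dom C f) (%h. act H h x = act H h y)"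
  and "!!f x. f : Arr C ==> Cod C f = c ==> x : H$(Dom C f) ==>
    locally (Dom C f) (%h. (f \<cdot> h, act H h x) : s) ==> (f, x) : s"
  and "locally c (%f. EX x. (f, x) : s)"
proof -
 note u = assms[unfolded local_section_def]
 note v = conjunct2[OF u] note w = conjunct2[OF v] note y = conjunct2[OF w]
 show "!!f x. (f, x) : s ==> f : Arr C & Cod C f = c & x : H$(Dom C f)" using conjunct1[OF u] by blast
 show "!!f x g. (f, x) : s ==> g : Arr C ==> Cod C g = Dom C f ==> (f \<cdot> g, act H g x) : s"
  by (rule conjunct1[OF v, rule_format])
 show "!!f x y. (f, x) : s ==> (f, y) : s ==> locally (Dom C f) (%h. act H h x = act H h y)"
  by (rule conjunct1[OF w, rule_format])
 show "!!f x. f : Arr C ==> Cod C f = c ==> x : H$(Dom C f) ==>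
   locally (Dom C f) (%h. (f \<cdot> h, act H h x) : s) ==> (f, x) : s"
  by (rule conjunct1[OF y, rule_format])
 show "locally c (%f. EX x. (f, x) : s)" by (rule conjunct2[OF y])
qed

lemma local_sectionI:
 assumes "!!f x. (f, x) : s ==> f : Arr C & Cod C f = c & x : H$(Dom C f)"
  and "!!f x g. (f, x) : s ==> g : Arr C ==> Cod C g = Dom C f ==> (f \<cdot> g, act H g x) : s"
  and "!!f x y. (f, x) : s ==> (f, y) : s ==> locally (Dom C f) (%h. act H h x = act H h y)"
  and "!!f x. f : Arr C ==> Cod C f = c ==> x : H$(Dom C f) ==>
    locally (Dom C f) (%h. (f \<cdot> h, act H h x) : s) ==> (f, x) : s"
  and "locally c (%f. EX x. (f, x) : s)"
 shows "local_section H c s"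
 unfolding local_section_def
proof (intro conjI allI impI)
 show "s \<subseteq> {(f, x). f : Arr C & Cod C f = c & x : H$(Dom C f)}" using assms(1) by blast
qed (rule assms(2-5); assumption)+

lemma section_closed:
 assumes s: "local_section H c s" and m: "(f, x) : s" and y: "y : H$(Dom C f)"
  and l: "locally (Dom C f) (%h. act H h x = act H h y)"
 shows "(f, y) : s"
proof -
 have f: "f : Arr C" "Cod C f = c" using local_sectionD(1)[OF s m] by simp_all
 have d: "Dom C f : Obj C" using f by simp
 show ?thesis
 proof (rule local_sectionD(4)[OF s f y], rule locally_mono[OF d l])
  fix h assume h: "h : Arr C" "Cod C h = Dom C f" and e: "act H h x = act H h y"
  show "(f \<cdot> h, act H h y) : s" using local_sectionD(2)[OF s m h] by (simp only: e)
 qed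
qed

lemma section_subset:
 assumes c: "c : Obj C" and s: "local_section H c s" and t: "local_section H c t"
  and l: "locally c (%f. EX x. (f, x) : s & (f, x) : t)"
 shows "s \<subseteq> t"
proof (rule subrelI)
 fix g y assume gy: "(g, y) : s"
 then have g: "g : Arr C" "Cod C g = c" and y: "y : H$(Dom C g)" using local_sectionD(1)[OF s gy] by simp_all
 have gc: "g : Hom C (Dom C g) c" using g by (simp add: in_Hom)
 have d: "Dom C g : Obj C" using g by simp
 show "(g, y) : t"
 proof (rule local_sectionD(4)[OF t g y], rule locally_mono[OF d locally_pull[OF gc l]])
  fix h assume h: "h : Arr C" "Cod C h = Dom C g" and "EX x. (g \<cdot> h, x) : s & (g \<cdot> h, x) : t"
  then obtain x where x: "(g \<cdot> h, x) : s" "(g \<cdot> h, x) : t" by blast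
  have hy: "(g \<cdot> h, act H h y) : s" by (rule local_sectionD(2)[OF s gy h])
  show "(g \<cdot> h, act H h y) : t"
   using section_closed[OF t x(2) _ local_sectionD(3)[OF s x(1) hy]] local_sectionD(1)[OF s hy] by blast
 qed
qed

lemma section_eqI:
 assumes c: "c : Obj C" and s: "local_section H c s" and t: "local_section H c t"
  and l: "locally c (%f. EX x. (f, x) : s & (f, x) : t)"
 shows "s = t"
proof (rule equalityI)
 have "(%f. EX x. (f, x) : t & (f, x) : s) = (%f. EX x. (f, x) : s & (f, x) : t)" by blast
 then have "locally c (%f. EX x. (f, x) : t & (f, x) : s)" using l by (simp only:)
 from section_subset[OF c t s this] show "t \<subseteq> s" .
qed (rule section_subset[OF c s t l])

lemma local_section_res:
 assumes s: "local_section H (Cod C g) s" and g: "g : Arr C"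
 shows "local_section H (Dom C g) (section_res g s)"
proof (rule local_sectionI)
 show "f : Arr C & Cod C f = Dom C g & x : H$(Dom C f)" if "(f, x) : section_res g s" for f x
  using that local_sectionD(1)[OF s, of "g \<cdot> f" x] g by (simp add: section_res_def)
 show "(f \<cdot> h, act H h x) : section_res g s" if "(f, x) : section_res g s" "h : Arr C" "Cod C h = Dom C f" for f x h
  using that local_sectionD(2)[OF s, of "g \<cdot> f" x h] g by (simp add: section_res_def)
 show "locally (Dom C f) (%h. act H h x = act H h y)"
  if "(f, x) : section_res g s" "(f, y) : section_res g s" for f x y
  using that local_sectionD(3)[OF s, of "g \<cdot> f" x y] g by (simp add: section_res_def)
 show "(f, x) : section_res g s"
  if f: "f : Arr C" "Cod C f = Dom C g" "x : H$(Dom C f)" and l: "locally (Dom C f) (%h. (f \<cdot> h, act H h x) : section_res g s)" for f x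
 proof -
  have d: "Dom C f : Obj C" using f by simp
  have gf: "g \<cdot> f : Arr C" "Cod C (g \<cdot> f) = Cod C g" "x : H$(Dom C (g \<cdot> f))" using f g by simp_all
  have "locally (Dom C (g \<cdot> f)) (%h. ((g \<cdot> f) \<cdot> h, act H h x) : s)"
  proof (rule locally_mono[OF _ _])
   show "Dom C (g \<cdot> f) : Obj C" "locally (Dom C (g \<cdot> f)) (%h. (f \<cdot> h, act H h x) : section_res g s)"
    using d l f g by simp_all
   show "((g \<cdot> f) \<cdot> h, act H h x) : s"
    if "h : Arr C" "Cod C h = Dom C (g \<cdot> f)" "(f \<cdot> h, act H h x) : section_res g s" for h
    using that f g by (simp add: section_res_def)
  qed
  from local_sectionD(4)[OF s gf this] show ?thesis using f by (simp add: section_res_def)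
 qed
 have gc: "g : Hom C (Dom C g) (Cod C g)" using g by (simp add: in_Hom)
 have d: "Dom C g : Obj C" using g by simp
 show "locally (Dom C g) (%f. EX x. (f, x) : section_res g s)"
 proof (rule locally_mono[OF d locally_pull[OF gc local_sectionD(5)[OF s]]])
  show "EX x. (f, x) : section_res g s" if "f : Arr C" "Cod C f = Dom C g" "EX x. (g \<cdot> f, x) : s" for f
   using that by (simp add: section_res_def)
 qed
qed

lemma section_res_id:
 assumes "c : Obj C" "local_section H c s"
 shows "section_res (Ident C c) s = s"
proof -
 have "(f, x) : section_res (Ident C c) s <-> (f, x) : s" for f x
 proof
  assume "(f, x) : section_res (Ident C c) s"
  then have "f : Arr C & Cod C f = Dom C (Ident C c) & (Ident C c \<cdot> f, x) : s"
   unfolding section_res_def mem_Collect_eq case_prod_conv .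
  moreover have "Dom C (Ident C c) = c" using assms(1) by simp
  ultimately have f: "f : Arr C" "Cod C f = c" "(Ident C c \<cdot> f, x) : s" by (simp_all only: simp_thms)
  have "Ident C c \<cdot> f = f" using f(1,2) by simp
  with f(3) show "(f, x) : s" by simp
 next
  assume m: "(f, x) : s"
  then have f: "f : Arr C" "Cod C f = c" using local_sectionD(1)[OF assms(2) m] by blast+
  then have "Ident C c \<cdot> f = f" by simp
  then show "(f, x) : section_res (Ident C c) s" using m f assms(1) by (simp add: section_res_def)
 qed
 then show ?thesis by (simp add: set_eq_iff)
qed

lemma section_res_comp:
 assumes "f : Arr C" "g : Arr C" "Cod C g = Dom C f"
 shows "section_res (f \<cdot> g) s = section_res g (section_res f s)"
 using assms by (auto simp: section_res_def)

lemma locally_eq_trans: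
 assumes d: "d : Obj C" and y: "y : H$d" "z : H$d"
  and "locally d (%h. act H h x = act H h y)" "locally d (%h. act H h x = act H h z)"
 shows "locally d (%h. act H h y = act H h z)"
proof (rule locally_mono[OF d locally_conj[OF d assms(4,5)]])
 show "act H h y = act H h z" if "act H h x = act H h y & act H h x = act H h z" for h
  using that by (rule conjE) (rule trans[OF sym])
qed

lemma local_section_of:
 assumes c: "c : Obj C" and x: "x : H$c"
 shows "local_section H c (section_of H c x)"
proof -
 have fx: "act H f x : H$(Dom C f)" if "f : Arr C" "Cod C f = c" for f using psh_in[OF H that(1)] that(2) x by simp
 show ?thesis
 proof (rule local_sectionI)
  show "f : Arr C & Cod C f = c & y : H$(Dom C f)" if "(f, y) : section_of H c x" for f y
   using that by (simp add: section_of_def)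
  show "(f \<cdot> g, act H g y) : section_of H c x" if m: "(f, y) : section_of H c x" and g: "g : Arr C" "Cod C g = Dom C f" for f y g
  proof -
   have f: "f : Arr C" "Cod C f = c" and y: "y : H$(Dom C f)"
    and l: "locally (Dom C f) (%h. act H h (act H f x) = act H h y)" using m by (simp_all add: section_of_def)
   have gf: "g : Hom C (Dom C g) (Dom C f)" using g by (simp add: in_Hom)
   have yg: "y : H$(Cod C g)" and fxg: "act H f x : H$(Cod C g)" using y fx[OF f] g by simp_all
   have gy: "act H g y : H$(Dom C g)" by (rule psh_in[OF H g(1) yg])
   have gfx: "act H (f \<cdot> g) x : H$(Dom C g)" using fx[of "f \<cdot> g"] f g by simp
   have d: "Dom C g : Obj C" using g by simp
   have "locally (Dom C g) (%h. act H h (act H (f \<cdot> g) x) = act H h (act H g y))"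
   proof (rule locally_mono[OF d locally_pull[OF gf l]])
    fix h assume h: "h : Arr C" "Cod C h = Dom C g" and e: "act H (g \<cdot> h) (act H f x) = act H (g \<cdot> h) y"
    have "act H (f \<cdot> g) x = act H g (act H f x)" by (rule psh_comp[OF H f(1) g]) (use f x in simp)
    then show "act H h (act H (f \<cdot> g) x) = act H h (act H g y)"
     using e psh_comp[OF H g(1) h yg] psh_comp[OF H g(1) h fxg] by simp
   qed
   then show ?thesis using f g gy by (simp add: section_of_def)
  qed
  show "locally (Dom C f) (%h. act H h y = act H h z)"
   if "(f, y) : section_of H c x" "(f, z) : section_of H c x" for f y z
   by (rule locally_eq_trans[of "Dom C f" y z "act H f x"]) (use that in \<open>simp_all add: section_of_def\<close>)
  show "(f, y) : section_of H c x"
   if f: "f : Arr C" "Cod C f = c" and y: "y : H$(Dom C f)"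
    and l: "locally (Dom C f) (%h. (f \<cdot> h, act H h y) : section_of H c x)" for f y
  proof -
   have d: "Dom C f : Obj C" using f by simp
   have "locally (Dom C f) (%h. act H h (act H f x) = act H h y)"
   proof (rule locally_trans[OF d l])
    fix h assume h: "h : Arr C" "Cod C h = Dom C f" and "(f \<cdot> h, act H h y) : section_of H c x"
    then have l': "locally (Dom C h) (%k. act H k (act H (f \<cdot> h) x) = act H k (act H h y))"
     using f by (simp add: section_of_def)
    have yh: "y : H$(Cod C h)" and fxh: "act H f x : H$(Cod C h)" using y fx[OF f] h by simp_all
    have e: "act H (f \<cdot> h) x = act H h (act H f x)" by (rule psh_comp[OF H f(1) h]) (use f x in simp)
    have dh: "Dom C h : Obj C" using h by simp
    show "locally (Dom C h) (%g. act H (h \<cdot> g) (act H f x) = act H (h \<cdot> g) y)"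
    proof (rule locally_mono[OF dh l'])
     show "act H (h \<cdot> g) (act H f x) = act H (h \<cdot> g) y"
      if "g : Arr C" "Cod C g = Dom C h" "act H g (act H (f \<cdot> h) x) = act H g (act H h y)" for g
      unfolding psh_comp[OF H h(1) that(1,2) yh] psh_comp[OF H h(1) that(1,2) fxh] using that(3) e by simp
    qed
   qed
   then show ?thesis using f y by (simp add: section_of_def)
  qed
  show "locally c (%f. EX y. (f, y) : section_of H c x)"
  proof (rule locally_all[OF c])
   fix f assume f: "f : Arr C" "Cod C f = c"
   have "locally (Dom C f) (%h. act H h (act H f x) = act H h (act H f x))" by (rule locally_all) (use f in simp_all)
   then have "(f, act H f x) : section_of H c x" using f fx[OF f] by (simp add: section_of_def)
   then show "EX y. (f, y) : section_of H c x" by blast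
  qed
 qed
qed

lemma section_of_self:
 assumes c: "c : Obj C" and x: "x : H$c" and f: "f : Arr C" "Cod C f = c"
 shows "(f, act H f x) : section_of H c x"
proof -
 have "locally (Dom C f) (%h. act H h (act H f x) = act H h (act H f x))" by (rule locally_all) (use f in simp_all)
 then show ?thesis using f psh_in[OF H f(1), of x] x by (simp add: section_of_def)
qed

lemma section_of_natural:
 assumes g: "g : Arr C" and x: "x : H$(Cod C g)"
 shows "section_of H (Dom C g) (act H g x) = section_res g (section_of H (Cod C g) x)"
proof -
 have "act H (g \<cdot> f) x = act H f (act H g x)" if "f : Arr C" "Cod C f = Dom C g" for f
  by (rule psh_comp[OF H g that x])
 then show ?thesis using g by (auto simp: section_of_def section_res_def)
qed

lemma section_of_eq_res:
 assumes c: "c : Obj C" and s: "local_section H c s" and m: "(f, x) : s"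
 shows "section_of H (Dom C f) x = section_res f s"
proof -
 have f: "f : Arr C" "Cod C f = c" and x: "x : H$(Dom C f)" using local_sectionD(1)[OF s m] by simp_all
 have d: "Dom C f : Obj C" using f by simp
 have r: "local_section H (Dom C f) (section_res f s)" by (rule local_section_res) (use s f in simp_all)
 show ?thesis
 proof (rule section_eqI[OF d local_section_of[OF d x] r locally_all[OF d]])
  fix h assume h: "h : Arr C" "Cod C h = Dom C f"
  have "(h, act H h x) : section_of H (Dom C f) x" by (rule section_of_self[OF d x h])
  moreover have "(h, act H h x) : section_res f s"
   using local_sectionD(2)[OF s m h] h by (simp add: section_res_def)
  ultimately show "EX y. (h, y) : section_of H (Dom C f) x & (h, y) : section_res f s" by blast
 qed
qed

lemma section_unique:
 assumes c: "c : Obj C" and phi: "locally c phi" and s: "local_section H c s" and t: "local_section H c t"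
  and eq: "!!f. f : Arr C ==> Cod C f = c ==> phi f ==> section_res f s = section_res f t"
 shows "s = t"
proof (rule section_eqI[OF c s t], rule locally_trans[OF c phi])
 fix f assume f: "f : Arr C" "Cod C f = c" "phi f"
 have d: "Dom C f : Obj C" and fc: "f : Hom C (Dom C f) c" using f by (auto simp: in_Hom)
 show "locally (Dom C f) (%g. EX x. (f \<cdot> g, x) : s & (f \<cdot> g, x) : t)"
 proof (rule locally_mono[OF d locally_pull[OF fc local_sectionD(5)[OF s]]])
  have st: "(f \<cdot> g, x) : t" if "g : Arr C" "Cod C g = Dom C f" "(f \<cdot> g, x) : s" for g x
  proof -
   have "(g, x) : section_res f s" using that by (simp add: section_res_def)
   then show ?thesis unfolding eq[OF f] by (simp add: section_res_def)
  qed
  then show "EX x. (f \<cdot> g, x) : s & (f \<cdot> g, x) : t" if "g : Arr C" "Cod C g = Dom C f" "EX x. (f \<cdot> g, x) : s" for g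
   using that by blast
 qed
qed

lemma section_glue:
 assumes c: "c : Obj C" and phi: "locally c phi"
  and z: "!!f. f : Arr C ==> Cod C f = c ==> phi f ==> local_section H (Dom C f) (z f)"
  and zc: "!!f g. f : Arr C ==> Cod C f = c ==> phi f ==> g : Arr C ==> Cod C g = Dom C f ==> phi (f \<cdot> g) & z (f \<cdot> g) = section_res g (z f)"
 shows "EX s. local_section H c s & (ALL f:Arr C. Cod C f = c --> phi f --> section_res f s = z f)"
proof -
 have phis: "phi (f \<cdot> g)" and zg: "z (f \<cdot> g) = section_res g (z f)"
  if "f : Arr C" "Cod C f = c" "phi f" "g : Arr C" "Cod C g = Dom C f" for f g
  using zc[OF that] by blast+
 define P where "P g x h <-> phi (g \<cdot> h) & (Ident C (Dom C h), act H h x) : z (g \<cdot> h)" for g x h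
 define s where "s = {(g, x). g : Arr C & Cod C g = c & x : H$(Dom C g) & locally (Dom C g) (P g x)}"
 have P_comp: "P (g \<cdot> h) (act H h x) k <-> P g x (h \<cdot> k)"
  if "g : Arr C" "h : Arr C" "k : Arr C" "Cod C h = Dom C g" "Cod C k = Dom C h" "x : H$(Dom C g)" for g h k x
  using psh_comp[OF H that(2,3,5), of x] that by (simp add: P_def)
 have zs: "(f \<cdot> g, x) : s" if f: "f : Arr C" "Cod C f = c" "phi f" and m: "(g, x) : z f" for f g x
 proof -
  have g: "g : Arr C" "Cod C g = Dom C f" and x: "x : H$(Dom C g)"
   using local_sectionD(1)[OF z[OF f] m] by simp_all
  have "P (f \<cdot> g) x k" if k: "k : Arr C" "Cod C k = Dom C g" for k
  proof -
   have gk: "g \<cdot> k : Arr C" "Cod C (g \<cdot> k) = Dom C f" using g k by simp_all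
   have "(g \<cdot> k, act H k x) : z f" by (rule local_sectionD(2)[OF z[OF f] m k])
   then have "(Ident C (Dom C k), act H k x) : z (f \<cdot> (g \<cdot> k))"
    unfolding zg[OF f gk] using g k by (simp add: section_res_def)
   then show ?thesis using phis[OF f gk] f g k by (simp add: P_def)
  qed
  then have "locally (Dom C g) (P (f \<cdot> g) x)" by (intro locally_all) (use g in simp_all)
  then show ?thesis using f g x by (simp add: s_def)
 qed
 have s: "local_section H c s"
 proof (rule local_sectionI)
  show "f : Arr C & Cod C f = c & x : H$(Dom C f)" if "(f, x) : s" for f x
   using that by (simp add: s_def)
  show cl: "(f \<cdot> g, act H g x) : s" if m: "(f, x) : s" and g: "g : Arr C" "Cod C g = Dom C f" for f x g
  proof -
   have f: "f : Arr C" "Cod C f = c" and x: "x : H$(Dom C f)" and l: "locally (Dom C f) (P f x)"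
    using m by (simp_all add: s_def)
   have gf: "g : Hom C (Dom C g) (Dom C f)" using g by (simp add: in_Hom)
   have d: "Dom C g : Obj C" using g by simp
   have gx: "act H g x : H$(Dom C g)" using psh_in[OF H g(1)] x g(2) by simp
   have "locally (Dom C g) (P (f \<cdot> g) (act H g x))"
   proof (rule locally_mono[OF d locally_pull[OF gf l]])
    show "P (f \<cdot> g) (act H g x) k" if "k : Arr C" "Cod C k = Dom C g" "P f x (g \<cdot> k)" for k
     using P_comp[OF f(1) g(1) that(1) g(2) that(2) x] that(3) by simp
   qed
   then show ?thesis using f g gx by (simp add: s_def)
  qed
  show "locally (Dom C f) (%h. act H h x = act H h y)" if m: "(f, x) : s" "(f, y) : s" for f x y
  proof -
   have f: "f : Arr C" "Cod C f = c" and x: "x : H$(Dom C f)" "y : H$(Dom C f)"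
    and l: "locally (Dom C f) (P f x)" "locally (Dom C f) (P f y)" using m by (simp_all add: s_def)
   have d: "Dom C f : Obj C" using f by simp
   show ?thesis
   proof (rule locally_trans[OF d locally_conj[OF d l]])
    fix h assume h: "h : Arr C" "Cod C h = Dom C f" and p: "P f x h & P f y h"
    have dh: "Dom C h : Obj C" using h by simp
    have fh: "f \<cdot> h : Arr C" "Cod C (f \<cdot> h) = c" "phi (f \<cdot> h)"
     and mm: "(Ident C (Dom C h), act H h x) : z (f \<cdot> h)" "(Ident C (Dom C h), act H h y) : z (f \<cdot> h)"
     using f h p by (simp_all add: P_def)
    have l': "locally (Dom C h) (%k. act H k (act H h x) = act H k (act H h y))"
     using local_sectionD(3)[OF z[OF fh] mm] dh by simp
    have hx: "x : H$(Cod C h)" "y : H$(Cod C h)" using x h by simp_all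
    have eq: "act H (h \<cdot> k) w = act H k (act H h w)" if "k : Arr C" "Cod C k = Dom C h" "w : H$(Cod C h)" for k w
     by (rule psh_comp[OF H h(1) that])
    show "locally (Dom C h) (%g. act H (h \<cdot> g) x = act H (h \<cdot> g) y)"
    proof (rule locally_mono[OF dh l'])
     show "act H (h \<cdot> g) x = act H (h \<cdot> g) y"
      if "g : Arr C" "Cod C g = Dom C h" "act H g (act H h x) = act H g (act H h y)" for g
      unfolding eq[OF that(1,2) hx(1)] eq[OF that(1,2) hx(2)] by (rule that(3))
    qed
   qed
  qed
  show "(f, x) : s"
   if f: "f : Arr C" "Cod C f = c" and x: "x : H$(Dom C f)" and l: "locally (Dom C f) (%h. (f \<cdot> h, act H h x) : s)" for f x
  proof -
   have d: "Dom C f : Obj C" using f by simp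
   have "locally (Dom C f) (P f x)"
   proof (rule locally_trans[OF d l])
    fix h assume h: "h : Arr C" "Cod C h = Dom C f" and m: "(f \<cdot> h, act H h x) : s"
    have hf: "h : Hom C (Dom C h) (Dom C f)" using h by (simp add: in_Hom)
    have dh: "Dom C h : Obj C" using h by simp
    have l': "locally (Dom C h) (P (f \<cdot> h) (act H h x))" using m f h by (simp add: s_def)
    have e: "P (f \<cdot> h) (act H h x) g <-> P f x (h \<cdot> g)" if "g : Arr C" "Cod C g = Dom C h" for g
     by (rule P_comp[OF f(1) h(1) that(1) h(2) that(2) x])
    show "locally (Dom C h) (%g. P f x (h \<cdot> g))"
     by (rule locally_mono[OF dh l']) (simp only: e)
   qed
   then show ?thesis using f x by (simp add: s_def)
  qed
  show "locally c (%f. EX x. (f, x) : s)"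
  proof (rule locally_trans[OF c phi])
   fix f assume f: "f : Arr C" "Cod C f = c" "phi f"
   have d: "Dom C f : Obj C" using f by simp
   show "locally (Dom C f) (%g. EX x. (f \<cdot> g, x) : s)"
    by (rule locally_mono[OF d local_sectionD(5)[OF z[OF f]]]) (use zs[OF f] in blast)
  qed
 qed
 have "section_res f s = z f" if f: "f : Arr C" "Cod C f = c" "phi f" for f
 proof (rule section_eqI[OF _ _ z[OF f]])
  show d: "Dom C f : Obj C" using f by simp
  show r: "local_section H (Dom C f) (section_res f s)" by (rule local_section_res) (use s f in simp_all)
  have "EX x. (g, x) : section_res f s & (g, x) : z f" if "EX x. (g, x) : z f" "g : Arr C" "Cod C g = Dom C f" for g
   using that zs[OF f] by (auto simp: section_res_def)
  then show "locally (Dom C f) (%g. EX x. (g, x) : section_res f s & (g, x) : z f)"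
   by (intro locally_mono[OF d local_sectionD(5)[OF z[OF f]]])
 qed
 with s show ?thesis by blast
qed

lemma sheafification_exists: "EX A eta. sheaf A & locally_bijective H A eta"
proof -
 let ?V = "Sigma (Arr C) (%f. H$(Dom C f))"
 have sm: "small_set (H$c)" if "c : Obj C" for c using set_functor.small[OF H, of c] that by simp
 have "tiny ?V"
  by (rule tiny_Sigma) (use small_C sm in \<open>auto simp: small_category_def small_set_tiny\<close>)
 then have tV: "tiny (Pow ?V)" by (rule tiny_Pow)
 obtain e :: "('u \<times> 'u) set => 'u" where e: "inj_on e (Pow ?V)" using encode[OF tV] .
 define S where "S c = {s. local_section H c s}" for c
 have SV: "S c \<subseteq> Pow ?V" for c
 proof
  fix s assume "s : S c"
  then have s: "local_section H c s" by (simp add: S_def)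
  show "s : Pow ?V" using local_sectionD(1)[OF s] by auto
 qed
 define d where "d = inv_into (Pow ?V) e"
 have d: "d (e s) = s" if "local_section H c s" for c s
  unfolding d_def by (rule inv_into_f_f[OF e]) (use SV[of c] that in \<open>auto simp: S_def\<close>)
 define A where "A = set_funct (opposite C) (%c. e ` S c) (%g u. e (section_res g (d u)))"
 have A_obj: "A$c = e ` S c" if "c : Obj C" for c using that by (simp add: A_def)
 have A_in: "e s : A$c" if "c : Obj C" "local_section H c s" for c s
  using that by (simp add: A_obj S_def)
 have A_obtain: "EX s. local_section H c s & u = e s" if "c : Obj C" "u : A$c" for c u
  using that by (auto simp: A_obj S_def)
 have e_inj: "s = t" if "local_section H c s" "local_section H c t" "e s = e t" for c s t
  by (rule trans[OF sym[OF d[OF that(1)]] trans[OF arg_cong[OF that(3), of d] d[OF that(2)]]])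
 have A_act: "act A g (e s) = e (section_res g s)" if g: "g : Arr C" and s: "local_section H (Cod C g) s" for g s
 proof -
  have "e s : e ` S (Cod C g)" using s by (simp add: S_def)
  then show ?thesis using g d[OF s] by (simp add: A_def)
 qed
 have A: "presheaf A"
  unfolding A_def
 proof (rule set_functor_set_funct[OF category_opposite[OF category_axioms]])
  show "small_set (e ` S c)" if "c : Obj (opposite C)" for c
   unfolding small_set_tiny by (rule tiny_image[OF tiny_subset[OF SV tV]])
  show "e (section_res g (d u)) : e ` S (Cod (opposite C) g)"
   if g: "g : Arr (opposite C)" and u: "u : e ` S (Dom (opposite C) g)" for g u
  proof -
   obtain s where s: "local_section H (Cod C g) s" "u = e s" using u by (auto simp: S_def)
   show ?thesis using local_section_res[OF s(1)] g d[OF s(1)] s(2) by (simp add: S_def)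
  qed
  show "e (section_res (Ident (opposite C) c) (d u)) = u" if c: "c : Obj (opposite C)" and u: "u : e ` S c" for c u
  proof -
   obtain s where s: "local_section H c s" "u = e s" using u by (auto simp: S_def)
   have "section_res (Ident C c) s = s" by (rule section_res_id[OF _ s(1)]) (use c in simp)
   then show ?thesis using d[OF s(1)] s(2) by simp
  qed
  show "e (section_res (g $$opposite C$$ f) (d u)) = e (section_res g (d (e (section_res f (d u)))))"
   if f: "f : Arr (opposite C)" and g: "g : Arr (opposite C)" "Dom (opposite C) g = Cod (opposite C) f" and u: "u : e ` S (Dom (opposite C) f)" for f g u
  proof -
   obtain s where s: "local_section H (Cod C f) s" "u = e s" using u by (auto simp: S_def)
   have r: "local_section H (Dom C f) (section_res f s)" by (rule local_section_res[OF s(1)]) (use f in simp)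
   have "section_res (f \<cdot> g) s = section_res g (section_res f s)" by (rule section_res_comp) (use f g in simp_all)
   then show ?thesis using d[OF s(1)] d[OF r] s(2) by simp
  qed
 qed
 have sheaf: "sheaf A"
  unfolding is_sheaf_def
 proof (intro conjI ballI allI impI)
  show "cat_functor (opposite C) Sets A" using A by (simp add: set_functor_def)
  fix c K x assume c: "c : Obj C" and K: "K : J c" and x: "matching_family C A K x"
  have sieve: "is_sieve C c K" using topology c K by (simp add: grothendieck_topology_def)
  then have K_in: "f : Arr C & Cod C f = c" if "f : K" for f using that by (auto simp: is_sieve_def)
  have "{f : Arr C. Cod C f = c & (ALL g:Arr C. Cod C g = Dom C f --> f \<cdot> g : K)} = K"
  proof (intro equalityI subsetI)
   show "f : {f : Arr C. Cod C f = c & (ALL g:Arr C. Cod C g = Dom C f --> f \<cdot> g : K)}" if "f : K" for f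
    using that K_in[OF that] sieve unfolding is_sieve_def by blast
  qed (use at_ident[of _ "%f. f : K"] in blast)
  then have lK: "locally c (%f. f : K)" using K by (simp add: locally_def)
  have xd: "local_section H (Dom C f) (d (x f)) & e (d (x f)) = x f" if f: "f : K" for f
  proof -
   have "x f : A$(Dom C f)" using x f by (simp add: matching_family_def)
   moreover have "Dom C f : Obj C" using K_in[OF f] by simp
   ultimately have "EX s. local_section H (Dom C f) s & x f = e s" using A_obtain by simp
   then obtain s where "local_section H (Dom C f) s" "x f = e s" by blast
   then show ?thesis using d by simp
  qed
  have xc: "f \<cdot> g : K & d (x (f \<cdot> g)) = section_res g (d (x f))" if f: "f : K" and g: "g : Arr C" "Cod C g = Dom C f" for f g
  proof -
   have xf: "local_section H (Cod C g) (d (x f))" using xd[OF f] g(2) by simp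
   have "x (f \<cdot> g) = act A g (x f)" using x f g by (simp add: matching_family_def act_def)
   also have "\<dots> = e (section_res g (d (x f)))" using A_act[OF g(1) xf] xd[OF f] by simp
   finally show ?thesis using d[OF local_section_res[OF xf g(1)]] sieve f g by (simp add: is_sieve_def)
  qed
  obtain s where s: "local_section H c s" "!!f. f : K ==> section_res f s = d (x f)"
   using section_glue[OF c lK, of "%f. d (x f)"] xd xc K_in by blast
  have iff: "act A f (e t) = x f <-> section_res f t = d (x f)" if f: "f : K" and t: "local_section H c t" for f t
  proof -
   have t': "local_section H (Cod C f) t" and fa: "f : Arr C" using K_in[OF f] t by simp_all
   have t'': "local_section H (Dom C f) (section_res f t)" by (rule local_section_res[OF t' fa])
   have xf: "local_section H (Dom C f) (d (x f))" "e (d (x f)) = x f" using xd[OF f] by blast+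
   have "e (section_res f t) = e (d (x f)) <-> section_res f t = d (x f)"
    using e_inj[OF t'' xf(1)] arg_cong[of _ _ e] by blast
   then show ?thesis unfolding A_act[OF fa t'] xf(2) .
  qed
  show "EX! y. y : A$c & (ALL f:K. body (farr A f) y = x f)"
   unfolding act_def[symmetric]
  proof (rule ex1I[of _ "e s"])
   show "e s : A$c & (ALL f:K. act A f (e s) = x f)" using A_in[OF c s(1)] iff[OF _ s(1)] s(2) by simp
   fix y assume y: "y : A$c & (ALL f:K. act A f y = x f)"
   then obtain t where t: "local_section H c t" "y = e t" using A_obtain[OF c] by blast
   have "section_res f t = section_res f s" if "f : K" for f using y iff[OF that t(1)] s(2)[OF that] that t(2) by simp
   then have "t = s" using section_unique[OF c lK t(1) s(1)] by blast
   then show "y = e s" using t(2) by simp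
  qed
 qed
 define eta where "eta = set_nat (opposite C) H (%c x. e (section_of H c x)) A"
 have eta_app: "app eta c x = e (section_of H c x)" if "c : Obj C" "x : H$c" for c x
  using that by (simp add: eta_def)
 have eta: "eta : Hom Psh H A"
  unfolding eta_def
 proof (rule set_nat_in_Hom[OF H A])
  show "e (section_of H c x) : A$c" if "c : Obj (opposite C)" "x : H$c" for c x
   using that A_in local_section_of by simp
  show "e (section_of H (Cod (opposite C) f) (act H f x)) = act A f (e (section_of H (Dom (opposite C) f) x))"
   if f: "f : Arr (opposite C)" and x: "x : H$(Dom (opposite C) f)" for f x
  proof -
   have fa: "f : Arr C" and xa: "x : H$(Cod C f)" using f x by simp_all
   have "Cod C f : Obj C" using fa by simp
   from A_act[OF fa local_section_of[OF this xa]] section_of_natural[OF fa xa] show ?thesis by simp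
  qed
 qed
 have "locally_bijective H A eta"
  unfolding locally_bijective_def
 proof (intro conjI ballI impI eta)
  fix c x y assume c: "c : Obj C" and x: "x : H$c" "y : H$c" and eq: "app eta c x = app eta c y"
  have "section_of H c x = section_of H c y"
   using e_inj[OF local_section_of[OF c x(1)] local_section_of[OF c x(2)]] eq eta_app[OF c] x by simp
  moreover have "(Ident C c, act H (Ident C c) y) : section_of H c y" by (rule section_of_self[OF c x(2)]) (use c in simp_all)
  ultimately have "(Ident C c, y) : section_of H c x" using psh_id[OF H c x(2)] by simp
  then show "locally c (%f. act H f x = act H f y)" using psh_id[OF H c x(1)] c by (simp add: section_of_def)
 next
  fix c a assume c: "c : Obj C" and "a : A$c"
  then obtain s where s: "local_section H c s" "a = e s" using A_obtain by blast
  have key: "EX x:fobj H (Dom C f). app eta (Dom C f) x = act A f a" if f: "f : Arr C" "Cod C f = c" and ex: "EX x. (f, x) : s" for f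
  proof -
   obtain x where m: "(f, x) : s" using ex by blast
   have x: "x : H$(Dom C f)" using local_sectionD(1)[OF s(1) m] by simp
   have s': "local_section H (Cod C f) s" using s(1) f(2) by simp
   have "app eta (Dom C f) x = act A f a"
    using eta_app[OF _ x] f(1) section_of_eq_res[OF c s(1) m] A_act[OF f(1) s'] s(2) by simp
   then show ?thesis using x by blast
  qed
  show "locally c (%f. EX x:fobj H (Dom C f). app eta (Dom C f) x = act A f a)"
   by (rule locally_mono[OF c local_sectionD(5)[OF s(1)]]) (use key in blast)
 qed
 with sheaf show ?thesis by blast
qed

end

end

lemma ff_reflects_limit:
 assumes ff: "fully_faithful D C R" and Dg: "cat_functor J D Dg" and cone: "is_cone J D Dg c p"
  and lim: "is_limit J C (comp_funct J R Dg) (R$c) (%j. farr R (p j))"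
 shows "is_limit J D Dg c p"
 unfolding is_limit_def
proof (intro conjI allI impI cone)
 interpret R: cat_functor D C R using ff by (simp add: fully_faithful_def)
 have c: "c : Obj D" and p: "!!j. j : Obj J ==> p j : Hom D c (Dg$j)" using cone by (simp_all add: is_cone_def)
 fix x q assume q: "is_cone J D Dg x q"
 have x: "x : Obj D" and qj: "!!j. j : Obj J ==> q j : Hom D x (Dg$j)" using q by (simp_all add: is_cone_def)
 obtain u where u: "u : Hom C (R$x) (R$c)" "!!j. j : Obj J ==> farr R (p j) $$C$$ u = farr R (q j)"
  and uu: "!!v. v : Hom C (R$x) (R$c) ==> (ALL j:Obj J. farr R (p j) $$C$$ v = farr R (q j)) ==> v = u"
  using limit_factor[OF lim cone_image[OF R.cat_functor_axioms Dg q]] by blast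
 obtain v where v: "v : Hom D x c" "farr R v = u" using ff_lift[OF ff x c u(1)] .
 show "EX! u. u : Hom D x c & (ALL j:Obj J. p j $$D$$ u = q j)"
 proof (rule ex1I[of _ v])
  have "p j $$D$$ v = q j" if j: "j : Obj J" for j
   by (rule ff_cancel[OF ff R.dom.comp_in[OF v(1) p[OF j]] qj[OF j]])
    (use R.farr_comp[OF v(1) p[OF j]] u(2)[OF j] v(2) in simp)
  then show "v : Hom D x c & (ALL j:Obj J. p j $$D$$ v = q j)" using v(1) by blast
  fix w assume w: "w : Hom D x c & (ALL j:Obj J. p j $$D$$ w = q j)"
  then have wH: "w : Hom D x c" and wj: "!!j. j : Obj J ==> p j $$D$$ w = q j" by blast+
  have "farr R (p j) $$C$$ farr R w = farr R (q j)" if j: "j : Obj J" for j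
   using R.farr_comp[OF wH p[OF j]] wj[OF j] by simp
  then have "farr R w = u" using uu[OF R.farr_in[OF wH]] by blast
  then show "w = v" using ff_cancel[OF ff wH v(1)] v(2) by simp
 qed
qed

context site
begin

lemma locally_bijective_iso:
 assumes eta: "locally_bijective H A eta" and tht: "tht : Hom Psh A B" "is_iso Psh tht"
 shows "locally_bijective H B (tht $$Psh$$ eta)"
proof -
 note lb = locally_bijectiveD[OF eta]
 have H: "presheaf H" and A: "presheaf A" using nat_functors[OF lb(1)] by auto
 have B: "presheaf B" using nat_functors[OF tht(1)] by auto
 obtain \<xi> where \<xi>: "\<xi> : Hom Psh B A" "\<xi> $$Psh$$ tht = Ident Psh A" "tht $$Psh$$ \<xi> = Ident Psh B"
  using functor_cat.is_isoE[OF tht(2,1)] .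
 have \<xi>tht: "app \<xi> c (app tht c a) = a" if "c : Obj C" "a : A$c" for c a
  using psh_app_comp[OF tht(1) that, of \<xi>] \<xi>(2) that app_ident[of c "opposite C" a A] by simp
 have tht\<xi>: "app tht c (app \<xi> c b) = b" if "c : Obj C" "b : B$c" for c b
  using psh_app_comp[OF \<xi>(1) that, of tht] \<xi>(3) that app_ident[of c "opposite C" b B] by simp
 have thteta: "app (tht $$Psh$$ eta) c x = app tht c (app eta c x)" if "c : Obj C" "x : H$c" for c x
  by (rule psh_app_comp[OF lb(1) that])
 show ?thesis
  unfolding locally_bijective_def
 proof (intro conjI ballI impI)
  show "tht $$Psh$$ eta : Hom Psh H B" by (rule functor_cat.comp_in[OF lb(1) tht(1)])
  fix c x y assume c: "c : Obj C" and x: "x : H$c" "y : H$c"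
   and eq: "app (tht $$Psh$$ eta) c x = app (tht $$Psh$$ eta) c y"
  have "app \<xi> c (app tht c (app eta c x)) = app \<xi> c (app tht c (app eta c y))"
   using eq thteta[OF c x(1)] thteta[OF c x(2)] by simp
  then have "app eta c x = app eta c y" using \<xi>tht[OF c psh_nat_in[OF lb(1) c x(1)]] \<xi>tht[OF c psh_nat_in[OF lb(1) c x(2)]] by simp
  then show "locally c (%f. act H f x = act H f y)" by (rule lb(2)[OF c x])
 next
  fix c b assume c: "c : Obj C" and b: "b : B$c"
  have a: "app \<xi> c b : A$c" by (rule psh_nat_in[OF \<xi>(1) c b])
  show "locally c (%f. EX x:fobj H (Dom C f). app (tht $$Psh$$ eta) (Dom C f) x = act B f b)"
  proof (rule locally_mono[OF c lb(3)[OF c a]])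
   fix f assume f: "f : Arr C" "Cod C f = c" and "EX x:fobj H (Dom C f). app eta (Dom C f) x = act A f (app \<xi> c b)"
   then obtain x where x: "x : H$(Dom C f)" "app eta (Dom C f) x = act A f (app \<xi> c b)" by blast
   have "app (tht $$Psh$$ eta) (Dom C f) x = act B f b"
    using thteta[OF _ x(1)] f(1) x(2) psh_natural[OF tht(1) f(1), of "app \<xi> c b"] a f(2) tht\<xi>[OF c b] by simp
   then show "EX x:fobj H (Dom C f). app (tht $$Psh$$ eta) (Dom C f) x = act B f b" using x(1) by blast
  qed
 qed
qed

lemma sheaves_presentation:
 assumes F: "equivalence E (sheaf_category C J) F"
 shows "EX L. is_presentation E (opposite C) L F"
proof -
 let ?Sh = "sheaf_category C J"
 interpret F: cat_functor E ?Sh F using F by (simp add: equivalence_def)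
 have op: "category (opposite C)" by (rule category_opposite[OF category_axioms])
 have Fsh: "sheaf (F$e)" if "e : Obj E" for e
  using F.fobj_in[OF that] by (simp add: sheaf_category_def)
 have Hom_Sh: "Hom ?Sh A B = Hom Psh A B" if "sheaf A" "sheaf B" for A B
  using that by (simp add: sheaf_category_def)
 have FP: "cat_functor E Psh F"
 proof unfold_locales
  show "F$e : Obj Psh" if "e : Obj E" for e using F.fobj_in[OF that] by (simp add: sheaf_category_def)
  show "farr F u : Hom Psh (F$a) (F$b)" if u: "u : Hom E a b" for u a b
   using F.farr_in[OF u] Hom_Sh[OF Fsh Fsh] F.dom.Hom_obj[OF u] by simp
  show "farr F (Ident E a) = Ident Psh (F$a)" if "a : Obj E" for a
   using F.farr_id[OF that] by (simp add: sheaf_category_def)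
  show "farr F (g $$E$$ f) = farr F g $$Psh$$ farr F f" if "f : Hom E a b" "g : Hom E b c" for f g a b c
   using F.farr_comp[OF that] by (simp add: sheaf_category_def)
 qed (use F.fobj_ext F.farr_ext in auto)
 have ffS: "fully_faithful E ?Sh F" and es: "essentially_surjective E ?Sh F" using equivalenceD[OF F] .
 have ff: "fully_faithful E Psh F"
  unfolding fully_faithful_def
 proof (intro conjI ballI FP)
  fix a b assume ab: "a : Obj E" "b : Obj E"
  then show "bij_betw (farr F) (Hom E a b) (Hom Psh (F$a) (F$b))"
   using ffS Hom_Sh[OF Fsh Fsh] by (simp add: fully_faithful_def)
 qed
 have ex: "EX e h. e : Obj E & locally_bijective H (F$e) h" if H: "H : Obj Psh" for H
 proof -
  have "presheaf H" using H by (simp add: set_functor_def)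
  from sheafification_exists[OF this] obtain A eta where A: "sheaf A" and eta: "locally_bijective H A eta" by (elim exE conjE)
  have "A : Obj ?Sh" using A sheaf_presheaf[OF A] by (simp add: sheaf_category_def set_functor_def)
  then have "EX e:Obj E. isomorphic ?Sh (F$e) A" using es unfolding essentially_surjective_def by blast
  then obtain e where e: "e : Obj E" "isomorphic ?Sh (F$e) A" by blast
  from F.cod.isomorphic_sym[OF e(2)] obtain tht where tht: "tht : Hom ?Sh A (F$e)" "is_iso ?Sh tht"
   unfolding isomorphic_def by blast
  have "is_iso Psh tht"
   using tht(2) is_iso_full_subcategory[OF category_functor_category, where f = tht and P = sheaf] HomD(1)[OF tht(1)] unfolding sheaf_category_def by blast
  moreover have "tht : Hom Psh A (F$e)" using tht(1) Hom_Sh[OF A Fsh[OF e(1)]] by simp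
  ultimately show ?thesis using locally_bijective_iso[OF eta] e(1) by blast
 qed
 have "ALL H:Obj Psh. EX p. fst p : Obj E & locally_bijective H (F$(fst p)) (snd p)" using ex by fastforce
 from bchoice[OF this] obtain p where p: "!!H. H : Obj Psh ==> fst (p H) : Obj E & locally_bijective H (F$(fst (p H))) (snd (p H))"
  by blast
 define l where "l H = fst (p H)" for H
 define h where "h H = snd (p H)" for H
 have l: "l H : Obj E" and h: "locally_bijective H (F$(l H)) (h H)" if "H : Obj Psh" for H
  using p[OF that] by (simp_all add: l_def h_def)
 have hH: "h H : Hom Psh H (F$(l H))" if "H : Obj Psh" for H by (rule locally_bijectiveD(1)[OF h[OF that]])
 have univ: "EX! u. u : Hom E (l H) e & farr F u $$Psh$$ h H = g"
  if e: "e : Obj E" and g: "g : Hom Psh H (F$e)" for H e g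
 proof -
  have H: "H : Obj Psh" by (rule functor_cat.Hom_obj(1)[OF g])
  from locally_bijective_universal[OF h[OF H] Fsh[OF e] g] obtain bet
   where bet: "bet : Hom Psh (F$(l H)) (F$e)" "bet $$Psh$$ h H = g"
    and betu: "!!\<gamma>. \<gamma> : Hom Psh (F$(l H)) (F$e) & \<gamma> $$Psh$$ h H = g ==> \<gamma> = bet" by (elim ex1E conjE) blast
  obtain u where u: "u : Hom E (l H) e" "farr F u = bet" using ff_lift[OF ff l[OF H] e bet(1)] .
  show ?thesis
  proof (rule ex1I[of _ u])
   show "u : Hom E (l H) e & farr F u $$Psh$$ h H = g" using u bet(2) by simp
   fix v assume v: "v : Hom E (l H) e & farr F v $$Psh$$ h H = g"
   then have vH: "v : Hom E (l H) e" and vg: "farr F v $$Psh$$ h H = g" by blast+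
   have "farr F v = bet" by (rule betu[OF conjI[OF cat_functor.farr_in[OF FP vH] vg]])
   then show "v = u" using ff_cancel[OF ff vH u(1)] u(2) by simp
  qed
 qed
 obtain L where adj: "adjoint Psh E L F" and Lo: "!!H. H : Obj Psh ==> L$H = l H"
  and Lh: "!!alp. alp : Arr Psh ==> farr F (farr L alp) $$Psh$$ h (Dom Psh alp) = h (Cod Psh alp) $$Psh$$ alp"
  by (rule left_adjoint_of_universal[OF FP category_functor_category l hH univ]) (assumption | rule that)+
 have Lf: "cat_functor Psh E L" using adj by (simp add: adjoint_def)
 interpret L: cat_functor Psh E L by (rule Lf)
 interpret FP: cat_functor E Psh F by (rule FP)
 have small_op: "small_category (opposite C)" using small_C op by (simp add: small_category_def)
 interpret X: small_index U "opposite C"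
  unfolding small_index_def small_index_axioms_def using op small_op universe_axioms by simp
 have "left_exact Psh E L"
  unfolding left_exact_def preserves_limits_of_shape_def
 proof (intro conjI allI impI Lf)
  fix I :: "(nat, nat) category" and D c \<pi>
  assume fin: "finite_category I" and D: "cat_functor I Psh D" and lim: "is_limit I Psh D c \<pi>"
  interpret D: cat_functor I Psh D by (rule D)
  have cone: "is_cone I Psh D c \<pi>" using lim by (simp add: is_limit_def)
  then have \<pi>: "\<pi> j : Hom Psh c (D$j)" if "j : Obj I" for j using that by (simp add: is_cone_def)
  have c: "c : Obj Psh" using cone by (simp add: is_cone_def del: functor_category_simps)
  let ?LD = "comp_funct I L D" and ?FLD = "comp_funct I F (comp_funct I L D)"
  have LD: "cat_functor I E ?LD" by (rule cat_functor_comp[OF D Lf])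
  have FLD: "cat_functor I Psh ?FLD" by (rule cat_functor_comp[OF LD FP])
  have coneE: "is_cone I E ?LD (L$c) (%j. farr L (\<pi> j))" by (rule cone_image[OF Lf D cone])
  show "is_limit I E ?LD (L$c) (%j. farr L (\<pi> j))"
  proof (rule ff_reflects_limit[OF ff LD coneE], rule power_limitI[OF FLD cone_image[OF FP LD coneE]])
   fix x assume "x : Obj (opposite C)"
   then have x: "x : Obj C" by simp
   show "elementwise_limit I (%j. ?FLD$j$x) (%k. app (farr ?FLD k) x) (F$(L$c)$x) (%j. app (farr F (farr L (\<pi> j))) x)"
   proof (rule sheaf_finite_limit[where eta = "%j. h (D$j)" and ?eta0.0 = "h c", OF _ _ _ D FLD _ _ _ cone _ _ _ _ _ x])
    show "finite (Obj I)" "finite (Arr I)" "category I" using fin by (simp_all add: finite_category_def)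
    show "sheaf (?FLD$j)" if "j : Obj I" for j using that Fsh L.fobj_in D.fobj_in by simp
    show "locally_bijective (D$j) (?FLD$j) (h (D$j))" if "j : Obj I" for j
     using h[OF D.fobj_in[OF that]] Lo[OF D.fobj_in[OF that]] that by simp
    show "farr ?FLD k $$Psh$$ h (D$(Dom I k)) = h (D$(Cod I k)) $$Psh$$ farr D k" if k: "k : Arr I" for k
     using Lh[of "farr D k"] HomD[OF D.farr_Hom[OF k]] k by simp
    show "elementwise_limit I (%j. D$j$y) (%k. app (farr D k) y) (c$y) (%j. app (\<pi> j) y)" if "y : Obj C" for y
     by (rule X.power_limitD[OF D lim]) (use that in simp)
    show "sheaf (F$(L$c))" by (rule Fsh[OF L.fobj_in[OF c]])
    show "locally_bijective c (F$(L$c)) (h c)" using h[OF c] Lo[OF c] by simp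
    show "farr F (farr L (\<pi> j)) : Hom Psh (F$(L$c)) (?FLD$j)" if j: "j : Obj I" for j
     using FP.farr_in[OF L.farr_in[OF \<pi>[OF j]]] j by simp
    show "farr F (farr L (\<pi> j)) $$Psh$$ h c = h (D$j) $$Psh$$ \<pi> j" if j: "j : Obj I" for j
     using Lh[of "\<pi> j"] HomD[OF \<pi>[OF j]] by simp
   qed
  qed
 qed
 then have "is_presentation E (opposite C) L F"
  using adj ff small_op by (simp add: is_presentation_def geometric_embedding_def geometric_morphism_def)
 then show ?thesis by blast
qed

end

lemma (in universe) presentation_exists:
 assumes "grothendieck_topos U E"
 shows "EX (X :: ('u, 'u) category) i_inv i_dir. is_presentation E X i_inv i_dir"
proof -
 obtain C :: "('u, 'u) category" and J
  and F :: "('a, 'b, 'u psh, 'u psh_map) funct"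
  where C: "small_category C" "grothendieck_topology C J" "equivalence E (sheaf_category C J) F"
  using assms unfolding grothendieck_topos_def by (elim exE conjE)
 interpret site U C J
  unfolding site_def site_axioms_def using C universe_axioms by (simp add: small_category_def)
 show ?thesis using sheaves_presentation[OF C(3)] by blast
qed

section \<open>The commuting square of inverse images\<close>

lemma precomposition_simps:
 "G : Obj Q ==> (precomposition Q C F)$G = comp_funct C G F"
 "alp : Arr Q ==> farr (precomposition Q C F) alp =
  Arrow (comp_funct C (src alp) F) (\<lambda>a\<in>Obj C. body alp (F$a)) (comp_funct C (tgt alp) F)"
 by (simp_all add: precomposition_def)

lemma precomposition_functor:
 assumes F: "cat_functor C D F" and Q: "Q = full_subcategory (functor_category D B) phi"
  and Q': "Q' = full_subcategory (functor_category C B) \<psi>"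
  and imp: "!!G. cat_functor D B G ==> phi G ==> \<psi> (comp_funct C G F)"
 shows "cat_functor Q Q' (precomposition Q C F)"
proof -
 interpret F: cat_functor C D F by (rule F)
 have cQ: "category Q" "category Q'" unfolding Q Q' by (intro category_full_subcategory category_functor_category)+
 interpret Q: category Q by (rule cQ(1))
 interpret Q': category Q' by (rule cQ(2))
 have GF: "comp_funct C G F : Obj Q'" if "G : Obj Q" for G
  using that imp by (simp add: Q Q' cat_functor_comp[OF F])
 have HQ: "alp : Hom (functor_category D B) G G'" if "alp : Hom Q G G'" for alp G G' using that by (simp add: Q in_Hom)
 have HQ': "Hom Q' G G' = Hom (functor_category C B) G G'" if "G : Obj Q'" "G' : Obj Q'" for G G'
  using that by (simp add: Q')
 have pre: "(precomposition Q C F)$G = comp_funct C G F" if "G : Obj Q" for G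
  by (rule precomposition_simps(1)[OF that])
 have arr: "farr (precomposition Q C F) alp = Arrow (comp_funct C G F) (\<lambda>a\<in>Obj C. body alp (F$a)) (comp_funct C G' F)"
  if "alp : Hom Q G G'" for alp G G'
 proof -
  have "src alp = G" "tgt alp = G'" using HQ[OF that] by (simp_all add: in_Hom_functor_category)
  then show ?thesis using precomposition_simps(2)[of alp Q C F] HomD(1)[OF that] by simp
 qed
 have arr_in: "farr (precomposition Q C F) alp : Hom Q' (comp_funct C G F) (comp_funct C G' F)"
  if alp: "alp : Hom Q G G'" for alp G G'
 proof -
  note o = category.Hom_obj[OF cQ(1) alp]
  have n: "nat_trans D B G G' (body alp)" using HQ[OF alp] by (simp add: in_Hom_functor_category)
  have "nat_trans C B (comp_funct C G F) (comp_funct C G' F) (\<lambda>a\<in>Obj C. body alp (F$a))"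
  proof (rule nat_transI)
   show "cat_functor C B (comp_funct C G F)" "cat_functor C B (comp_funct C G' F)"
    using GF[OF o(1)] GF[OF o(2)] by (simp_all add: Q')
   show "restrict (%a. body alp (F$a)) (Obj C) a : Hom B ((comp_funct C G F)$a) ((comp_funct C G' F)$a)"
    if "a : Obj C" for a using nat_trans_in[OF n F.fobj_in[OF that]] that by simp
   fix f a b assume f: "f : Hom C a b"
   note fs = HomD[OF f] F.dom.Hom_obj[OF f]
   have "body alp (F$b) $$B$$ farr G (farr F f) = farr G' (farr F f) $$B$$ body alp (F$a)"
    using nat_transD(6)[OF n, of "farr F f"] fs by simp
   then show "restrict (%a. body alp (F$a)) (Obj C) b $$B$$ farr (comp_funct C G F) f =
     farr (comp_funct C G' F) f $$B$$ restrict (%a. body alp (F$a)) (Obj C) a"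
    using fs by simp
  qed simp
  then show ?thesis unfolding arr[OF alp] HQ'[OF GF[OF o(1)] GF[OF o(2)]] by (simp add: in_Hom_functor_category)
 qed
 have eqI: "alp = bet" if "alp : Hom Q' G G'" "bet : Hom Q' G G'" and b: "!!a. a : Obj C ==> body alp a = body bet a" for alp bet G G'
 proof -
  have n: "src alp = G & tgt alp = G' & nat_trans C B G G' (body alp)" "src bet = G & tgt bet = G' & nat_trans C B G G' (body bet)"
   using that(1,2) unfolding in_Hom_functor_category[symmetric] by (simp_all add: Q' in_Hom)
  have "body alp = body bet"
   by (rule extensionalityI[of _ "Obj C"]) (use n b in \<open>auto simp: nat_trans_def\<close>)
  then show ?thesis using n by (cases alp; cases bet) simp
 qed
 have comp: "body (g $$Q'$$ f) a = body g a $$B$$ body f a" if "a : Obj C" for f g a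
  using functor_category_comp[OF that] by (simp add: Q')
 have compQ: "body (g $$Q$$ f) a = body g a $$B$$ body f a" if "a : Obj D" for f g a
  using functor_category_comp[OF that] by (simp add: Q)
 show ?thesis
 proof (unfold_locales)
  show "(precomposition Q C F)$G : Obj Q'" if "G : Obj Q" for G
   using GF[OF that] pre[OF that] by simp
  show "farr (precomposition Q C F) alp : Hom Q' ((precomposition Q C F)$G) ((precomposition Q C F)$G')"
   if "alp : Hom Q G G'" for alp G G'
   using arr_in[OF that] category.Hom_obj[OF cQ(1) that] by (simp add: pre)
  show "farr (precomposition Q C F) (Ident Q G) = Ident Q' ((precomposition Q C F)$G)" if G: "G : Obj Q" for G
  proof (rule eqI)
   have i: "Ident Q G : Hom Q G G" by (rule category.id_in[OF cQ(1) G])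
   show "farr (precomposition Q C F) (Ident Q G) : Hom Q' (comp_funct C G F) (comp_funct C G F)" by (rule arr_in[OF i])
   show "Ident Q' ((precomposition Q C F)$G) : Hom Q' (comp_funct C G F) (comp_funct C G F)"
    using category.id_in[OF cQ(2) GF[OF G]] pre[OF G] by simp
   fix a assume a: "a : Obj C"
   have "body (Ident Q G) (F$a) = Ident B (G$(F$a))"
    using functor_category_ident[OF F.fobj_in[OF a]] by (simp add: Q)
   moreover have "body (Ident Q' (comp_funct C G F)) a = Ident B (G$(F$a))"
    using a by (simp add: Q' functor_category_ident[OF a])
   ultimately show "body (farr (precomposition Q C F) (Ident Q G)) a = body (Ident Q' ((precomposition Q C F)$G)) a"
    using arr[OF i] a pre[OF G] by simp
  qed
  show "farr (precomposition Q C F) (bet $$Q$$ alp) = farr (precomposition Q C F) bet $$Q'$$ farr (precomposition Q C F) alp"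
   if alp: "alp : Hom Q G G'" and bet: "bet : Hom Q G' G''" for alp bet G G' G''
  proof (rule eqI)
   note c = category.comp_in[OF cQ(1) alp bet]
   show "farr (precomposition Q C F) (bet $$Q$$ alp) : Hom Q' (comp_funct C G F) (comp_funct C G'' F)" by (rule arr_in[OF c])
   show "farr (precomposition Q C F) bet $$Q'$$ farr (precomposition Q C F) alp : Hom Q' (comp_funct C G F) (comp_funct C G'' F)"
    by (rule category.comp_in[OF cQ(2) arr_in[OF alp] arr_in[OF bet]])
   fix a assume a: "a : Obj C"
   show "body (farr (precomposition Q C F) (bet $$Q$$ alp)) a = body (farr (precomposition Q C F) bet $$Q'$$ farr (precomposition Q C F) alp) a"
    unfolding comp[OF a] arr[OF c] arr[OF alp] arr[OF bet] using a compQ[OF F.fobj_in[OF a]] by simp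
  qed
 qed (simp_all add: precomposition_def)
qed

lemma is_iso_counit:
 assumes u: "u : Hom E a b" and eps: "farr (counit_inverse_image U E) u : Hom (scott U (points U E)) A B"
 shows "is_iso (scott U (points U E)) (farr (counit_inverse_image U E) u) <->
  (ALL p:Obj (points U E). is_iso Sets (farr p u))"
proof -
 let ?epsu = "farr (counit_inverse_image U E) u"
 note u' = HomD[OF u]
 have AB: "A = evaluation (points U E) a" "B = evaluation (points U E) b"
  using HomD[OF eps] u' by (simp_all add: counit_simps(2) scott_def)
 have "is_iso (scott U (points U E)) ?epsu <-> is_iso (set_power (points U E)) ?epsu"
  using is_iso_full_subcategory[OF category_functor_category] HomD(1)[OF eps] unfolding scott_def by blast
 also have "\<dots> <-> (ALL p:Obj (points U E). bij_betw (app ?epsu p) (A$p) (B$p))"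
  by (rule is_iso_set_power_iff[OF Hom_scottD[OF eps]])
 also have "\<dots> <-> (ALL p:Obj (points U E). is_iso Sets (farr p u))"
 proof (rule ball_cong[OF refl])
  fix p assume p: "p : Obj (points U E)"
  interpret p: set_functor E p by (rule point_functor[OF p])
  have "app ?epsu p = body (farr p u)" using app_counit[OF u'(1) p] by (auto simp: act_def)
  then show "bij_betw (app ?epsu p) (A$p) (B$p) <-> is_iso Sets (farr p u)"
   using is_iso_set_iff[OF p.farr_in[OF u]] p AB by (simp del: points_simps(1))
 qed
 finally show ?thesis .
qed

lemma (in universe) enough_points_iff_conservative:
 assumes E: "category E"
 shows "enough_points U E <-> conservative E (scott U (points U E)) (counit_inverse_image U E)"
proof -
 interpret eps: cat_functor E "scott U (points U E)" "counit_inverse_image U E" by (rule counit_functor[OF E])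
 have "is_iso (scott U (points U E)) (farr (counit_inverse_image U E) u) <->
   (ALL p:Obj (points U E). is_iso Sets (farr p u))" if "u : Arr E" for u
  by (rule is_iso_counit[OF _ eps.farr_Hom[OF that]]) (use that in \<open>simp add: in_Hom\<close>)
 then show ?thesis unfolding enough_points_def conservative_def by blast
qed

locale presentation = small_index U X for U :: "'u itself" and X :: "('u, 'u) category" +
 fixes E :: "('o, 'a) category" and i_inv i_dir
 assumes E: "category E" and pres: "is_presentation E X i_inv i_dir"
begin

abbreviation PX :: "('u psh, 'u psh_map) category" where "PX \<equiv> set_power X"
abbreviation ptE where "ptE \<equiv> points U E"
abbreviation ptX where "ptX \<equiv> points U PX"
abbreviation epsE where "epsE \<equiv> counit_inverse_image U E"
abbreviation epsX where "epsX \<equiv> counit_inverse_image U PX"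
abbreviation pt_i where "pt_i \<equiv> points_map U E PX i_inv"
abbreviation S_i where "S_i \<equiv> scott_inverse_image U ptE ptX pt_i"

lemma i_localization: "reflective_localization PX E i_inv"
 using pres by (intro localization_of_adjoint) (auto simp: is_presentation_def geometric_embedding_def geometric_morphism_def)

lemma i_left_exact: "left_exact PX E i_inv"
 using pres by (simp add: is_presentation_def geometric_embedding_def geometric_morphism_def)

lemma i_functor: "cat_functor PX E i_inv"
 using i_left_exact by (simp add: left_exact_def)

lemma point_comp:
 assumes "cat_functor E Sets p" "cocontinuous U E Sets p & left_exact E Sets p"
 shows "cocontinuous U PX Sets (comp_funct PX p i_inv) \<and>
  left_exact PX Sets (comp_funct PX p i_inv)"
proof
 have "preserves_colimits_of_shape J PX Sets (comp_funct PX p i_inv)"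
  if "small_category J" for J :: "('u, 'u) category"
  by (rule preserves_colimits_comp[OF i_functor localization_preserves_colimits[OF i_localization] assms(1)])
   (use that assms(2) in \<open>simp add: cocontinuous_def\<close>)
 then show "cocontinuous U PX Sets (comp_funct PX p i_inv)"
  unfolding cocontinuous_def using cat_functor_comp[OF i_functor assms(1)] by blast
 show "left_exact PX Sets (comp_funct PX p i_inv)"
  using left_exact_comp[OF i_left_exact] assms(2) by blast
qed

lemma pt_functor: "cat_functor ptE ptX pt_i"
 unfolding points_map_def by (rule precomposition_functor[OF i_functor points_def points_def point_comp])

lemma fobj_pt: "p : Obj ptE ==> pt_i$p = comp_funct PX p i_inv"
 unfolding points_map_def by (rule precomposition_simps(1))

lemma body_pt: "alp : Arr ptE ==> H : Obj PX ==> body (farr pt_i alp) H = body alp (i_inv$H)"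
 unfolding points_map_def by (simp add: precomposition_simps(2) del: points_simps(1) functor_category_simps(1))

lemma pt_preserves_directed_colimits: "preserves_directed_colimits U ptE ptX pt_i"
 unfolding preserves_directed_colimits_def preserves_colimits_of_shape_def
proof (intro conjI allI impI pt_functor)
 fix P :: "'u set" and r D p q
 assume P: "small_set P" and dir: "directed_poset P r" and D: "cat_functor (poset_category P r) ptE D"
  and colim: "is_colimit (poset_category P r) ptE D p q"
 let ?PD = "comp_funct (poset_category P r) pt_i D"
 interpret D: cat_functor "poset_category P r" ptE D by (rule D)
 have coc: "is_cocone (poset_category P r) ptE D p q" using colim by (simp add: is_colimit_def)
 then have p: "p : Obj ptE" and q: "!!l. l : P ==> q l : Arr ptE"
  by (auto simp: is_cocone_def in_Hom simp del: points_simps(1))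
 have pw: "pointwise_colimit P r E D p q" by (rule points_colimitD[OF E P dir D colim])
 have PD: "cat_functor (poset_category P r) ptX ?PD" by (rule cat_functor_comp[OF D pt_functor])
 have cocX: "is_cocone (poset_category P r) ptX ?PD (pt_i$p) (%l. farr pt_i (q l))"
  by (rule cocone_image[OF pt_functor D coc])
 show "is_colimit (poset_category P r) ptX ?PD (pt_i$p) (%l. farr pt_i (q l))"
 proof (rule points_colimitI[OF dir PD cocX])
  show "pointwise_colimit P r PX ?PD (pt_i$p) (%l. farr pt_i (q l))"
   unfolding pointwise_colimit_def
  proof
   fix H assume H: "H : Obj PX"
   have iH: "i_inv$H : Obj E" by (rule cat_functor.fobj_in[OF i_functor H])
   have e: "elementwise_colimit P r (%l. D$l$(i_inv$H)) (%k. app (farr D k) (i_inv$H))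
     (p$(i_inv$H)) (%l. app (q l) (i_inv$H))"
    using pw iH by (simp add: pointwise_colimit_def)
   have o: "pt_i$(D$l)$H = D$l$(i_inv$H)" if "l : P" for l
    using fobj_pt[of "D$l"] D.fobj_in[of l] that H by (simp del: points_simps(1) functor_category_simps(1))
   have a: "app (farr pt_i (farr D k)) H = app (farr D k) (i_inv$H)" if "k : r" for k
    using body_pt[OF _ H, of "farr D k"] HomD(1)[OF D.farr_Hom, of k] that by (simp add: app_def fun_eq_iff del: points_simps(1))
   have c: "app (farr pt_i (q l)) H = app (q l) (i_inv$H)" if "l : P" for l
    using body_pt[OF q[OF that] H] by (simp add: app_def fun_eq_iff)
   have d: "(l, m) : r ==> l : P" for l m using directed_posetD[OF dir] by blast
   show "elementwise_colimit P r (%l. ?PD$l$H) (%k. app (farr ?PD k) H) (pt_i$p$H) (%l. app (farr pt_i (q l)) H)"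
    using e unfolding elementwise_colimit_def fobj_pt[OF p] comp_funct_simps(1)[OF H]
    by (simp add: o c a cong: conj_cong)
  qed
 qed
qed

lemma S_functor: "cat_functor (scott U ptX) (scott U ptE) S_i"
 unfolding scott_inverse_image_def
proof (rule precomposition_functor[OF pt_functor scott_def scott_def])
 fix G :: "(_, _, 'u) set_funct"
 assume G: "cat_functor ptX Sets G" "preserves_directed_colimits U ptX Sets G"
 show "preserves_directed_colimits U ptE Sets (comp_funct ptE G pt_i)"
  unfolding preserves_directed_colimits_def
 proof (intro conjI allI impI cat_functor_comp[OF pt_functor G(1)])
  fix P :: "'u set" and r assume "small_set P" "directed_poset P r"
  then show "preserves_colimits_of_shape (poset_category P r) ptE Sets (comp_funct ptE G pt_i)"
   using preserves_colimits_comp[OF pt_functor _ G(1)] pt_preserves_directed_colimits G(2)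
   unfolding preserves_directed_colimits_def by blast
 qed
qed

lemma square: "comp_funct PX S_i epsX = comp_funct PX epsE i_inv"
proof (rule cat_functor_eqI)
 interpret i: cat_functor "set_power X" E i_inv by (rule i_functor)
 interpret eps: cat_functor "set_power X" "scott U ptX" epsX by (rule counit_functor[OF category_functor_category])
 interpret pt: cat_functor ptE ptX pt_i by (rule pt_functor)
 show "cat_functor PX (scott U ptE) (comp_funct PX S_i epsX)"
  by (rule cat_functor_comp[OF eps.cat_functor_axioms S_functor])
 show "cat_functor PX (scott U ptE) (comp_funct PX epsE i_inv)"
  by (rule cat_functor_comp[OF i_functor counit_functor[OF E]])
 have ev: "comp_funct ptE (evaluation ptX H) pt_i = evaluation ptE (i_inv$H)" if H: "H : Obj PX" for H
 proof (rule cat_functor_eqI)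
  note iH = i.fobj_in[OF H]
  show "cat_functor ptE Sets (comp_funct ptE (evaluation ptX H) pt_i)"
   using set_functor_evaluation_points[OF H] by (intro cat_functor_comp[OF pt_functor]) (simp add: set_functor_def)
  show "cat_functor ptE Sets (evaluation ptE (i_inv$H))"
   using set_functor_evaluation_points[OF iH] by (simp add: set_functor_def)
  show "(comp_funct ptE (evaluation ptX H) pt_i)$p = (evaluation ptE (i_inv$H))$p" if p: "p : Obj ptE" for p
   using pt.fobj_in[OF p] fobj_pt[OF p] p H by (simp add: evaluation_def del: points_simps(1) functor_category_simps(1))
  show "farr (comp_funct ptE (evaluation ptX H) pt_i) alp = farr (evaluation ptE (i_inv$H)) alp" if alp: "alp : Arr ptE" for alp
   using HomD(1)[OF pt.farr_Hom[OF alp]] body_pt[OF alp H] alp by (simp add: evaluation_def del: points_simps(1) functor_category_simps(1))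
 qed
 show "(comp_funct PX S_i epsX)$H = (comp_funct PX epsE i_inv)$H" if H: "H : Obj PX" for H
 proof -
  have "S_i$(epsX$H) = comp_funct ptE (epsX$H) pt_i"
   unfolding scott_inverse_image_def by (rule precomposition_simps(1)[OF eps.fobj_in[OF H]])
  then show ?thesis
   unfolding comp_funct_simps(1)[OF H] counit_simps(1)[OF H] counit_simps(1)[OF i.fobj_in[OF H]] ev[OF H] .
 qed
 fix u assume u: "u : Arr PX"
 let ?a = "Dom PX u" and ?b = "Cod PX u"
 have uH: "u : Hom PX ?a ?b" using u by (simp only: in_Hom simp_thms)
 have ab: "?a : Obj PX" "?b : Obj PX"
  by (rule functor_cat.Hom_obj[OF uH])+
 have iu: "farr i_inv u : Arr E" "Dom E (farr i_inv u) = i_inv$?a" "Cod E (farr i_inv u) = i_inv$?b"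
  using HomD[OF i.farr_in[OF uH]] by auto
 have epsu: "farr epsX u = Arrow (evaluation ptX ?a) (\<lambda>p\<in>Obj ptX. farr p u) (evaluation ptX ?b)" by (rule counit_simps(2)[OF u])
 have "farr S_i (farr epsX u) = Arrow (comp_funct ptE (evaluation ptX ?a) pt_i) (\<lambda>p\<in>Obj ptE. farr (pt_i$p) u)
   (comp_funct ptE (evaluation ptX ?b) pt_i)"
 proof -
  have "restrict (%p. restrict (%p. farr p u) (Obj ptX) (pt_i$p)) (Obj ptE) = (\<lambda>p\<in>Obj ptE. farr (pt_i$p) u)"
   by (rule restrict_ext) (simp only: pt.fobj_in restrict_apply if_True)
  then show ?thesis
   unfolding scott_inverse_image_def precomposition_simps(2)[OF HomD(1)[OF eps.farr_in[OF uH]]]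
   unfolding epsu by (simp only: arrow.sel)
 qed
 also have "\<dots> = Arrow (evaluation ptE (i_inv$?a)) (\<lambda>p\<in>Obj ptE. farr p (farr i_inv u)) (evaluation ptE (i_inv$?b))"
 proof -
  have "(\<lambda>p\<in>Obj ptE. farr (pt_i$p) u) = (\<lambda>p\<in>Obj ptE. farr p (farr i_inv u))"
   by (rule restrict_ext) (simp only: fobj_pt comp_funct_simps(2)[OF u])
  then show ?thesis unfolding ev[OF ab(1)] ev[OF ab(2)] by (simp only:)
 qed
 also have "\<dots> = farr epsE (farr i_inv u)" unfolding counit_simps(2)[OF iu(1)] iu(2,3) ..
 finally show "farr (comp_funct PX S_i epsX) u = farr (comp_funct PX epsE i_inv) u"
  unfolding comp_funct_simps(2)[OF u] .
qed

lemma topological_embedding_of_equivalence: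
 assumes "fully_faithful E (scott U ptE) epsE" "essentially_surjective E (scott U ptE) epsE"
 shows "topological_embedding U ptE ptX pt_i"
proof -
 have "reflective_localization PX (scott U ptE) (comp_funct PX S_i epsX)"
  unfolding square by (rule localization_postcomp_equivalence[OF assms i_localization])
 then have loc: "reflective_localization (scott U ptX) (scott U ptE) S_i"
  by (rule localization_precomp_equivalence[OF eps_fully_faithful eps_essentially_surjective S_functor])
 have "left_exact PX (scott U ptE) (comp_funct PX S_i epsX)"
  unfolding square by (rule left_exact_comp[OF i_left_exact equivalence_of_ff(3)[OF assms]])
 then have lex: "left_exact (scott U ptX) (scott U ptE) S_i"
  by (rule left_exact_precomp_equivalence[OF eps_fully_faithful eps_essentially_surjective S_functor])
 obtain dir where "adjoint (scott U ptX) (scott U ptE) S_i dir" "fully_faithful (scott U ptE) (scott U ptX) dir"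
  using localization_right_adjoint[OF loc] .
 then show ?thesis
  using lex pt_preserves_directed_colimits
  unfolding topological_embedding_def geometric_embedding_def geometric_morphism_def by blast
qed

lemma equivalence_of_topological_embedding:
 assumes "enough_points U E" "topological_embedding U ptE ptX pt_i"
 shows "fully_faithful E (scott U ptE) epsE" "essentially_surjective E (scott U ptE) epsE"
proof -
 obtain dir where "adjoint (scott U ptX) (scott U ptE) S_i dir" "fully_faithful (scott U ptE) (scott U ptX) dir"
  using assms(2) unfolding topological_embedding_def geometric_embedding_def geometric_morphism_def by blast
 then have "reflective_localization (scott U ptX) (scott U ptE) S_i" by (rule localization_of_adjoint)
 then have "reflective_localization PX (scott U ptE) (comp_funct PX S_i epsX)"
  by (rule localization_comp_equivalence[OF eps_fully_faithful eps_essentially_surjective])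
 then have "reflective_localization PX (scott U ptE) (comp_funct PX epsE i_inv)"
  unfolding square .
 from ff_of_conservative_localization[OF i_localization this counit_functor[OF E]]
 show "fully_faithful E (scott U ptE) epsE" "essentially_surjective E (scott U ptE) epsE"
  using assms(1) enough_points_iff_conservative[OF E] by blast+
qed

end

lemma counit_is_equivalence_iff:
 "counit_is_equivalence U E <->
  fully_faithful E (scott U (points U E)) (counit_inverse_image U E) \<and>
  essentially_surjective E (scott U (points U E)) (counit_inverse_image U E)"
proof
 assume "counit_is_equivalence U E"
 then have "equivalence E (scott U (points U E)) (counit_inverse_image U E)"
  by (auto simp: counit_is_equivalence_def geometric_equivalence_def)
 from equivalenceD[OF this] show "fully_faithful E (scott U (points U E)) (counit_inverse_image U E) \<and>
   essentially_surjective E (scott U (points U E)) (counit_inverse_image U E)" ..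
next
 assume a: "fully_faithful E (scott U (points U E)) (counit_inverse_image U E) \<and>
   essentially_surjective E (scott U (points U E)) (counit_inverse_image U E)"
 note e = equivalence_of_ff[OF conjunct1[OF a] conjunct2[OF a]]
 show "counit_is_equivalence U E"
  using e unfolding counit_is_equivalence_def geometric_equivalence_def geometric_morphism_def by blast
qed

lemma (in universe) counit_equivalence_enough_points:
 assumes E: "category E" and eq: "counit_is_equivalence U E"
 shows "enough_points U E"
 unfolding enough_points_iff_conservative[OF E] conservative_def
proof (intro ballI impI)
 fix u assume u: "u : Arr E" "is_iso (scott U (points U E)) (farr (counit_inverse_image U E) u)"
 have ff: "fully_faithful E (scott U (points U E)) (counit_inverse_image U E)"
  using eq by (simp add: counit_is_equivalence_iff)
 have "u : Hom E (Dom E u) (Cod E u)" using u(1) by (simp add: in_Hom)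
 from ff_reflects_iso[OF ff this u(2)] show "is_iso E u" .
qed

theorem theorem3p4p10:
  fixes E :: "('o, 'a) category"
  assumes "grothendieck_universe TYPE('u)"
    and "grothendieck_topos TYPE('u) E"
  shows "(counit_is_equivalence TYPE('u) E \<longleftrightarrow>
            enough_points TYPE('u) E \<and>
            (\<forall>(X :: ('u, 'u) category) i_inv i_dir. is_presentation E X i_inv i_dir \<longrightarrow>
               topological_embedding TYPE('u) (points TYPE('u) E) (points TYPE('u) (set_power X))
                 (points_map TYPE('u) E (set_power X) i_inv))) \<and>
         (counit_is_equivalence TYPE('u) E \<longleftrightarrow>
            enough_points TYPE('u) E \<and>
            (\<exists>(X :: ('u, 'u) category) i_inv i_dir. is_presentation E X i_inv i_dir \<and>
               topological_embedding TYPE('u) (points TYPE('u) E) (points TYPE('u) (set_power X))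
                 (points_map TYPE('u) E (set_power X) i_inv)))"
    (is "(?eq <-> ?ep & (ALL X i_inv i_dir. ?pres X i_inv i_dir --> ?emb X i_inv)) & _")
proof -
 interpret universe "TYPE('u)" by (unfold_locales) (rule assms(1))
 have E: "category E" using assms(2) by (simp add: grothendieck_topos_def)
 have p: "presentation X E i_inv i_dir" if "?pres X i_inv i_dir" for X i_inv i_dir
  using that E universe_axioms
  by (simp add: presentation_def presentation_axioms_def small_index_def small_index_axioms_def is_presentation_def small_category_def)
 have all: "?emb X i_inv" if "?eq" "?pres X i_inv i_dir" for X i_inv i_dir
  using presentation.topological_embedding_of_equivalence[OF p[OF that(2)]] that(1) by (simp add: counit_is_equivalence_iff)
 have conv: "?eq" if "?ep" "?pres X i_inv i_dir" "?emb X i_inv" for X i_inv i_dir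
  using presentation.equivalence_of_topological_embedding[OF p[OF that(2)] that(1,3)] by (simp add: counit_is_equivalence_iff)
 have ep: "?ep" if "?eq" using counit_equivalence_enough_points[OF E that] .
 obtain X :: "('u, 'u) category" and i_inv i_dir where pres: "?pres X i_inv i_dir"
  using presentation_exists[OF assms(2)] by (elim exE)
 show ?thesis
  using all conv ep pres by blast
qed

end
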